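(* Let $1<p<\infty$, let $\mu,\nu\in\mathcal P_2^{\rm ac}(\mathbb R^d)$, and assume that there is a convex function $\varphi\in C^2(\mathbb R^d)$ and constants $0<\sigma_m(\varphi)\le\sigma_M(\varphi)<\infty$ such that $(\nabla\varphi)_\#\mu=\nu$ and $\sigma_m(\varphi)I\preceq\nabla^2\varphi(y)\preceq\sigma_M(\varphi)I$ for all $y\in\mathbb R^d$. Then the limit $$\lim_{\varepsilon\to0^+}\frac{{\rm ROT}_{\varepsilon,p}(\mu,\nu)-{\rm OT}(\mu,\nu)}{\varepsilon^{\frac{2}{d(p-1)+2}}}=\mathfrak C_{d,p}\cdot\mathcal K(\mu,\nu,p)$$ holds in any of the following cases: (i) $p\in(1,2]$ and $\mu,\nu\in\mathcal P_{2+\beta}(\mathbb R^d)$ for some $\beta>0$; (ii) $p>2$, and the following two conditions hold: (a) the interiors $\Omega_0={\rm int}\,{\rm supp}\,\mu$ and $\Omega_1={\rm int}\,{\rm supp}\,\nu$ are bounded sets with Lipschitz boundaries satisfying ${\rm supp}\,\mu=\overline{\Omega_0}$ and ${\rm supp}\,\nu=\overline{\Omega_1}$; (b) the densities $f_\mu$ and $f_\nu$ are continuous, uniformly bounded, and bounded away from zero on ${\rm supp}(\mu)$ and ${\rm supp}(\nu)$, respectively; (iii) $\mathcal K(\mu,\nu,p)=\infty$. In cases (i) and (ii), we have $\mathcal K(\mu,\nu,p)\in\mathbb R$, and hence the limit is finite.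
   Context: For $q>0$, $\mathcal P_q(\mathbb R^d)$ is the set of Borel probability measures on $\mathbb R^d$ with finite $q$-th moment, and $\mathcal P_q^{\rm ac}(\mathbb R^d)$ the subset of those absolutely continuous with respect to Lebesgue measure; $f_\mu$ denotes the Lebesgue density of $\mu$. $\Pi(\mu,\nu)$ is the set of couplings, i.e. probability measures on $\mathbb R^d\times\mathbb R^d$ with marginals $(\mu,\nu)$. Define $${\rm OT}(\mu,\nu)=\inf_{\pi\in\Pi(\mu,\nu)}\int\|x-y\|^2\,d\pi(x,y),$$ $${\rm ROT}_{\varepsilon,p}(\mu,\nu)=\inf_{\pi\in\Pi(\mu,\nu)}\left\{\int\|x-y\|^2\,d\pi(x,y)+\varepsilon\left\|\frac{d\pi}{d(\mu\otimes\nu)}\right\|_{L^p(\mu\otimes\nu)}^p\right\},$$ where the $L^p$ term is $+\infty$ if $\pi\not\ll\mu\otimes\nu$. The gradient $\nabla\varphi$ of a convex function pushing $\mu$ forward to $\nu$ is $\mu$-a.s. unique. Define $$\mathcal K(\mu,\nu,p)=\int\left[f_\nu(\nabla\varphi(x))f_\mu(x)\right]^{-\frac{p-1}{d(p-1)+2}}d\mu(x)\in[0,\infty],$$ $$\mathfrak B_{d,p}=\frac{p^{d/2}}{2}\,\omega_{d-1}\,B\!\left(\frac{p}{p-1},\frac d2\right),\qquad \mathfrak C_{d,p}=\frac{p(d(p-1)+2)}{d(p-1)+2p}\,\mathfrak B_{d,p}^{-\frac{2(p-1)}{d(p-1)+2}},$$ where $\omega_{d-1}$ is the $(d-1)$-dimensional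 Hausdorff measure of the unit sphere $\mathbb S^{d-1}\subset\mathbb R^d$ and $B(\cdot,\cdot)$ is the beta function. Lipschitz boundary: an open set $Q\subset\mathbb R^d$ has Lipschitz boundary if there are constants $L,r_0>0$ such that for every $x_0\in\partial Q$ there exist an orthogonal map $R:\mathbb R^d\to\mathbb R^d$ and an $L$-Lipschitz function $g:\mathbb R^{d-1}\to\mathbb R$ with $g(0)=0$ such that $R\big((Q-x_0)\cap\mathbb B(0,r_0)\big)=\{(x',x_d)\in\mathbb B(0,r_0):x_d>g(x')\}$, where $\mathbb B(0,r_0)$ is the open ball of radius $r_0$ centered at $0$ and $(x',x_d)\in\mathbb R^{d-1}\times\mathbb R$. *)

theory Defs
  imports "HOL-Probability.Probability"
begin

section \<open>Probability measures with finite moments\<close>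

definition prob_moment :: "real \<Rightarrow> (real ^ 'n) measure set" where
  "prob_moment q = {\<mu>. prob_space \<mu> \<and> sets \<mu> = sets borel \<and>
     (\<integral>\<^sup>+ x. ennreal (norm x powr q) \<partial>\<mu>) < \<infinity>}"

definition prob_moment_ac :: "real \<Rightarrow> (real ^ 'n) measure set" where
  "prob_moment_ac q = {\<mu> \<in> prob_moment q. absolutely_continuous lborel \<mu>}"

(* One fixed version of the density; it is only meaningful up to Lebesgue null sets. *)
definition leb_density :: "(real ^ 'n) measure \<Rightarrow> real ^ 'n \<Rightarrow> real" where
  "leb_density \<mu> x = enn2real (RN_deriv lborel \<mu> x)"

definition msupport :: "'a::topological_space measure \<Rightarrow> 'a set" where
  "msupport \<mu> = {x. \<forall>U. open U \<and> x \<in> U \<longrightarrow> emeasure \<mu> U > 0}"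


section \<open>Optimal transport and its regularisation\<close>

definition couplings ::
  "(real ^ 'n) measure \<Rightarrow> (real ^ 'n) measure \<Rightarrow> ((real ^ 'n) \<times> (real ^ 'n)) measure set" where
  "couplings \<mu> \<nu> = {\<pi>. prob_space \<pi> \<and> sets \<pi> = sets borel \<and>
     distr \<pi> borel fst = \<mu> \<and> distr \<pi> borel snd = \<nu>}"

definition transport_cost :: "((real ^ 'n) \<times> (real ^ 'n)) measure \<Rightarrow> ennreal" where
  "transport_cost \<pi> = (\<integral>\<^sup>+ z. ennreal ((norm (fst z - snd z))\<^sup>2) \<partial>\<pi>)"

definition OT :: "(real ^ 'n) measure \<Rightarrow> (real ^ 'n) measure \<Rightarrow> ennreal" where
  "OT \<mu> \<nu> = (INF \<pi>\<in>couplings \<mu> \<nu>. transport_cost \<pi>)"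

(* The p-th power of the L^p(\<rho>) norm of d\<pi>/d\<rho>.  In the library,
   absolutely_continuous \<rho> \<pi> says that \<pi> << \<rho>.  The derivative of a finite measure
   is finite almost everywhere, so enn2real loses nothing. *)
definition Lp_penalty :: "real \<Rightarrow> 'a measure \<Rightarrow> 'a measure \<Rightarrow> ennreal" where
  "Lp_penalty p \<rho> \<pi> =
     (if absolutely_continuous \<rho> \<pi>
      then (\<integral>\<^sup>+ z. ennreal (enn2real (RN_deriv \<rho> \<pi> z) powr p) \<partial>\<rho>)
      else \<infinity>)"

definition ROT :: "real \<Rightarrow> real \<Rightarrow> (real ^ 'n) measure \<Rightarrow> (real ^ 'n) measure \<Rightarrow> ennreal" where
  "ROT \<epsilon> p \<mu> \<nu> =
     (INF \<pi>\<in>couplings \<mu> \<nu>. transport_cost \<pi> + ennreal \<epsilon> * Lp_penalty p (\<mu> \<Otimes>\<^sub>M \<nu>) \<pi>)"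


section \<open>Second-order calculus\<close>

definition gradient :: "(real ^ 'n \<Rightarrow> real) \<Rightarrow> real ^ 'n \<Rightarrow> real ^ 'n" where
  "gradient \<phi> x = (THE D. GDERIV \<phi> x :> D)"

definition hessian :: "(real ^ 'n \<Rightarrow> real) \<Rightarrow> real ^ 'n \<Rightarrow> real ^ 'n ^ 'n" where
  "hessian \<phi> x = jacobian (gradient \<phi>) (at x)"

definition C2 :: "(real ^ 'n \<Rightarrow> real) \<Rightarrow> bool" where
  "C2 \<phi> \<longleftrightarrow> (\<forall>x. \<phi> differentiable at x) \<and> (\<forall>x. gradient \<phi> differentiable at x) \<and>
     continuous_on UNIV (hessian \<phi>)"

(* The Loewner order, to be used on symmetric matrices only. *)
definition loewner_le :: "real ^ 'n ^ 'n \<Rightarrow> real ^ 'n ^ 'n \<Rightarrow> bool" where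
  "loewner_le A B \<longleftrightarrow> (\<forall>v. 0 \<le> v \<bullet> ((B - A) *v v))"


section \<open>Lipschitz boundary\<close>

(* The distinguished coordinate k plays the role of the last one (the index type carries no
   order; by permuting coordinates all choices of k are equivalent), and R^(d-1) is the
   hyperplane x $ k = 0. *)
definition lipschitz_boundary :: "(real ^ 'n) set \<Rightarrow> bool" where
  "lipschitz_boundary Q \<longleftrightarrow> open Q \<and>
     (\<exists>L>0. \<exists>r0>0. \<forall>x0 \<in> frontier Q. \<exists>(R :: real ^ 'n \<Rightarrow> real ^ 'n) k (g :: real ^ 'n \<Rightarrow> real).
        orthogonal_transformation R \<and>
        L-lipschitz_on {x. x $ k = 0} g \<and> g 0 = 0 \<and>
        R ` ((\<lambda>x. x - x0) ` Q \<inter> ball 0 r0) =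
          {x \<in> ball 0 r0. x $ k > g (x - axis k (x $ k))})"


section \<open>Hausdorff measure and the constants\<close>

(* Usual normalisation: the s-dimensional Hausdorff measure agrees with Lebesgue measure on
   R^s.  Empty sets in a cover never contribute, also for s = 0 (counting measure). *)
definition hausdorff_content :: "nat \<Rightarrow> real \<Rightarrow> 'a::metric_space set \<Rightarrow> ennreal" where
  "hausdorff_content s \<delta> A =
     (INF C\<in>{C :: nat \<Rightarrow> 'a set. A \<subseteq> (\<Union>i. C i) \<and> (\<forall>i. bounded (C i) \<and> diameter (C i) \<le> \<delta>)}.
        \<Sum>i. if C i = {} then 0
             else ennreal (unit_ball_vol (real s) * (diameter (C i) / 2) ^ s))"

definition hausdorff_measure :: "nat \<Rightarrow> 'a::metric_space set \<Rightarrow> ennreal" where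
  "hausdorff_measure s A = (SUP \<delta>\<in>{0<..}. hausdorff_content s \<delta> A)"

definition sphere_area :: "'n::finite itself \<Rightarrow> real" where
  "sphere_area _ = enn2real (hausdorff_measure (CARD('n) - 1) (sphere (0 :: real ^ 'n) 1))"

definition B_const :: "'n::finite itself \<Rightarrow> real \<Rightarrow> real" where
  "B_const N p =
     p powr (real CARD('n) / 2) / 2 * sphere_area N * Beta (p / (p - 1)) (real CARD('n) / 2)"

definition C_const :: "'n::finite itself \<Rightarrow> real \<Rightarrow> real" where
  "C_const N p = (let d = real CARD('n) in
     p * (d * (p - 1) + 2) / (d * (p - 1) + 2 * p) *
     B_const N p powr (- (2 * (p - 1) / (d * (p - 1) + 2))))"

(* \<phi> is a convex function whose gradient pushes \<mu> forward to \<nu>; that gradient is \<mu>-a.s.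
   unique, so the value depends on \<mu>, \<nu> and p only.  The negative power is an inverse in
   ennreal, so that it is infinite where the base vanishes. *)
definition K_fun ::
  "(real ^ 'n) measure \<Rightarrow> (real ^ 'n) measure \<Rightarrow> (real ^ 'n \<Rightarrow> real) \<Rightarrow> real \<Rightarrow> ennreal" where
  "K_fun \<mu> \<nu> \<phi> p =
     (\<integral>\<^sup>+ x. inverse (ennreal ((leb_density \<nu> (gradient \<phi> x) * leb_density \<mu> x)
                powr ((p - 1) / (real CARD('n) * (p - 1) + 2)))) \<partial>\<mu>)"


section \<open>Regularity of the marginals\<close>

definition regular_support :: "(real ^ 'n) measure \<Rightarrow> bool" where
  "regular_support \<mu> \<longleftrightarrow> bounded (interior (msupport \<mu>)) \<and>
     lipschitz_boundary (interior (msupport \<mu>)) \<and>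
     msupport \<mu> = closure (interior (msupport \<mu>))"

(* A continuous density is a continuous version of the a.e. class.  Continuity, like the two
   bounds, is required on the support: the density vanishes outside it. *)
definition regular_density :: "(real ^ 'n) measure \<Rightarrow> bool" where
  "regular_density \<mu> \<longleftrightarrow> (\<exists>f. (AE x in lborel. leb_density \<mu> x = f x) \<and>
     continuous_on (msupport \<mu>) f \<and>
     (\<exists>M. \<forall>x \<in> msupport \<mu>. f x \<le> M) \<and>
     (\<exists>m>0. \<forall>x \<in> msupport \<mu>. m \<le> f x))"

end

theory Submission
  imports Defs
begin

text \<open>Write T=\<nabla>\<phi>, d for the dimension, f for the density of \<mu>, and
B(x,y)=\<phi>(x)-\<phi>(y)-T(y)\<cdot>(x-y) for the Bregman gap. T is a homeomorphism, so a coupling of \<mu> and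
\<nu> may be pulled back to a coupling of \<mu> with itself. Up to functions of x and of y alone, |x-T(y)|^2 is
2B(x,y), a nonnegative quantity comparable to |x-y|^2 that vanishes on the diagonal
(\<open>transport_cost_split\<close>). Hence ROT minus OT is the infimum of \<integral>\<integral> 2B
u+\<epsilon>\<integral>\<integral> u^p over densities u of self-couplings. If \<epsilon>=\<delta>^{d(p-1)+2}, both
terms balance when mass moves by distances of order \<delta>, and both are then of order
\<delta>^2=\<epsilon>^{2/(d(p-1)+2)}. After the substitution y=x+\<delta> w the limiting problem at x is to minimise
\<integral> (w\<cdot> Aw) U+c^{1-p}U^p over probability densities U, where A=\<nabla>^2\<phi>(x) and c=f(x). Its
minimiser is a power of a truncated quadratic and its value is C_{d,p} t^{-\<theta>} with t=c/sqrt(det A) and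
\<theta>=2(p-1)/(d(p-1)+2) (\<open>opt_profile_value\<close>). By the Monge-Ampere equation
t^2=f_\<nu>(T(x))f_\<mu>(x), so integrating the local values over \<mu> gives C_{d,p}K.

Lower bound. Young's inequality bounds the cost of the conditional law of a coupling at x from below by a dual
integral with a free multiplier; the optimal multiplier of the local problem, scaled by \<delta>^2, is inserted at
every x (\<open>ROT_ge_scaled\<close>). Fatou's lemma and Lebesgue differentiation pass to the limit
(\<open>lower_functional_liminf\<close>). This bound alone settles the case K=\<infinity>.

Upper bound. Most of the mass lies in finitely many classes on which f and \<nabla>^2\<phi> are almost constant. On
each class the optimal profile of the frozen problem is used at scale \<delta>; it leaves a small marginal deficit, at
most 2\<eta> at density points for small \<delta> (locale \<open>local_classes\<close>). The deficit has to be coupled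
with itself at a cost of order \<delta>^2 with a small constant; \<open>remainder_property\<close> states that this
can be done, and \<open>ROT_upper_limit\<close> follows. In both regimes of the theorem the deficit is handled by a
plan that is a product measure on each cell of a partition (\<open>block_plan\<close>). For p\<le>2 its penalty
depends only on the number of cells, and a moment beyond the second allows O(\<delta>^{-d}) cells of suitable,
spatially growing, diameter. For regular marginals the cells have diameter and mass comparable to \<delta> and
\<delta>^d, by the inner ball property of Lipschitz domains. Coupling the whole mass in this way, and comparing with
the lower bound, shows that K is finite (\<open>K_fun_finite\<close>).

The constant involves the Hausdorff measure of the unit sphere, while the radial integrals produce d times the volume
of the unit ball; the two are identified in \<open>sphere_area_eq\<close>.\<close>

section \<open>Change of variables on Euclidean space\<close>

text \<open>The change of variables formula for Lebesgue measure is stated for index types with a well-order. A finite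
type carries one through \<open>to_nat\<close>; on a copy of the type it cannot clash with an existing order.\<close>

typedef 'a ordered_copy = "UNIV :: 'a set" morphisms of_copy to_copy by simp

instance ordered_copy :: (finite) finite
proof
  have "(UNIV :: 'a ordered_copy set) = range to_copy"
    by (metis of_copy_inverse surj_def)
  then show "finite (UNIV :: 'a ordered_copy set)" by (metis finite finite_imageI)
qed

instantiation ordered_copy :: (finite) wellorder
begin

definition less_eq_ordered_copy :: "'a ordered_copy => 'a ordered_copy => bool" where
  "x \<le> y \<longleftrightarrow> to_nat (of_copy x) \<le> to_nat (of_copy y)"

definition less_ordered_copy :: "'a ordered_copy => 'a ordered_copy => bool" where
  "x < y \<longleftrightarrow> to_nat (of_copy x) < to_nat (of_copy y)"

instance
proof
  fix P :: "'a ordered_copy => bool" and a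
  assume *: "\<And>x. (\<And>y. y < x ==> P y) ==> P x"
  show "P a"
    by (induction a rule: measure_induct_rule[of "\<lambda>x. to_nat (of_copy x)"])
      (use * in \<open>auto simp: less_ordered_copy_def\<close>)
qed (auto simp: less_eq_ordered_copy_def less_ordered_copy_def of_copy_inject)

end

lemma bij_of_copy: "bij of_copy"
  by (metis UNIV_I bijI' of_copy_inject to_copy_inverse)

definition vec_copy :: "real ^ 'n => real ^ ('n ordered_copy)" where
  "vec_copy x = (\<chi> i. x $ of_copy i)"

definition vec_uncopy :: "real ^ ('n ordered_copy) => real ^ 'n" where
  "vec_uncopy y = (\<chi> i. y $ to_copy i)"

lemma vec_uncopy_copy [simp]: "vec_uncopy (vec_copy x) = x"
  by (simp add: vec_uncopy_def vec_copy_def vec_eq_iff to_copy_inverse)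

lemma vec_copy_uncopy [simp]: "vec_copy (vec_uncopy y) = y"
  by (simp add: vec_uncopy_def vec_copy_def vec_eq_iff of_copy_inverse)

lemma linear_vec_copy: "linear vec_copy"
  by (rule linearI) (simp_all add: vec_copy_def vec_eq_iff)

lemma linear_vec_uncopy: "linear vec_uncopy"
  by (rule linearI) (simp_all add: vec_uncopy_def vec_eq_iff)

lemma vec_copy_measurable [measurable]: "vec_copy \<in> borel_measurable borel"
  by (intro borel_measurable_continuous_onI linear_continuous_on linear_vec_copy
      linear_conv_bounded_linear[THEN iffD1])

lemma vec_uncopy_measurable [measurable]: "vec_uncopy \<in> borel_measurable borel"
  by (intro borel_measurable_continuous_onI linear_continuous_on linear_vec_uncopy
      linear_conv_bounded_linear[THEN iffD1])

lemma prod_Basis_cart: "(\<Prod>b\<in>(Basis :: (real ^ 'n) set). f b) = (\<Prod>i\<in>UNIV. f (axis i 1))"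
proof -
  have B: "(Basis :: (real ^ 'n) set) = range (\<lambda>i. axis i 1)"
    by (auto simp: Basis_vec_def)
  have "inj (\<lambda>i. axis i 1 :: real ^ 'n)"
    by (auto simp: inj_on_def axis_eq_axis)
  then show ?thesis unfolding B by (subst prod.reindex) (auto simp: comp_def)
qed

lemma lborel_vec_copy:
  "(lborel :: (real ^ 'n::finite ordered_copy) measure) = distr lborel borel vec_copy"
proof (rule lborel_eqI)
  fix l u :: "real ^ 'n ordered_copy"
  assume le: "\<And>b. b \<in> Basis ==> l \<bullet> b \<le> u \<bullet> b"
  have le': "l $ i \<le> u $ i" for i
    using le[of "axis i 1"] by (simp add: cart_eq_inner_axis axis_in_Basis_iff)
  have "vec_copy -` box l u = box (vec_uncopy l) (vec_uncopy u)"
    by (auto simp: mem_box_cart vec_copy_def vec_uncopy_def)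
      (metis of_copy_inverse to_copy_inverse UNIV_I)+
  then have "emeasure (distr lborel borel vec_copy) (box l u) =
      emeasure lborel (box (vec_uncopy l) (vec_uncopy u))"
    by (subst emeasure_distr) auto
  also have "... = (\<Prod>b\<in>Basis. (vec_uncopy u - vec_uncopy l) \<bullet> b)"
    by (rule emeasure_lborel_box)
      (auto simp: Basis_vec_def vec_uncopy_def le' cart_eq_inner_axis[symmetric])
  also have "(\<Prod>b\<in>Basis. (vec_uncopy u - vec_uncopy l) \<bullet> b) = (\<Prod>i\<in>UNIV. (u - l) $ to_copy i)"
    unfolding prod_Basis_cart by (simp add: cart_eq_inner_axis[symmetric] vec_uncopy_def)
  also have "... = (\<Prod>i\<in>UNIV. (u - l) $ i)"
    by (rule prod.reindex_bij_witness[of _ of_copy to_copy])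
      (auto simp: of_copy_inverse to_copy_inverse)
  also have "... = (\<Prod>b\<in>Basis. (u - l) \<bullet> b)"
    unfolding prod_Basis_cart by (simp add: cart_eq_inner_axis[symmetric])
  finally show "emeasure (distr lborel borel vec_copy) (box l u) = (\<Prod>b\<in>Basis. (u - l) \<bullet> b)" .
qed simp

lemma det_copy:
  fixes A :: "real ^ 'n ^ 'n"
  shows "det (\<chi> i j. A $ of_copy i $ of_copy j) = det A"
proof -
  let ?m = "\<lambda>p. map_permutation UNIV to_copy p"
  have inj: "inj (to_copy :: 'n => _)" by (simp add: inj_on_def to_copy_inject)
  have bij_to: "bij (to_copy :: 'n => _)"
    by (metis bijI' of_copy_inverse to_copy_inject UNIV_I)
  have m: "?m p i = to_copy (p (of_copy i))" for p :: "'n => 'n" and i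
    by (metis UNIV_I inj map_permutation_apply of_copy_inverse)
  have m': "map_permutation UNIV of_copy q i = of_copy (q (to_copy i))"
    for q :: "'n ordered_copy => 'n ordered_copy" and i
    by (metis UNIV_I bij_of_copy bij_is_inj map_permutation_apply to_copy_inverse)
  have perm: "?m p permutes UNIV" if "p permutes UNIV" for p :: "'n => 'n"
    using map_permutation_permutes[OF bij_to that] .
  have perm': "map_permutation UNIV of_copy q permutes UNIV" if "q permutes UNIV"
    for q :: "'n ordered_copy => 'n ordered_copy"
    using map_permutation_permutes[OF bij_of_copy that] .
  show ?thesis
    unfolding det_def
  proof (rule sum.reindex_bij_witness[of _ "?m" "map_permutation UNIV of_copy"])
    fix q :: "'n ordered_copy => 'n ordered_copy" assume q: "q \<in> {p. p permutes UNIV}"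
    show "?m (map_permutation UNIV of_copy q) = q"
      by (simp add: fun_eq_iff m m' of_copy_inverse)
    show "map_permutation UNIV of_copy q \<in> {p. p permutes UNIV}" using perm' q by simp
    have "(\<Prod>i\<in>UNIV. A $ i $ of_copy (q (to_copy i))) =
        (\<Prod>i\<in>UNIV. A $ of_copy i $ of_copy (q i))"
      by (rule prod.reindex_bij_witness[of _ of_copy to_copy])
        (auto simp: of_copy_inverse to_copy_inverse)
    then show "of_int (sign (map_permutation UNIV of_copy q)) *
          (\<Prod>i\<in>UNIV. A $ i $ map_permutation UNIV of_copy q i) =
        of_int (sign q) * (\<Prod>i\<in>UNIV. (\<chi> i j. A $ of_copy i $ of_copy j) $ i $ q i)"
      using q sign_map_permutation[OF bij_is_inj[OF bij_of_copy], of q] by (simp add: m')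
  next
    fix p :: "'n => 'n" assume p: "p \<in> {p. p permutes UNIV}"
    show "map_permutation UNIV of_copy (?m p) = p"
      by (simp add: fun_eq_iff m m' to_copy_inverse)
    show "?m p \<in> {p. p permutes UNIV}" using perm p by simp
  qed
qed

text \<open>Both measures are compared on boxes: the integral of |det DT| over the preimage of a box is the volume of
its image, the box itself.\<close>

lemma lborel_change_of_variables_wellorder:
  fixes T :: "real ^ 'n::{finite,wellorder} => real ^ 'n::_" and M :: "real ^ 'n::_ => real ^ 'n::_ ^ 'n::_"
  assumes T: "\<And>x. (T has_derivative (\<lambda>h. M x *v h)) (at x)"
    and "inj T" "surj T"
    and [measurable]: "(\<lambda>x. det (M x)) \<in> borel_measurable borel"
  shows "lborel = distr (density lborel (\<lambda>x. ennreal \<bar>det (M x)\<bar>)) borel T"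
proof (rule lborel_eqI)
  have cont: "continuous_on UNIV T"
    using T by (meson continuous_at_imp_continuous_on has_derivative_continuous)
  then have [measurable]: "T \<in> borel_measurable borel"
    by (rule borel_measurable_continuous_onI)
  fix l u :: "real ^ 'n::_"
  assume le: "\<And>b. b \<in> Basis ==> l \<bullet> b \<le> u \<bullet> b"
  let ?S = "T -` box l u"
  have S: "?S \<in> sets borel" by (intro measurable_sets_borel[of T borel]) auto
  have im: "T ` ?S = box l u" using \<open>surj T\<close> by (simp add: surj_image_vimage_eq)
  have "((\<lambda>x. \<bar>det (matrix (\<lambda>h. M x *v h))\<bar>) has_integral measure lebesgue (box l u)) ?S"
    by (rule has_measure_differentiable_image[THEN iffD1])
      (use S im T \<open>inj T\<close> in \<open>auto intro: has_derivative_at_withinI inj_on_subset\<close>)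
  then have "(\<integral>\<^sup>+x. ennreal \<bar>det (M x)\<bar> * indicator ?S x \<partial>lborel) = measure lebesgue (box l u)"
    using nn_integral_has_integral_lebesgue'[of ?S "\<lambda>x. \<bar>det (M x)\<bar>"]
    by (simp add: matrix_of_matrix_vector_mul)
  moreover have "emeasure (distr (density lborel (\<lambda>x. ennreal \<bar>det (M x)\<bar>)) borel T) (box l u)
     = (\<integral>\<^sup>+x. ennreal \<bar>det (M x)\<bar> * indicator ?S x \<partial>lborel)"
    using S by (subst emeasure_distr) (auto simp: emeasure_density)
  moreover have "measure lebesgue (box l u) = (\<Prod>b\<in>Basis. (u - l) \<bullet> b)"
    using le by (simp add: measure_lborel_box_eq)
  ultimately show "emeasure (distr (density lborel (\<lambda>x. ennreal \<bar>det (M x)\<bar>)) borel T) (box l u)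
     = (\<Prod>b\<in>Basis. (u - l) \<bullet> b)" by simp
qed simp

text \<open>Conjugation with the relabelling of coordinates transfers the formula to an arbitrary finite index
type.\<close>

lemma nn_integral_change_of_variables:
  fixes T :: "real ^ 'n => real ^ 'n" and M :: "real ^ 'n => real ^ 'n ^ 'n"
  assumes T: "\<And>x. (T has_derivative (\<lambda>h. M x *v h)) (at x)"
    and inj: "inj T" and surj: "surj T"
    and [measurable]: "(\<lambda>x. det (M x)) \<in> borel_measurable borel"
    and [measurable]: "g \<in> borel_measurable borel"
  shows "(\<integral>\<^sup>+y. g y \<partial>lborel) = (\<integral>\<^sup>+x. ennreal \<bar>det (M x)\<bar> * g (T x) \<partial>lborel)"
proof -
  let ?T = "\<lambda>y. vec_copy (T (vec_uncopy y))"
  let ?M = "\<lambda>y. \<chi> i j. M (vec_uncopy y) $ of_copy i $ of_copy j"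
  have cont: "continuous_on UNIV T"
    using T by (meson continuous_at_imp_continuous_on has_derivative_continuous)
  then have [measurable]: "T \<in> borel_measurable borel"
    by (rule borel_measurable_continuous_onI)
  have bl: "bounded_linear vec_copy" "bounded_linear vec_uncopy"
    using linear_vec_copy linear_vec_uncopy linear_conv_bounded_linear by blast+
  have mv: "vec_copy (M (vec_uncopy y) *v vec_uncopy h) = ?M y *v h" for y h
    apply (simp add: vec_eq_iff vec_copy_def matrix_vector_mult_def vec_uncopy_def)
    apply (intro allI sum.reindex_bij_witness[of _ of_copy to_copy])
    apply (auto simp: of_copy_inverse to_copy_inverse)
    done
  have "(?T has_derivative (\<lambda>h. vec_copy (M (vec_uncopy y) *v vec_uncopy h))) (at y)" for y
  proof -
    have "((\<lambda>y. T (vec_uncopy y)) has_derivative (\<lambda>h. M (vec_uncopy y) *v vec_uncopy h)) (at y)"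
      using has_derivative_compose[OF bounded_linear_imp_has_derivative[OF bl(2)] T] by simp
    then show ?thesis by (rule bounded_linear.has_derivative[OF bl(1)])
  qed
  then have der: "(?T has_derivative (\<lambda>h. ?M y *v h)) (at y)" for y
    by (simp add: mv)
  have "inj ?T"
  proof (rule injI)
    fix x y assume "?T x = ?T y"
    then have "T (vec_uncopy x) = T (vec_uncopy y)" by (metis vec_uncopy_copy)
    then have "vec_uncopy x = vec_uncopy y" by (rule injD[OF inj])
    then show "x = y" by (metis vec_copy_uncopy)
  qed
  moreover have "surj ?T"
  proof (rule surjI)
    fix y show "?T (vec_copy (inv T (vec_uncopy y))) = y"
      using surj by (simp add: surj_f_inv_f)
  qed
  moreover have "(\<lambda>y. det (?M y)) \<in> borel_measurable borel"
    unfolding det_copy by measurable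
  ultimately have eq: "lborel = distr (density lborel (\<lambda>x. ennreal \<bar>det (?M x)\<bar>)) borel ?T"
    by (intro lborel_change_of_variables_wellorder der)
  have "(\<integral>\<^sup>+y. g y \<partial>lborel) = (\<integral>\<^sup>+y. g (vec_uncopy y) \<partial>lborel)"
    by (subst lborel_vec_copy) (simp add: nn_integral_distr)
  also have "... = (\<integral>\<^sup>+x. ennreal \<bar>det (M (vec_uncopy x))\<bar> * g (T (vec_uncopy x)) \<partial>lborel)"
    by (subst eq, subst nn_integral_distr, simp, simp, subst nn_integral_density)
      (simp_all add: det_copy)
  also have "... = (\<integral>\<^sup>+x. ennreal \<bar>det (M x)\<bar> * g (T x) \<partial>lborel)"
    by (subst lborel_vec_copy) (simp add: nn_integral_distr)
  finally show ?thesis .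
qed

lemma nn_integral_linear_change:
  fixes P :: "real ^ 'n ^ 'n"
  assumes P: "det P \<noteq> 0" and g: "g \<in> borel_measurable borel"
  shows "(\<integral>\<^sup>+y. g y \<partial>lborel) = ennreal \<bar>det P\<bar> * (\<integral>\<^sup>+x. g (P *v x) \<partial>lborel)"
proof -
  have inv: "invertible P" using P invertible_det_nz by blast
  have inj: "inj ((*v) P)" using inv by (rule inj_matrix_vector_mult)
  have surj: "surj ((*v) P)"
    using inv by (simp add: invertible_def matrix_right_invertible_surjective[symmetric]) blast
  have [measurable]: "(*v) P \<in> borel_measurable borel"
    by (intro borel_measurable_continuous_onI matrix_vector_mult_linear_continuous_on)
  have "(\<integral>\<^sup>+y. g y \<partial>lborel) = (\<integral>\<^sup>+x. ennreal \<bar>det P\<bar> * g (P *v x) \<partial>lborel)"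
  proof (rule nn_integral_change_of_variables[OF _ inj surj _ g])
    show "((*v) P has_derivative (*v) P) (at x)" for x
      by (rule bounded_linear_imp_has_derivative) (rule matrix_vector_mul_bounded_linear)
  qed simp
  also have "... = ennreal \<bar>det P\<bar> * (\<integral>\<^sup>+x. g (P *v x) \<partial>lborel)"
    by (intro nn_integral_cmult measurable_compose[OF _ g]) measurable
  finally show ?thesis .
qed

section \<open>Positive definite forms\<close>

lemma inner_transpose_mult:
  fixes P :: "real ^ 'n ^ 'm"
  shows "w \<bullet> (transpose P *v z) = (P *v w) \<bullet> z"
  by (simp add: inner_commute[of w] dot_lmul_matrix inner_commute[of z])

lemma symmetric_matrix_inner:
  fixes A :: "real ^ 'n ^ 'n"
  assumes "transpose A = A"
  shows "x \<bullet> (A *v y) = y \<bullet> (A *v x)"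
  using inner_transpose_mult[of x A y] assms by (simp add: inner_commute)

text \<open>Gram-Schmidt for the scalar product x\<cdot> Ay.\<close>

lemma pos_def_orthonormal_family:
  fixes A :: "real ^ 'n ^ 'n" and I :: "'n set"
  assumes sym: "transpose A = A" and pos: "\<And>v. v \<noteq> 0 ==> 0 < v \<bullet> (A *v v)"
  shows "\<exists>e. \<forall>i\<in>I. \<forall>j\<in>I. e i \<bullet> (A *v e j) = (if i = j then 1 else 0)"
proof -
  have "finite I" by simp
  then show ?thesis
  proof induction
    case (insert k I)
    then obtain e where e: "\<And>i j. i \<in> I ==> j \<in> I ==> e i \<bullet> (A *v e j) = (if i = j then 1 else 0)"
      by auto
    have "dim (span (e ` I)) \<le> card I"
      by (metis card_image_le dim_le_card' dim_span finite finite_imageI le_trans)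
    also have "card I < CARD('n)"
      using insert by (metis UNIV_I finite psubset_card_mono psubset_eq subset_UNIV)
    finally have "span (e ` I) \<noteq> UNIV" by (metis DIM_cart DIM_real dim_UNIV mult.right_neutral less_irrefl)
    then obtain v where v: "v \<notin> span (e ` I)" by auto
    define w where "w = v - (\<Sum>i\<in>I. (e i \<bullet> (A *v v)) *\<^sub>R e i)"
    have "(\<Sum>i\<in>I. (e i \<bullet> (A *v v)) *\<^sub>R e i) \<in> span (e ` I)"
      by (intro span_sum span_scale span_base) auto
    with v have "w \<noteq> 0" by (auto simp: w_def)
    then have W: "0 < w \<bullet> (A *v w)" by (rule pos)
    have orth: "e j \<bullet> (A *v w) = 0" if "j \<in> I" for j
    proof -
      have "e j \<bullet> (A *v w) = e j \<bullet> (A *v v) - (\<Sum>i\<in>I. (e i \<bullet> (A *v v)) * (e j \<bullet> (A *v e i)))"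
        by (simp add: w_def matrix_vector_mult_diff_distrib inner_diff_right linear_sum[OF matrix_vector_mul_linear] 
            matrix_vector_mult_scaleR inner_sum_right)
      also have "(\<Sum>i\<in>I. (e i \<bullet> (A *v v)) * (e j \<bullet> (A *v e i))) =
          (\<Sum>i\<in>I. if i = j then e i \<bullet> (A *v v) else 0)"
        by (intro sum.cong) (auto simp: e that)
      also have "... = e j \<bullet> (A *v v)" using that by simp
      finally show ?thesis by simp
    qed
    define e' where "e' = e(k := (1 / sqrt (w \<bullet> (A *v w))) *\<^sub>R w)"
    have orth': "w \<bullet> (A *v e j) = 0" if "j \<in> I" for j
      using orth[OF that] symmetric_matrix_inner[OF sym, of w "e j"] by simp
    have "\<forall>i\<in>insert k I. \<forall>j\<in>insert k I. e' i \<bullet> (A *v e' j) = (if i = j then 1 else 0)"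
    proof (intro ballI)
      fix i j assume ij: "i \<in> insert k I" "j \<in> insert k I"
      consider "i = k" "j = k" | "i = k" "j \<in> I" "j \<noteq> k" | "i \<in> I" "i \<noteq> k" "j = k"
        | "i \<in> I" "i \<noteq> k" "j \<in> I" "j \<noteq> k" using ij insert.hyps(2) by auto
      then show "e' i \<bullet> (A *v e' j) = (if i = j then 1 else 0)"
      proof cases
        case 1
        then show ?thesis using W by (simp add: e'_def matrix_vector_mult_scaleR)
      next
        case 2
        then show ?thesis by (simp add: e'_def orth')
      next
        case 3
        then show ?thesis by (simp add: e'_def matrix_vector_mult_scaleR orth)
      next
        case 4
        then show ?thesis by (simp add: e'_def e)
      qed
    qed
    then show ?case by (rule exI[of _ e'])
  qed simp
qed

text \<open>The columns of P form an orthonormal basis for A, so that P^TAP=I.\<close>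

lemma pos_def_congruent_identity:
  fixes A :: "real ^ 'n ^ 'n"
  assumes sym: "transpose A = A" and pos: "\<And>v. v \<noteq> 0 ==> 0 < v \<bullet> (A *v v)"
  shows "\<exists>P :: real ^ 'n ^ 'n. (\<forall>w. (P *v w) \<bullet> (A *v (P *v w)) = w \<bullet> w) \<and> (det P)^2 * det A = 1"
proof -
  obtain e :: "'n => real ^ 'n" where e: "\<And>i j. e i \<bullet> (A *v e j) = (if i = j then 1 else 0)"
    using pos_def_orthonormal_family[OF assms, of UNIV] by auto
  define P :: "real ^ 'n ^ 'n" where "P = (\<chi> a b. e b $ a)"
  have P: "P *v w = (\<Sum>i\<in>UNIV. w $ i *\<^sub>R e i)" for w
    by (simp add: P_def vec_eq_iff matrix_vector_mult_def mult.commute)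
  have Pax: "P *v axis j 1 = e j" for j
    by (simp add: P_def matrix_vector_mul_component vec_eq_iff matrix_vector_mult_def axis_def if_distrib cong: if_cong)
  have "transpose P ** A ** P = mat 1"
  proof -
    have "(transpose P ** A ** P) $ i $ j = mat 1 $ i $ j" for i j
    proof -
      have "(transpose P ** A ** P) $ i $ j = axis i 1 \<bullet> ((transpose P ** A ** P) *v axis j 1)"
        by (simp add: matrix_vector_mult_basis column_def inner_axis')
      also have "... = (P *v axis i 1) \<bullet> (A *v (P *v axis j 1))"
        by (simp only: matrix_vector_mul_assoc[symmetric] inner_transpose_mult)
      also have "... = mat 1 $ i $ j" by (simp add: Pax e mat_def)
      finally show ?thesis .
    qed
    then show ?thesis by (simp add: vec_eq_iff)
  qed
  note PAP = this
  show ?thesis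
  proof (intro exI conjI allI)
    show "(P *v w) \<bullet> (A *v (P *v w)) = w \<bullet> w" for w
    proof -
      have "(P *v w) \<bullet> (A *v (P *v w)) = w \<bullet> ((transpose P ** A ** P) *v w)"
        by (simp only: matrix_vector_mul_assoc[symmetric] inner_transpose_mult)
      then show ?thesis by (simp add: PAP)
    qed
    have "det (transpose P ** A ** P) = 1" by (simp add: PAP)
    then show "(det P)^2 * det A = 1"
      by (simp add: det_mul det_transpose power2_eq_square mult_ac)
  qed
qed

lemma pos_def_det_pos:
  fixes A :: "real ^ 'n ^ 'n"
  assumes "transpose A = A" and "\<And>v. v \<noteq> 0 ==> 0 < v \<bullet> (A *v v)"
  shows "0 < det A"
proof -
  have "\<exists>P :: real ^ 'n ^ 'n. (\<forall>w. (P *v w) \<bullet> (A *v (P *v w)) = w \<bullet> w) \<and> (det P)^2 * det A = 1"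
    by (rule pos_def_congruent_identity[OF assms(1)]) (rule assms(2))
  then obtain P :: "real ^ 'n ^ 'n" where P: "(det P)^2 * det A = 1" by blast
  then have "0 < (det P)^2" by (metis mult_zero_left zero_less_power2 zero_neq_one power_zero_numeral)
  with P show ?thesis by (metis zero_less_mult_pos zero_less_one)
qed

lemma quadratic_form_measurable [measurable]: "(\<lambda>z :: real ^ 'n. z \<bullet> (M *v z)) \<in> borel_measurable borel"
  by (intro borel_measurable_continuous_onI continuous_intros matrix_vector_mult_linear_continuous_on)

text \<open>The substitution z=Pw with P^TAP=I turns the form into |w|^2 and has Jacobian (det A)^{-1/2}.\<close>

lemma nn_integral_quadratic_form:
  fixes A :: "real ^ 'n ^ 'n" and g :: "real => ennreal"
  assumes A: "transpose A = A" "\<And>v. v \<noteq> 0 ==> 0 < v \<bullet> (A *v v)"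
    and g [measurable]: "g \<in> borel_measurable borel"
  shows "(\<integral>\<^sup>+z. g (z \<bullet> (A *v z)) \<partial>lborel) = ennreal (1 / sqrt (det A)) * (\<integral>\<^sup>+w. g (w \<bullet> w) \<partial>(lborel :: (real ^ 'n) measure))"
proof -
  have "\<exists>P :: real ^ 'n ^ 'n. (\<forall>w. (P *v w) \<bullet> (A *v (P *v w)) = w \<bullet> w) \<and> (det P)^2 * det A = 1"
    by (rule pos_def_congruent_identity[OF A(1)]) (rule A(2))
  then obtain P :: "real ^ 'n ^ 'n" where
    P: "\<And>w. (P *v w) \<bullet> (A *v (P *v w)) = w \<bullet> w" "(det P)^2 * det A = 1" by blast
  have "det A \<noteq> 0" using P(2) by auto
  have "det P \<noteq> 0" using P(2) by auto
  have "\<bar>det P\<bar> = sqrt ((det P)^2)" by simp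
  also have "(det P)^2 = 1 / det A"
    using P(2) \<open>det A \<noteq> 0\<close> by (simp add: field_simps)
  finally have "\<bar>det P\<bar> = 1 / sqrt (det A)" by (simp add: real_sqrt_divide)
  moreover have "(\<lambda>z. g (z \<bullet> (A *v z))) \<in> borel_measurable borel"
    by (intro measurable_compose[OF _ g] borel_measurable_continuous_onI continuous_intros
       matrix_vector_mult_linear_continuous_on)
  ultimately show ?thesis
    using nn_integral_linear_change[OF \<open>det P \<noteq> 0\<close>, of "\<lambda>z. g (z \<bullet> (A *v z))"] by (simp add: P(1))
qed

definition bregman :: "(real ^ 'n => real) => real ^ 'n => real ^ 'n => real" where
  "bregman \<phi> x y = \<phi> x - \<phi> y - gradient \<phi> y \<bullet> (x - y)"

section \<open>Potentials with pinched Hessian\<close>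

locale pinched_C2 =
  fixes \<phi> :: "real ^ 'n => real" and \<sigma>m \<sigma>M :: real
  assumes C2: "C2 \<phi>" and \<sigma>m_pos: "0 < \<sigma>m" and \<sigma>m_le: "\<sigma>m \<le> \<sigma>M"
    and hessian_bounds: "\<And>y. loewner_le (mat \<sigma>m) (hessian \<phi> y) \<and> loewner_le (hessian \<phi> y) (mat \<sigma>M)"
begin

abbreviation "T \<equiv> gradient \<phi>"
abbreviation "A \<equiv> hessian \<phi>"

lemma mat_scale: "mat c *v v = c *\<^sub>R (v :: real ^ 'n)"
  by (simp add: vec_eq_iff matrix_vector_mult_def mat_def if_distrib[of "\<lambda>x. x * _"] cong: if_cong)

lemma hessian_ge: "\<sigma>m * (norm v)^2 \<le> v \<bullet> (A y *v v)"
  and hessian_le: "v \<bullet> (A y *v v) \<le> \<sigma>M * (norm v)^2"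
  using hessian_bounds[of y] unfolding loewner_le_def
  by (auto simp: matrix_vector_mult_diff_rdistrib inner_diff_right mat_scale power2_norm_eq_inner
      dest!: spec[of _ v])

lemma hessian_nonneg: "0 \<le> v \<bullet> (A y *v v)"
  using hessian_ge[of v y] \<sigma>m_pos by (smt (verit) mult_nonneg_nonneg zero_le_power2)

lemma hessian_pos: "v \<noteq> 0 ==> 0 < v \<bullet> (A y *v v)"
  using hessian_ge[of v y] \<sigma>m_pos by (meson less_le_trans mult_pos_pos zero_less_norm_iff zero_less_power)

lemma gderiv: "GDERIV \<phi> x :> T x"
proof -
  have "\<phi> differentiable at x" using C2 by (simp add: C2_def)
  then obtain D where D: "(\<phi> has_derivative D) (at x)" by (auto simp: differentiable_def)
  then have "linear D" by (rule has_derivative_linear)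
  have "D h = h \<bullet> (\<chi> i. D (axis i 1))" for h
  proof -
    have "D h = D (\<Sum>i\<in>UNIV. h $ i *\<^sub>R axis i 1)" by (simp add: basis_expansion scalar_mult_eq_scaleR[symmetric])
    also have "... = h \<bullet> (\<chi> i. D (axis i 1))"
      by (simp add: linear_sum[OF \<open>linear D\<close>] linear_scale[OF \<open>linear D\<close>] inner_vec_def)
    finally show ?thesis .
  qed
  then have "D = (\<lambda>h. h \<bullet> (\<chi> i. D (axis i 1)))" by blast
  with D have G: "GDERIV \<phi> x :> (\<chi> i. D (axis i 1))" by (simp add: gderiv_def)
  have U: "E = F" if "GDERIV \<phi> x :> E" "GDERIV \<phi> x :> F" for E F
  proof -
    have "(\<lambda>h. h \<bullet> E) = (\<lambda>h. h \<bullet> F)"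
      using that unfolding gderiv_def by (rule has_derivative_unique)
    then show ?thesis by (metis vector_eq_ldot)
  qed
  show ?thesis unfolding gradient_def by (rule theI[where P = "\<lambda>D. GDERIV \<phi> x :> D", OF G]) (rule U[OF _ G])
qed

lemma gradient_has_derivative: "(T has_derivative (\<lambda>h. A x *v h)) (at x)"
  using C2 unfolding C2_def hessian_def by (metis jacobian_works)

lemma continuous_on_gradient: "continuous_on S T"
  using gradient_has_derivative has_derivative_continuous
  by (meson continuous_at_imp_continuous_on)

lemma continuous_on_hessian: "continuous_on S A"
  using C2 continuous_on_subset unfolding C2_def by blast

lemma continuous_on_phi: "continuous_on S \<phi>"
  using gderiv unfolding gderiv_def
  by (meson continuous_at_imp_continuous_on has_derivative_continuous)

lemma phi_line:
  "((\<lambda>t. \<phi> (x + t *\<^sub>R u)) has_real_derivative T (x + t *\<^sub>R u) \<bullet> u) (at t)"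
proof -
  have "((\<lambda>t. \<phi> (x + t *\<^sub>R u)) has_derivative (\<lambda>h. (h *\<^sub>R u) \<bullet> T (x + t *\<^sub>R u))) (at t)"
    by (rule has_derivative_compose[of "\<lambda>t. x + t *\<^sub>R u" "\<lambda>h. h *\<^sub>R u" t UNIV \<phi>])
      (auto intro!: derivative_eq_intros gderiv[unfolded gderiv_def])
  then show ?thesis
    by (simp add: has_field_derivative_def inner_commute mult_commute_abs)
qed

lemma gradient_line:
  "((\<lambda>t. T (x + t *\<^sub>R u) \<bullet> v) has_real_derivative v \<bullet> (A (x + t *\<^sub>R u) *v u)) (at t)"
proof -
  have "((\<lambda>t. T (x + t *\<^sub>R u)) has_derivative (\<lambda>h. A (x + t *\<^sub>R u) *v (h *\<^sub>R u))) (at t)"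
    by (rule has_derivative_compose[of "\<lambda>t. x + t *\<^sub>R u" "\<lambda>h. h *\<^sub>R u" t UNIV T])
      (auto intro!: derivative_eq_intros gradient_has_derivative)
  from has_derivative_inner_left[OF this, of v] show ?thesis
    by (simp add: has_field_derivative_def inner_commute mult_commute_abs matrix_vector_mult_scaleR)
qed

text \<open>Two applications of the mean value theorem to a mixed second difference; interchanging u and v leaves the
left side unchanged, which is why the Hessian is symmetric.\<close>

lemma second_difference:
  assumes "0 < s"
  shows "\<exists>\<xi>\<in>{0<..<s}. \<exists>\<eta>\<in>{0<..<s}.
    \<phi> (x + s *\<^sub>R u + s *\<^sub>R v) - \<phi> (x + s *\<^sub>R u) - (\<phi> (x + s *\<^sub>R v) - \<phi> x) =
      s^2 * (u \<bullet> (A (x + \<xi> *\<^sub>R u + \<eta> *\<^sub>R v) *v v))"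
proof -
  let ?g = "\<lambda>t. \<phi> (x + s *\<^sub>R v + t *\<^sub>R u) - \<phi> (x + t *\<^sub>R u)"
  have "\<exists>\<xi>>0. \<xi> < s \<and> ?g s - ?g 0 = (s - 0) * (T (x + s *\<^sub>R v + \<xi> *\<^sub>R u) \<bullet> u - T (x + \<xi> *\<^sub>R u) \<bullet> u)"
    using assms by (intro MVT2 DERIV_diff phi_line) auto
  then obtain \<xi> where \<xi>: "0 < \<xi>" "\<xi> < s"
    "?g s - ?g 0 = s * (T (x + s *\<^sub>R v + \<xi> *\<^sub>R u) \<bullet> u - T (x + \<xi> *\<^sub>R u) \<bullet> u)" by auto
  let ?h = "\<lambda>t. T (x + \<xi> *\<^sub>R u + t *\<^sub>R v) \<bullet> u"
  have "\<exists>\<eta>>0. \<eta> < s \<and> ?h s - ?h 0 = (s - 0) * (u \<bullet> (A (x + \<xi> *\<^sub>R u + \<eta> *\<^sub>R v) *v v))"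
    using assms by (intro MVT2 gradient_line) auto
  then obtain \<eta> where \<eta>: "0 < \<eta>" "\<eta> < s"
    "?h s - ?h 0 = s * (u \<bullet> (A (x + \<xi> *\<^sub>R u + \<eta> *\<^sub>R v) *v v))" by auto
  have "?g s - ?g 0 = s^2 * (u \<bullet> (A (x + \<xi> *\<^sub>R u + \<eta> *\<^sub>R v) *v v))"
    using \<xi>(3) \<eta>(3) by (simp add: add_ac power2_eq_square)
  then show ?thesis using \<xi> \<eta> by (intro bexI[of _ \<xi>] bexI[of _ \<eta>]) (auto simp: add_ac)
qed

lemma hessian_form_continuous: "continuous_on S (\<lambda>y. u \<bullet> (A y *v v))"
  unfolding matrix_vector_mult_def inner_vec_def
  by (auto intro!: continuous_intros continuous_on_hessian)

text \<open>Both orders of the mixed second difference are compared as s\<rightarrow>0, using that the Hessian is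
continuous.\<close>

lemma hessian_symmetric: "transpose (A x) = A x"
proof -
  have *: "u \<bullet> (A x *v v) \<le> v \<bullet> (A x *v u)" for u v
  proof (rule field_le_epsilon)
    fix e :: real assume "0 < e"
    have near: "\<exists>r>0. \<forall>\<xi> \<eta>. \<bar>\<xi>\<bar> < r --> \<bar>\<eta>\<bar> < r -->
      \<bar>a \<bullet> (A (x + \<xi> *\<^sub>R a + \<eta> *\<^sub>R b) *v b) - a \<bullet> (A x *v b)\<bar> < e / 2" for a b
    proof -
      have c: "continuous (at x) (\<lambda>y. a \<bullet> (A y *v b))"
        using hessian_form_continuous[of UNIV a b] by (simp add: continuous_on_eq_continuous_at)
      obtain d where d: "d > 0" "\<And>y. dist y x < d ==> dist (a \<bullet> (A y *v b)) (a \<bullet> (A x *v b)) < e / 2"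
        using c[unfolded continuous_at_eps_delta, rule_format, of "e / 2"] \<open>0 < e\<close> by auto
      define r where "r = d / (norm a + norm b + 1)"
      have pos: "0 < norm a + norm b + 1"
        by (intro add_nonneg_pos add_nonneg_nonneg) auto
      then have r: "r > 0" using d by (simp add: r_def)
      moreover have "dist (x + \<xi> *\<^sub>R a + \<eta> *\<^sub>R b) x < d" if "\<bar>\<xi>\<bar> < r" "\<bar>\<eta>\<bar> < r" for \<xi> \<eta>
      proof -
        have "dist (x + \<xi> *\<^sub>R a + \<eta> *\<^sub>R b) x \<le> \<bar>\<xi>\<bar> * norm a + \<bar>\<eta>\<bar> * norm b"
          using norm_triangle_ineq[of "\<xi> *\<^sub>R a" "\<eta> *\<^sub>R b"] by (simp add: dist_norm)
        also have "... \<le> r * norm a + r * norm b"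
          using that by (intro add_mono mult_right_mono) auto
        also have "... < r * (norm a + norm b + 1)" using r by (simp add: algebra_simps)
        also have "... = d" using pos by (simp add: r_def)
        finally show ?thesis .
      qed
      ultimately show ?thesis using d(2) by (auto simp: dist_real_def)
    qed
    obtain r1 where r1: "r1 > 0" "\<And>\<xi> \<eta>. \<bar>\<xi>\<bar> < r1 ==> \<bar>\<eta>\<bar> < r1 ==>
      \<bar>u \<bullet> (A (x + \<xi> *\<^sub>R u + \<eta> *\<^sub>R v) *v v) - u \<bullet> (A x *v v)\<bar> < e / 2" using near[of u v] by auto
    obtain r2 where r2: "r2 > 0" "\<And>\<xi> \<eta>. \<bar>\<xi>\<bar> < r2 ==> \<bar>\<eta>\<bar> < r2 ==>
      \<bar>v \<bullet> (A (x + \<xi> *\<^sub>R v + \<eta> *\<^sub>R u) *v u) - v \<bullet> (A x *v u)\<bar> < e / 2" using near[of v u] by auto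
    define s where "s = min r1 r2"
    have s: "0 < s" "s \<le> r1" "s \<le> r2" using r1 r2 by (auto simp: s_def)
    obtain \<xi> \<eta> where 1: "0 < \<xi>" "\<xi> < s" "0 < \<eta>" "\<eta> < s"
      "\<phi> (x + s *\<^sub>R u + s *\<^sub>R v) - \<phi> (x + s *\<^sub>R u) - (\<phi> (x + s *\<^sub>R v) - \<phi> x) =
      s^2 * (u \<bullet> (A (x + \<xi> *\<^sub>R u + \<eta> *\<^sub>R v) *v v))"
      using second_difference[OF \<open>0 < s\<close>, of x u v] by auto
    obtain \<xi>' \<eta>' where 2: "0 < \<xi>'" "\<xi>' < s" "0 < \<eta>'" "\<eta>' < s"
      "\<phi> (x + s *\<^sub>R v + s *\<^sub>R u) - \<phi> (x + s *\<^sub>R v) - (\<phi> (x + s *\<^sub>R u) - \<phi> x) =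
      s^2 * (v \<bullet> (A (x + \<xi>' *\<^sub>R v + \<eta>' *\<^sub>R u) *v u))"
      using second_difference[OF \<open>0 < s\<close>, of x v u] by auto
    have "s^2 * (u \<bullet> (A (x + \<xi> *\<^sub>R u + \<eta> *\<^sub>R v) *v v)) = s^2 * (v \<bullet> (A (x + \<xi>' *\<^sub>R v + \<eta>' *\<^sub>R u) *v u))"
      unfolding 1(5)[symmetric] 2(5)[symmetric] by (simp add: add_ac)
    then have "u \<bullet> (A (x + \<xi> *\<^sub>R u + \<eta> *\<^sub>R v) *v v) = v \<bullet> (A (x + \<xi>' *\<^sub>R v + \<eta>' *\<^sub>R u) *v u)"
      using s by simp
    moreover have "\<bar>u \<bullet> (A (x + \<xi> *\<^sub>R u + \<eta> *\<^sub>R v) *v v) - u \<bullet> (A x *v v)\<bar> < e / 2"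
      using 1 s by (intro r1) auto
    moreover have "\<bar>v \<bullet> (A (x + \<xi>' *\<^sub>R v + \<eta>' *\<^sub>R u) *v u) - v \<bullet> (A x *v u)\<bar> < e / 2"
      using 2 s by (intro r2) auto
    ultimately show "u \<bullet> (A x *v v) \<le> v \<bullet> (A x *v u) + e" by linarith
  qed
  have "u \<bullet> (A x *v v) = v \<bullet> (A x *v u)" for u v using *[of u v] *[of v u] by linarith
  from this[of "axis i 1" "axis j 1" for i j] show ?thesis
    by (simp add: vec_eq_iff transpose_def matrix_vector_mult_basis column_def inner_axis')
qed

lemma det_hessian_pos: "0 < det (A x)"
  by (intro pos_def_det_pos hessian_symmetric hessian_pos)

lemma bregman_mean_value:
  "\<exists>t\<in>{0<..<1}. 2 * bregman \<phi> x y = (x - y) \<bullet> (A (y + t *\<^sub>R (x - y)) *v (x - y))"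
proof -
  let ?u = "x - y"
  let ?diff = "\<lambda>(m::nat) (t::real). if m = 0 then \<phi> (y + t *\<^sub>R ?u) else if m = 1 then T (y + t *\<^sub>R ?u) \<bullet> ?u
     else ?u \<bullet> (A (y + t *\<^sub>R ?u) *v ?u)"
  have "\<exists>t>0. t < 1 \<and> \<phi> (y + 1 *\<^sub>R ?u) = (\<Sum>m<2. ?diff m 0 / fact m * 1 ^ m) + ?diff 2 t / fact 2 * 1 ^ 2"
    by (rule Maclaurin[where diff = ?diff])
      (auto simp: less_Suc_eq numeral_2_eq_2 phi_line gradient_line)
  then obtain t where "t > 0" "t < 1" "\<phi> (y + ?u) = \<phi> y + T y \<bullet> ?u + (?u \<bullet> (A (y + t *\<^sub>R ?u) *v ?u)) / 2"
    by (auto simp: numeral_2_eq_2)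
  then show ?thesis by (intro bexI[of _ t]) (auto simp: bregman_def)
qed

lemma bregman_ge: "\<sigma>m * (norm (x - y))^2 \<le> 2 * bregman \<phi> x y"
  using bregman_mean_value[of x y] hessian_ge by metis

lemma bregman_le: "2 * bregman \<phi> x y \<le> \<sigma>M * (norm (x - y))^2"
  using bregman_mean_value[of x y] hessian_le by metis

lemma bregman_nonneg: "0 \<le> bregman \<phi> x y"
  using bregman_ge[of x y] \<sigma>m_pos by (smt (verit) mult_nonneg_nonneg zero_le_power2)

text \<open>The Bregman gaps at (x,y) and (y,x) add up to (T(x)-T(y))\<cdot>(x-y), and each is at least
\<sigma>m|x-y|^2/2.\<close>

lemma gradient_expanding: "\<sigma>m * norm (x - y) \<le> norm (T x - T y)"
proof (cases "x = y")
  case False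
  have "\<sigma>m * (norm (x - y))^2 \<le> bregman \<phi> x y + bregman \<phi> y x"
    using bregman_ge[of x y] bregman_ge[of y x] by (simp add: norm_minus_commute)
  also have "... = (T x - T y) \<bullet> (x - y)" by (simp add: bregman_def algebra_simps)
  also have "... \<le> norm (T x - T y) * norm (x - y)" by (rule norm_cauchy_schwarz)
  finally show ?thesis using False by (simp add: power2_eq_square)
qed simp

lemma inj_gradient: "inj T"
proof (rule injI)
  fix x y assume "T x = T y"
  then have "\<sigma>m * norm (x - y) \<le> 0" using gradient_expanding[of x y] by simp
  then show "x = y" using \<sigma>m_pos by (simp add: mult_le_0_iff)
qed

text \<open>The range of T is open, by invariance of domain, and closed, because T is expanding.\<close>

lemma surj_gradient: "surj T"
proof -
  have "open (range T)"
    by (intro invariance_of_domain continuous_on_gradient inj_gradient) simp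
  moreover have "closed (range T)"
    unfolding closed_sequential_limits
  proof safe
    fix f l assume f: "\<forall>n. f n \<in> range T" and lim: "f \<longlonglongrightarrow> l"
    define g where "g n = inv T (f n)" for n
    have g: "T (g n) = f n" for n using f by (simp add: g_def f_inv_into_f)
    have "Cauchy g"
    proof (rule metric_CauchyI)
      fix e :: real assume "0 < e"
      then have "0 < e * \<sigma>m" using \<sigma>m_pos by simp
      then obtain N where N: "\<And>m n. m \<ge> N ==> n \<ge> N ==> dist (f m) (f n) < e * \<sigma>m"
        using LIMSEQ_imp_Cauchy[OF lim] metric_CauchyD by blast
      have "dist (g m) (g n) < e" if "m \<ge> N" "n \<ge> N" for m n
      proof -
        have "\<sigma>m * dist (g m) (g n) < \<sigma>m * e"
          using gradient_expanding[of "g m" "g n"] N[OF that] by (simp add: g dist_norm mult.commute)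
        then show ?thesis using \<sigma>m_pos by simp
      qed
      then show "\<exists>M. \<forall>m\<ge>M. \<forall>n\<ge>M. dist (g m) (g n) < e" by blast
    qed
    then obtain z where z: "g \<longlonglongrightarrow> z" using Cauchy_convergent convergent_def by blast
    have "isCont T z" using continuous_on_gradient[of UNIV] by (simp add: continuous_on_eq_continuous_at)
    then have "(\<lambda>n. T (g n)) \<longlonglongrightarrow> T z" using z by (rule isCont_tendsto_compose)
    then have "l = T z" using lim by (simp add: g LIMSEQ_unique)
    then show "l \<in> range T" by simp
  qed
  ultimately show ?thesis using clopen[of "range T"] by auto
qed

abbreviation "S \<equiv> inv T"

lemma T_S [simp]: "T (S y) = y" using surj_gradient by (rule surj_f_inv_f)
lemma S_T [simp]: "S (T x) = x" using inj_gradient by (rule inv_f_f)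

lemma continuous_on_inv_gradient: "continuous_on X S"
proof -
  have "(1 / \<sigma>m)-lipschitz_on X S"
  proof (rule lipschitz_onI)
    fix x y
    show "dist (S x) (S y) \<le> 1 / \<sigma>m * dist x y"
      using gradient_expanding[of "S x" "S y"] \<sigma>m_pos by (simp add: dist_norm field_simps)
  qed (use \<sigma>m_pos in simp)
  then show ?thesis by (rule lipschitz_on_continuous_on)
qed

lemma gradient_measurable [measurable]: "T \<in> borel_measurable borel"
  by (intro borel_measurable_continuous_onI continuous_on_gradient)
lemma inv_gradient_measurable [measurable]: "S \<in> borel_measurable borel"
  by (intro borel_measurable_continuous_onI continuous_on_inv_gradient)
lemma phi_measurable [measurable]: "\<phi> \<in> borel_measurable borel"
  by (intro borel_measurable_continuous_onI continuous_on_phi)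
lemma det_hessian_continuous: "continuous_on X (\<lambda>x. det (A x))"
  unfolding det_def by (auto intro!: continuous_intros continuous_on_hessian)
lemma det_hessian_measurable [measurable]: "(\<lambda>x. det (A x)) \<in> borel_measurable borel"
  by (intro borel_measurable_continuous_onI det_hessian_continuous)
lemma bregman_measurable [measurable]:
  "(\<lambda>z. bregman \<phi> (fst z) (snd z)) \<in> borel_measurable borel"
  unfolding bregman_def
  by (intro borel_measurable_continuous_onI continuous_intros
      continuous_on_compose2[OF continuous_on_phi] continuous_on_compose2[OF continuous_on_gradient]) auto

end

section \<open>Density points\<close>

text \<open>Lebesgue differentiation for a measure at points of one of its null sets. Where the average stays above
1/k, an open set U\<supseteq> N of small L-mass is covered in the sense of Vitali by disjoint balls whose volume is at
most a multiple of their L-mass, so such points form a null set.\<close>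

lemma cball_average_vanishes:
  fixes L :: "'a::euclidean_space measure"
  assumes "finite_measure L" and sets [simp]: "sets L = sets borel"
    and N [measurable]: "N \<in> sets borel" and null: "emeasure L N = 0"
  shows "AE x in lborel. x \<in> N -->
    ((\<lambda>r. measure L (cball x r) / r ^ DIM('a)) \<longlongrightarrow> 0) (at_right 0)"
proof -
  interpret finite_measure L by fact
  define Bad where "Bad k = {x\<in>N. \<forall>d>0. \<exists>r>0. r < d \<and> r ^ DIM('a) < real (Suc k) * measure L (cball x r)}" for k
  have space: "space L = UNIV" using sets_eq_imp_space_eq[OF sets] by simp
  have cball_sets [measurable]: "cball x r \<in> sets L" for x :: 'a and r by simp
  have neg: "negligible (Bad k)" for k
    unfolding negligible_outer_le
  proof (intro allI impI)
    fix e :: real assume "0 < e"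
    define \<omega> where "\<omega> = unit_ball_vol (real DIM('a))"
    have \<omega>: "0 < \<omega>" by (simp add: \<omega>_def)
    define e' where "e' = e / (\<omega> * real (Suc k))"
    have "0 < e'" using \<open>0 < e\<close> \<omega> by (simp add: e'_def)
    have "(INF U\<in>{U. N \<subseteq> U \<and> open U}. emeasure L U) = 0"
      using outer_regular[OF sets _ N] null by (simp add: emeasure_finite)
    then have "(INF U\<in>{U. N \<subseteq> U \<and> open U}. emeasure L U) < ennreal e'"
      using \<open>0 < e'\<close> by simp
    then obtain U where U: "N \<subseteq> U" "open U" "emeasure L U < ennreal e'"
      by (auto simp: INF_less_iff)
    define K where "K = {z. fst z \<in> Bad k \<and> 0 < snd z \<and> cball (fst z) (snd z) \<subseteq> U \<and>
       snd z ^ DIM('a) < real (Suc k) * measure L (cball (fst z) (snd z))}"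
    obtain C where C: "countable C" "C \<subseteq> K"
       "pairwise (\<lambda>i j. disjnt (cball (fst i) (snd i)) (cball (fst j) (snd j))) C"
       "negligible (Bad k - (\<Union>i\<in>C. cball (fst i) (snd i)))"
    proof (rule Vitali_covering_theorem_cballs[of K snd "Bad k" fst])
      show "0 < snd i" if "i \<in> K" for i using that by (simp add: K_def)
      fix x and d :: real assume x: "x \<in> Bad k" and "0 < d"
      then have "x \<in> U" using U by (auto simp: Bad_def)
      then obtain d' where d': "0 < d'" "cball x d' \<subseteq> U"
        using \<open>open U\<close> open_contains_cball by blast
      then have "0 < min d d'" using \<open>0 < d\<close> by simp
      then obtain r where r: "0 < r" "r < min d d'" "r ^ DIM('a) < real (Suc k) * measure L (cball x r)"
        using x unfolding Bad_def by blast
      have "cball x r \<subseteq> U" using r d' by (meson cball_subset_cball_iff less_imp_le min.strict_boundedE order_trans subset_cball)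
      then show "\<exists>i. i \<in> K \<and> x \<in> cball (fst i) (snd i) \<and> snd i < d"
        using r x by (intro exI[of _ "(x, r)"]) (auto simp: K_def)
    qed
    define V where "V = (\<Union>i\<in>C. cball (fst i) (snd i))"
    have V: "V \<in> sets borel" unfolding V_def using C(1) by (intro sets.countable_UN') auto
    have disj: "disjoint_family_on (\<lambda>i. cball (fst i) (snd i)) C"
      using C(3) by (auto simp: disjoint_family_on_def pairwise_def disjnt_def)
    have "emeasure lborel V = (\<integral>\<^sup>+i. emeasure lborel (cball (fst i) (snd i)) \<partial>count_space C)"
      unfolding V_def by (intro emeasure_UN_countable C(1) disj) auto
    also have "... \<le> (\<integral>\<^sup>+i. ennreal (\<omega> * real (Suc k)) * emeasure L (cball (fst i) (snd i)) \<partial>count_space C)"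
    proof (rule nn_integral_mono)
      fix i assume "i \<in> space (count_space C)"
      then have i: "0 < snd i" "snd i ^ DIM('a) < real (Suc k) * measure L (cball (fst i) (snd i))"
        using C(2) by (auto simp: K_def)
      then have "emeasure lborel (cball (fst i) (snd i)) = ennreal (\<omega> * snd i ^ DIM('a))"
        by (simp add: emeasure_cball \<omega>_def)
      also have "... \<le> ennreal (\<omega> * (real (Suc k) * measure L (cball (fst i) (snd i))))"
        using i \<omega> by (intro ennreal_leI mult_left_mono) auto
      also have "... = ennreal (\<omega> * real (Suc k)) * emeasure L (cball (fst i) (snd i))"
        using \<omega> by (simp add: emeasure_eq_measure ennreal_mult' mult.assoc)
      finally show "emeasure lborel (cball (fst i) (snd i)) \<le>
        ennreal (\<omega> * real (Suc k)) * emeasure L (cball (fst i) (snd i))" .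
    qed
    also have "... = ennreal (\<omega> * real (Suc k)) * (\<integral>\<^sup>+i. emeasure L (cball (fst i) (snd i)) \<partial>count_space C)"
      by (rule nn_integral_cmult) simp
    also have "(\<integral>\<^sup>+i. emeasure L (cball (fst i) (snd i)) \<partial>count_space C) = emeasure L V"
      unfolding V_def by (intro emeasure_UN_countable[symmetric] C(1) disj) auto
    finally have "emeasure lborel V \<le> ennreal (\<omega> * real (Suc k)) * emeasure L V" .
    also have "... \<le> ennreal (\<omega> * real (Suc k)) * ennreal e'"
    proof (rule mult_left_mono)
      have "emeasure L V \<le> emeasure L U"
        using C(2) \<open>open U\<close> by (intro emeasure_mono) (auto simp: V_def K_def)
      then show "emeasure L V \<le> ennreal e'" using U by simp
    qed simp
    also have "... = ennreal e"
      using \<omega> \<open>0 < e\<close> by (simp add: ennreal_mult'[symmetric] e'_def)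
    finally have Vle: "emeasure lborel V \<le> ennreal e" .
    then have Vl: "V \<in> lmeasurable"
      using V by (intro fmeasurableI) (auto simp: less_top[symmetric] top_unique)
    have mV: "measure lebesgue V \<le> e"
      using Vle V \<open>0 < e\<close> by (simp add: measure_def enn2real_leI)
    have nV: "negligible (Bad k - V)" using C(4) unfolding V_def .
    have eq: "Bad k \<union> V = V \<union> (Bad k - V)" by auto
    have "V \<union> (Bad k - V) \<in> lmeasurable"
      by (intro fmeasurable.Un Vl negligible_imp_measurable nV)
    moreover have "measure lebesgue (V \<union> (Bad k - V)) \<le> measure lebesgue V + measure lebesgue (Bad k - V)"
      by (intro measure_Un_le fmeasurableD Vl negligible_imp_measurable nV)
    ultimately have "Bad k \<union> V \<in> lmeasurable \<and> measure lebesgue (Bad k \<union> V) \<le> e"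
      unfolding eq using mV negligible_imp_measure0[OF nV] by linarith
    then show "\<exists>T. Bad k \<subseteq> T \<and> T \<in> lmeasurable \<and> measure lebesgue T \<le> e" by blast
  qed
  have "negligible (\<Union>k. Bad k)" by (rule negligible_countable_Union) (auto simp: neg)
  then have "(\<Union>k. Bad k) \<in> null_sets (completion lborel)" by (simp add: negligible_iff_null_sets)
  then obtain N' where N': "N' \<in> null_sets lborel" "(\<Union>k. Bad k) \<subseteq> N'"
    by (auto simp: null_sets_completion_iff2)
  show ?thesis
  proof (rule AE_I'[OF N'(1)], rule subsetI)
    fix x assume "x \<in> {x \<in> space lborel. \<not> (x \<in> N -->
      ((\<lambda>r. measure L (cball x r) / r ^ DIM('a)) \<longlongrightarrow> 0) (at_right 0))}"
    then have x: "x \<in> N" "\<not> ((\<lambda>r. measure L (cball x r) / r ^ DIM('a)) \<longlongrightarrow> 0) (at_right 0)"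
      by auto
    have "\<exists>k. x \<in> Bad k"
    proof (rule ccontr)
      assume nb: "\<nexists>k. x \<in> Bad k"
      have "((\<lambda>r. measure L (cball x r) / r ^ DIM('a)) \<longlongrightarrow> 0) (at_right 0)"
      proof (rule tendstoI)
        fix e :: real assume "0 < e"
        then obtain k where k: "1 / real (Suc k) < e" by (rule nat_approx_posE)
        from nb have "x \<notin> Bad k" by simp
        then obtain d where d: "d > 0" "\<And>r. 0 < r ==> r < d ==> real (Suc k) * measure L (cball x r) \<le> r ^ DIM('a)"
          using \<open>x \<in> N\<close> unfolding Bad_def mem_Collect_eq by (meson not_less)
        have "dist (measure L (cball x r) / r ^ DIM('a)) 0 < e" if "0 < r" "r < d" for r
        proof -
          have "measure L (cball x r) / r ^ DIM('a) \<le> 1 / real (Suc k)"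
            using d(2)[OF that] that by (simp add: field_simps del: of_nat_Suc)
          then show ?thesis using k that by (simp add: dist_real_def)
        qed
        then show "\<forall>\<^sub>F r in at_right 0. dist (measure L (cball x r) / r ^ DIM('a)) 0 < e"
          using d(1) by (auto simp: eventually_at_right_field)
      qed
      with x show False by simp
    qed
    then show "x \<in> N'" using N' by auto
  qed
qed

text \<open>Almost every point of a set is a density point: Lebesgue measure on the complement, cut off to a finite
measure, does not charge the set.\<close>

lemma density_point_complement:
  fixes E :: "'a::euclidean_space set"
  assumes E [measurable]: "E \<in> sets borel"
  shows "AE x in lborel. x \<in> E -->
    ((\<lambda>r. measure lborel (cball x r - E) / r ^ DIM('a)) \<longlongrightarrow> 0) (at_right 0)"
proof -
  let ?F = "\<lambda>n::nat. cball 0 (real n) - E"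
  let ?L = "\<lambda>n. density lborel (indicator (?F n))"
  have em: "emeasure (?L n) X = emeasure lborel (X \<inter> ?F n)" if "X \<in> sets borel" for n X
    using that by (simp add: emeasure_restricted Int_commute)
  have fin: "emeasure lborel (X \<inter> ?F n) < \<infinity>" if "X \<in> sets borel" for n X
    by (rule le_less_trans[OF emeasure_mono[of _ "cball 0 (real n)"] emeasure_lborel_cball_finite]) auto
  have "AE x in lborel. x \<in> E --> ((\<lambda>r. measure (?L n) (cball x r) / r ^ DIM('a)) \<longlongrightarrow> 0) (at_right 0)" for n
  proof (rule cball_average_vanishes)
    show "finite_measure (?L n)" using fin[of UNIV n] by (intro finite_measureI) (auto simp: em)
    show "emeasure (?L n) E = 0" by (subst em) auto
  qed auto
  then have "AE x in lborel. \<forall>n. x \<in> E --> ((\<lambda>r. measure (?L n) (cball x r) / r ^ DIM('a)) \<longlongrightarrow> 0) (at_right 0)"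
    by (intro AE_all_countable[THEN iffD2] allI)
  then show ?thesis
  proof (eventually_elim, safe)
    fix x assume "\<forall>n. x \<in> E --> ((\<lambda>r. measure (?L n) (cball x r) / r ^ DIM('a)) \<longlongrightarrow> 0) (at_right 0)" and x: "x \<in> E"
    then have lim: "((\<lambda>r. measure (?L n) (cball x r) / r ^ DIM('a)) \<longlongrightarrow> 0) (at_right 0)" for n by simp
    obtain n :: nat where n: "norm x + 1 \<le> real n" using real_arch_simple by blast
    have "\<forall>\<^sub>F r in at_right 0. measure (?L n) (cball x r) / r ^ DIM('a) = measure lborel (cball x r - E) / r ^ DIM('a)"
      unfolding eventually_at_right_field
    proof (intro exI[of _ 1] conjI allI impI)
      fix r :: real assume r: "0 < r" "r < 1"
      have "cball x r \<subseteq> cball 0 (real n)"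
      proof
        fix y assume "y \<in> cball x r"
        then show "y \<in> cball 0 (real n)"
          using n r dist_triangle[of 0 y x] by (simp add: dist_norm)
      qed
      then have "cball x r \<inter> ?F n = cball x r - E" by auto
      then show "measure (?L n) (cball x r) / r ^ DIM('a) = measure lborel (cball x r - E) / r ^ DIM('a)"
        by (simp add: measure_def em)
    qed simp
    then show "((\<lambda>r. measure lborel (cball x r - E) / r ^ DIM('a)) \<longlongrightarrow> 0) (at_right 0)"
      using lim[of n] by (rule Lim_transform_eventually[rotated])
  qed
qed

text \<open>The measure with density (f-s)^+ does not charge {f\<le> s}. This one-sided form of Lebesgue points
suffices for the lower bound.\<close>

lemma excess_average_vanishes:
  fixes f :: "'a::euclidean_space => real"
  assumes f [measurable]: "f \<in> borel_measurable borel" and fin: "(\<integral>\<^sup>+x. ennreal (f x) \<partial>lborel) < \<infinity>" and "0 \<le> s"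
  shows "AE x in lborel. f x \<le> s -->
    ((\<lambda>r. (\<integral>\<^sup>+y. ennreal (f y - s) * indicator (cball x r) y \<partial>lborel) / ennreal (r ^ DIM('a))) \<longlongrightarrow> 0) (at_right 0)"
proof -
  let ?L = "density lborel (\<lambda>y. ennreal (f y - s))"
  have em: "emeasure ?L X = (\<integral>\<^sup>+y. ennreal (f y - s) * indicator X y \<partial>lborel)" if "X \<in> sets borel" for X
    using that by (simp add: emeasure_density)
  have "emeasure ?L UNIV < \<infinity>"
  proof -
    have "emeasure ?L UNIV \<le> (\<integral>\<^sup>+x. ennreal (f x) \<partial>lborel)"
      by (subst em) (use \<open>0 \<le> s\<close> in \<open>auto intro!: nn_integral_mono ennreal_leI\<close>)
    then show ?thesis using fin by (rule le_less_trans)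
  qed
  then have fm: "finite_measure ?L" by (intro finite_measureI) simp
  have "AE x in lborel. x \<in> {x. f x \<le> s} --> ((\<lambda>r. measure ?L (cball x r) / r ^ DIM('a)) \<longlongrightarrow> 0) (at_right 0)"
  proof (rule cball_average_vanishes[OF fm])
    have "(\<integral>\<^sup>+y. ennreal (f y - s) * indicator {x. f x \<le> s} y \<partial>lborel) = (\<integral>\<^sup>+y. 0 \<partial>(lborel :: 'a measure))"
      by (intro nn_integral_cong) (auto simp: indicator_def ennreal_neg)
    then show "emeasure ?L {x. f x \<le> s} = 0" by (subst em) auto
  qed auto
  then show ?thesis
  proof (eventually_elim, intro impI)
    fix x assume "x \<in> {x. f x \<le> s} --> ((\<lambda>r. measure ?L (cball x r) / r ^ DIM('a)) \<longlongrightarrow> 0) (at_right 0)" "f x \<le> s"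
    then have "((\<lambda>r. measure ?L (cball x r) / r ^ DIM('a)) \<longlongrightarrow> 0) (at_right 0)" by simp
    then have "((\<lambda>r. ennreal (measure ?L (cball x r) / r ^ DIM('a))) \<longlongrightarrow> ennreal 0) (at_right 0)"
      by (rule tendsto_ennrealI)
    moreover have "\<forall>\<^sub>F r in at_right 0. ennreal (measure ?L (cball x r) / r ^ DIM('a)) =
       (\<integral>\<^sup>+y. ennreal (f y - s) * indicator (cball x r) y \<partial>lborel) / ennreal (r ^ DIM('a))"
      unfolding eventually_at_right_field
      by (intro exI[of _ 1] conjI allI impI)
        (auto simp: divide_ennreal[symmetric] finite_measure.emeasure_eq_measure[OF fm, symmetric] em)
    ultimately have "((\<lambda>r. (\<integral>\<^sup>+y. ennreal (f y - s) * indicator (cball x r) y \<partial>lborel) / ennreal (r ^ DIM('a))) \<longlongrightarrow> ennreal 0) (at_right 0)"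
      by (rule Lim_transform_eventually)
    then show "((\<lambda>r. (\<integral>\<^sup>+y. ennreal (f y - s) * indicator (cball x r) y \<partial>lborel) / ennreal (r ^ DIM('a))) \<longlongrightarrow> 0) (at_right 0)"
      by simp
  qed
qed

section \<open>Steiner symmetrisation\<close>

abbreviation prod_lborel :: "'i set => ('i => real) measure" where
  "prod_lborel I \<equiv> Pi\<^sub>M I (\<lambda>_. lborel)"

text \<open>Every section in direction i is replaced by the centred open interval of the same length.\<close>

definition steiner :: "'i => 'i set => ('i => real) set => ('i => real) set" where
  "steiner i I A = {f \<in> space (prod_lborel I). ennreal (2 * \<bar>f i\<bar>) < emeasure lborel {t. f(i := t) \<in> A}}"

text \<open>If all distances were below a+b, the convex hulls of P and Q would have total length at most
2(a+b).\<close>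

lemma far_points_of_long_sets:
  fixes P Q :: "real set"
  assumes [measurable]: "P \<in> sets borel" "Q \<in> sets borel"
    and a: "ennreal (2 * a) < emeasure lborel P" and b: "ennreal (2 * b) < emeasure lborel Q"
    and "0 \<le> a" "0 \<le> b"
  shows "\<exists>s\<in>P. \<exists>t\<in>Q. a + b \<le> \<bar>s - t\<bar>"
proof (rule ccontr)
  assume "\<not> ?thesis"
  then have near: "\<And>s t. s \<in> P ==> t \<in> Q ==> \<bar>s - t\<bar> < a + b" by force
  obtain s0 t0 where s0: "s0 \<in> P" and t0: "t0 \<in> Q"
    using a b by (cases "P = {}"; cases "Q = {}") auto
  have bdP: "bdd_above P" "bdd_below P"
    by (rule bdd_aboveI[of _ "t0 + (a + b)"], use near[OF _ t0] in force)
      (rule bdd_belowI[of _ "t0 - (a + b)"], use near[OF _ t0] in force)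
  have bdQ: "bdd_above Q" "bdd_below Q"
    by (rule bdd_aboveI[of _ "s0 + (a + b)"], use near[OF s0] in force)
      (rule bdd_belowI[of _ "s0 - (a + b)"], use near[OF s0] in force)
  have len: "emeasure lborel R \<le> ennreal (Sup R - Inf R)" and le: "Inf R \<le> Sup R"
    if "bdd_above R" "bdd_below R" "R \<noteq> {}" "R \<in> sets borel" for R :: "real set"
  proof -
    show "Inf R \<le> Sup R" using that cInf_le_cSup by blast
    have "emeasure lborel R \<le> emeasure lborel {Inf R..Sup R}"
      using that by (intro emeasure_mono) (auto intro: cInf_lower cSup_upper)
    then show "emeasure lborel R \<le> ennreal (Sup R - Inf R)" using \<open>Inf R \<le> Sup R\<close> by simp
  qed
  have "Sup P \<le> Inf Q + (a + b)"
  proof (rule cSup_least)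
    fix s assume s: "s \<in> P"
    have "s - (a + b) \<le> Inf Q" using t0 near[OF s] by (intro cInf_greatest) force+
    then show "s \<le> Inf Q + (a + b)" by simp
  qed (use s0 in auto)
  moreover have "Sup Q \<le> Inf P + (a + b)"
  proof (rule cSup_least)
    fix t assume t: "t \<in> Q"
    have "t - (a + b) \<le> Inf P" using s0 near[OF _ t] by (intro cInf_greatest) force+
    then show "t \<le> Inf P + (a + b)" by simp
  qed (use t0 in auto)
  moreover have "2 * a < Sup P - Inf P"
    using less_le_trans[OF a len[OF bdP]] le[OF bdP] s0 \<open>0 \<le> a\<close> by (auto simp: ennreal_less_iff)
  moreover have "2 * b < Sup Q - Inf Q"
    using less_le_trans[OF b len[OF bdQ]] le[OF bdQ] t0 \<open>0 \<le> b\<close> by (auto simp: ennreal_less_iff)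
  ultimately show False by linarith
qed

lemma emeasure_centred_interval:
  "emeasure lborel {t :: real. ennreal (2 * \<bar>t\<bar>) < l} = l"
proof (cases l)
  case (real r)
  have "{t. ennreal (2 * \<bar>t\<bar>) < l} = {- (r / 2) <..< r / 2}"
    using real by (auto simp: ennreal_less_iff)
  then show ?thesis using real by simp
qed (simp add: emeasure_lborel_UNIV)

context
  fixes I :: "'i set" and i :: 'i and A :: "('i => real) set"
  assumes I: "finite I" "i \<in> I" and A: "A \<in> sets (prod_lborel I)"
begin

lemma update_space: "f \<in> space (prod_lborel I) ==> f(i := t) \<in> space (prod_lborel I)"
  using I by (auto simp: space_PiM PiE_def extensional_def)

lemma section_measurable: "f \<in> space (prod_lborel I) ==> {t. f(i := t) \<in> A} \<in> sets borel"
proof -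
  assume f: "f \<in> space (prod_lborel I)"
  have "(\<lambda>t. f(i := t)) \<in> lborel \<rightarrow>\<^sub>M prod_lborel I"
    using measurable_fun_upd[of I "I - {i}" i "\<lambda>_. f" lborel] f I
    by (intro measurable_PiM_single') (auto simp: space_PiM PiE_def extensional_def Pi_def)
  then have "(\<lambda>t. f(i := t)) -` A \<inter> space lborel \<in> sets lborel" using A by (rule measurable_sets)
  then show ?thesis by (simp add: vimage_def)
qed

lemma section_length_measurable:
  "(\<lambda>f. emeasure lborel {t. f(i := t) \<in> A}) \<in> borel_measurable (prod_lborel I)"
proof -
  have *: "(\<lambda>z. (fst z)(i := snd z)) \<in> prod_lborel I \<Otimes>\<^sub>M lborel \<rightarrow>\<^sub>M prod_lborel I"
    using I by (intro measurable_PiM_single') 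
      (auto simp: space_pair_measure space_PiM PiE_def extensional_def Pi_def)
  have m: "{z \<in> space (prod_lborel I \<Otimes>\<^sub>M lborel). (fst z)(i := snd z) \<in> A} \<in> sets (prod_lborel I \<Otimes>\<^sub>M lborel)"
  proof -
    have eq: "{z \<in> space (prod_lborel I \<Otimes>\<^sub>M lborel). (fst z)(i := snd z) \<in> A} =
        (\<lambda>z. (fst z)(i := snd z)) -` A \<inter> space (prod_lborel I \<Otimes>\<^sub>M lborel)" by auto
    show ?thesis unfolding eq by (rule measurable_sets[OF * A])
  qed
  have "(\<lambda>f. emeasure lborel (Pair f -` {z \<in> space (prod_lborel I \<Otimes>\<^sub>M lborel). (fst z)(i := snd z) \<in> A})) \<in> borel_measurable (prod_lborel I)"
    by (rule sigma_finite_measure.measurable_emeasure_Pair[OF sigma_finite_lborel m])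
  then show ?thesis
    by (rule measurable_cong[THEN iffD1, rotated]) (auto simp: space_pair_measure intro!: arg_cong[where f = "emeasure lborel"])
qed

lemma steiner_sets: "steiner i I A \<in> sets (prod_lborel I)"
proof -
  have [measurable]: "(\<lambda>f. f i) \<in> borel_measurable (prod_lborel I)" using I by measurable
  note [measurable] = section_length_measurable
  show ?thesis unfolding steiner_def by measurable
qed

lemma emeasure_steiner: "emeasure (prod_lborel I) (steiner i I A) = emeasure (prod_lborel I) A"
proof -
  interpret product_sigma_finite "\<lambda>_ :: 'i. lborel :: real measure" by standard
  define J where "J = I - {i}"
  have J: "finite J" "i \<notin> J" "I = insert i J" using I by (auto simp: J_def)
  have meas: "emeasure (prod_lborel I) X = (\<integral>\<^sup>+f. emeasure lborel {t. f(i := t) \<in> X} \<partial>prod_lborel J)"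
    if X: "X \<in> sets (prod_lborel I)"
      and Xm: "\<And>f. f \<in> space (prod_lborel J) ==> {t. f(i := t) \<in> X} \<in> sets borel" for X
  proof -
    have "emeasure (prod_lborel I) X = (\<integral>\<^sup>+f. indicator X f \<partial>prod_lborel (insert i J))"
      using X J by simp
    also have "... = (\<integral>\<^sup>+f. \<integral>\<^sup>+t. indicator X (f(i := t)) \<partial>lborel \<partial>prod_lborel J)"
      using J X by (intro product_nn_integral_insert) auto
    also have "... = (\<integral>\<^sup>+f. emeasure lborel {t. f(i := t) \<in> X} \<partial>prod_lborel J)"
    proof (rule nn_integral_cong)
      fix f assume f: "f \<in> space (prod_lborel J)"
      have "(\<integral>\<^sup>+t. indicator X (f(i := t)) \<partial>lborel) = (\<integral>\<^sup>+t. indicator {t. f(i := t) \<in> X} t \<partial>lborel)"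
        by (intro nn_integral_cong) (auto simp: indicator_def)
      also have "... = emeasure lborel {t. f(i := t) \<in> X}" using Xm[OF f] by simp
      finally show "(\<integral>\<^sup>+t. indicator X (f(i := t)) \<partial>lborel) = emeasure lborel {t. f(i := t) \<in> X}" .
    qed
    finally show ?thesis .
  qed
  have sp: "f(i := t) \<in> space (prod_lborel I)" if "f \<in> space (prod_lborel J)" for f t
    using that J by (auto simp: space_PiM PiE_def extensional_def)
  have sec: "{t. f(i := t) \<in> steiner i I A} = {t. ennreal (2 * \<bar>t\<bar>) < emeasure lborel {t. f(i := t) \<in> A}}"
    if "f \<in> space (prod_lborel J)" for f
    using sp[OF that] by (simp add: steiner_def)
  have "emeasure (prod_lborel I) (steiner i I A) = (\<integral>\<^sup>+f. emeasure lborel {t. f(i := t) \<in> steiner i I A} \<partial>prod_lborel J)"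
    by (rule meas[OF steiner_sets]) (simp add: sec)
  also have "... = (\<integral>\<^sup>+f. emeasure lborel {t. f(i := t) \<in> A} \<partial>prod_lborel J)"
    by (intro nn_integral_cong) (simp add: sec emeasure_centred_interval)
  also have "... = emeasure (prod_lborel I) A"
    by (rule meas[OF A, symmetric]) (use section_measurable[OF sp, of _ undefined] in auto)
  finally show ?thesis .
qed

text \<open>Symmetrisation does not enlarge differences: two sections contain points at least as far apart as two
points of the centred intervals.\<close>

lemma steiner_differences:
  assumes f: "f \<in> steiner i I A" and g: "g \<in> steiner i I A"
  shows "\<exists>s t. f(i := s) \<in> A \<and> g(i := t) \<in> A \<and> \<bar>f i - g i\<bar> \<le> \<bar>s - t\<bar>"
proof -
  have "\<exists>s\<in>{t. f(i := t) \<in> A}. \<exists>t\<in>{t. g(i := t) \<in> A}. \<bar>f i\<bar> + \<bar>g i\<bar> \<le> \<bar>s - t\<bar>"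
    using f g by (intro far_points_of_long_sets section_measurable) (auto simp: steiner_def)
  then show ?thesis by (smt (verit) mem_Collect_eq)
qed

lemma steiner_symmetric: "f \<in> steiner i I A ==> f(i := - f i) \<in> steiner i I A"
  using update_space by (auto simp: steiner_def)

lemma steiner_keeps_symmetry:
  assumes "j \<noteq> i" and sym: "\<And>f. f \<in> A ==> f(j := - f j) \<in> A" and "j \<in> I" and f: "f \<in> steiner i I A"
  shows "f(j := - f j) \<in> steiner i I A"
proof -
  have "f(j := - f j, i := t) \<in> A \<longleftrightarrow> f(i := t) \<in> A" for t
  proof
    assume "f(i := t) \<in> A"
    from sym[OF this] show "f(j := - f j, i := t) \<in> A"
      using \<open>j \<noteq> i\<close> by (simp add: fun_upd_twist)
  next
    assume "f(j := - f j, i := t) \<in> A"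
    moreover have "(f(j := - f j, i := t))(j := - (f(j := - f j, i := t)) j) = f(i := t)"
      using \<open>j \<noteq> i\<close> by auto
    ultimately show "f(i := t) \<in> A" using sym by metis
  qed
  moreover have "f(j := - f j) \<in> space (prod_lborel I)"
    using f \<open>j \<in> I\<close> by (auto simp: steiner_def space_PiM PiE_def extensional_def)
  ultimately show ?thesis using f \<open>j \<noteq> i\<close> by (simp add: steiner_def)
qed

end

text \<open>After symmetrisation in every coordinate the set is invariant under f\<mapsto>-f, hence 2f=f-(-f)\<in> K
for each of its points. Solidity of K keeps the differences in K at every stage.\<close>

lemma isodiametric_solid:
  fixes I :: "'i set" and K :: "('i => real) set"
  assumes I: "finite I" and A: "A \<in> sets (prod_lborel I)"
    and solid: "\<And>h h'. h \<in> K ==> (\<And>i. i \<in> I ==> \<bar>h' i\<bar> \<le> \<bar>h i\<bar>) ==> h' \<in> K"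
    and diff: "\<And>f g. f \<in> A ==> g \<in> A ==> (\<lambda>i. f i - g i) \<in> K"
    and Km: "{f \<in> space (prod_lborel I). (\<lambda>i. 2 * f i) \<in> K} \<in> sets (prod_lborel I)"
  shows "emeasure (prod_lborel I) A \<le> emeasure (prod_lborel I) {f \<in> space (prod_lborel I). (\<lambda>i. 2 * f i) \<in> K}"
proof -
  have "\<exists>B. B \<in> sets (prod_lborel I) \<and> emeasure (prod_lborel I) B = emeasure (prod_lborel I) A \<and>
      (\<forall>f\<in>B. \<forall>g\<in>B. (\<lambda>i. f i - g i) \<in> K) \<and> (\<forall>j\<in>J. \<forall>f\<in>B. f(j := - f j) \<in> B)"
    if "finite J" "J \<subseteq> I" for J
    using that
  proof (induction J)
    case empty
    then show ?case using A diff by blast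
  next
    case (insert k J)
    then have "J \<subseteq> I" by simp
    from insert.IH[OF this] obtain B where B: "B \<in> sets (prod_lborel I)" "emeasure (prod_lborel I) B = emeasure (prod_lborel I) A"
      and B': "\<forall>f\<in>B. \<forall>g\<in>B. (\<lambda>i. f i - g i) \<in> K" "\<forall>j\<in>J. \<forall>f\<in>B. f(j := - f j) \<in> B"
      by (elim exE conjE)
    note B = B B'[rule_format]
    have k: "k \<in> I" using insert by simp
    have "(\<lambda>i. f i - g i) \<in> K" if fg: "f \<in> steiner k I B" "g \<in> steiner k I B" for f g
    proof -
      obtain s t where st: "f(k := s) \<in> B" "g(k := t) \<in> B" "\<bar>f k - g k\<bar> \<le> \<bar>s - t\<bar>"
        using steiner_differences[OF I k B(1) fg] by auto
      show ?thesis by (rule solid[OF B(3)[OF st(1,2)]]) (use st(3) in auto)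
    qed
    note d = this
    have e: "f(j := - f j) \<in> steiner k I B" if "j \<in> insert k J" "f \<in> steiner k I B" for j f
    proof (cases "j = k")
      case True
      then show ?thesis using steiner_symmetric[OF I k B(1)] that by simp
    next
      case False
      then show ?thesis
        using steiner_keeps_symmetry[OF I k B(1) False B(4)] that insert.prems by auto
    qed
    show ?case
      by (intro exI[of _ "steiner k I B"] conjI ballI steiner_sets[OF I k B(1)] d e)
        (simp_all add: emeasure_steiner[OF I k B(1)] B(2))
  qed
  from this[OF I subset_refl] obtain B where
    B: "B \<in> sets (prod_lborel I)" "emeasure (prod_lborel I) B = emeasure (prod_lborel I) A"
    and B': "\<forall>f\<in>B. \<forall>g\<in>B. (\<lambda>i. f i - g i) \<in> K" "\<forall>j\<in>I. \<forall>f\<in>B. f(j := - f j) \<in> B"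
    by auto
  note B = B B'[rule_format]
  \<comment> \<open>Composing the single reflections yields the point reflection at the origin.\<close>
  have refl: "(\<lambda>i. if i \<in> J then - f i else f i) \<in> B" if "finite J" "J \<subseteq> I" "f \<in> B" for J f
    using that
  proof (induction J)
    case (insert k J)
    have "(\<lambda>i. if i \<in> J then - f i else f i)(k := - (if k \<in> J then - f k else f k)) \<in> B"
      using insert by (intro B(4)) auto
    also have "(\<lambda>i. if i \<in> J then - f i else f i)(k := - (if k \<in> J then - f k else f k)) =
        (\<lambda>i. if i \<in> insert k J then - f i else f i)" using insert by auto
    finally show ?case .
  qed simp
  have "B \<subseteq> {f \<in> space (prod_lborel I). (\<lambda>i. 2 * f i) \<in> K}"
  proof safe
    fix f assume f: "f \<in> B"
    show "f \<in> space (prod_lborel I)" using f B(1) sets.sets_into_space by blast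
    have "(\<lambda>i. f i - (if i \<in> I then - f i else f i)) \<in> K" by (intro B(3) f refl[OF I]) auto
    then show "(\<lambda>i. 2 * f i) \<in> K" by (rule solid) auto
  qed
  then show ?thesis unfolding B(2)[symmetric] by (intro emeasure_mono Km)
qed

lemma emeasure_PiM_cylinder:
  fixes I :: "'i set"
  assumes I: "finite I" "k \<in> I" and R [measurable]: "R \<in> sets borel" and "0 < b"
  shows "emeasure (prod_lborel I) {f \<in> space (prod_lborel I). f k \<in> R \<and> sqrt (\<Sum>i\<in>I - {k}. (f i)^2) \<le> b}
    = emeasure lborel R * ennreal (unit_ball_vol (real (card I - 1)) * b ^ (card I - 1))"
proof -
  interpret product_sigma_finite "\<lambda>_ :: 'i. lborel :: real measure" by standard
  define J where "J = I - {k}"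
  have J: "finite J" "k \<notin> J" "I = insert k J" "card J = card I - 1" using I by (auto simp: J_def)
  let ?X = "{f \<in> space (prod_lborel I). f k \<in> R \<and> sqrt (\<Sum>i\<in>J. (f i)^2) \<le> b}"
  have [measurable]: "(\<lambda>f. f k) \<in> borel_measurable (prod_lborel I)" using I by measurable
  have [measurable]: "(\<lambda>f. \<Sum>i\<in>J. (f i)^2) \<in> borel_measurable (prod_lborel I)"
  proof (intro borel_measurable_sum borel_measurable_power)
    fix i assume "i \<in> J"
    then have "i \<in> I" using J by auto
    then show "(\<lambda>f. f i) \<in> borel_measurable (prod_lborel I)"
      using measurable_component_singleton[of i I "\<lambda>_. lborel :: real measure"] by simp
  qed
  have X: "?X \<in> sets (prod_lborel (insert k J))"
    unfolding J(3)[symmetric] by measurable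
  let ?Y = "{f. sqrt (\<Sum>i\<in>J. (f i)^2) \<le> b} \<inter> space (prod_lborel J)"
  have Y: "?Y \<in> sets (prod_lborel J)"
  proof -
    have [measurable]: "(\<lambda>f. \<Sum>i\<in>J. (f i)^2) \<in> borel_measurable (prod_lborel J)"
      using measurable_component_singleton[of _ J "\<lambda>_. lborel :: real measure"]
      by (intro borel_measurable_sum borel_measurable_power) simp
    have "{f \<in> space (prod_lborel J). sqrt (\<Sum>i\<in>J. (f i)^2) \<le> b} \<in> sets (prod_lborel J)" by measurable
    then show ?thesis by (simp add: Int_def conj_commute)
  qed
  have "emeasure (prod_lborel I) ?X = (\<integral>\<^sup>+f. indicator ?X f \<partial>prod_lborel (insert k J))"
    unfolding J(3)[symmetric] using X unfolding J(3)[symmetric] by simp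
  also have "... = (\<integral>\<^sup>+f. \<integral>\<^sup>+t. indicator ?X (f(k := t)) \<partial>lborel \<partial>prod_lborel J)"
    by (intro product_nn_integral_insert J(1,2) borel_measurable_indicator X)
  also have "... = (\<integral>\<^sup>+f. emeasure lborel R * indicator ?Y f \<partial>prod_lborel J)"
  proof (rule nn_integral_cong)
    fix f assume f: "f \<in> space (prod_lborel J)"
    have sp: "f(k := t) \<in> space (prod_lborel I)" for t
      using f unfolding J(3) by (auto simp: space_PiM PiE_def extensional_def)
    have sum: "(\<Sum>i\<in>J. (if i = k then t else f i)^2) = (\<Sum>i\<in>J. (f i)^2)" for t
      using J(2) by (intro sum.cong) auto
    have "(\<integral>\<^sup>+t. indicator ?X (f(k := t)) \<partial>lborel) = (\<integral>\<^sup>+t. indicator ?Y f * indicator R t \<partial>lborel)"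
      using f by (intro nn_integral_cong) (auto simp: indicator_def sp sum)
    also have "... = indicator ?Y f * emeasure lborel R"
      by (simp add: nn_integral_cmult)
    finally show "(\<integral>\<^sup>+t. indicator ?X (f(k := t)) \<partial>lborel) = emeasure lborel R * indicator ?Y f"
      by (simp add: mult.commute)
  qed
  also have "... = emeasure lborel R * emeasure (prod_lborel J) ?Y"
    using Y by (simp add: nn_integral_cmult)
  also have "emeasure (prod_lborel J) ?Y = ennreal (unit_ball_vol (real (card J)) * b ^ card J)"
    by (intro emeasure_cball_aux J(1) \<open>0 < b\<close>)
  finally show ?thesis
    unfolding J_def[symmetric] J(4) .
qed

section \<open>Cones over subsets of the sphere\<close>

lemma emeasure_orthogonal_vimage:
  fixes R :: "real ^ 'n => real ^ 'n"
  assumes R: "orthogonal_transformation R" and E [measurable]: "E \<in> sets borel"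
  shows "emeasure lborel (R -` E) = emeasure lborel E"
proof -
  have lin: "linear R" using R by (rule orthogonal_transformation_linear)
  have Rm: "matrix R *v x = R x" for x by (rule fun_cong[OF matrix_vector_mul(2)[OF lin]])
  have "det (matrix R) = 1 \<or> det (matrix R) = - 1"
    using R by (intro det_orthogonal_matrix) (simp add: orthogonal_transformation_matrix)
  then have "det (matrix R) \<noteq> 0" "\<bar>det (matrix R)\<bar> = 1" by auto
  then have "(\<integral>\<^sup>+y. indicator E y \<partial>lborel) = (\<integral>\<^sup>+x. indicator E (R x) \<partial>lborel)"
    using nn_integral_linear_change[of "matrix R" "indicator E"] by (simp add: Rm)
  moreover have "R -` E \<in> sets borel"
    using measurable_sets_borel[of R borel E] lin E
    by (auto intro!: borel_measurable_continuous_onI linear_continuous_on simp: linear_conv_bounded_linear)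
  moreover have "(\<lambda>x. indicator E (R x) :: ennreal) = indicator (R -` E)"
    by (auto simp: indicator_def)
  ultimately show ?thesis by simp
qed

lemma norm_minus_component:
  fixes x k :: "'a::euclidean_space"
  assumes "k \<in> Basis"
  shows "norm (x - (x \<bullet> k) *\<^sub>R k) = sqrt (\<Sum>i\<in>Basis - {k}. (x \<bullet> i)^2)"
proof -
  have "norm (x - (x \<bullet> k) *\<^sub>R k) = sqrt (\<Sum>i\<in>Basis. ((x - (x \<bullet> k) *\<^sub>R k) \<bullet> i)^2)"
    unfolding norm_eq_sqrt_inner by (subst euclidean_inner) (simp add: power2_eq_square)
  also have "(\<Sum>i\<in>Basis. ((x - (x \<bullet> k) *\<^sub>R k) \<bullet> i)^2) = (\<Sum>i\<in>Basis. if i = k then 0 else (x \<bullet> i)^2)"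
    using assms by (intro sum.cong) (auto simp: inner_diff_left inner_Basis)
  also have "... = (\<Sum>i\<in>Basis - {k}. (x \<bullet> i)^2)"
    by (intro sum.mono_neutral_cong_right) auto
  finally show ?thesis .
qed

lemma ex_rotation_to_Basis:
  fixes u :: "real ^ 'n"
  assumes "norm u = 1"
  shows "\<exists>R (k :: real ^ 'n). orthogonal_transformation R \<and> k \<in> Basis \<and> R k = u"
proof -
  obtain k :: "real ^ 'n" where k: "k \<in> Basis" using nonempty_Basis by blast
  then have "norm k = norm u" using assms by simp
  then show ?thesis using k orthogonal_transformation_exists by metis
qed

lemma perp_continuous: "continuous_on S (\<lambda>x. norm (x - (x \<bullet> u) *\<^sub>R u))"
  by (intro continuous_intros)

text \<open>A rotation moves the axis to a coordinate axis.\<close>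

lemma emeasure_cylinder:
  fixes u :: "real ^ 'n"
  assumes u: "norm u = 1" and R [measurable]: "R \<in> sets borel" and b: "0 < b"
  shows "emeasure lborel {x. x \<bullet> u \<in> R \<and> norm (x - (x \<bullet> u) *\<^sub>R u) \<le> b}
    = emeasure lborel R * ennreal (unit_ball_vol (real (CARD('n) - 1)) * b ^ (CARD('n) - 1))"
proof -
  have [measurable]: "(\<lambda>x. norm (x - (x \<bullet> v) *\<^sub>R v)) \<in> borel_measurable borel" for v :: "real ^ 'n"
    by (intro borel_measurable_continuous_onI perp_continuous)
  obtain Q and k :: "real ^ 'n" where Q: "orthogonal_transformation Q" and k: "k \<in> Basis" "Q k = u"
    using ex_rotation_to_Basis[OF u] by blast
  let ?X = "\<lambda>u. {x :: real ^ 'n. x \<bullet> u \<in> R \<and> norm (x - (x \<bullet> u) *\<^sub>R u) \<le> b}"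
  have lin: "linear Q" using Q by (rule orthogonal_transformation_linear)
  have "Q x \<bullet> u = x \<bullet> k" for x using Q k(2) by (metis orthogonal_transformation_def)
  moreover have "norm (Q x - c *\<^sub>R u) = norm (x - c *\<^sub>R k)" for x c
    using orthogonal_transformation_norm[OF Q, of "x - c *\<^sub>R k"] k(2)
    by (simp add: linear_diff[OF lin] linear_scale[OF lin])
  ultimately have "Q -` ?X u = ?X k" by auto
  then have "emeasure lborel (?X u) = emeasure lborel (?X k)"
    using emeasure_orthogonal_vimage[OF Q, of "?X u"] by simp
  also have "... = emeasure (prod_lborel Basis) ((\<lambda>f. \<Sum>b\<in>Basis. f b *\<^sub>R b) -` ?X k \<inter> space (prod_lborel Basis))"
    by (subst lborel_eq, subst emeasure_distr) simp_all
  also have "(\<lambda>f. \<Sum>b\<in>Basis. f b *\<^sub>R b) -` ?X k \<inter> space (prod_lborel Basis) =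
     {f \<in> space (prod_lborel Basis). f k \<in> R \<and> sqrt (\<Sum>i\<in>Basis - {k}. (f i)^2) \<le> b}"
    using k by (auto simp: norm_minus_component)
  also have "emeasure (prod_lborel Basis) ... = emeasure lborel R *
      ennreal (unit_ball_vol (real (card (Basis :: (real ^ 'n) set) - 1)) * b ^ (card (Basis :: (real ^ 'n) set) - 1))"
    using k b by (intro emeasure_PiM_cylinder) auto
  finally show ?thesis by simp
qed

text \<open>The admissible differences form a cylinder around the axis u, which is solid once u has been rotated to a
coordinate axis.\<close>

lemma cylinder_isodiametric_pos:
  fixes E :: "(real ^ 'n) set"
  assumes E [measurable]: "E \<in> sets borel" and u: "norm u = 1" and "0 \<le> a" and b: "0 < b"
    and axial: "\<And>x y. x \<in> E ==> y \<in> E ==> \<bar>(x - y) \<bullet> u\<bar> \<le> 2 * a"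
    and radial: "\<And>x y. x \<in> E ==> y \<in> E ==> norm ((x - y) - ((x - y) \<bullet> u) *\<^sub>R u) \<le> 2 * b"
  shows "emeasure lborel E \<le> ennreal (2 * a * (unit_ball_vol (real (CARD('n) - 1)) * b ^ (CARD('n) - 1)))"
proof -
  obtain Q and k :: "real ^ 'n" where Q: "orthogonal_transformation Q" and k: "k \<in> Basis" "Q k = u"
    using ex_rotation_to_Basis[OF u] by blast
  have lin: "linear Q" using Q by (rule orthogonal_transformation_linear)
  have in_Q: "Q x \<bullet> u = x \<bullet> k" for x using Q k(2) by (metis orthogonal_transformation_def)
  have norm_Q: "norm (Q x - c *\<^sub>R u) = norm (x - c *\<^sub>R k)" for x c
    using orthogonal_transformation_norm[OF Q, of "x - c *\<^sub>R k"] k(2)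
    by (simp add: linear_diff[OF lin] linear_scale[OF lin])
  let ?B = "Basis :: (real ^ 'n) set"
  let ?s = "\<lambda>f. \<Sum>b\<in>?B. f b *\<^sub>R b"
  have [measurable]: "?s \<in> prod_lborel ?B \<rightarrow>\<^sub>M borel" by simp
  have Om: "Q -` E \<in> sets borel"
    using measurable_sets_borel[of Q borel E] lin E
    by (auto intro!: borel_measurable_continuous_onI linear_continuous_on simp: linear_conv_bounded_linear)
  define A where "A = ?s -` (Q -` E) \<inter> space (prod_lborel ?B)"
  have A: "A \<in> sets (prod_lborel ?B)"
    unfolding A_def using Om by (intro measurable_sets[of ?s _ borel]) simp_all
  define K where "K = {h. \<bar>h k\<bar> \<le> 2 * a \<and> sqrt (\<Sum>i\<in>?B - {k}. (h i)^2) \<le> 2 * b}"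
  have half: "{f \<in> space (prod_lborel ?B). (\<lambda>i. 2 * f i) \<in> K} =
     {f \<in> space (prod_lborel ?B). f k \<in> {-a..a} \<and> sqrt (\<Sum>i\<in>?B - {k}. (f i)^2) \<le> b}"
  proof -
    have "sqrt (\<Sum>i\<in>?B - {k}. (2 * f i)^2) = 2 * sqrt (\<Sum>i\<in>?B - {k}. (f i)^2)" for f :: "real ^ 'n => real"
      by (simp add: power_mult_distrib sum_distrib_left[symmetric] real_sqrt_mult)
    then show ?thesis by (auto simp: K_def)
  qed
  have "emeasure lborel E = emeasure lborel (Q -` E)"
    by (rule emeasure_orthogonal_vimage[OF Q, symmetric]) simp
  also have "... = emeasure (prod_lborel ?B) A"
    unfolding A_def using Om by (subst lborel_eq, subst emeasure_distr) simp_all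
  also have "... \<le> emeasure (prod_lborel ?B) {f \<in> space (prod_lborel ?B). (\<lambda>i. 2 * f i) \<in> K}"
  proof (rule isodiametric_solid)
    fix h h' assume h: "h \<in> K" and le: "\<And>i. i \<in> ?B ==> \<bar>h' i\<bar> \<le> \<bar>h i\<bar>"
    have "sqrt (\<Sum>i\<in>?B - {k}. (h' i)^2) \<le> sqrt (\<Sum>i\<in>?B - {k}. (h i)^2)"
      using le by (intro real_sqrt_le_mono sum_mono) (auto simp: abs_le_square_iff)
    also have "... \<le> 2 * b" using h by (simp add: K_def)
    finally show "h' \<in> K" using h le[OF k(1)] by (simp add: K_def)
  next
    fix f g assume fg: "f \<in> A" "g \<in> A"
    have m: "Q (?s f) \<in> E" "Q (?s g) \<in> E" using fg by (auto simp: A_def)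
    have d: "Q (?s f) - Q (?s g) = Q (?s f - ?s g)" by (simp add: linear_diff[OF lin])
    have c: "(?s f - ?s g) \<bullet> i = f i - g i" if "i \<in> ?B" for i using that by (simp add: inner_diff_left)
    have "\<bar>f k - g k\<bar> \<le> 2 * a" using axial[OF m] unfolding d in_Q by (simp add: c k)
    moreover have "sqrt (\<Sum>i\<in>?B - {k}. (f i - g i)^2) \<le> 2 * b"
      using radial[OF m] unfolding d in_Q norm_Q norm_minus_component[OF k(1)] by (simp add: c)
    ultimately show "(\<lambda>i. f i - g i) \<in> K" by (simp add: K_def)
  next
    show "{f \<in> space (prod_lborel ?B). (\<lambda>i. 2 * f i) \<in> K} \<in> sets (prod_lborel ?B)"
    proof -
      have [measurable]: "(\<lambda>f. f i) \<in> borel_measurable (prod_lborel ?B)" if "i \<in> ?B" for i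
        using measurable_component_singleton[of i ?B "\<lambda>_. lborel :: real measure"] that by simp
      have [measurable]: "(\<lambda>f. \<Sum>i\<in>?B - {k}. (f i)^2) \<in> borel_measurable (prod_lborel ?B)"
        by (intro borel_measurable_sum borel_measurable_power) auto
      have [measurable]: "(\<lambda>f. f k) \<in> borel_measurable (prod_lborel ?B)" using k by simp
      show ?thesis unfolding half by measurable
    qed
  qed (use A in simp_all)
  also have "... = emeasure lborel {-a..a} * ennreal (unit_ball_vol (real (card ?B - 1)) * b ^ (card ?B - 1))"
    unfolding half using k b by (intro emeasure_PiM_cylinder) auto
  also have "... = ennreal (2 * a * (unit_ball_vol (real (CARD('n) - 1)) * b ^ (CARD('n) - 1)))"
    using \<open>0 \<le> a\<close> by (simp add: ennreal_mult')
  finally show ?thesis .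
qed

lemma cylinder_isodiametric:
  fixes E :: "(real ^ 'n) set"
  assumes E [measurable]: "E \<in> sets borel" and u: "norm u = 1" and a: "0 \<le> a" and b: "0 \<le> b"
    and axial: "\<And>x y. x \<in> E ==> y \<in> E ==> \<bar>(x - y) \<bullet> u\<bar> \<le> 2 * a"
    and radial: "\<And>x y. x \<in> E ==> y \<in> E ==> norm ((x - y) - ((x - y) \<bullet> u) *\<^sub>R u) \<le> 2 * b"
  shows "emeasure lborel E \<le> ennreal (2 * a * (unit_ball_vol (real (CARD('n) - 1)) * b ^ (CARD('n) - 1)))"
proof (rule tendsto_lowerbound)
  show "((\<lambda>b. ennreal (2 * a * (unit_ball_vol (real (CARD('n) - 1)) * b ^ (CARD('n) - 1)))) \<longlongrightarrow>
     ennreal (2 * a * (unit_ball_vol (real (CARD('n) - 1)) * b ^ (CARD('n) - 1)))) (at_right b)"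
    by (intro tendsto_intros)
  have "emeasure lborel E \<le> ennreal (2 * a * (unit_ball_vol (real (CARD('n) - 1)) * c ^ (CARD('n) - 1)))" if "b < c" for c
  proof (rule cylinder_isodiametric_pos[OF E u a _ axial])
    show "0 < c" using that b by simp
    show "norm ((x - y) - ((x - y) \<bullet> u) *\<^sub>R u) \<le> 2 * c" if "x \<in> E" "y \<in> E" for x y
      using radial[OF that] \<open>b < c\<close> by simp
  qed
  then show "\<forall>\<^sub>F c in at_right b. emeasure lborel E \<le> ennreal (2 * a * (unit_ball_vol (real (CARD('n) - 1)) * c ^ (CARD('n) - 1)))"
    by (intro eventually_at_rightI[of b "b + 1"]) auto
qed simp

lemma emeasure_lborel_scale:
  fixes E :: "'a::euclidean_space set"
  assumes "c \<noteq> 0" and [measurable]: "E \<in> sets borel"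
  shows "emeasure lborel E = ennreal (\<bar>c\<bar> ^ DIM('a)) * emeasure lborel {x. c *\<^sub>R x \<in> E}"
proof -
  have eq: "(\<lambda>x::'a. c *\<^sub>R x) -` E = {x. c *\<^sub>R x \<in> E}" by auto
  have "emeasure lborel E = emeasure (density (distr lborel borel (\<lambda>x. 0 + c *\<^sub>R x)) (\<lambda>_. \<bar>c\<bar> ^ DIM('a))) E"
    using lborel_affine[OF assms(1), of "0::'a"] by simp
  also have "... = ennreal (\<bar>c\<bar> ^ DIM('a)) * emeasure lborel {x. c *\<^sub>R x \<in> E}"
    by (simp add: emeasure_density nn_integral_cmult_indicator emeasure_distr eq)
  finally show ?thesis .
qed

text \<open>Up to the factor d, the volume of the cone is the area of C\<subseteq> S^{d-1}.\<close>

definition cone_over :: "(real ^ 'n) set => (real ^ 'n) set" where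
  "cone_over C = {x. 0 < norm x \<and> norm x \<le> 1 \<and> sgn x \<in> C}"

definition shell_over :: "real => (real ^ 'n) set => (real ^ 'n) set" where
  "shell_over h C = {x. 1 - h < norm x \<and> norm x \<le> 1 \<and> sgn x \<in> C}"

lemma sgn_vec_measurable [measurable]: "(sgn :: real ^ 'n => _) \<in> borel_measurable borel"
  unfolding sgn_div_norm[abs_def] by measurable

lemma cone_over_measurable [measurable]:
  assumes [measurable]: "C \<in> sets borel" shows "cone_over C \<in> sets borel"
  unfolding cone_over_def by measurable

lemma shell_over_measurable [measurable]:
  assumes [measurable]: "C \<in> sets borel" shows "shell_over h C \<in> sets borel"
  unfolding shell_over_def by measurable

lemma emeasure_cone_over_finite: "emeasure lborel (cone_over C) < \<infinity>"
  by (rule le_less_trans[OF emeasure_mono[of _ "cball 0 1"] emeasure_lborel_cball_finite])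
    (auto simp: cone_over_def)

text \<open>The shell is the cone minus its copy scaled by 1-h.\<close>

lemma shell_over_cone_over:
  fixes C :: "(real ^ 'n) set"
  assumes [measurable]: "C \<in> sets borel" and h: "0 < h" "h < 1"
  shows "emeasure lborel (shell_over h C) = ennreal (1 - (1 - h) ^ CARD('n)) * emeasure lborel (cone_over C)"
proof -
  let ?F = "{x :: real ^ 'n. 0 < norm x \<and> norm x \<le> 1 - h \<and> sgn x \<in> C}"
  have F: "emeasure lborel ?F = ennreal ((1 - h) ^ CARD('n)) * emeasure lborel (cone_over C)"
  proof -
    have "{x. (1 - h) *\<^sub>R x \<in> ?F} = cone_over C"
      using h by (auto simp: cone_over_def sgn_scaleR mult_le_cancel_left1)
    then show ?thesis using h emeasure_lborel_scale[of "1 - h" ?F] by simp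
  qed
  obtain m where m: "emeasure lborel (cone_over C) = ennreal m" "0 \<le> m"
    using emeasure_cone_over_finite[of C] by (cases "emeasure lborel (cone_over C)") auto
  have "cone_over C = shell_over h C \<union> ?F" "shell_over h C \<inter> ?F = {}"
    using h by (auto simp: cone_over_def shell_over_def)
  then have "emeasure lborel (cone_over C) = emeasure lborel (shell_over h C) + emeasure lborel ?F"
    by (simp add: plus_emeasure)
  then have eq: "ennreal m = emeasure lborel (shell_over h C) + ennreal ((1 - h) ^ CARD('n) * m)"
    unfolding F m(1) using h m(2) by (simp add: ennreal_mult')
  then have "emeasure lborel (shell_over h C) \<noteq> \<infinity>" by auto
  then obtain s where s: "emeasure lborel (shell_over h C) = ennreal s" "0 \<le> s"
    by (cases "emeasure lborel (shell_over h C)") auto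
  have "m = s + (1 - h) ^ CARD('n) * m"
    using eq s m h by (simp flip: ennreal_plus)
  then have "s = (1 - (1 - h) ^ CARD('n)) * m" by (simp add: algebra_simps)
  moreover have "0 \<le> 1 - (1 - h) ^ CARD('n)" using h by (simp add: power_le_one)
  ultimately show ?thesis using s m by (simp add: ennreal_mult')
qed

lemma norm_perp:
  fixes u :: "'a::real_inner"
  assumes "norm u = 1"
  shows "(norm (w - (w \<bullet> u) *\<^sub>R u))^2 = (norm w)^2 - (w \<bullet> u)^2"
  using assms unfolding power2_norm_eq_inner norm_eq_1
  by (simp add: inner_diff inner_commute power2_eq_square)

text \<open>A thin shell over a set of small diameter has its differences in a flat cylinder along the normal of one
of the points, whose height is about h and whose radius is about D/2.\<close>

lemma cone_over_small_diameter:
  fixes C :: "(real ^ 'n) set"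
  assumes C [measurable]: "C \<in> sets borel" and sph: "C \<subseteq> sphere 0 1"
    and D: "\<And>x y. x \<in> C ==> y \<in> C ==> dist x y \<le> D" and "0 \<le> D" "D \<le> 1" and h: "0 < h" "h < 1"
  shows "ennreal (1 - (1 - h) ^ CARD('n)) * emeasure lborel (cone_over C) \<le>
    ennreal ((h + D^2 / 2) * (unit_ball_vol (real (CARD('n) - 1)) * (D * (1 + h) / 2) ^ (CARD('n) - 1)))"
proof (cases "C = {}")
  case True
  then show ?thesis by (simp add: cone_over_def)
next
  case False
  then obtain u where u: "u \<in> C" by auto
  then have nu: "norm u = 1" using sph by auto
  have uu: "u \<bullet> u = 1" using nu by (simp add: norm_eq_1)
  have rep: "\<exists>t v. x = t *\<^sub>R v \<and> v \<in> C \<and> 1 - h \<le> t \<and> t \<le> 1" if "x \<in> shell_over h C" for x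
  proof -
    have "norm x \<noteq> 0" using that h by (auto simp: shell_over_def)
    then show ?thesis
      using that by (intro exI[of _ "norm x"] exI[of _ "sgn x"]) (auto simp: shell_over_def sgn_div_norm)
  qed
  have ax: "1 - D^2 / 2 \<le> v \<bullet> u \<and> v \<bullet> u \<le> 1" if "v \<in> C" for v
  proof -
    have nv: "norm v = 1" using that sph by auto
    have "(norm (v - u))^2 = 2 - 2 * (v \<bullet> u)"
      using nv nu by (simp add: power2_norm_eq_inner inner_diff inner_commute norm_eq_1)
    moreover have "(norm (v - u))^2 \<le> D^2" using D[OF that u] by (simp add: dist_norm power_mono)
    moreover have "0 \<le> (norm (v - u))^2" by simp
    ultimately show ?thesis by simp
  qed
  have perp_le: "norm (w - (w \<bullet> u) *\<^sub>R u) \<le> norm w" for w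
  proof -
    have "(norm (w - (w \<bullet> u) *\<^sub>R u))^2 \<le> (norm w)^2" by (simp add: norm_perp[OF nu])
    then show ?thesis using power2_le_imp_le norm_ge_zero by blast
  qed
  have "emeasure lborel (shell_over h C) \<le> ennreal (2 * ((h + D^2 / 2) / 2) *
     (unit_ball_vol (real (CARD('n) - 1)) * (D * (1 + h) / 2) ^ (CARD('n) - 1)))"
  proof (rule cylinder_isodiametric[OF _ nu])
    fix x y assume "x \<in> shell_over h C" "y \<in> shell_over h C"
    then obtain t v s w where x: "x = t *\<^sub>R v" "v \<in> C" "1 - h \<le> t" "t \<le> 1"
      and y: "y = s *\<^sub>R w" "w \<in> C" "1 - h \<le> s" "s \<le> 1" using rep by metis
    have bound: "1 - h - D^2 / 2 \<le> t * (v \<bullet> u) \<and> t * (v \<bullet> u) \<le> 1"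
      if "v \<in> C" "1 - h \<le> t" "t \<le> 1" for t v
    proof -
      have D1: "D^2 \<le> 1" using \<open>0 \<le> D\<close> \<open>D \<le> 1\<close> by (simp add: power_le_one)
      then have p: "0 \<le> v \<bullet> u" using ax[OF that(1)] by linarith
      have "(1 - h) * (1 - D^2 / 2) \<le> t * (v \<bullet> u)"
        using that ax[OF that(1)] h D1 by (intro mult_mono) auto
      moreover have "(1 - h) * (1 - D^2 / 2) = 1 - h - D^2 / 2 + h * D^2 / 2" by (simp add: field_simps)
      moreover have "t * (v \<bullet> u) \<le> 1 * 1" using that ax[OF that(1)] h p by (intro mult_mono) auto
      ultimately show ?thesis using h by (smt (verit) divide_nonneg_nonneg mult_nonneg_nonneg zero_le_power2)
    qed
    show "\<bar>(x - y) \<bullet> u\<bar> \<le> 2 * ((h + D^2 / 2) / 2)"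
    proof -
      have "2 * ((h + D^2 / 2) / 2) = h + D^2 / 2" by simp
      then show ?thesis
        using bound[OF x(2,3,4), THEN conjunct1] bound[OF y(2,3,4), THEN conjunct1]
          bound[OF x(2,3,4), THEN conjunct2] bound[OF y(2,3,4), THEN conjunct2]
        unfolding x(1) y(1) inner_diff_left inner_scaleR_left by linarith
    qed
    have P: "(t *\<^sub>R a + c *\<^sub>R b) - ((t *\<^sub>R a + c *\<^sub>R b) \<bullet> u) *\<^sub>R u =
        t *\<^sub>R (a - (a \<bullet> u) *\<^sub>R u) + c *\<^sub>R (b - (b \<bullet> u) *\<^sub>R u)" for a b and t c :: real
      by (simp add: inner_add_left scaleR_add_left scaleR_diff_right)
    have Pu: "w - (w \<bullet> u) *\<^sub>R u = (w - u) - ((w - u) \<bullet> u) *\<^sub>R u"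
      by (simp add: inner_diff_left uu scaleR_diff_left)
    have "x - y = t *\<^sub>R (v - w) + (t - s) *\<^sub>R w"
      by (simp add: x y scaleR_diff_right scaleR_diff_left)
    then have "(x - y) - ((x - y) \<bullet> u) *\<^sub>R u =
        t *\<^sub>R ((v - w) - ((v - w) \<bullet> u) *\<^sub>R u) + (t - s) *\<^sub>R ((w - u) - ((w - u) \<bullet> u) *\<^sub>R u)"
      by (simp only: P Pu[symmetric])
    also have "norm ... \<le> \<bar>t\<bar> * norm ((v - w) - ((v - w) \<bullet> u) *\<^sub>R u) + \<bar>t - s\<bar> * norm ((w - u) - ((w - u) \<bullet> u) *\<^sub>R u)"
      by (rule order_trans[OF norm_triangle_ineq]) simp
    also have "... \<le> 1 * D + h * D"
    proof (intro add_mono mult_mono)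
      show "norm ((v - w) - ((v - w) \<bullet> u) *\<^sub>R u) \<le> D"
        using perp_le[of "v - w"] D[OF x(2) y(2)] by (simp add: dist_norm)
      show "norm ((w - u) - ((w - u) \<bullet> u) *\<^sub>R u) \<le> D"
        using perp_le[of "w - u"] D[OF y(2) u] by (simp add: dist_norm)
    qed (use x y h in auto)
    finally show "norm ((x - y) - ((x - y) \<bullet> u) *\<^sub>R u) \<le> 2 * (D * (1 + h) / 2)"
      by (simp add: algebra_simps)
  qed (use h \<open>0 \<le> D\<close> in auto)
  moreover have "2 * ((h + D^2 / 2) / 2) = h + D^2 / 2" by simp
  ultimately show ?thesis by (simp only: shell_over_cone_over[OF C h])
qed

text \<open>The shell over a cap contains a flat cylinder of height about h and radius about r.\<close>

lemma cone_over_cap_ge: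
  fixes u :: "real ^ 'n"
  assumes u: "norm u = 1" and h: "0 < h" "h < 1" and r: "0 < r" "r^2 \<le> h" "r < 1"
  shows "ennreal ((h - r^2) * (unit_ball_vol (real (CARD('n) - 1)) * ((1 - h) * r) ^ (CARD('n) - 1))) \<le>
    ennreal (1 - (1 - h) ^ CARD('n)) * emeasure lborel (cone_over (sphere 0 1 \<inter> cball u r))"
proof -
  let ?C = "sphere 0 1 \<inter> cball u r"
  have uu: "u \<bullet> u = 1" using u by (simp add: norm_eq_1)
  have "{x. x \<bullet> u \<in> {1 - h<..1 - r^2} \<and> norm (x - (x \<bullet> u) *\<^sub>R u) \<le> (1 - h) * r} \<subseteq> shell_over h ?C"
  proof safe
    fix x assume q: "x \<bullet> u \<in> {1 - h<..1 - r^2}" and p: "norm (x - (x \<bullet> u) *\<^sub>R u) \<le> (1 - h) * r"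
    define q where "q = x \<bullet> u"
    define p where "p = norm (x - (x \<bullet> u) *\<^sub>R u)"
    have q1: "1 - h < q" "q \<le> 1 - r^2" using q by (auto simp: q_def)
    have p1: "0 \<le> p" "p \<le> (1 - h) * r" using p by (auto simp: p_def)
    have "0 < q" using q1 h by linarith
    have nx: "(norm x)^2 = q^2 + p^2"
      by (simp add: p_def q_def norm_perp[OF u])
    have qn: "q \<le> norm x" by (rule power2_le_imp_le) (use nx in auto)
    have "(1 - h) * r \<le> 1 * r" using h r by (intro mult_right_mono) auto
    then have "p \<le> r" using p1(2) by simp
    then have pr: "p^2 \<le> r^2" using p1 by (simp add: power_mono)
    have n1: "norm x \<le> 1"
    proof (rule power2_le_imp_le)
      have "q^2 \<le> (1 - r^2)^2" using q1 \<open>0 < q\<close> by (intro power_mono) auto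
      then have "(norm x)^2 \<le> (1 - r^2)^2 + r^2" using nx pr by linarith
      also have "... = 1 - r^2 * (1 - r^2)" by (simp add: power2_eq_square algebra_simps)
      also have "... \<le> 1^2" using r h by auto
      finally show "(norm x)^2 \<le> 1^2" .
    qed simp
    have "0 < norm x" using qn \<open>0 < q\<close> by linarith
    then have sg: "norm (sgn x) = 1" by (simp add: norm_sgn)
    have "(norm (u - sgn x))^2 = 2 - 2 * (sgn x \<bullet> u)"
      using sg u by (simp add: power2_norm_eq_inner inner_diff inner_commute norm_eq_1)
    also have "sgn x \<bullet> u = q / norm x" by (simp add: sgn_div_norm q_def divide_inverse mult.commute)
    also have "2 - 2 * (q / norm x) = 2 * (norm x - q) / norm x" using \<open>0 < norm x\<close> by (simp add: field_simps)
    also have "... \<le> p^2 / q / norm x"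
    proof (rule divide_right_mono)
      have "2 * (norm x - q) * q \<le> (norm x - q) * (norm x + q)"
        using qn by (subst mult.commute[of 2], subst mult.assoc) (intro mult_left_mono, auto)
      also have "... = p^2" using nx by (simp add: power2_eq_square algebra_simps)
      finally show "2 * (norm x - q) \<le> p^2 / q" using \<open>0 < q\<close> by (simp add: field_simps)
    qed simp
    also have "... = p^2 / (q * norm x)" by simp
    also have "... \<le> ((1 - h) * r)^2 / ((1 - h) * (1 - h))"
      using p1 q1 qn h by (intro frac_le power_mono mult_mono mult_pos_pos) auto
    also have "... = r^2" using h by (simp add: power2_eq_square)
    finally have "(norm (u - sgn x))^2 \<le> r^2" .
    then have "norm (u - sgn x) \<le> r" by (rule power2_le_imp_le) (use r in simp)
    then have "sgn x \<in> ?C" using sg by (simp add: dist_norm)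
    then show "x \<in> shell_over h ?C" using q1 qn n1 by (auto simp: shell_over_def)
  qed
  then have "emeasure lborel {x. x \<bullet> u \<in> {1 - h<..1 - r^2} \<and> norm (x - (x \<bullet> u) *\<^sub>R u) \<le> (1 - h) * r}
     \<le> emeasure lborel (shell_over h ?C)" by (intro emeasure_mono) auto
  then show ?thesis
    using h r emeasure_cylinder[OF u, of "{1 - h<..1 - r^2}" "(1 - h) * r"]
    by (simp add: shell_over_cone_over ennreal_mult')
qed

section \<open>The Hausdorff area of the sphere\<close>

text \<open>Cone volume, normalised so as to equal the surface area; see
\<open>emeasure_sphere_measure\<close>.\<close>

definition sphere_measure :: "(real ^ 'n) measure" where
  "sphere_measure = distr (density lborel
     (\<lambda>x. ennreal (real CARD('n)) * indicator (cball 0 1 - {0 :: real ^ 'n}) x)) borel sgn"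

lemma sets_sphere_measure [simp]: "sets sphere_measure = sets borel"
  by (simp add: sphere_measure_def)

lemma space_sphere_measure [simp]: "space sphere_measure = UNIV"
  by (simp add: sphere_measure_def)

lemma emeasure_sphere_measure:
  fixes C :: "(real ^ 'n) set"
  assumes C [measurable]: "C \<in> sets borel"
  shows "emeasure sphere_measure C = ennreal (real CARD('n)) * emeasure lborel (cone_over C)"
proof -
  have "emeasure sphere_measure C = (\<integral>\<^sup>+x. ennreal (real CARD('n)) * indicator (cball 0 1 - {0 :: real ^ 'n}) x * indicator (sgn -` C) x \<partial>lborel)"
    unfolding sphere_measure_def using measurable_sets_borel[OF sgn_vec_measurable C]
    by (subst emeasure_distr, simp, simp, subst emeasure_density) (measurable, simp_all)
  also have "... = (\<integral>\<^sup>+x. ennreal (real CARD('n)) * indicator (cone_over C) x \<partial>lborel)"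
  proof (intro nn_integral_cong)
    fix x :: "real ^ 'n"
    have "x \<in> cone_over C \<longleftrightarrow> x \<in> cball 0 1 - {0} \<and> x \<in> sgn -` C"
      unfolding cone_over_def by simp blast
    then show "ennreal (real CARD('n)) * indicator (cball 0 1 - {0}) x * indicator (sgn -` C) x =
        ennreal (real CARD('n)) * indicator (cone_over C) x"
      unfolding indicator_def by simp
  qed
  also have "... = ennreal (real CARD('n)) * emeasure lborel (cone_over C)"
    by (rule nn_integral_cmult_indicator) simp
  finally show ?thesis .
qed

lemma finite_sphere_measure: "finite_measure (sphere_measure :: (real ^ 'n) measure)"
  using emeasure_cone_over_finite[of "UNIV :: (real ^ 'n) set"]
  by (intro finite_measureI) (auto simp: emeasure_sphere_measure ennreal_mult_eq_top_iff)

interpretation sphere_measure: finite_measure "sphere_measure :: (real ^ 'n) measure"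
  by (rule finite_sphere_measure)

lemma cone_over_Int_sphere: "cone_over (C \<inter> sphere 0 1) = cone_over C"
  by (auto simp: cone_over_def norm_sgn)

lemma measure_sphere_measure:
  fixes C :: "(real ^ 'n) set"
  assumes "C \<in> sets borel"
  shows "measure sphere_measure C = real CARD('n) * measure lborel (cone_over C)"
  using assms by (simp add: measure_def emeasure_sphere_measure enn2real_mult)

lemma sphere_measure_sphere:
  "emeasure sphere_measure (sphere 0 1 :: (real ^ 'n) set) = ennreal (real CARD('n) * unit_ball_vol (real CARD('n)))"
proof -
  have "cone_over (sphere 0 1) = cball 0 1 - {0 :: real ^ 'n}"
    by (auto simp: cone_over_def norm_sgn)
  moreover have "emeasure lborel (cball 0 1 - {0 :: real ^ 'n}) = emeasure lborel (cball 0 1 :: (real ^ 'n) set)"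
    by (rule emeasure_Diff_null_set) auto
  ultimately show ?thesis
    by (simp add: emeasure_sphere_measure emeasure_cball ennreal_mult')
qed

lemma ennreal_le_multD: "ennreal a \<le> ennreal b * ennreal c ==> 0 \<le> b ==> 0 \<le> c ==> a \<le> b * c"
  by (simp flip: ennreal_mult' add: ennreal_le_iff)

lemma ennreal_mult_leD:
  "ennreal a * ennreal b \<le> ennreal c ==> 0 \<le> a ==> 0 \<le> b ==> 0 \<le> c ==> a * b \<le> c"
  by (simp flip: ennreal_mult' add: ennreal_le_iff)

lemma one_minus_power_factor:
  fixes h :: real
  shows "1 - (1 - h) ^ n = h * (\<Sum>k<n. (1 - h) ^ k)"
  using one_diff_power_eq[of "1 - h" n] by simp

lemma ex_shell_height:
  fixes \<kappa> :: real
  assumes "1 < \<kappa>" and "0 < n"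
  shows "\<exists>h. 0 < h \<and> h < 1 \<and> real n * (1 + h) ^ n \<le> \<kappa> * (\<Sum>k<n. (1 - h) ^ k) \<and> 1 \<le> \<kappa> * (1 - h) ^ n"
proof -
  have "((\<lambda>h. \<kappa> * (\<Sum>k<n. (1 - h) ^ k) - real n * (1 + h) ^ n) \<longlongrightarrow> \<kappa> * (\<Sum>k<n. (1 - 0) ^ k) - real n * (1 + 0) ^ n) (at_right 0)"
    by (intro tendsto_intros)
  moreover have "0 < \<kappa> * (\<Sum>k<n. (1 - 0) ^ k) - real n * (1 + 0) ^ n" using assms by simp
  ultimately have 1: "\<forall>\<^sub>F h in at_right 0. 0 < \<kappa> * (\<Sum>k<n. (1 - h) ^ k) - real n * (1 + h) ^ n"
    by (rule order_tendstoD)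
  have "((\<lambda>h. \<kappa> * (1 - h) ^ n) \<longlongrightarrow> \<kappa> * (1 - 0) ^ n) (at_right 0)" by (intro tendsto_intros)
  then have 2: "\<forall>\<^sub>F h in at_right 0. 1 < \<kappa> * (1 - h) ^ n"
    by (rule order_tendstoD) (use assms in simp)
  have 3: "\<forall>\<^sub>F h in at_right 0. 0 < h \<and> h < (1 :: real)"
    by (intro eventually_at_rightI[of 0 1]) auto
  have "\<exists>h. 0 < h \<and> h < 1 \<and> 0 < \<kappa> * (\<Sum>k<n. (1 - h) ^ k) - real n * (1 + h) ^ n \<and> 1 < \<kappa> * (1 - h) ^ n"
    using eventually_happens[OF eventually_conj[OF 1 eventually_conj[OF 2 3]]] by auto
  then show ?thesis by force
qed

text \<open>The shell height h is fixed first, so small that all factors 1\<plusminus> h are absorbed by \<kappa>; for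
D\<le> h the term D^2 is negligible against h.\<close>

lemma sphere_measure_le_diameter:
  assumes "1 < \<kappa>"
  shows "\<exists>\<delta>>0. \<forall>(C :: (real ^ 'n) set) D. C \<in> sets borel --> C \<subseteq> sphere 0 1 -->
    (\<forall>x\<in>C. \<forall>y\<in>C. dist x y \<le> D) --> 0 \<le> D --> D \<le> \<delta> -->
    measure sphere_measure C \<le> \<kappa> * (unit_ball_vol (real (CARD('n) - 1)) * (D / 2) ^ (CARD('n) - 1))"
proof -
  let ?n = "CARD('n)"
  let ?\<omega> = "unit_ball_vol (real (?n - 1))"
  obtain h where h: "0 < h" "h < 1" "real ?n * (1 + h) ^ ?n \<le> \<kappa> * (\<Sum>k<?n. (1 - h) ^ k)"
    using ex_shell_height[OF assms, of ?n] by auto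
  let ?g = "\<Sum>k<?n. (1 - h) ^ k"
  have g: "0 < ?g" using h by (intro sum_pos) (auto simp: lessThan_empty_iff)
  show ?thesis
  proof (intro exI[of _ h] conjI allI impI)
    fix C :: "(real ^ 'n) set" and D
    assume C: "C \<in> sets borel" "C \<subseteq> sphere 0 1" and D: "\<forall>x\<in>C. \<forall>y\<in>C. dist x y \<le> D" "0 \<le> D" "D \<le> h"
    define m where "m = measure lborel (cone_over C)"
    have m: "emeasure lborel (cone_over C) = ennreal m" "0 \<le> m"
      using emeasure_cone_over_finite[of C] by (auto simp: m_def emeasure_eq_ennreal_measure)
    have "D^2 \<le> h^2" using D by (intro power_mono) auto
    have pos: "0 \<le> 1 - (1 - h) ^ ?n" using h by (simp add: power_le_one)
    have "ennreal (1 - (1 - h) ^ ?n) * ennreal m \<le>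
        ennreal ((h + D^2 / 2) * (?\<omega> * (D * (1 + h) / 2) ^ (?n - 1)))"
      unfolding m(1)[symmetric] using C D h by (intro cone_over_small_diameter) auto
    then have "(1 - (1 - h) ^ ?n) * m \<le> (h + D^2 / 2) * (?\<omega> * (D * (1 + h) / 2) ^ (?n - 1))"
      using pos m D h by (intro ennreal_mult_leD) auto
    also have "... \<le> (h + h^2) * (?\<omega> * (D * (1 + h) / 2) ^ (?n - 1))"
    proof (rule mult_right_mono)
      have "0 \<le> h^2" by simp
      then show "h + D^2 / 2 \<le> h + h^2" using \<open>D^2 \<le> h^2\<close> by linarith
      show "0 \<le> ?\<omega> * (D * (1 + h) / 2) ^ (?n - 1)" using D h by simp
    qed
    also have "... = h * ((1 + h) * (1 + h) ^ (?n - 1)) * (?\<omega> * (D / 2) ^ (?n - 1))"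
    proof -
      have "h + h^2 = h * (1 + h)" by (simp add: power2_eq_square distrib_left)
      moreover have "(D * (1 + h) / 2) ^ (?n - 1) = (D / 2) ^ (?n - 1) * (1 + h) ^ (?n - 1)"
        by (simp flip: power_mult_distrib)
      ultimately show ?thesis by (simp only: mult_ac)
    qed
    also have "(1 + h) * (1 + h) ^ (?n - 1) = (1 + h) ^ ?n"
      by (simp flip: power_Suc)
    finally have "h * (?g * m) \<le> h * ((1 + h) ^ ?n * (?\<omega> * (D / 2) ^ (?n - 1)))"
      by (simp only: one_minus_power_factor mult.assoc)
    then have "?g * m \<le> (1 + h) ^ ?n * (?\<omega> * (D / 2) ^ (?n - 1))"
      using h(1) by (rule mult_left_le_imp_le)
    then have "real ?n * (?g * m) \<le> real ?n * ((1 + h) ^ ?n * (?\<omega> * (D / 2) ^ (?n - 1)))"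
      by (rule mult_left_mono) simp
    also have "... = real ?n * (1 + h) ^ ?n * (?\<omega> * (D / 2) ^ (?n - 1))" by (simp only: mult.assoc)
    also have "... \<le> \<kappa> * ?g * (?\<omega> * (D / 2) ^ (?n - 1))"
      using h(3) D by (intro mult_right_mono) auto
    finally have "?g * (real ?n * m) \<le> ?g * (\<kappa> * (?\<omega> * (D / 2) ^ (?n - 1)))"
      by (simp only: mult_ac)
    then have "real ?n * m \<le> \<kappa> * (?\<omega> * (D / 2) ^ (?n - 1))"
      using g by (rule mult_left_le_imp_le)
    then show "measure sphere_measure C \<le> \<kappa> * (?\<omega> * (D / 2) ^ (?n - 1))"
      using C by (simp only: measure_sphere_measure m_def)
  qed (use h in auto)
qed

text \<open>The counterpart for caps, from the flat cylinder inside the shell.\<close>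

lemma sphere_measure_cap_ge:
  assumes "1 < \<kappa>"
  shows "\<exists>\<delta>>0. \<forall>(u :: real ^ 'n) r. norm u = 1 --> 0 < r --> r \<le> \<delta> -->
    unit_ball_vol (real (CARD('n) - 1)) * r ^ (CARD('n) - 1) \<le> \<kappa> * measure sphere_measure (cball u r)"
proof -
  let ?n = "CARD('n)"
  let ?\<omega> = "unit_ball_vol (real (?n - 1))"
  obtain h where h: "0 < h" "h < 1" "1 \<le> \<kappa> * (1 - h) ^ ?n"
    using ex_shell_height[OF assms, of ?n] by auto
  let ?g = "\<Sum>k<?n. (1 - h) ^ k"
  have "?g \<le> (\<Sum>k<?n. 1)" using h by (intro sum_mono power_le_one) auto
  then have g: "?g \<le> real ?n" by simp
  show ?thesis
  proof (intro exI[of _ h] conjI allI impI)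
    fix u :: "real ^ 'n" and r :: real assume u: "norm u = 1" and r: "0 < r" "r \<le> h"
    let ?C = "sphere 0 1 \<inter> cball u r"
    define m where "m = measure lborel (cone_over ?C)"
    have m: "emeasure lborel (cone_over ?C) = ennreal m" "0 \<le> m"
      using emeasure_cone_over_finite[of ?C] by (auto simp: m_def emeasure_eq_ennreal_measure)
    have "r^2 \<le> h^2" using r by (intro power_mono) auto
    moreover have "h^2 < h" using h by (simp add: power2_eq_square)
    ultimately have r2: "r^2 \<le> h" by simp
    have pos: "0 \<le> 1 - (1 - h) ^ ?n" using h by (simp add: power_le_one)
    have "ennreal ((h - r^2) * (?\<omega> * ((1 - h) * r) ^ (?n - 1))) \<le> ennreal (1 - (1 - h) ^ ?n) * ennreal m"
      unfolding m(1)[symmetric] using u h r r2 by (intro cone_over_cap_ge) auto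
    then have 1: "(h - r^2) * (?\<omega> * ((1 - h) * r) ^ (?n - 1)) \<le> (1 - (1 - h) ^ ?n) * m"
      using pos m by (intro ennreal_le_multD)
    have "h * ((1 - h) ^ ?n * (?\<omega> * r ^ (?n - 1))) = (h - h^2) * (?\<omega> * ((1 - h) * r) ^ (?n - 1))"
    proof -
      have "(1 - h) ^ ?n = (1 - h) * (1 - h) ^ (?n - 1)" by (simp flip: power_Suc)
      moreover have "h - h^2 = h * (1 - h)" by (simp add: power2_eq_square right_diff_distrib)
      ultimately show ?thesis unfolding power_mult_distrib by (simp only: mult_ac)
    qed
    also have "... \<le> (h - r^2) * (?\<omega> * ((1 - h) * r) ^ (?n - 1))"
      using \<open>r^2 \<le> h^2\<close> h r by (intro mult_right_mono) auto
    also note 1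
    also have "(1 - (1 - h) ^ ?n) * m = h * (?g * m)" by (simp only: one_minus_power_factor mult.assoc)
    finally have "(1 - h) ^ ?n * (?\<omega> * r ^ (?n - 1)) \<le> ?g * m"
      using h(1) by (rule mult_left_le_imp_le)
    also have "... \<le> real ?n * m" using g m by (intro mult_right_mono) auto
    finally have 2: "(1 - h) ^ ?n * (?\<omega> * r ^ (?n - 1)) \<le> real ?n * m" .
    have "1 * (?\<omega> * r ^ (?n - 1)) \<le> \<kappa> * (1 - h) ^ ?n * (?\<omega> * r ^ (?n - 1))"
      using h r by (intro mult_right_mono) auto
    also have "... \<le> \<kappa> * (real ?n * m)"
      unfolding mult.assoc by (rule mult_left_mono[OF 2]) (use assms in simp)
    also have "real ?n * m = measure sphere_measure (cball u r)"
      using cone_over_Int_sphere[of "cball u r"] by (simp add: measure_sphere_measure m_def Int_commute)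
    finally show "?\<omega> * r ^ (?n - 1) \<le> \<kappa> * measure sphere_measure (cball u r)" by simp
  qed (use h in auto)
qed

text \<open>The diameter bound \<open>sphere_measure_le_diameter\<close> is summed over an arbitrary cover by sets of
small diameter.\<close>

lemma hausdorff_measure_sphere_ge:
  "ennreal (real CARD('n) * unit_ball_vol (real CARD('n))) \<le>
    hausdorff_measure (CARD('n) - 1) (sphere (0 :: real ^ 'n) 1)"
proof -
  let ?S = "sphere (0 :: real ^ 'n) 1" and ?s = "CARD('n) - 1"
  let ?A = "real CARD('n) * unit_ball_vol (real CARD('n))"
  let ?H = "hausdorff_measure ?s ?S"
  have *: "ennreal ?A \<le> ennreal \<kappa> * ?H" if \<kappa>: "1 < \<kappa>" for \<kappa>
  proof -
    obtain \<delta> where \<delta>: "0 < \<delta>" and le: "\<And>(C :: (real ^ 'n) set) D. C \<in> sets borel ==> C \<subseteq> ?S ==>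
      (\<forall>x\<in>C. \<forall>y\<in>C. dist x y \<le> D) ==> 0 \<le> D ==> D \<le> \<delta> ==>
      measure sphere_measure C \<le> \<kappa> * (unit_ball_vol (real ?s) * (D / 2) ^ ?s)"
      using sphere_measure_le_diameter[OF \<kappa>, where ?'n = 'n] by auto
    have "ennreal ?A / ennreal \<kappa> \<le> hausdorff_content ?s \<delta> ?S"
      unfolding hausdorff_content_def
    proof (rule INF_greatest, clarify)
      fix C :: "nat => (real ^ 'n) set"
      assume cov: "?S \<subseteq> (\<Union>i. C i)" and C: "\<forall>i. bounded (C i) \<and> diameter (C i) \<le> \<delta>"
      let ?t = "\<lambda>i. if C i = {} then 0 else ennreal (unit_ball_vol (real ?s) * (diameter (C i) / 2) ^ ?s)"
      have "ennreal ?A = emeasure sphere_measure ?S" by (rule sphere_measure_sphere[symmetric])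
      also have "... \<le> emeasure sphere_measure (\<Union>i. closure (C i) \<inter> ?S)"
      proof (rule emeasure_mono)
        show "?S \<subseteq> (\<Union>i. closure (C i) \<inter> ?S)"
        proof
          fix x assume x: "x \<in> ?S"
          then obtain i where "x \<in> C i" using cov by blast
          then have "x \<in> closure (C i) \<inter> ?S" using closure_subset x by blast
          then show "x \<in> (\<Union>i. closure (C i) \<inter> ?S)" by blast
        qed
      qed simp
      also have "... \<le> (\<Sum>i. emeasure sphere_measure (closure (C i) \<inter> ?S))"
        by (rule emeasure_subadditive_countably) auto
      also have "... \<le> (\<Sum>i. ennreal \<kappa> * ?t i)"
      proof (rule suminf_le[OF _ summableI summableI])
        fix i
        show "emeasure sphere_measure (closure (C i) \<inter> ?S) \<le> ennreal \<kappa> * ?t i"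
        proof (cases "C i = {}")
          case False
          have "measure sphere_measure (closure (C i) \<inter> ?S) \<le> \<kappa> * (unit_ball_vol (real ?s) * (diameter (C i) / 2) ^ ?s)"
          proof (rule le)
            show "\<forall>x\<in>closure (C i) \<inter> ?S. \<forall>y\<in>closure (C i) \<inter> ?S. dist x y \<le> diameter (C i)"
            proof (intro ballI)
              fix x y assume "x \<in> closure (C i) \<inter> ?S" "y \<in> closure (C i) \<inter> ?S"
              then have "dist x y \<le> diameter (closure (C i))"
                using C by (intro diameter_bounded_bound) (auto intro: bounded_closure)
              then show "dist x y \<le> diameter (C i)" using C by (simp add: diameter_closure)
            qed
          qed (use C in \<open>auto intro: diameter_ge_0\<close>)
          then show ?thesis using False \<kappa> C
            by (simp add: sphere_measure.emeasure_eq_measure diameter_ge_0 flip: ennreal_mult')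
        qed simp
      qed
      also have "... = ennreal \<kappa> * (\<Sum>i. ?t i)" by (rule ennreal_suminf_cmult)
      finally have "ennreal ?A / ennreal \<kappa> \<le> ennreal \<kappa> * (\<Sum>i. ?t i) / ennreal \<kappa>"
        by (rule divide_right_mono_ennreal)
      also have "... = (\<Sum>i. ?t i)"
        using \<kappa> by (simp add: ennreal_mult_divide_eq mult.commute[of "ennreal \<kappa>"])
      finally show "ennreal ?A / ennreal \<kappa> \<le> (\<Sum>i. ?t i)" .
    qed
    also have "... \<le> ?H" unfolding hausdorff_measure_def using \<delta> by (intro SUP_upper) auto
    finally have "ennreal ?A / ennreal \<kappa> * ennreal \<kappa> \<le> ?H * ennreal \<kappa>" by (rule mult_right_mono) simp
    moreover have "ennreal ?A / ennreal \<kappa> * ennreal \<kappa> = ennreal ?A"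
      using \<kappa> by (simp add: divide_ennreal flip: ennreal_mult')
    ultimately show ?thesis by (simp add: mult.commute)
  qed
  show ?thesis
  proof (cases ?H)
    case (real H)
    have "?A \<le> 1 * H"
    proof (rule tendsto_lowerbound)
      show "((\<lambda>\<kappa>. \<kappa> * H) \<longlongrightarrow> 1 * H) (at_right 1)" by (intro tendsto_intros)
      have "?A \<le> \<kappa> * H" if "1 < \<kappa>" for \<kappa>
        using *[OF that] real that by (intro ennreal_le_multD) auto
      then show "\<forall>\<^sub>F \<kappa> in at_right 1. ?A \<le> \<kappa> * H" by (intro eventually_at_rightI[of 1 2]) auto
    qed simp
    then show ?thesis using real by (simp add: ennreal_leI)
  qed simp
qed

text \<open>Sums over a countable index set become series, as required by the definition of the Hausdorff content;
indices outside the range of the code stand for empty sets.\<close>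

lemma nn_integral_count_space_nat_code:
  fixes f :: "'a => ennreal" and e :: "'a => nat"
  assumes "inj_on e K"
  shows "(\<integral>\<^sup>+z. f z \<partial>count_space K) = (\<Sum>i. if i \<in> e ` K then f (inv_into K e i) else 0)"
proof -
  have "(\<integral>\<^sup>+z. f z \<partial>count_space K) = (\<integral>\<^sup>+z. f (inv_into K e (e z)) \<partial>count_space K)"
    using assms by (intro nn_integral_cong) simp
  also have "... = (\<integral>\<^sup>+i. f (inv_into K e i) \<partial>count_space (e ` K))"
    using assms by (intro nn_integral_bij_count_space) (simp add: inj_on_imp_bij_betw)
  also have "... = (\<integral>\<^sup>+i. f (inv_into K e i) * indicator (e ` K) i \<partial>count_space UNIV)"
    by (rule nn_integral_count_space_indicator) simp
  also have "... = (\<Sum>i. f (inv_into K e i) * indicator (e ` K) i)"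
    by (rule nn_integral_count_space_nat)
  also have "... = (\<Sum>i. if i \<in> e ` K then f (inv_into K e i) else 0)"
    by (intro suminf_cong) (simp add: indicator_def)
  finally show ?thesis .
qed

lemma nn_integral_count_space_le:
  fixes f :: "'a => ennreal"
  assumes "countable K" and "\<And>F. finite F ==> F \<subseteq> K ==> sum f F \<le> t"
  shows "(\<integral>\<^sup>+z. f z \<partial>count_space K) \<le> t"
proof -
  obtain e :: "'a => nat" where e: "inj_on e K" using assms(1) by (auto simp: countable_def)
  show ?thesis
    unfolding nn_integral_count_space_nat_code[OF e]
  proof (rule suminf_le_const[OF summableI])
    fix n
    let ?F = "{z \<in> K. e z < n}"
    have "e ` ?F \<subseteq> {..<n}" by auto
    then have "finite (e ` ?F)" by (rule finite_subset) simp
    moreover have "inj_on e ?F" by (rule inj_on_subset[OF e]) auto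
    ultimately have fin: "finite ?F" by (rule finite_imageD)
    have "(\<Sum>i<n. if i \<in> e ` K then f (inv_into K e i) else 0) = (\<Sum>i\<in>e ` ?F. f (inv_into K e i))"
      by (intro sum.mono_neutral_cong_right) auto
    also have "... = (\<Sum>z\<in>?F. f (inv_into K e (e z)))"
      by (intro sum.reindex_cong[where l = e]) (auto intro: inj_on_subset[OF e])
    also have "... = sum f ?F" using e by (intro sum.cong) auto
    also have "... \<le> t" using fin by (rule assms(2)) auto
    finally show "(\<Sum>i<n. if i \<in> e ` K then f (inv_into K e i) else 0) \<le> t" .
  qed
qed

lemma hausdorff_content_le_balls:
  fixes A :: "'a::euclidean_space set"
  assumes K: "countable K" "\<And>x r. (x, r) \<in> K ==> 0 < r \<and> 2 * r \<le> \<delta>" and "0 \<le> \<delta>"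
    and cov: "A \<subseteq> (\<Union>z\<in>K. cball (fst z) (snd z))"
  shows "hausdorff_content s \<delta> A \<le> (\<integral>\<^sup>+z. ennreal (unit_ball_vol (real s) * snd z ^ s) \<partial>count_space K)"
proof -
  obtain e :: "'a \<times> real => nat" where e: "inj_on e K" using K(1) by (auto simp: countable_def)
  define C where "C i = (if i \<in> e ` K then cball (fst (inv_into K e i)) (snd (inv_into K e i)) else {})" for i
  have inv: "inv_into K e i \<in> K" if "i \<in> e ` K" for i using that by (rule inv_into_into)
  have pos: "0 < snd (inv_into K e i)" "2 * snd (inv_into K e i) \<le> \<delta>" if "i \<in> e ` K" for i
    using K(2)[of "fst (inv_into K e i)" "snd (inv_into K e i)"] inv[OF that] by auto
  have "hausdorff_content s \<delta> A \<le> (\<Sum>i. if C i = {} then 0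
             else ennreal (unit_ball_vol (real s) * (diameter (C i) / 2) ^ s))"
    unfolding hausdorff_content_def
  proof (rule INF_lower, safe)
    fix x assume "x \<in> A"
    then obtain z where z: "z \<in> K" "x \<in> cball (fst z) (snd z)" using cov by auto
    then have "x \<in> C (e z)" using e by (simp add: C_def)
    then show "x \<in> (\<Union>i. C i)" by blast
  next
    fix i show "bounded (C i)" by (simp add: C_def)
    show "diameter (C i) \<le> \<delta>"
      using pos[of i] \<open>0 \<le> \<delta>\<close> by (simp add: C_def)
  qed
  also have "... = (\<Sum>i. if i \<in> e ` K then ennreal (unit_ball_vol (real s) * snd (inv_into K e i) ^ s) else 0)"
  proof (rule suminf_cong)
    fix i
    show "(if C i = {} then 0 else ennreal (unit_ball_vol (real s) * (diameter (C i) / 2) ^ s)) =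
      (if i \<in> e ` K then ennreal (unit_ball_vol (real s) * snd (inv_into K e i) ^ s) else 0)"
      using pos[of i] by (auto simp: C_def)
  qed
  also have "... = (\<integral>\<^sup>+z. ennreal (unit_ball_vol (real s) * snd z ^ s) \<partial>count_space K)"
    by (rule nn_integral_count_space_nat_code[OF e, symmetric])
  finally show ?thesis .
qed

lemma nn_integral_count_space_Un_le:
  fixes f :: "'a => ennreal"
  shows "(\<integral>\<^sup>+z. f z \<partial>count_space (K \<union> L)) \<le> (\<integral>\<^sup>+z. f z \<partial>count_space K) + (\<integral>\<^sup>+z. f z \<partial>count_space L)"
proof -
  have "(\<integral>\<^sup>+z. f z \<partial>count_space (K \<union> L)) = (\<integral>\<^sup>+z. f z * indicator (K \<union> L) z \<partial>count_space UNIV)"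
    by (rule nn_integral_count_space_indicator) simp
  also have "... \<le> (\<integral>\<^sup>+z. f z * indicator K z + f z * indicator L z \<partial>count_space UNIV)"
    by (intro nn_integral_mono) (auto simp: indicator_def)
  also have "... = (\<integral>\<^sup>+z. f z * indicator K z \<partial>count_space UNIV) + (\<integral>\<^sup>+z. f z * indicator L z \<partial>count_space UNIV)"
    by (rule nn_integral_add) auto
  also have "... = (\<integral>\<^sup>+z. f z \<partial>count_space K) + (\<integral>\<^sup>+z. f z \<partial>count_space L)"
    by (simp add: nn_integral_count_space_indicator[symmetric])
  finally show ?thesis .
qed

text \<open>Disjoint caps nearly maximal in total area are chosen first. The remaining part of the sphere is covered
by the fivefold enlargements of disjoint caps, whose total area is at most \<tau> by maximality. Caps are efficient up
to the factor \<kappa> by \<open>sphere_measure_cap_ge\<close>.\<close>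

lemma hausdorff_content_sphere_le:
  fixes \<kappa> \<delta> \<tau> :: real
  assumes \<kappa>: "1 < \<kappa>" and "0 < \<delta>" and "0 < \<tau>"
  shows "hausdorff_content (CARD('n) - 1) \<delta> (sphere (0 :: real ^ 'n) 1) \<le>
    ennreal (\<kappa> * (real CARD('n) * unit_ball_vol (real CARD('n))) + 5 ^ (CARD('n) - 1) * \<kappa> * \<tau>)"
proof -
  let ?S = "sphere (0 :: real ^ 'n) 1" and ?s = "CARD('n) - 1"
  let ?A = "real CARD('n) * unit_ball_vol (real CARD('n))"
  let ?w = "\<lambda>z :: (real ^ 'n) \<times> real. unit_ball_vol (real ?s) * snd z ^ ?s"
  let ?B = "\<lambda>z :: (real ^ 'n) \<times> real. cball (fst z) (snd z)"
  let ?m = "\<lambda>z. measure sphere_measure (?B z)"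
  obtain \<delta>0 where "0 < \<delta>0" and cap: "\<And>(u :: real ^ 'n) r. norm u = 1 ==> 0 < r ==> r \<le> \<delta>0 ==>
    unit_ball_vol (real ?s) * r ^ ?s \<le> \<kappa> * measure sphere_measure (cball u r)"
    using sphere_measure_cap_ge[OF \<kappa>, where ?'n = 'n] by blast
  define \<delta>1 where "\<delta>1 = min \<delta>0 (\<delta> / 10)"
  have \<delta>1: "0 < \<delta>1" "\<delta>1 \<le> \<delta>0" "10 * \<delta>1 \<le> \<delta>" using \<open>0 < \<delta>0\<close> \<open>0 < \<delta>\<close> by (auto simp: \<delta>1_def)
  define Adm where "Adm = {z :: (real ^ 'n) \<times> real. norm (fst z) = 1 \<and> 0 < snd z \<and> snd z \<le> \<delta>1}"
  \<comment> \<open>Finite disjoint families of small caps; the supremum of their areas is nearly attained.\<close>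
  define Fam where "Fam = {F. finite F \<and> F \<subseteq> Adm \<and> disjoint_family_on ?B F}"
  have wle: "?w z \<le> \<kappa> * ?m z" if "z \<in> Adm" for z
    using that \<delta>1 by (intro cap) (auto simp: Adm_def)
  have total: "measure sphere_measure X \<le> ?A" for X :: "(real ^ 'n) set"
  proof -
    have "emeasure sphere_measure (UNIV :: (real ^ 'n) set) = emeasure sphere_measure ?S"
      using cone_over_Int_sphere[of "UNIV :: (real ^ 'n) set"] by (simp add: emeasure_sphere_measure)
    then have "measure sphere_measure (UNIV :: (real ^ 'n) set) = ?A"
      by (simp add: measure_def sphere_measure_sphere)
    then show ?thesis using sphere_measure.bounded_measure[of X] by simp
  qed
  have sum_m: "(\<Sum>z\<in>F. ?m z) = measure sphere_measure (\<Union>z\<in>F. ?B z)" if "F \<in> Fam" for F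
    using that by (intro sphere_measure.finite_measure_finite_Union[symmetric]) (auto simp: Fam_def)
  have bdd: "bdd_above ((\<lambda>F. \<Sum>z\<in>F. ?m z) ` Fam)"
    by (rule bdd_aboveI2[of _ _ ?A]) (simp add: sum_m total)
  have "{} \<in> Fam" by (simp add: Fam_def disjoint_family_on_def)
  define s where "s = (SUP F\<in>Fam. \<Sum>z\<in>F. ?m z)"
  have "\<exists>F\<in>Fam. s - \<tau> < (\<Sum>z\<in>F. ?m z)"
    unfolding s_def by (intro less_cSUP_iff[THEN iffD1] bdd) (use \<open>{} \<in> Fam\<close> \<open>0 < \<tau>\<close> in auto)
  then obtain F where F: "F \<in> Fam" "s - \<tau> < (\<Sum>z\<in>F. ?m z)" by auto
  define G where "G = - (\<Union>z\<in>F. ?B z)"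
  have "open G" using F(1) unfolding G_def Fam_def by (auto intro!: closed_UN)
  define K where "K = {z \<in> Adm. ?B z \<subseteq> G}"
  obtain C where C: "countable C" "C \<subseteq> K"
     "pairwise (\<lambda>i j. disjnt (?B i) (?B j)) C"
     "?S \<inter> G \<subseteq> (\<Union>i\<in>C. cball (fst i) (5 * snd i))"
  proof (rule Vitali_covering_lemma_cballs[where S = "?S \<inter> G" and K = K and a = fst and r = snd and B = \<delta>1])
    show "?S \<inter> G \<subseteq> (\<Union>i\<in>K. ?B i)"
    proof
      fix x assume x: "x \<in> ?S \<inter> G"
      then obtain d where d: "0 < d" "cball x d \<subseteq> G" using \<open>open G\<close> open_contains_cball by blast
      then have "(x, min d \<delta>1) \<in> K"
        using x \<delta>1 by (auto simp: K_def Adm_def)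
      then show "x \<in> (\<Union>i\<in>K. ?B i)" using d(1) \<delta>1(1) by (intro UN_I[of "(x, min d \<delta>1)"]) auto
    qed
  qed (auto simp: K_def Adm_def)
  have disjFC: "?B z \<inter> ?B z' = {}" if "z \<in> F" "z' \<in> C" for z z'
    using that C(2) unfolding K_def G_def by blast
  have small: "(\<Sum>z\<in>F'. ?m z) \<le> \<tau>" if F': "finite F'" "F' \<subseteq> C" for F'
  proof -
    have "F \<union> F' \<in> Fam"
      unfolding Fam_def
    proof (intro CollectI conjI)
      show "finite (F \<union> F')" "F \<union> F' \<subseteq> Adm" using F(1) F' C(2) by (auto simp: Fam_def K_def)
      show "disjoint_family_on ?B (F \<union> F')"
        unfolding disjoint_family_on_def
      proof (intro ballI impI)
        fix z z' assume z: "z \<in> F \<union> F'" "z' \<in> F \<union> F'" "z \<noteq> z'"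
        have FF: "?B z \<inter> ?B z' = {}" if "z \<in> F" "z' \<in> F"
          using F(1) that z(3) by (auto simp: Fam_def disjoint_family_on_def)
        have CC: "?B z \<inter> ?B z' = {}" if "z \<in> C" "z' \<in> C"
          using C(3) that z(3) by (auto simp: pairwise_def disjnt_def)
        show "?B z \<inter> ?B z' = {}"
          using z F' FF CC disjFC[of z z'] disjFC[of z' z] by blast
      qed
    qed
    then have "(\<Sum>z\<in>F \<union> F'. ?m z) \<le> s" unfolding s_def by (intro cSUP_upper bdd)
    moreover have "F \<inter> F' = {}"
    proof (rule ccontr)
      assume "F \<inter> F' \<noteq> {}"
      then obtain z where z: "z \<in> F" "z \<in> F'" by auto
      then have "?B z = {}" using disjFC[of z z] F' by auto
      moreover have "0 < snd z" using z F(1) by (auto simp: Fam_def Adm_def)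
      ultimately show False by simp
    qed
    ultimately show ?thesis using F F' by (subst (asm) sum.union_disjoint) (auto simp: Fam_def)
  qed
  define C5 where "C5 = (\<lambda>z. (fst z, 5 * snd z)) ` C"
  have inj5: "inj_on (\<lambda>z :: (real ^ 'n) \<times> real. (fst z, 5 * snd z)) C"
    by (auto simp: inj_on_def prod_eq_iff)
  have "hausdorff_content ?s \<delta> ?S \<le> (\<integral>\<^sup>+z. ennreal (?w z) \<partial>count_space (F \<union> C5))"
  proof (rule hausdorff_content_le_balls)
    show "countable (F \<union> C5)" using F(1) C(1) by (auto simp: Fam_def C5_def countable_finite)
    show "0 < r \<and> 2 * r \<le> \<delta>" if "(x, r) \<in> F \<union> C5" for x r
      using that F(1) C(2) \<delta>1 by (force simp: Fam_def Adm_def K_def C5_def)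
    show "?S \<subseteq> (\<Union>z\<in>F \<union> C5. ?B z)"
    proof
      fix x assume x: "x \<in> ?S"
      show "x \<in> (\<Union>z\<in>F \<union> C5. ?B z)"
      proof (cases "x \<in> G")
        case True
        then obtain i where "i \<in> C" "x \<in> cball (fst i) (5 * snd i)" using x C(4) by blast
        then show ?thesis by (intro UN_I[of "(fst i, 5 * snd i)"]) (auto simp: C5_def)
      qed (auto simp: G_def)
    qed
  qed (use \<open>0 < \<delta>\<close> in simp)
  also have "... \<le> (\<integral>\<^sup>+z. ennreal (?w z) \<partial>count_space F) + (\<integral>\<^sup>+z. ennreal (?w z) \<partial>count_space C5)"
    by (rule nn_integral_count_space_Un_le)
  also have "... \<le> ennreal (\<kappa> * ?A) + ennreal (5 ^ ?s * \<kappa> * \<tau>)"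
  proof (rule add_mono)
    have "(\<integral>\<^sup>+z. ennreal (?w z) \<partial>count_space F) = (\<Sum>z\<in>F. ennreal (?w z))"
      using F(1) by (intro nn_integral_count_space_finite) (simp add: Fam_def)
    also have "... = ennreal (\<Sum>z\<in>F. ?w z)"
      using F(1) by (intro sum_ennreal) (auto simp: Fam_def Adm_def)
    also have "(\<Sum>z\<in>F. ?w z) \<le> (\<Sum>z\<in>F. \<kappa> * ?m z)"
      using F(1) by (intro sum_mono wle) (auto simp: Fam_def)
    also have "(\<Sum>z\<in>F. \<kappa> * ?m z) = \<kappa> * (\<Sum>z\<in>F. ?m z)" by (simp add: sum_distrib_left)
    also have "... \<le> \<kappa> * ?A" using \<kappa> by (simp add: sum_m[OF F(1)] total)
    finally show "(\<integral>\<^sup>+z. ennreal (?w z) \<partial>count_space F) \<le> ennreal (\<kappa> * ?A)"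
      by (simp add: ennreal_leI)
    have "(\<integral>\<^sup>+z. ennreal (?w z) \<partial>count_space C5) = (\<integral>\<^sup>+z. ennreal (?w (fst z, 5 * snd z)) \<partial>count_space C)"
      unfolding C5_def by (rule nn_integral_bij_count_space[symmetric, OF inj_on_imp_bij_betw[OF inj5]])
    also have "... \<le> ennreal (5 ^ ?s * \<kappa> * \<tau>)"
    proof (rule nn_integral_count_space_le[OF C(1)])
      fix F' assume F': "finite F'" "F' \<subseteq> C"
      have "(\<Sum>z\<in>F'. ennreal (?w (fst z, 5 * snd z))) = ennreal (\<Sum>z\<in>F'. ?w (fst z, 5 * snd z))"
        using F' C(2) by (intro sum_ennreal) (auto simp: K_def Adm_def)
      also have "(\<Sum>z\<in>F'. ?w (fst z, 5 * snd z)) = 5 ^ ?s * (\<Sum>z\<in>F'. ?w z)"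
        by (simp add: power_mult_distrib sum_distrib_left mult_ac)
      also have "(\<Sum>z\<in>F'. ?w z) \<le> (\<Sum>z\<in>F'. \<kappa> * ?m z)"
        using F' C(2) by (intro sum_mono wle) (auto simp: K_def)
      also have "(\<Sum>z\<in>F'. \<kappa> * ?m z) = \<kappa> * (\<Sum>z\<in>F'. ?m z)" by (simp add: sum_distrib_left)
      also have "... \<le> \<kappa> * \<tau>" using \<kappa> small[OF F'] by simp
      finally show "(\<Sum>z\<in>F'. ennreal (?w (fst z, 5 * snd z))) \<le> ennreal (5 ^ ?s * \<kappa> * \<tau>)"
        by (simp add: ennreal_leI mult.assoc)
    qed
    finally show "(\<integral>\<^sup>+z. ennreal (?w z) \<partial>count_space C5) \<le> ennreal (5 ^ ?s * \<kappa> * \<tau>)" .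
  qed
  also have "... = ennreal (\<kappa> * ?A + 5 ^ ?s * \<kappa> * \<tau>)"
    using \<kappa> \<open>0 < \<tau>\<close> by (intro ennreal_plus[symmetric]) auto
  finally show ?thesis .
qed

text \<open>Both bounds hold up to a factor that may be taken arbitrarily close to 1.\<close>

theorem sphere_area_eq: "sphere_area TYPE('n::finite) = real CARD('n) * unit_ball_vol (real CARD('n))"
proof -
  let ?S = "sphere (0 :: real ^ 'n) 1" and ?s = "CARD('n) - 1"
  let ?A = "real CARD('n) * unit_ball_vol (real CARD('n))"
  have "hausdorff_measure ?s ?S \<le> ennreal ?A"
    unfolding hausdorff_measure_def
  proof (rule SUP_least)
    fix \<delta> :: real assume "\<delta> \<in> {0<..}"
    show "hausdorff_content ?s \<delta> ?S \<le> ennreal ?A"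
    proof (rule tendsto_lowerbound)
      show "((\<lambda>t. ennreal ((1 + t) * ?A + 5 ^ ?s * (1 + t) * t)) \<longlongrightarrow> ennreal ?A) (at_right 0)"
      proof (rule tendsto_ennrealI)
        have "((\<lambda>t. (1 + t) * ?A + 5 ^ ?s * (1 + t) * t) \<longlongrightarrow> (1 + 0) * ?A + 5 ^ ?s * (1 + 0) * 0) (at_right 0)"
          by (intro tendsto_intros)
        then show "((\<lambda>t. (1 + t) * ?A + 5 ^ ?s * (1 + t) * t) \<longlongrightarrow> ?A) (at_right 0)" by simp
      qed
      show "\<forall>\<^sub>F t in at_right 0. hausdorff_content ?s \<delta> ?S \<le> ennreal ((1 + t) * ?A + 5 ^ ?s * (1 + t) * t)"
        using \<open>\<delta> \<in> {0<..}\<close>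
        by (intro eventually_at_rightI[of 0 1] hausdorff_content_sphere_le) auto
    qed simp
  qed
  then have "hausdorff_measure ?s ?S = ennreal ?A"
    using hausdorff_measure_sphere_ge[where ?'n = 'n] by (rule antisym)
  then show ?thesis by (simp add: sphere_area_def)
qed

section \<open>The local variational problem\<close>

text \<open>The integral of (1-|w|^2)_+^q over R^d; see \<open>nn_integral_radial\<close>.\<close>

definition radial_mass :: "'n::finite itself => real => real" where
  "radial_mass N q = sphere_area N / 2 * Beta (q + 1) (real CARD('n) / 2)"

lemma Beta_real_pos: "0 < x ==> 0 < y ==> 0 < Beta x (y :: real)"
  by (simp add: Beta_def Gamma_real_pos)

lemma pos_not_nonpos_Ints: "0 < (x :: real) ==> x \<notin> \<int>\<^sub>\<le>\<^sub>0"
  by (auto elim!: nonpos_Ints_cases)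

lemma sphere_area_pos: "0 < sphere_area TYPE('n::finite)"
  unfolding sphere_area_eq by simp

lemma radial_mass_pos: "- 1 < q ==> 0 < radial_mass TYPE('n::finite) q"
  unfolding radial_mass_def using sphere_area_pos by (intro mult_pos_pos Beta_real_pos) auto

text \<open>The functional equation of the beta function. It relates the exponents 1/(p-1) and p/(p-1)=1/(p-1)+1 that
occur in the mass and in the value.\<close>

lemma radial_mass_Suc:
  assumes "- 1 < q"
  shows "(q + 1 + real CARD('n) / 2) * radial_mass TYPE('n::finite) (q + 1) = (q + 1) * radial_mass TYPE('n) q"
proof -
  have "(q + 1 + real CARD('n) / 2) * Beta (q + 1 + 1) (real CARD('n) / 2) = (q + 1) * Beta (q + 1) (real CARD('n) / 2)"
    using assms by (intro Beta_plus1_left pos_not_nonpos_Ints) simp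
  then show ?thesis
    unfolding radial_mass_def mult.left_commute[of _ "sphere_area TYPE('n) / 2"] by simp
qed

lemma nn_integral_powr_from_0:
  assumes "0 < q" "0 \<le> y"
  shows "(\<integral>\<^sup>+s. ennreal (q * s powr (q - 1)) * indicator {0..y} s \<partial>lborel) = ennreal (y powr q)"
proof -
  have "((\<lambda>s. s powr (q - 1)) has_integral (y powr (q - 1 + 1) / (q - 1 + 1))) {0..y}"
    using assms by (intro has_integral_powr_from_0) auto
  then have "((\<lambda>s. q * s powr (q - 1)) has_integral (q * (y powr q / q))) {0..y}"
    by (intro has_integral_mult_right) simp
  then show ?thesis using assms
    by (subst nn_integral_has_integral_lebesgue'[of _ _ "y powr q"]) auto
qed

lemma nn_integral_cmult_real:
  assumes "0 \<le> k" and [measurable]: "g \<in> borel_measurable M"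
  shows "(\<integral>\<^sup>+z. ennreal (k * g z) \<partial>M) = ennreal k * (\<integral>\<^sup>+z. ennreal (g z) \<partial>M)"
  using assms(1) by (subst nn_integral_cmult[symmetric]) (auto simp: ennreal_mult')

text \<open>Layer cake: the superlevel sets of the integrand are balls, and the remaining integral over the radius is
a beta integral.\<close>

lemma nn_integral_radial:
  assumes "0 < q"
  shows "(\<integral>\<^sup>+w. ennreal (max 0 (1 - w \<bullet> w) powr q) \<partial>(lborel :: (real ^ 'n) measure))
    = ennreal (radial_mass TYPE('n) q)"
proof -
  let ?d = "real CARD('n)"
  let ?\<omega> = "unit_ball_vol ?d"
  let ?B = "lborel :: (real ^ 'n) measure"
  have "(\<integral>\<^sup>+w. ennreal (max 0 (1 - w \<bullet> w) powr q) \<partial>?B) =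
      (\<integral>\<^sup>+w. \<integral>\<^sup>+s. ennreal (q * s powr (q - 1)) * indicator {0..max 0 (1 - w \<bullet> w)} s \<partial>lborel \<partial>?B)"
    using assms by (intro nn_integral_cong) (simp only: nn_integral_powr_from_0 max.cobounded1)
  also have "... = (\<integral>\<^sup>+w. \<integral>\<^sup>+s. ennreal (q * s powr (q - 1)) * indicator {0..1} s * indicator {z. fst z \<bullet> fst z \<le> 1 - snd z} (w, s) \<partial>lborel \<partial>?B)"
  proof (rule nn_integral_cong)
    fix w :: "real ^ 'n"
    show "(\<integral>\<^sup>+s. ennreal (q * s powr (q - 1)) * indicator {0..max 0 (1 - w \<bullet> w)} s \<partial>lborel) =
      (\<integral>\<^sup>+s. ennreal (q * s powr (q - 1)) * indicator {0..1} s * indicator {z. fst z \<bullet> fst z \<le> 1 - snd z} (w, s) \<partial>lborel)"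
    proof (rule nn_integral_cong_AE)
      have "AE s in lborel. s \<noteq> (0 :: real)" by (rule AE_lborel_singleton)
      then show "AE s in lborel. ennreal (q * s powr (q - 1)) * indicator {0..max 0 (1 - w \<bullet> w)} s =
        ennreal (q * s powr (q - 1)) * indicator {0..1} s * indicator {z. fst z \<bullet> fst z \<le> 1 - snd z} (w, s)"
      proof eventually_elim
        case (elim s)
        have "s \<in> {0..max 0 (1 - w \<bullet> w)} \<longleftrightarrow> s \<in> {0..1} \<and> w \<bullet> w \<le> 1 - s"
          using elim inner_ge_zero[of w] by (auto simp: max_def simp del: inner_ge_zero split: if_splits)
        then show ?case by (simp add: indicator_def)
      qed
    qed
  qed
  also have "... = (\<integral>\<^sup>+s. \<integral>\<^sup>+w. ennreal (q * s powr (q - 1)) * indicator {0..1} s * indicator {z. fst z \<bullet> fst z \<le> 1 - snd z} (w, s) \<partial>?B \<partial>lborel)"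
  proof (rule lborel_pair.Fubini'[symmetric])
    have "{z :: (real ^ 'n) \<times> real. fst z \<bullet> fst z \<le> 1 - snd z} \<in> sets borel"
      by (intro borel_closed closed_Collect_le continuous_intros)
    then have [measurable]: "{z :: (real ^ 'n) \<times> real. fst z \<bullet> fst z \<le> 1 - snd z} \<in> sets (lborel \<Otimes>\<^sub>M lborel)"
      unfolding lborel_prod by simp
    show "(\<lambda>(w :: real ^ 'n, s :: real). ennreal (q * s powr (q - 1)) * indicator {0..1} s *
        indicator {z. fst z \<bullet> fst z \<le> 1 - snd z} (w, s)) \<in> borel_measurable (lborel \<Otimes>\<^sub>M lborel)"
      unfolding case_prod_beta prod.collapse by measurable
  qed
  also have "... = (\<integral>\<^sup>+s. ennreal (q * ?\<omega>) * ennreal (s powr (q - 1) * (1 - s) powr (?d / 2 + 1 - 1)) * indicator {0..1} s \<partial>lborel)"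
  proof (rule nn_integral_cong_AE)
    have "AE s in lborel. s \<noteq> (1 :: real)" by (rule AE_lborel_singleton)
    then show "AE s in lborel. (\<integral>\<^sup>+w. ennreal (q * s powr (q - 1)) * indicator {0..1} s * indicator {z. fst z \<bullet> fst z \<le> 1 - snd z} (w, s) \<partial>?B) =
       ennreal (q * ?\<omega>) * ennreal (s powr (q - 1) * (1 - s) powr (?d / 2 + 1 - 1)) * indicator {0..1} s"
    proof eventually_elim
      case (elim s)
      show ?case
      proof (cases "s \<in> {0..1}")
        case True
        then have s: "0 < 1 - s" using elim by auto
        have "w \<bullet> w \<le> 1 - s \<longleftrightarrow> w \<in> cball 0 (sqrt (1 - s))" for w :: "real ^ 'n"
          using s by (simp add: norm_eq_sqrt_inner)
        then have "(\<integral>\<^sup>+w. ennreal (q * s powr (q - 1)) * indicator {0..1} s * indicator {z. fst z \<bullet> fst z \<le> 1 - snd z} (w, s) \<partial>?B) =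
            (\<integral>\<^sup>+w. ennreal (q * s powr (q - 1)) * indicator (cball 0 (sqrt (1 - s))) w \<partial>?B)"
          using True by (intro nn_integral_cong) (auto simp: indicator_def)
        also have "... = ennreal (q * s powr (q - 1)) * ennreal (?\<omega> * sqrt (1 - s) ^ CARD('n))"
          using s by (subst nn_integral_cmult_indicator) (auto simp: emeasure_cball)
        also have "sqrt (1 - s) ^ CARD('n) = (1 - s) powr (?d / 2 + 1 - 1)"
          using s by (simp add: powr_half_sqrt[symmetric] powr_realpow[symmetric] powr_powr)
        finally show ?thesis
          using True assms by (simp add: mult_ac flip: ennreal_mult')
      qed simp
    qed
  qed
  also have "... = ennreal (q * ?\<omega>) * (\<integral>\<^sup>+s. ennreal (s powr (q - 1) * (1 - s) powr (?d / 2 + 1 - 1)) * indicator {0..1} s \<partial>lborel)"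
    by (simp add: nn_integral_cmult mult.assoc)
  also have "(\<integral>\<^sup>+s. ennreal (s powr (q - 1) * (1 - s) powr (?d / 2 + 1 - 1)) * indicator {0..1} s \<partial>lborel) = ennreal (Beta q (?d / 2 + 1))"
    using assms by (intro nn_integral_has_integral_lebesgue' has_integral_Beta_real) auto
  also have "ennreal (q * ?\<omega>) * ennreal (Beta q (?d / 2 + 1)) = ennreal (q * ?\<omega> * Beta q (?d / 2 + 1))"
    using assms by (intro ennreal_mult'[symmetric]) simp
  also have "q * ?\<omega> * Beta q (?d / 2 + 1) = radial_mass TYPE('n) q"
  proof -
    have 1: "(q + ?d / 2) * Beta (q + 1) (?d / 2) = q * Beta q (?d / 2)"
      using assms by (intro Beta_plus1_left pos_not_nonpos_Ints)
    have 2: "(q + ?d / 2) * Beta q (?d / 2 + 1) = (?d / 2) * Beta q (?d / 2)"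
      by (intro Beta_plus1_right pos_not_nonpos_Ints) simp
    have "(q + ?d / 2) * (q * Beta q (?d / 2 + 1)) = (q + ?d / 2) * ((?d / 2) * Beta (q + 1) (?d / 2))"
      using 1 2 by (metis mult.left_commute)
    moreover have "q + ?d / 2 \<noteq> 0" using assms by (smt (verit) divide_nonneg_pos of_nat_0_le_iff)
    ultimately have "q * Beta q (?d / 2 + 1) = ?d / 2 * Beta (q + 1) (?d / 2)" by simp
    then have "?\<omega> * (q * Beta q (?d / 2 + 1)) = ?\<omega> * (?d / 2 * Beta (q + 1) (?d / 2))" by simp
    then show ?thesis by (simp add: radial_mass_def sphere_area_eq mult_ac)
  qed
  finally show ?thesis .
qed

lemma nn_integral_lborel_affine:
  fixes x :: "'a::euclidean_space"
  assumes "0 < c" and [measurable]: "g \<in> borel_measurable borel"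
  shows "(\<integral>\<^sup>+y. g y \<partial>lborel) = ennreal (c ^ DIM('a)) * (\<integral>\<^sup>+w. g (x + c *\<^sub>R w) \<partial>lborel)"
proof -
  have "(\<integral>\<^sup>+y. g y \<partial>lborel) = (\<integral>\<^sup>+y. g y \<partial>density (distr lborel borel (\<lambda>w. x + c *\<^sub>R w)) (\<lambda>_. \<bar>c\<bar> ^ DIM('a)))"
    using lborel_affine[of c x] assms(1) by simp
  also have "... = ennreal (c ^ DIM('a)) * (\<integral>\<^sup>+w. g (x + c *\<^sub>R w) \<partial>lborel)"
    using assms(1) by (subst nn_integral_density) (auto simp: nn_integral_distr nn_integral_cmult)
  finally show ?thesis .
qed

lemma nn_integral_quadratic_power:
  fixes A :: "real ^ 'n ^ 'n"
  assumes A: "transpose A = A" "\<And>v. v \<noteq> 0 ==> 0 < v \<bullet> (A *v v)" and a: "0 < a" and q: "0 < q"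
  shows "(\<integral>\<^sup>+z. ennreal (max 0 (a - z \<bullet> (A *v z)) powr q) \<partial>lborel)
    = ennreal (a powr (q + real CARD('n) / 2) / sqrt (det A) * radial_mass TYPE('n) q)"
proof -
  let ?g = "\<lambda>w :: real ^ 'n. ennreal (max 0 (a - w \<bullet> w) powr q)"
  have "(\<integral>\<^sup>+z. ennreal (max 0 (a - z \<bullet> (A *v z)) powr q) \<partial>lborel) =
      ennreal (1 / sqrt (det A)) * (\<integral>\<^sup>+w. ?g w \<partial>lborel)"
    using nn_integral_quadratic_form[OF A, of "\<lambda>t. ennreal (max 0 (a - t) powr q)"] by simp
  also have "(\<integral>\<^sup>+w. ?g w \<partial>lborel) = ennreal (sqrt a ^ CARD('n)) * (\<integral>\<^sup>+w. ?g (0 + sqrt a *\<^sub>R w) \<partial>lborel)"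
    using a nn_integral_lborel_affine[of "sqrt a" ?g "0 :: real ^ 'n"] by simp
  also have "(\<integral>\<^sup>+w. ?g (0 + sqrt a *\<^sub>R w) \<partial>lborel) = (\<integral>\<^sup>+w. ennreal (a powr q) * ennreal (max 0 (1 - w \<bullet> w) powr q) \<partial>(lborel :: (real ^ 'n) measure))"
  proof (rule nn_integral_cong)
    fix w :: "real ^ 'n"
    have "max 0 (a - (sqrt a *\<^sub>R w) \<bullet> (sqrt a *\<^sub>R w)) = max 0 (a * (1 - w \<bullet> w))"
    proof -
      have "(sqrt a *\<^sub>R w) \<bullet> (sqrt a *\<^sub>R w) = (sqrt a * sqrt a) * (w \<bullet> w)"
        by (simp only: inner_scaleR_left inner_scaleR_right mult.assoc)
      also have "sqrt a * sqrt a = a" using a by simp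
      finally have "(sqrt a *\<^sub>R w) \<bullet> (sqrt a *\<^sub>R w) = a * (w \<bullet> w)" .
      then show ?thesis by (simp only: right_diff_distrib mult_1_right)
    qed
    also have "... = a * max 0 (1 - w \<bullet> w)" using a by (auto simp: max_def zero_le_mult_iff mult_le_0_iff)
    finally show "?g (0 + sqrt a *\<^sub>R w) = ennreal (a powr q) * ennreal (max 0 (1 - w \<bullet> w) powr q)"
      using a by (simp add: powr_mult flip: ennreal_mult')
  qed
  also have "... = ennreal (a powr q) * ennreal (radial_mass TYPE('n) q)"
    using nn_integral_radial[OF q, where ?'n = 'n] by (simp add: nn_integral_cmult)
  also have "sqrt a ^ CARD('n) = a powr (real CARD('n) / 2)"
    using a by (simp add: powr_half_sqrt[symmetric] powr_realpow[symmetric] powr_powr)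
  finally show ?thesis
    using a pos_def_det_pos[OF A] radial_mass_pos[of q, where ?'n = 'n] q
    by (simp add: powr_add mult_ac flip: ennreal_mult')
qed

text \<open>Young's inequality, that is, the Legendre transform of u\<mapsto> l u^p on [0,\<infinity>).\<close>

lemma power_duality:
  fixes p u b l :: real
  assumes p: "1 < p" and l: "0 < l" and u: "0 \<le> u"
  shows "b * u \<le> l * u powr p + (p - 1) / p * (p * l) powr (- 1 / (p - 1)) * max 0 b powr (p / (p - 1))"
proof (cases "0 < b")
  case False
  then have "b * u \<le> 0" using u by (simp add: mult_nonpos_nonneg)
  also have "0 \<le> l * u powr p" using l by simp
  finally have "b * u \<le> l * u powr p" .
  moreover have "max 0 b = 0" using False by simp
  ultimately show ?thesis by simp
next
  case True
  define r where "r = (p * l) powr (1 / p)"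
  have r: "0 < r" using p l by (simp add: r_def)
  have pl: "0 < p * l" using p l by simp
  have "b * u = (u * r) * (b / r)" using r by simp
  also have "... \<le> (u * r) powr p / p + (b / r) powr (p / (p - 1)) / (p / (p - 1))"
    using p u r True by (intro Youngs_inequality) (auto simp: field_simps)
  also have "(u * r) powr p = u powr p * (p * l)"
    using u pl p l by (simp add: powr_mult r_def powr_powr)
  also have "(b / r) powr (p / (p - 1)) = b powr (p / (p - 1)) * (p * l) powr (- 1 / (p - 1))"
  proof -
    have "(b / r) powr (p / (p - 1)) = b powr (p / (p - 1)) / (p * l) powr (1 / p * (p / (p - 1)))"
      using True r by (simp add: powr_divide r_def powr_powr)
    also have "1 / p * (p / (p - 1)) = 1 / (p - 1)" using p by simp
    finally show ?thesis by (simp add: powr_minus_divide)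
  qed
  finally show ?thesis using p True by (simp add: max_def mult_ac)
qed

lemma power_duality_eq:
  fixes p b l :: real
  assumes p: "1 < p" and l: "0 < l"
  defines "u \<equiv> (max 0 b / (p * l)) powr (1 / (p - 1))"
  shows "b * u = l * u powr p + (p - 1) / p * (p * l) powr (- 1 / (p - 1)) * max 0 b powr (p / (p - 1))"
proof (cases "0 < b")
  case False
  then show ?thesis by (simp add: u_def max_def)
next
  case True
  have pl: "0 < p * l" using p l by simp
  define v where "v = (p * l) powr (- 1 / (p - 1))"
  have uv: "u = b powr (1 / (p - 1)) * v"
    using True pl by (simp add: u_def max_def powr_divide v_def powr_minus_divide)
  have bu: "b * b powr (1 / (p - 1)) = b powr (p / (p - 1))"
  proof -
    have "p / (p - 1) = 1 + 1 / (p - 1)" using p by (simp add: field_simps)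
    then show ?thesis using True by (simp add: powr_add)
  qed
  have "p * l * v powr p = v"
  proof -
    have "v powr p = (p * l) powr (- p / (p - 1))" by (simp add: v_def powr_powr)
    also have "- p / (p - 1) = - 1 / (p - 1) - 1" using p by (simp add: field_simps)
    finally show ?thesis using pl by (simp add: powr_diff v_def)
  qed
  then have lv: "l * v powr p = v / p" using p by (simp add: field_simps)
  have "u powr p = b powr (p / (p - 1)) * v powr p"
    using True by (simp add: uv powr_mult powr_powr v_def)
  then have "l * u powr p = b powr (p / (p - 1)) * (l * v powr p)" by (simp add: mult_ac)
  also have "... = b powr (p / (p - 1)) * v / p" by (simp add: lv)
  finally have lu: "l * u powr p = b powr (p / (p - 1)) * v / p" .
  have "b * u = b powr (p / (p - 1)) * v" using bu by (simp add: uv flip: mult.assoc)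
  also have "... = b powr (p / (p - 1)) * v / p + (p - 1) / p * v * b powr (p / (p - 1))"
    using p by (simp add: field_simps)
  finally show ?thesis using True lu by (simp add: v_def max_def)
qed

definition scaling_exponent :: "'n::finite itself => real => real" where
  "scaling_exponent N p = 2 * (p - 1) / (real CARD('n) * (p - 1) + 2)"

text \<open>The minimiser of the local problem with multiplier a has mass mass_factor * t * a^{1/\<theta>}.\<close>

definition mass_factor :: "'n::finite itself => real => real" where
  "mass_factor N p = p powr (- 1 / (p - 1)) * radial_mass N (1 / (p - 1))"

text \<open>The multiplier for which the minimiser has mass one.\<close>

definition opt_level :: "'n::finite itself => real => real => real" where
  "opt_level N p t = (mass_factor N p * t) powr (- scaling_exponent N p)"

definition opt_profile :: "real => real => real => real ^ 'n ^ 'n => real ^ 'n => real" where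
  "opt_profile p c a A z = (max 0 (a - z \<bullet> (A *v z)) / (p * c powr (1 - p))) powr (1 / (p - 1))"

context
  fixes p :: real assumes p: "1 < p"
begin

lemma denominator_pos: "0 < real CARD('n::finite) * (p - 1) + 2"
  using p by (simp add: add_nonneg_pos)

lemma scaling_exponent_pos: "0 < scaling_exponent TYPE('n::finite) p"
  using p denominator_pos[where ?'n = 'n] by (simp add: scaling_exponent_def)

lemma mass_factor_pos: "0 < mass_factor TYPE('n::finite) p"
proof -
  have "- 1 < 1 / (p - 1)" using p by (smt (verit) divide_nonneg_nonneg)
  then show ?thesis using p radial_mass_pos[of "1 / (p - 1)", where ?'n = 'n] by (simp add: mass_factor_def)
qed

lemma opt_level_pos: "0 < t ==> 0 < opt_level TYPE('n::finite) p t"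
  using mass_factor_pos[where ?'n = 'n] by (simp add: opt_level_def)

lemma inverse_scaling_exponent:
  "1 / (p - 1) + real CARD('n) / 2 = 1 / scaling_exponent TYPE('n::finite) p"
  using p denominator_pos[where ?'n = 'n] unfolding scaling_exponent_def by (simp add: field_simps)

lemma opt_level_power:
  assumes "0 < t"
  shows "opt_level TYPE('n::finite) p t powr (1 / (p - 1) + real CARD('n) / 2) = 1 / (mass_factor TYPE('n) p * t)"
proof -
  let ?e = "scaling_exponent TYPE('n) p"
  have e: "- ?e * (1 / ?e) = - 1" using scaling_exponent_pos[where ?'n = 'n] by simp
  have "0 < mass_factor TYPE('n) p * t" using assms mass_factor_pos[where ?'n = 'n] by simp
  then show ?thesis
    unfolding inverse_scaling_exponent opt_level_def powr_powr e by (simp add: powr_minus_divide)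
qed

text \<open>The value of the local problem, by homogeneity a fixed fraction of the multiplier, in terms of
C_{d,p}.\<close>

lemma C_const_level:
  assumes "0 < t"
  shows "opt_level TYPE('n::finite) p t * (1 - 1 / (p / (p - 1) + real CARD('n) / 2))
    = C_const TYPE('n) p * t powr (- scaling_exponent TYPE('n) p)"
proof -
  let ?d = "real CARD('n)" and ?e = "scaling_exponent TYPE('n) p"
  let ?I = "radial_mass TYPE('n) (1 / (p - 1))"
  have d: "0 < ?d" by simp
  have den: "0 < ?d * (p - 1) + 2" by (rule denominator_pos)
  have den2: "0 < ?d * (p - 1) + 2 * p" using p d by (intro add_nonneg_pos) auto
  have p1: "1 / (p - 1) + 1 = p / (p - 1)" using p by (simp add: field_simps)
  have I: "0 < ?I"
  proof (rule radial_mass_pos)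
    have "0 < 1 / (p - 1)" using p by simp
    then show "- 1 < 1 / (p - 1)" by linarith
  qed
  have B: "B_const TYPE('n) p = p powr (?d / 2) * ?I"
    unfolding B_const_def radial_mass_def p1 by simp
  have "1 - 1 / (p / (p - 1) + ?d / 2) = (?d * (p - 1) + 2) / (?d * (p - 1) + 2 * p)"
  proof -
    have "p / (p - 1) + ?d / 2 = (?d * (p - 1) + 2 * p) / (2 * (p - 1))" using p by (simp add: field_simps)
    then have "1 - 1 / (p / (p - 1) + ?d / 2) = 1 - 2 * (p - 1) / (?d * (p - 1) + 2 * p)" by simp
    also have "... = (?d * (p - 1) + 2 * p - 2 * (p - 1)) / (?d * (p - 1) + 2 * p)"
      by (subst diff_divide_distrib) (use den2 in simp)
    also have "?d * (p - 1) + 2 * p - 2 * (p - 1) = ?d * (p - 1) + 2" by (simp add: algebra_simps)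
    finally show ?thesis .
  qed
  moreover have "mass_factor TYPE('n) p powr (- ?e) = p * B_const TYPE('n) p powr (- ?e)"
  proof -
    have "mass_factor TYPE('n) p powr (- ?e) = p powr (?e / (p - 1)) * ?I powr (- ?e)"
      using p I by (simp add: mass_factor_def powr_mult powr_powr)
    also have "?e / (p - 1) = 1 - ?d / 2 * ?e"
    proof -
      have e0: "?e = 2 / (?d * (p - 1) + 2) * (p - 1)" by (simp add: scaling_exponent_def)
      then have e: "?e / (p - 1) = 2 / (?d * (p - 1) + 2)"
        using p by (simp only: nonzero_mult_div_cancel_right)
      have "?d / 2 * (2 / X * Y) = ?d * Y / X" for X Y :: real by simp
      then have "?d / 2 * ?e = ?d * (p - 1) / (?d * (p - 1) + 2)" unfolding e0 .
      moreover have "1 - ?d * (p - 1) / (?d * (p - 1) + 2) = 2 / (?d * (p - 1) + 2)"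
        using den by (subst eq_divide_eq) (simp add: left_diff_distrib)
      ultimately show ?thesis using e by (simp only:)
    qed
    also have "p powr (1 - ?d / 2 * ?e) = p * (p powr (?d / 2)) powr (- ?e)"
      using p by (simp add: powr_diff powr_powr powr_minus_divide)
    finally show ?thesis using p I by (simp add: B powr_mult)
  qed
  moreover have "?e = 2 * (p - 1) / (?d * (p - 1) + 2)" by (simp add: scaling_exponent_def)
  moreover have "opt_level TYPE('n) p t = mass_factor TYPE('n) p powr (- ?e) * t powr (- ?e)"
    using assms mass_factor_pos[where ?'n = 'n] by (simp add: opt_level_def powr_mult)
  ultimately show ?thesis unfolding C_const_def Let_def by (simp add: mult_ac)
qed

context
  fixes A :: "real ^ 'n ^ 'n" and c t a :: real
  assumes A: "transpose A = A" "\<And>v. v \<noteq> 0 ==> 0 < v \<bullet> (A *v v)"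
    and c: "0 < c" and t_def: "t = c / sqrt (det A)" and a_def: "a = opt_level TYPE('n) p t"
begin

lemma t_pos: "0 < t" using c pos_def_det_pos[OF A] by (simp add: t_def)
lemma a_pos: "0 < a" unfolding a_def by (rule opt_level_pos[OF t_pos])

lemma quadratic_power:
  assumes "0 < q"
  shows "(\<integral>\<^sup>+z. ennreal (max 0 (a - z \<bullet> (A *v z)) powr q) \<partial>lborel)
    = ennreal (a powr (q + real CARD('n) / 2) / sqrt (det A) * radial_mass TYPE('n) q)"
  by (rule nn_integral_quadratic_power[OF A(1) _ a_pos assms]) (rule A(2))

lemma lagrange_factor: "(p * c powr (1 - p)) powr (- 1 / (p - 1)) = p powr (- 1 / (p - 1)) * c"
proof -
  have "(c powr (1 - p)) powr (- 1 / (p - 1)) = c powr ((1 - p) * (- 1 / (p - 1)))" by (rule powr_powr)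
  also have "(1 - p) * (- 1 / (p - 1)) = 1" using p by (simp add: field_simps)
  finally show ?thesis using p c by (simp add: powr_mult)
qed

lemma opt_profile_nonneg: "0 \<le> opt_profile p c a A z"
  by (simp add: opt_profile_def)

lemma opt_profile_measurable [measurable]: "opt_profile p c a A \<in> borel_measurable borel"
  unfolding opt_profile_def[abs_def] by measurable

lemma opt_profile_mass: "(\<integral>\<^sup>+z. ennreal (opt_profile p c a A z) \<partial>lborel) = 1"
proof -
  let ?q = "1 / (p - 1)"
  have q: "0 < ?q" using p by simp
  have apow: "a powr (?q + real CARD('n) / 2) = 1 / (mass_factor TYPE('n) p * t)"
    unfolding a_def by (rule opt_level_power[OF t_pos])
  have eq: "opt_profile p c a A z = p powr (- 1 / (p - 1)) * c * max 0 (a - z \<bullet> (A *v z)) powr ?q" for z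
  proof -
    have "opt_profile p c a A z = max 0 (a - z \<bullet> (A *v z)) powr ?q / (p * c powr (1 - p)) powr ?q"
      unfolding opt_profile_def by (rule powr_divide)
    also have "... = (p * c powr (1 - p)) powr (- 1 / (p - 1)) * max 0 (a - z \<bullet> (A *v z)) powr ?q"
      by (simp add: powr_minus_divide)
    finally show ?thesis unfolding lagrange_factor .
  qed
  have "(\<integral>\<^sup>+z. ennreal (opt_profile p c a A z) \<partial>lborel) =
      ennreal (p powr (- 1 / (p - 1)) * c) * (\<integral>\<^sup>+z. ennreal (max 0 (a - z \<bullet> (A *v z)) powr ?q) \<partial>lborel)"
    unfolding eq using c by (intro nn_integral_cmult_real) auto
  also have "... = ennreal (p powr (- 1 / (p - 1)) * c) *
      ennreal (1 / (mass_factor TYPE('n) p * t) / sqrt (det A) * radial_mass TYPE('n) ?q)"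
    by (simp only: quadratic_power[OF q] apow)
  also have "... = ennreal (p powr (- 1 / (p - 1)) * c * (1 / (mass_factor TYPE('n) p * t) / sqrt (det A) * radial_mass TYPE('n) ?q))"
    using c by (intro ennreal_mult'[symmetric]) simp
  also have "p powr (- 1 / (p - 1)) * c * (1 / (mass_factor TYPE('n) p * t) / sqrt (det A) * radial_mass TYPE('n) ?q) =
      (mass_factor TYPE('n) p * (c / sqrt (det A))) / (mass_factor TYPE('n) p * t)"
    by (simp add: mass_factor_def)
  also have "... = 1" using mass_factor_pos[where ?'n = 'n] t_pos by (simp flip: t_def)
  finally show ?thesis by simp
qed

lemma dual_integral:
  "(\<integral>\<^sup>+z. ennreal ((p - 1) / p * (p * c powr (1 - p)) powr (- 1 / (p - 1)) * max 0 (a - z \<bullet> (A *v z)) powr (p / (p - 1))) \<partial>lborel)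
    = ennreal (a / (p / (p - 1) + real CARD('n) / 2))"
proof -
  let ?q = "1 / (p - 1)" and ?q' = "p / (p - 1)" and ?d = "real CARD('n)"
  have q: "0 < ?q" "- 1 < ?q" "0 < ?q'" using p by (auto simp: less_divide_eq)
  have q': "?q + 1 = ?q'" using p by (simp add: field_simps)
  have dpos: "0 < ?q' + ?d / 2" using q by (simp add: add_pos_nonneg)
  have I': "radial_mass TYPE('n) ?q' = ?q' * radial_mass TYPE('n) ?q / (?q' + ?d / 2)"
    using radial_mass_Suc[OF q(2), where ?'n = 'n] dpos unfolding q'
    by (subst nonzero_eq_divide_eq) (auto simp: mult.commute)
  have "a powr (?q' + ?d / 2) = a * a powr (?q + ?d / 2)"
    using a_pos by (simp flip: q' add: powr_add)
  also have "... = a / (mass_factor TYPE('n) p * t)"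
    by (subst (2) a_def, subst opt_level_power[OF t_pos]) simp
  finally have apow: "a powr (?q' + ?d / 2) = a / (mass_factor TYPE('n) p * t)" .
  have "(\<integral>\<^sup>+z. ennreal ((p - 1) / p * (p * c powr (1 - p)) powr (- 1 / (p - 1)) * max 0 (a - z \<bullet> (A *v z)) powr ?q') \<partial>lborel)
     = ennreal ((p - 1) / p * (p powr (- 1 / (p - 1)) * c)) * (\<integral>\<^sup>+z. ennreal (max 0 (a - z \<bullet> (A *v z)) powr ?q') \<partial>lborel)"
    unfolding lagrange_factor using p c by (intro nn_integral_cmult_real) auto
  also have "... = ennreal ((p - 1) / p * (p powr (- 1 / (p - 1)) * c)) *
     ennreal (a / (mass_factor TYPE('n) p * t) / sqrt (det A) * radial_mass TYPE('n) ?q')"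
    by (simp only: quadratic_power[OF q(3)] apow)
  also have "... = ennreal ((p - 1) / p * (p powr (- 1 / (p - 1)) * c) * (a / (mass_factor TYPE('n) p * t) / sqrt (det A) * radial_mass TYPE('n) ?q'))"
    using p c by (intro ennreal_mult'[symmetric]) simp
  also have "(p - 1) / p * (p powr (- 1 / (p - 1)) * c) * (a / (mass_factor TYPE('n) p * t) / sqrt (det A) * radial_mass TYPE('n) ?q') =
     ((p - 1) / p * ?q') * (mass_factor TYPE('n) p * (c / sqrt (det A))) / (mass_factor TYPE('n) p * t) * (a / (?q' + ?d / 2))"
    by (simp add: I' mass_factor_def mult_ac)
  also have "... = a / (?q' + ?d / 2)"
    using mass_factor_pos[where ?'n = 'n] t_pos p by (simp flip: t_def)
  finally show ?thesis .
qed

text \<open>Equality in Young's inequality: the value is the multiplier times the mass minus the dual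
integral.\<close>

lemma opt_profile_value:
  "(\<integral>\<^sup>+z. ennreal ((z \<bullet> (A *v z)) * opt_profile p c a A z + c powr (1 - p) * opt_profile p c a A z powr p) \<partial>lborel)
    = ennreal (C_const TYPE('n) p * t powr (- scaling_exponent TYPE('n) p))"
proof -
  let ?U = "opt_profile p c a A" and ?Q = "\<lambda>z. z \<bullet> (A *v z)"
  let ?D = "\<lambda>z. (p - 1) / p * (p * c powr (1 - p)) powr (- 1 / (p - 1)) * max 0 (a - ?Q z) powr (p / (p - 1))"
  let ?V = "\<lambda>z. ?Q z * ?U z + c powr (1 - p) * ?U z powr p"
  have Q: "0 \<le> ?Q z" for z using A(2)[of z] by (cases "z = 0") auto
  have V: "0 \<le> ?V z" for z using Q opt_profile_nonneg by simp
  have D: "0 \<le> ?D z" for z using p by simp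
  have "a * ?U z = ?V z + ?D z" for z
  proof -
    have "(a - ?Q z) * ?U z = c powr (1 - p) * ?U z powr p + ?D z"
      unfolding opt_profile_def by (rule power_duality_eq) (use p c in auto)
    then show ?thesis by (simp add: algebra_simps)
  qed
  then have "(\<integral>\<^sup>+z. ennreal (a * ?U z) \<partial>lborel) = (\<integral>\<^sup>+z. ennreal (?V z) + ennreal (?D z) \<partial>lborel)"
    using V D by (intro nn_integral_cong) simp
  also have "... = (\<integral>\<^sup>+z. ennreal (?V z) \<partial>lborel) + (\<integral>\<^sup>+z. ennreal (?D z) \<partial>lborel)"
    by (intro nn_integral_add) auto
  also have "(\<integral>\<^sup>+z. ennreal (?D z) \<partial>lborel) = ennreal (a / (p / (p - 1) + real CARD('n) / 2))"
    by (rule dual_integral)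
  also have "(\<integral>\<^sup>+z. ennreal (a * ?U z) \<partial>lborel) = ennreal a * (\<integral>\<^sup>+z. ennreal (?U z) \<partial>lborel)"
    using a_pos by (subst nn_integral_cmult[symmetric]) (auto simp: ennreal_mult')
  finally have eq: "ennreal a = (\<integral>\<^sup>+z. ennreal (?V z) \<partial>lborel) + ennreal (a / (p / (p - 1) + real CARD('n) / 2))"
    by (simp add: opt_profile_mass)
  have "0 < p / (p - 1)" using p by simp
  then have "0 \<le> p / (p - 1) + real CARD('n) / 2" by (intro add_nonneg_nonneg) simp_all
  then have dpos: "0 \<le> a / (p / (p - 1) + real CARD('n) / 2)" 
    by (intro divide_nonneg_nonneg less_imp_le[OF a_pos]) simp
  have "(\<integral>\<^sup>+z. ennreal (?V z) \<partial>lborel) = ennreal a - ennreal (a / (p / (p - 1) + real CARD('n) / 2))"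
    unfolding eq by simp
  also have "... = ennreal (a - a / (p / (p - 1) + real CARD('n) / 2))"
    using dpos by (rule ennreal_minus)
  also have "a - a / (p / (p - 1) + real CARD('n) / 2) = C_const TYPE('n) p * t powr (- scaling_exponent TYPE('n) p)"
    unfolding C_const_level[OF t_pos, symmetric] a_def by (simp add: right_diff_distrib)
  finally show ?thesis .
qed

end

lemma C_const_pos: "0 < C_const TYPE('n::finite) p"
proof -
  have "0 < 1 - 1 / (p / (p - 1) + real CARD('n) / 2)"
  proof -
    have "1 < p / (p - 1)" using p by (simp add: less_divide_eq)
    moreover have "0 \<le> real CARD('n) / 2" by simp
    ultimately have "1 < p / (p - 1) + real CARD('n) / 2" by linarith
    then show ?thesis by simp
  qed
  then have "0 < opt_level TYPE('n) p 1 * (1 - 1 / (p / (p - 1) + real CARD('n) / 2))"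
    using opt_level_pos[of 1, where ?'n = 'n] by simp
  then show ?thesis using C_const_level[of 1, where ?'n = 'n] by simp
qed

end

section \<open>From couplings to self-couplings\<close>

text \<open>Second order Taylor expansion along the segment from x+\<delta> w to x.\<close>

lemma (in pinched_C2) bregman_scaled_limit:
  assumes "\<delta> \<longlonglongrightarrow> 0" and pos: "\<And>n. 0 < \<delta> n"
  shows "(\<lambda>n. 2 * bregman \<phi> x (x + \<delta> n *\<^sub>R w) / (\<delta> n)^2) \<longlonglongrightarrow> w \<bullet> (A x *v w)"
proof -
  have "\<exists>t\<in>{0<..<1}. 2 * bregman \<phi> x (x + \<delta> n *\<^sub>R w) / (\<delta> n)^2 = w \<bullet> (A (x + ((1 - t) * \<delta> n) *\<^sub>R w) *v w)" for n
  proof -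
    let ?y = "x + \<delta> n *\<^sub>R w"
    obtain t where t: "t \<in> {0<..<1}" "2 * bregman \<phi> x ?y = (x - ?y) \<bullet> (A (?y + t *\<^sub>R (x - ?y)) *v (x - ?y))"
      using bregman_mean_value[of x ?y] by auto
    have e1: "?y + t *\<^sub>R (x - ?y) = x + ((1 - t) * \<delta> n) *\<^sub>R w" by (simp add: algebra_simps)
    have e2: "x - ?y = (- \<delta> n) *\<^sub>R w" by simp
    have "2 * bregman \<phi> x ?y = (\<delta> n)^2 * (w \<bullet> (A (x + ((1 - t) * \<delta> n) *\<^sub>R w) *v w))"
      unfolding t(2) e1 unfolding e2 by (simp add: matrix_vector_mult_scaleR power2_eq_square del: scaleR_minus_left)
    then show ?thesis using t(1) pos[of n] by (intro bexI[of _ t]) auto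
  qed
  then obtain t where t: "\<And>n. t n \<in> {0<..<1}"
    "\<And>n. 2 * bregman \<phi> x (x + \<delta> n *\<^sub>R w) / (\<delta> n)^2 = w \<bullet> (A (x + ((1 - t n) * \<delta> n) *\<^sub>R w) *v w)"
    by metis
  have "(\<lambda>n. (1 - t n) * \<delta> n) \<longlonglongrightarrow> 0"
  proof (rule Lim_null_comparison[OF _ assms(1)], rule always_eventually, rule allI)
    fix n
    have "0 < t n" "t n < 1" using t(1)[of n] by auto
    then have "\<bar>1 - t n\<bar> * \<bar>\<delta> n\<bar> \<le> 1 * \<bar>\<delta> n\<bar>" by (intro mult_right_mono) auto
    then show "norm ((1 - t n) * \<delta> n) \<le> \<delta> n" using pos[of n] by (simp add: abs_mult)
  qed
  then have "(\<lambda>n. x + ((1 - t n) * \<delta> n) *\<^sub>R w) \<longlonglongrightarrow> x + 0 *\<^sub>R w" by (intro tendsto_intros)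
  then have lim: "(\<lambda>n. x + ((1 - t n) * \<delta> n) *\<^sub>R w) \<longlonglongrightarrow> x" by simp
  have "isCont (\<lambda>y. w \<bullet> (A y *v w)) x"
    using hessian_form_continuous[of UNIV w w] by (simp add: continuous_on_eq_continuous_at)
  from isCont_tendsto_compose[OF this lim] show ?thesis by (simp only: t(2))
qed

locale transport_setting = pinched_C2 \<phi> \<sigma>m \<sigma>M for \<phi> :: "real ^ 'n => real" and \<sigma>m \<sigma>M :: real +
  fixes \<mu> \<nu> :: "(real ^ 'n) measure" and p :: real
  assumes p: "1 < p"
    and \<mu>_ac: "\<mu> \<in> prob_moment_ac 2" and \<nu>_ac: "\<nu> \<in> prob_moment_ac 2"
    and push: "distr \<mu> borel (gradient \<phi>) = \<nu>"
begin

sublocale \<mu>: prob_space \<mu> using \<mu>_ac by (simp add: prob_moment_ac_def prob_moment_def)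
sublocale \<nu>: prob_space \<nu> using \<nu>_ac by (simp add: prob_moment_ac_def prob_moment_def)

lemma sets_\<mu> [simp, measurable_cong]: "sets \<mu> = sets borel"
  using \<mu>_ac by (simp add: prob_moment_ac_def prob_moment_def)
lemma sets_\<nu> [simp, measurable_cong]: "sets \<nu> = sets borel"
  using \<nu>_ac by (simp add: prob_moment_ac_def prob_moment_def)
lemma space_\<mu> [simp]: "space \<mu> = UNIV" using sets_eq_imp_space_eq[OF sets_\<mu>] by simp
lemma space_\<nu> [simp]: "space \<nu> = UNIV" using sets_eq_imp_space_eq[OF sets_\<nu>] by simp

abbreviation "f \<equiv> leb_density \<mu>"
abbreviation "g \<equiv> leb_density \<nu>"

lemma leb_density_nonneg: "0 \<le> leb_density M x"
  by (simp add: leb_density_def)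

lemma leb_density_measurable [measurable]: "leb_density M \<in> borel_measurable borel"
  unfolding leb_density_def[abs_def] by measurable

lemma density_leb_density:
  fixes M :: "(real ^ 'n) measure"
  assumes "prob_space M" "sets M = sets borel" "absolutely_continuous lborel M"
  shows "density lborel (\<lambda>x. ennreal (leb_density M x)) = M"
proof -
  interpret prob_space M by fact
  have "AE x in lborel. RN_deriv lborel M x \<noteq> \<infinity>"
    using assms by (intro sigma_finite_measure.RN_deriv_finite) (auto intro: sigma_finite_lborel sigma_finite_measure_axioms)
  then have "AE x in lborel. ennreal (leb_density M x) = RN_deriv lborel M x"
    by eventually_elim (simp add: leb_density_def less_top)
  then have "density lborel (\<lambda>x. ennreal (leb_density M x)) = density lborel (RN_deriv lborel M)"
    by (intro density_cong) auto
  also have "... = M"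
    using assms by (intro sigma_finite_measure.density_RN_deriv) (auto intro: sigma_finite_lborel)
  finally show ?thesis .
qed

lemma \<mu>_density: "density lborel (\<lambda>x. ennreal (f x)) = \<mu>"
  using \<mu>_ac by (intro density_leb_density) (auto simp: prob_moment_ac_def prob_moment_def)
lemma \<nu>_density: "density lborel (\<lambda>x. ennreal (g x)) = \<nu>"
  using \<nu>_ac by (intro density_leb_density) (auto simp: prob_moment_ac_def prob_moment_def)

lemma nn_integral_\<mu>: "h \<in> borel_measurable borel ==> (\<integral>\<^sup>+x. h x \<partial>\<mu>) = (\<integral>\<^sup>+x. ennreal (f x) * h x \<partial>lborel)"
  by (subst \<mu>_density[symmetric], subst nn_integral_density) auto

lemma nn_integral_\<nu>: "h \<in> borel_measurable borel ==> (\<integral>\<^sup>+y. h y \<partial>\<nu>) = (\<integral>\<^sup>+x. h (T x) \<partial>\<mu>)"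
  by (subst push[symmetric], subst nn_integral_distr) auto

lemma AE_\<mu>I: "(AE x in lborel. 0 < f x --> P x) ==> AE x in \<mu>. P x"
  by (subst \<mu>_density[symmetric], subst AE_density) (auto simp: ennreal_less_zero_iff)

lemma density_positive_AE: "AE x in \<mu>. 0 < f x"
  by (rule AE_\<mu>I) simp

lemma density_integrable: "(\<integral>\<^sup>+x. ennreal (f x) \<partial>lborel) < \<infinity>"
  using nn_integral_\<mu>[of "\<lambda>_. 1"] \<mu>.emeasure_space_1 by simp

text \<open>Two densities of the same measure: change of variables in the push-forward condition.\<close>

lemma monge_ampere: "AE x in lborel. f x = g (T x) * det (A x)"
proof -
  have "density lborel (\<lambda>x. ennreal (f x)) = density lborel (\<lambda>x. ennreal (g (T x) * det (A x)))"
  proof (rule measure_eqI)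
    fix B assume "B \<in> sets (density lborel (\<lambda>x. ennreal (f x)))"
    then have B [measurable]: "B \<in> sets borel" by simp
    have "emeasure (density lborel (\<lambda>x. ennreal (f x))) B = (\<integral>\<^sup>+x. indicator B (S (T x)) \<partial>\<mu>)"
      by (simp add: \<mu>_density)
    also have "... = (\<integral>\<^sup>+y. indicator B (S y) \<partial>\<nu>)"
      by (rule nn_integral_\<nu>[symmetric]) measurable
    also have "... = (\<integral>\<^sup>+y. ennreal (g y) * indicator B (S y) \<partial>lborel)"
      by (subst \<nu>_density[symmetric], subst nn_integral_density) auto
    also have "... = (\<integral>\<^sup>+x. ennreal \<bar>det (A x)\<bar> * (ennreal (g (T x)) * indicator B (S (T x))) \<partial>lborel)"
      by (rule nn_integral_change_of_variables[OF gradient_has_derivative inj_gradient surj_gradient]) measurable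
    also have "... = (\<integral>\<^sup>+x. ennreal (g (T x) * det (A x)) * indicator B x \<partial>lborel)"
    proof (rule nn_integral_cong)
      fix x
      have "ennreal (g (T x) * det (A x)) = ennreal (g (T x)) * ennreal (det (A x))"
        by (rule ennreal_mult[OF leb_density_nonneg less_imp_le[OF det_hessian_pos]])
      moreover have "\<bar>det (A x)\<bar> = det (A x)" using det_hessian_pos[of x] by simp
      ultimately show "ennreal \<bar>det (A x)\<bar> * (ennreal (g (T x)) * indicator B (S (T x))) =
          ennreal (g (T x) * det (A x)) * indicator B x" by (simp add: mult_ac)
    qed
    also have "... = emeasure (density lborel (\<lambda>x. ennreal (g (T x) * det (A x)))) B"
      by (simp add: emeasure_density)
    finally show "emeasure (density lborel (\<lambda>x. ennreal (f x))) B = emeasure (density lborel (\<lambda>x. ennreal (g (T x) * det (A x)))) B" .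
  qed simp
  then have "AE x in lborel. ennreal (f x) = ennreal (g (T x) * det (A x))"
    by (subst (asm) sigma_finite_measure.density_unique_iff[OF sigma_finite_lborel]) auto
  then show ?thesis
  proof eventually_elim
    case (elim x)
    then show ?case
      by (subst (asm) ennreal_inj)
        (auto intro!: mult_nonneg_nonneg leb_density_nonneg less_imp_le[OF det_hessian_pos])
  qed
qed

text \<open>The geometric mean of f_\<mu>(x) and f_\<nu>(T(x)), by the Monge-Ampere equation.\<close>

definition "geo x = f x / sqrt (det (A x))"

lemma geo_measurable [measurable]: "geo \<in> borel_measurable borel"
  unfolding geo_def[abs_def] by measurable

lemma geo_pos: "0 < f x ==> 0 < geo x"
  using det_hessian_pos by (simp add: geo_def)

lemma K_fun_geo: "K_fun \<mu> \<nu> \<phi> p = (\<integral>\<^sup>+x. ennreal (geo x powr (- scaling_exponent TYPE('n) p)) \<partial>\<mu>)"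
  unfolding K_fun_def
proof (rule nn_integral_cong_AE, rule AE_\<mu>I)
  let ?\<theta> = "(p - 1) / (real CARD('n) * (p - 1) + 2)"
  show "AE x in lborel. 0 < f x --> inverse (ennreal ((g (T x) * f x) powr ?\<theta>)) =
     ennreal (geo x powr (- scaling_exponent TYPE('n) p))"
    using monge_ampere
  proof eventually_elim
    case (elim x)
    show ?case
    proof
    assume fx: "0 < f x"
    have d: "0 < det (A x)" by (rule det_hessian_pos)
    have "(geo x)^2 = f x * f x / det (A x)"
      using d by (simp add: geo_def power_divide power2_eq_square)
    also have "... = g (T x) * f x" using d elim by simp
    finally have "g (T x) * f x = geo x powr 2"
      using geo_pos[OF fx] by (simp only: powr_numeral)
    then have "(g (T x) * f x) powr ?\<theta> = geo x powr scaling_exponent TYPE('n) p"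
      by (simp add: powr_powr scaling_exponent_def)
    then show "inverse (ennreal ((g (T x) * f x) powr ?\<theta>)) = ennreal (geo x powr (- scaling_exponent TYPE('n) p))"
      using geo_pos[OF fx] by (simp add: inverse_ennreal powr_minus)
    qed
  qed
qed

definition "\<alpha>pot x = (norm x)^2 - 2 * \<phi> x"
definition "\<beta>pot y = (norm y)^2 - 2 * (S y \<bullet> y - \<phi> (S y))"

text \<open>Complete the square with y=T(S(y)). The two potentials are, up to the quadratic terms, the Kantorovich
potentials -2\<phi> and -2\<phi>^*.\<close>

lemma cost_split: "(norm (x - y))^2 = 2 * bregman \<phi> x (S y) + \<alpha>pot x + \<beta>pot y"
  by (simp add: \<alpha>pot_def \<beta>pot_def bregman_def power2_norm_eq_inner inner_diff inner_commute algebra_simps)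

lemma \<alpha>pot_measurable [measurable]: "\<alpha>pot \<in> borel_measurable borel"
  unfolding \<alpha>pot_def[abs_def] by measurable
lemma \<beta>pot_measurable [measurable]: "\<beta>pot \<in> borel_measurable borel"
  unfolding \<beta>pot_def[abs_def] by measurable

lemma second_moment:
  assumes "M \<in> prob_moment_ac 2"
  shows "integrable M (\<lambda>x. (norm (x :: real ^ 'n))^2)"
proof (rule integrableI_bounded)
  have s: "sets M = sets borel" using assms by (simp add: prob_moment_ac_def prob_moment_def)
  then show "(\<lambda>x. (norm x)^2) \<in> borel_measurable M" by (simp cong: measurable_cong_sets)
  have "(\<integral>\<^sup>+x. ennreal (norm ((norm x)^2)) \<partial>M) = (\<integral>\<^sup>+x. ennreal (norm x powr 2) \<partial>M)"
    by (intro nn_integral_cong) (simp add: powr_numeral)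
  then show "(\<integral>\<^sup>+x. ennreal (norm ((norm x)^2)) \<partial>M) < \<infinity>"
    using assms by (simp add: prob_moment_ac_def prob_moment_def)
qed

lemma integrable_norm: "integrable \<mu> (\<lambda>x. norm x)"
proof (rule Bochner_Integration.integrable_bound[of _ "\<lambda>x. 1 + (norm x)^2"])
  show "integrable \<mu> (\<lambda>x. 1 + (norm x)^2)" using second_moment[OF \<mu>_ac] by simp
  have "norm x \<le> 1 + (norm x)^2" for x :: "real ^ 'n"
    using zero_le_power2[of "norm x - 1"] by (simp add: power2_diff) (smt (verit) norm_ge_zero)
  then show "AE x in \<mu>. norm (norm x) \<le> norm (1 + (norm x)^2)" by (simp add: abs_of_nonneg)
qed simp

lemma integrable_\<phi>: "integrable \<mu> \<phi>"
proof (rule Bochner_Integration.integrable_bound[of _ "\<lambda>x. \<sigma>M * (norm x)^2 + \<bar>\<phi> 0\<bar> + norm (T 0) * norm x"])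
  show "integrable \<mu> (\<lambda>x. \<sigma>M * (norm x)^2 + \<bar>\<phi> 0\<bar> + norm (T 0) * norm x)"
    using second_moment[OF \<mu>_ac] integrable_norm by simp
  have "\<bar>\<phi> x\<bar> \<le> \<sigma>M * (norm x)^2 + \<bar>\<phi> 0\<bar> + norm (T 0) * norm x" for x
  proof -
    have "\<phi> x = bregman \<phi> x 0 + \<phi> 0 + T 0 \<bullet> x" by (simp add: bregman_def)
    moreover have "bregman \<phi> x 0 \<le> \<sigma>M * (norm x)^2" "0 \<le> bregman \<phi> x 0"
      using bregman_le[of x 0] bregman_nonneg[of x 0] by auto
    moreover have "\<bar>T 0 \<bullet> x\<bar> \<le> norm (T 0) * norm x" by (rule Cauchy_Schwarz_ineq2)
    ultimately show ?thesis by linarith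
  qed
  then show "AE x in \<mu>. norm (\<phi> x) \<le> norm (\<sigma>M * (norm x)^2 + \<bar>\<phi> 0\<bar> + norm (T 0) * norm x)"
    by (intro AE_I2) (smt (verit) real_norm_def)
qed simp

lemma integrable_\<alpha>pot: "integrable \<mu> \<alpha>pot"
  unfolding \<alpha>pot_def[abs_def] using second_moment[OF \<mu>_ac] integrable_\<phi> by simp

lemma norm_diff_square_le: "(norm (x - y))^2 \<le> 2 * (norm x)^2 + 2 * (norm (y :: real ^ 'n))^2"
proof -
  have "(norm (x - y))^2 \<le> (norm x + norm y)^2" by (intro power_mono norm_triangle_ineq4) simp
  also have "... \<le> 2 * (norm x)^2 + 2 * (norm y)^2"
    using zero_le_power2[of "norm x - norm y"] by (simp add: power2_sum power2_diff)
  finally show ?thesis .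
qed

lemma integrable_map_cost: "integrable \<mu> (\<lambda>x. (norm (x - T x))^2)"
proof (rule Bochner_Integration.integrable_bound[of _ "\<lambda>x. 2 * (norm x)^2 + 2 * (norm (T x))^2"])
  have "integrable (distr \<mu> borel T) (\<lambda>y. (norm y)^2)" using second_moment[OF \<nu>_ac] push by simp
  then have "integrable \<mu> (\<lambda>x. (norm (T x))^2)" by (rule integrable_distr[rotated]) simp
  then show "integrable \<mu> (\<lambda>x. 2 * (norm x)^2 + 2 * (norm (T x))^2)" using second_moment[OF \<mu>_ac] by simp
  show "AE x in \<mu>. norm ((norm (x - T x))^2) \<le> norm (2 * (norm x)^2 + 2 * (norm (T x))^2)"
    using norm_diff_square_le by simp
qed simp

lemma bregman_self [simp]: "bregman \<phi> x x = 0" by (simp add: bregman_def)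

lemma integrable_\<beta>pot: "integrable \<nu> \<beta>pot"
proof -
  have "\<beta>pot (T x) = (norm (x - T x))^2 - \<alpha>pot x" for x using cost_split[of x "T x"] by simp
  then have "integrable \<mu> (\<lambda>x. \<beta>pot (T x))" using integrable_map_cost integrable_\<alpha>pot by simp
  then show ?thesis by (subst push[symmetric], subst integrable_distr_eq) auto
qed

text \<open>The part of the cost that depends on the marginals only; it will turn out to be the optimal cost.\<close>

definition "base_cost = (\<integral>x. \<alpha>pot x \<partial>\<mu>) + (\<integral>y. \<beta>pot y \<partial>\<nu>)"

lemma base_cost_eq: "base_cost = (\<integral>x. (norm (x - T x))^2 \<partial>\<mu>)"
proof -
  have "\<beta>pot (T x) = (norm (x - T x))^2 - \<alpha>pot x" for x using cost_split[of x "T x"] by simp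
  then have "(\<integral>y. \<beta>pot y \<partial>\<nu>) = (\<integral>x. (norm (x - T x))^2 \<partial>\<mu>) - (\<integral>x. \<alpha>pot x \<partial>\<mu>)"
    using integrable_map_cost integrable_\<alpha>pot
    by (subst push[symmetric], subst integral_distr) auto
  then show ?thesis by (simp add: base_cost_def)
qed

lemma base_cost_nonneg: "0 \<le> base_cost" by (simp add: base_cost_eq)

lemma bregman_inverse_measurable [measurable]:
  "(\<lambda>z. bregman \<phi> (fst z) (S (snd z))) \<in> borel_measurable borel"
proof -
  have m: "(\<lambda>z :: (real ^ 'n) \<times> (real ^ 'n). (fst z, S (snd z))) \<in> borel_measurable borel"
    by (intro borel_measurable_continuous_onI continuous_intros continuous_on_compose2[OF continuous_on_inv_gradient]) auto
  show ?thesis using measurable_compose[OF m bregman_measurable] by simp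
qed

lemma couplingD:
  assumes "\<pi> \<in> couplings \<mu> \<nu>"
  shows "prob_space \<pi>" "sets \<pi> = sets borel" "distr \<pi> borel fst = \<mu>" "distr \<pi> borel snd = \<nu>"
  using assms by (auto simp: couplings_def)

text \<open>The potentials are integrable by the second moments, so their integrals split off and depend on the
marginals only.\<close>

lemma transport_cost_split:
  assumes \<pi>: "\<pi> \<in> couplings \<mu> \<nu>"
  shows "transport_cost \<pi> = ennreal base_cost + (\<integral>\<^sup>+z. ennreal (2 * bregman \<phi> (fst z) (S (snd z))) \<partial>\<pi>)"
proof -
  note [simp, measurable_cong] = couplingD(2)[OF \<pi>]
  have [measurable]: "fst \<in> borel_measurable \<pi>" "snd \<in> borel_measurable \<pi>"
    by (simp_all cong: measurable_cong_sets flip: borel_prod)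
  have i1: "integrable \<pi> (\<lambda>z. h (fst z))" and e1: "(\<integral>z. h (fst z) \<partial>\<pi>) = (\<integral>x. h x \<partial>\<mu>)"
    if "integrable \<mu> h" "h \<in> borel_measurable borel" for h :: "real ^ 'n => real"
  proof -
    show "integrable \<pi> (\<lambda>z. h (fst z))"
      using that(1) by (subst (asm) couplingD(3)[OF \<pi>, symmetric], subst (asm) integrable_distr_eq) (use that(2) in auto)
    show "(\<integral>z. h (fst z) \<partial>\<pi>) = (\<integral>x. h x \<partial>\<mu>)"
      by (subst couplingD(3)[OF \<pi>, symmetric], subst integral_distr) (use that(2) in auto)
  qed
  have i2: "integrable \<pi> (\<lambda>z. h (snd z))" and e2: "(\<integral>z. h (snd z) \<partial>\<pi>) = (\<integral>x. h x \<partial>\<nu>)"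
    if "integrable \<nu> h" "h \<in> borel_measurable borel" for h :: "real ^ 'n => real"
  proof -
    show "integrable \<pi> (\<lambda>z. h (snd z))"
      using that(1) by (subst (asm) couplingD(4)[OF \<pi>, symmetric], subst (asm) integrable_distr_eq) (use that(2) in auto)
    show "(\<integral>z. h (snd z) \<partial>\<pi>) = (\<integral>x. h x \<partial>\<nu>)"
      by (subst couplingD(4)[OF \<pi>, symmetric], subst integral_distr) (use that(2) in auto)
  qed
  let ?c = "\<lambda>z :: (real ^ 'n) \<times> (real ^ 'n). (norm (fst z - snd z))^2"
  let ?b = "\<lambda>z :: (real ^ 'n) \<times> (real ^ 'n). 2 * bregman \<phi> (fst z) (S (snd z))"
  have ic: "integrable \<pi> ?c"
  proof (rule Bochner_Integration.integrable_bound[of _ "\<lambda>z. 2 * (norm (fst z))^2 + 2 * (norm (snd z))^2"])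
    show "integrable \<pi> (\<lambda>z. 2 * (norm (fst z))^2 + 2 * (norm (snd z))^2)"
      using i1[OF second_moment[OF \<mu>_ac]] i2[OF second_moment[OF \<nu>_ac]] by simp
    show "AE z in \<pi>. norm (?c z) \<le> norm (2 * (norm (fst z))^2 + 2 * (norm (snd z))^2)"
      using norm_diff_square_le by simp
  qed simp
  have b: "?b z = ?c z - \<alpha>pot (fst z) - \<beta>pot (snd z)" for z using cost_split[of "fst z" "snd z"] by simp
  have ib: "integrable \<pi> ?b"
    unfolding b using ic i1[OF integrable_\<alpha>pot] i2[OF integrable_\<beta>pot] by simp
  have bn: "0 \<le> ?b z" for z using bregman_nonneg by simp
  have "(\<integral>z. ?b z \<partial>\<pi>) = (\<integral>z. ?c z \<partial>\<pi>) - base_cost"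
    unfolding b base_cost_def using ic i1[OF integrable_\<alpha>pot] i2[OF integrable_\<beta>pot]
      e1[OF integrable_\<alpha>pot] e2[OF integrable_\<beta>pot] by simp
  then have "(\<integral>z. ?c z \<partial>\<pi>) = base_cost + (\<integral>z. ?b z \<partial>\<pi>)" by simp
  moreover have "transport_cost \<pi> = ennreal (\<integral>z. ?c z \<partial>\<pi>)"
    unfolding transport_cost_def using ic by (intro nn_integral_eq_integral) auto
  moreover have "(\<integral>\<^sup>+z. ennreal (?b z) \<partial>\<pi>) = ennreal (\<integral>z. ?b z \<partial>\<pi>)"
    using ib bn by (intro nn_integral_eq_integral) auto
  moreover have "0 \<le> (\<integral>z. ?b z \<partial>\<pi>)" using bn by (intro integral_nonneg_AE) auto
  ultimately show ?thesis using base_cost_nonneg by (simp add: ennreal_plus)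
qed

text \<open>The excess is nonnegative, and zero for the coupling carried by the graph of T.\<close>

lemma OT_eq: "OT \<mu> \<nu> = ennreal base_cost"
proof (rule antisym)
  show "ennreal base_cost \<le> OT \<mu> \<nu>"
    unfolding OT_def by (rule INF_greatest) (simp add: transport_cost_split)
  let ?\<pi> = "distr \<mu> borel (\<lambda>x. (x, T x))"
  have [measurable]: "(\<lambda>x. (x, T x)) \<in> borel_measurable borel"
    by (intro borel_measurable_continuous_onI continuous_intros continuous_on_gradient)
  have [measurable]: "(fst :: (real ^ 'n) \<times> (real ^ 'n) => _) \<in> borel_measurable borel"
     "(snd :: (real ^ 'n) \<times> (real ^ 'n) => _) \<in> borel_measurable borel"
    by (simp_all cong: measurable_cong_sets flip: borel_prod)
  have "distr ?\<pi> borel fst = distr \<mu> borel (\<lambda>x. x)" by (subst distr_distr) (auto simp: comp_def)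
  also have "... = \<mu>" by (rule distr_id2) simp
  finally have 1: "distr ?\<pi> borel fst = \<mu>" .
  have 2: "distr ?\<pi> borel snd = \<nu>" by (subst distr_distr) (auto simp: comp_def push)
  have \<pi>: "?\<pi> \<in> couplings \<mu> \<nu>"
    unfolding couplings_def using 1 2 by (auto intro: \<mu>.prob_space_distr)
  have "OT \<mu> \<nu> \<le> transport_cost ?\<pi>" unfolding OT_def by (rule INF_lower[OF \<pi>])
  also have "... = ennreal base_cost + (\<integral>\<^sup>+x. ennreal (2 * bregman \<phi> x (S (T x))) \<partial>\<mu>)"
    by (subst transport_cost_split[OF \<pi>], subst nn_integral_distr) auto
  also have "... = ennreal base_cost" by simp
  finally show "OT \<mu> \<nu> \<le> ennreal base_cost" .
qed

end

section \<open>The lower bound by duality\<close>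

context transport_setting
begin

lemma bregman_measurable_compose [measurable]:
  assumes "u \<in> borel_measurable M" "v \<in> borel_measurable M"
  shows "(\<lambda>z. bregman \<phi> (u z) (v z)) \<in> borel_measurable M"
proof -
  have "(\<lambda>z. (u z, v z)) \<in> borel_measurable M" using assms by (rule borel_measurable_Pair)
  from measurable_compose[OF this bregman_measurable] show ?thesis by simp
qed

definition dual_factor :: "real => real" where
  "dual_factor \<epsilon> = (p - 1) / p * (p * \<epsilon>) powr (- 1 / (p - 1))"

lemma dual_factor_nonneg: "0 \<le> dual_factor \<epsilon>" using p by (simp add: dual_factor_def)

definition dual_integrand :: "real => real => real ^ 'n => real ^ 'n => real" where
  "dual_integrand \<epsilon> a x y = dual_factor \<epsilon> * max 0 (a - 2 * bregman \<phi> x y) powr (p / (p - 1))"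

lemma dual_integrand_nonneg: "0 \<le> dual_integrand \<epsilon> a x y"
  using dual_factor_nonneg by (simp add: dual_integrand_def)

lemma dual_integrand_measurable [measurable]:
  assumes [measurable]: "a \<in> borel_measurable M" "u \<in> borel_measurable M" "v \<in> borel_measurable M"
  shows "(\<lambda>z. dual_integrand \<epsilon> (a z) (u z) (v z)) \<in> borel_measurable M"
  unfolding dual_integrand_def by measurable

text \<open>Young's inequality pointwise in y; since u has mass one, the multiplier a is integrated to itself.
Truncated subtraction keeps the bound valid when the dual integral is large.\<close>

lemma conditional_cost_ge:
  assumes [measurable]: "u \<in> borel_measurable borel" and u: "\<And>y. 0 \<le> u y" "(\<integral>\<^sup>+y. ennreal (u y) \<partial>\<nu>) = 1"
    and "0 < \<epsilon>" "0 \<le> a"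
  shows "ennreal a - (\<integral>\<^sup>+y. ennreal (dual_integrand \<epsilon> a x y) \<partial>\<mu>) \<le>
    (\<integral>\<^sup>+y. ennreal (2 * bregman \<phi> x (S y) * u y + \<epsilon> * u y powr p) \<partial>\<nu>)"
proof -
  have pw: "a * u y \<le> (2 * bregman \<phi> x (S y) * u y + \<epsilon> * u y powr p) + dual_integrand \<epsilon> a x (S y)" for y
    using power_duality[OF p \<open>0 < \<epsilon>\<close> u(1)[of y], of "a - 2 * bregman \<phi> x (S y)"]
    unfolding dual_integrand_def dual_factor_def left_diff_distrib by linarith
  have pos: "0 \<le> 2 * bregman \<phi> x (S y) * u y + \<epsilon> * u y powr p" for y
    using bregman_nonneg u(1) \<open>0 < \<epsilon>\<close> by simp
  have "ennreal a = (\<integral>\<^sup>+y. ennreal (a * u y) \<partial>\<nu>)"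
    using nn_integral_cmult_real[OF \<open>0 \<le> a\<close>, of u \<nu>] u(2) by simp
  also have "... \<le> (\<integral>\<^sup>+y. ennreal (2 * bregman \<phi> x (S y) * u y + \<epsilon> * u y powr p) + ennreal (dual_integrand \<epsilon> a x (S y)) \<partial>\<nu>)"
    using pw pos dual_integrand_nonneg by (intro nn_integral_mono) (simp flip: ennreal_plus add: ennreal_leI)
  also have "... = (\<integral>\<^sup>+y. ennreal (2 * bregman \<phi> x (S y) * u y + \<epsilon> * u y powr p) \<partial>\<nu>) + (\<integral>\<^sup>+y. ennreal (dual_integrand \<epsilon> a x (S y)) \<partial>\<nu>)"
    by (rule nn_integral_add) measurable
  also have "(\<integral>\<^sup>+y. ennreal (dual_integrand \<epsilon> a x (S y)) \<partial>\<nu>) = (\<integral>\<^sup>+y. ennreal (dual_integrand \<epsilon> a x y) \<partial>\<mu>)"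
  proof -
    have "(\<lambda>y. ennreal (dual_integrand \<epsilon> a x (S y))) \<in> borel_measurable borel" by measurable
    then show ?thesis by (simp add: nn_integral_\<nu>)
  qed
  finally show ?thesis by (simp add: ennreal_minus_le_iff add.commute)
qed

lemma fst_borel_measurable [measurable]: "(fst :: (real ^ 'n) \<times> (real ^ 'n) => _) \<in> borel_measurable borel"
  by (intro borel_measurable_continuous_onI continuous_intros)

lemma snd_borel_measurable [measurable]: "(snd :: (real ^ 'n) \<times> (real ^ 'n) => _) \<in> borel_measurable borel"
  by (intro borel_measurable_continuous_onI continuous_intros)

lemma sets_product: "sets (\<mu> \<Otimes>\<^sub>M \<nu>) = sets borel"
  unfolding borel_prod[symmetric] by (rule sets_pair_measure_cong[OF sets_\<mu> sets_\<nu>])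

text \<open>The bound for conditional laws is integrated over the first marginal.\<close>

lemma coupling_value_ge:
  assumes \<pi>: "\<pi> \<in> couplings \<mu> \<nu>" and \<epsilon>: "0 < \<epsilon>"
    and a [measurable]: "a \<in> borel_measurable borel" and a0: "\<And>x. 0 \<le> a x"
  shows "ennreal base_cost + (\<integral>\<^sup>+x. ennreal (a x) - (\<integral>\<^sup>+y. ennreal (dual_integrand \<epsilon> (a x) x y) \<partial>\<mu>) \<partial>\<mu>)
    \<le> transport_cost \<pi> + ennreal \<epsilon> * Lp_penalty p (\<mu> \<Otimes>\<^sub>M \<nu>) \<pi>"
proof (cases "absolutely_continuous (\<mu> \<Otimes>\<^sub>M \<nu>) \<pi>")
  case False
  then show ?thesis using \<epsilon> by (simp add: Lp_penalty_def ennreal_mult_top)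
next
  case True
  interpret P: pair_prob_space \<mu> \<nu> ..
  interpret \<pi>: prob_space \<pi> by (rule couplingD(1)[OF \<pi>])
  note [measurable_cong] = couplingD(2)[OF \<pi>]
  let ?R = "\<mu> \<Otimes>\<^sub>M \<nu>"
  have s\<pi>: "sets \<pi> = sets ?R" by (simp only: couplingD(2)[OF \<pi>] sets_product)
  define u where "u z = enn2real (RN_deriv ?R \<pi> z)" for z
  have u0: "0 \<le> u z" for z by (simp add: u_def)
  have um [measurable]: "u \<in> borel_measurable borel"
    unfolding u_def[abs_def] by (subst measurable_cong_sets[OF sets_product[symmetric] refl]) measurable
  have um' [measurable]: "u \<in> borel_measurable (\<mu> \<Otimes>\<^sub>M \<nu>)"
    by (subst measurable_cong_sets[OF sets_product refl]) (rule um)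
  have um'' [measurable]: "u \<in> borel_measurable (borel \<Otimes>\<^sub>M borel)"
    by (subst borel_prod) (rule um)
  have "AE z in ?R. RN_deriv ?R \<pi> z \<noteq> \<infinity>"
    by (rule P.RN_deriv_finite[OF \<pi>.sigma_finite_measure_axioms True s\<pi>])
  then have ue: "AE z in ?R. ennreal (u z) = RN_deriv ?R \<pi> z"
    by eventually_elim (simp add: u_def less_top)
  have "density ?R (\<lambda>z. ennreal (u z)) = density ?R (RN_deriv ?R \<pi>)"
    using ue by (intro density_cong) measurable
  also have "... = \<pi>" by (rule P.density_RN_deriv[OF True s\<pi>])
  finally have \<pi>_eq: "density ?R (\<lambda>z. ennreal (u z)) = \<pi>" .
  have int\<pi>: "(\<integral>\<^sup>+z. ennreal (h z) \<partial>\<pi>) = (\<integral>\<^sup>+x. \<integral>\<^sup>+y. ennreal (h (x, y) * u (x, y)) \<partial>\<nu> \<partial>\<mu>)"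
    if h [measurable]: "h \<in> borel_measurable borel" and h0: "\<And>z. 0 \<le> h z" for h
  proof -
    have [measurable]: "h \<in> borel_measurable (\<mu> \<Otimes>\<^sub>M \<nu>)"
      by (subst measurable_cong_sets[OF sets_product refl]) (rule h)
    have "(\<integral>\<^sup>+z. ennreal (h z) \<partial>\<pi>) = (\<integral>\<^sup>+z. ennreal (u z) * ennreal (h z) \<partial>?R)"
      by (subst \<pi>_eq[symmetric], rule nn_integral_density) measurable
    also have "... = (\<integral>\<^sup>+z. ennreal (h z * u z) \<partial>?R)"
      using u0 h0 by (intro nn_integral_cong) (simp add: ennreal_mult mult.commute)
    also have "... = (\<integral>\<^sup>+x. \<integral>\<^sup>+y. ennreal (h (x, y) * u (x, y)) \<partial>\<nu> \<partial>\<mu>)"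
      by (rule \<nu>.nn_integral_fst[symmetric]) measurable
    finally show ?thesis .
  qed
  have marg: "AE x in \<mu>. (\<integral>\<^sup>+y. ennreal (u (x, y)) \<partial>\<nu>) = 1"
  proof -
    have [measurable]: "(\<lambda>x. \<integral>\<^sup>+y. ennreal (u (x, y)) \<partial>\<nu>) \<in> borel_measurable \<mu>" by measurable
    have "density \<mu> (\<lambda>x. \<integral>\<^sup>+y. ennreal (u (x, y)) \<partial>\<nu>) = density \<mu> (\<lambda>_. 1)"
    proof (rule measure_eqI)
      fix B assume "B \<in> sets (density \<mu> (\<lambda>x. \<integral>\<^sup>+y. ennreal (u (x, y)) \<partial>\<nu>))"
      then have B [measurable]: "B \<in> sets borel" by simp
      have fB: "fst -` B \<in> sets (borel :: ((real ^ 'n) \<times> (real ^ 'n)) measure)"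
        by (rule measurable_sets_borel[OF fst_borel_measurable B])
      have sp: "space \<pi> = UNIV" using sets_eq_imp_space_eq[OF couplingD(2)[OF \<pi>]] by simp
      have fm: "fst \<in> \<pi> \<rightarrow>\<^sub>M borel"
        by (subst measurable_cong_sets[OF couplingD(2)[OF \<pi>] refl]) (rule fst_borel_measurable)
      have "emeasure \<mu> B = emeasure \<pi> (fst -` B)"
        unfolding couplingD(3)[OF \<pi>, symmetric] emeasure_distr[OF fm B] sp by simp
      also have "... = (\<integral>\<^sup>+z. ennreal (indicator (fst -` B) z) \<partial>\<pi>)"
        unfolding ennreal_indicator using fB by (intro nn_integral_indicator[symmetric]) (simp add: couplingD(2)[OF \<pi>])
      also have "... = (\<integral>\<^sup>+x. \<integral>\<^sup>+y. ennreal (indicator (fst -` B) (x, y) * u (x, y)) \<partial>\<nu> \<partial>\<mu>)"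
        by (rule int\<pi>[OF borel_measurable_indicator[OF fB]]) simp
      also have "... = (\<integral>\<^sup>+x. (\<integral>\<^sup>+y. ennreal (u (x, y)) \<partial>\<nu>) * indicator B x \<partial>\<mu>)"
      proof (rule nn_integral_cong)
        fix x
        have "(\<integral>\<^sup>+y. ennreal (indicator (fst -` B) (x, y) * u (x, y)) \<partial>\<nu>) = (\<integral>\<^sup>+y. ennreal (u (x, y)) * indicator B x \<partial>\<nu>)"
          by (intro nn_integral_cong) (auto simp: indicator_def)
        also have "... = (\<integral>\<^sup>+y. ennreal (u (x, y)) \<partial>\<nu>) * indicator B x"
          by (rule nn_integral_multc) measurable
        finally show "(\<integral>\<^sup>+y. ennreal (indicator (fst -` B) (x, y) * u (x, y)) \<partial>\<nu>) = (\<integral>\<^sup>+y. ennreal (u (x, y)) \<partial>\<nu>) * indicator B x" .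
      qed
      finally show "emeasure (density \<mu> (\<lambda>x. \<integral>\<^sup>+y. ennreal (u (x, y)) \<partial>\<nu>)) B = emeasure (density \<mu> (\<lambda>_. 1)) B"
        by (simp add: emeasure_density)
    qed simp
    then show ?thesis by (subst (asm) \<mu>.density_unique_iff) auto
  qed
  have LP: "Lp_penalty p ?R \<pi> = (\<integral>\<^sup>+x. \<integral>\<^sup>+y. ennreal (u (x, y) powr p) \<partial>\<nu> \<partial>\<mu>)"
    unfolding Lp_penalty_def u_def[symmetric] if_P[OF True]
    by (rule \<nu>.nn_integral_fst[symmetric]) measurable
  have "(\<integral>\<^sup>+x. ennreal (a x) - (\<integral>\<^sup>+y. ennreal (dual_integrand \<epsilon> (a x) x y) \<partial>\<mu>) \<partial>\<mu>) \<le>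
      (\<integral>\<^sup>+x. \<integral>\<^sup>+y. ennreal (2 * bregman \<phi> x (S y) * u (x, y) + \<epsilon> * u (x, y) powr p) \<partial>\<nu> \<partial>\<mu>)"
  proof (rule nn_integral_mono_AE, use marg in eventually_elim)
    case (elim x)
    have "(\<lambda>y. u (x, y)) \<in> borel_measurable borel"
      by (rule measurable_compose[OF borel_measurable_Pair um]) simp_all
    from conditional_cost_ge[OF this u0 elim \<epsilon> a0[of x], of x] show ?case .
  qed
  also have "... = (\<integral>\<^sup>+x. (\<integral>\<^sup>+y. ennreal (2 * bregman \<phi> x (S y) * u (x, y)) \<partial>\<nu>) + (\<integral>\<^sup>+y. ennreal \<epsilon> * ennreal (u (x, y) powr p) \<partial>\<nu>) \<partial>\<mu>)"
  proof (rule nn_integral_cong)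
    fix x
    have "(\<integral>\<^sup>+y. ennreal (2 * bregman \<phi> x (S y) * u (x, y) + \<epsilon> * u (x, y) powr p) \<partial>\<nu>) =
        (\<integral>\<^sup>+y. ennreal (2 * bregman \<phi> x (S y) * u (x, y)) + ennreal \<epsilon> * ennreal (u (x, y) powr p) \<partial>\<nu>)"
      using bregman_nonneg u0 \<epsilon> by (intro nn_integral_cong) (simp add: ennreal_plus ennreal_mult')
    also have "... = (\<integral>\<^sup>+y. ennreal (2 * bregman \<phi> x (S y) * u (x, y)) \<partial>\<nu>) + (\<integral>\<^sup>+y. ennreal \<epsilon> * ennreal (u (x, y) powr p) \<partial>\<nu>)"
      by (rule nn_integral_add) measurable
    finally show "(\<integral>\<^sup>+y. ennreal (2 * bregman \<phi> x (S y) * u (x, y) + \<epsilon> * u (x, y) powr p) \<partial>\<nu>) =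
      (\<integral>\<^sup>+y. ennreal (2 * bregman \<phi> x (S y) * u (x, y)) \<partial>\<nu>) + (\<integral>\<^sup>+y. ennreal \<epsilon> * ennreal (u (x, y) powr p) \<partial>\<nu>)" .
  qed
  also have "... = (\<integral>\<^sup>+x. \<integral>\<^sup>+y. ennreal (2 * bregman \<phi> x (S y) * u (x, y)) \<partial>\<nu> \<partial>\<mu>) +
      (\<integral>\<^sup>+x. \<integral>\<^sup>+y. ennreal \<epsilon> * ennreal (u (x, y) powr p) \<partial>\<nu> \<partial>\<mu>)"
    by (rule nn_integral_add) measurable
  also have "(\<integral>\<^sup>+x. \<integral>\<^sup>+y. ennreal \<epsilon> * ennreal (u (x, y) powr p) \<partial>\<nu> \<partial>\<mu>) = ennreal \<epsilon> * Lp_penalty p ?R \<pi>"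
    unfolding LP by (simp add: nn_integral_cmult)
  also have "(\<integral>\<^sup>+x. \<integral>\<^sup>+y. ennreal (2 * bregman \<phi> x (S y) * u (x, y)) \<partial>\<nu> \<partial>\<mu>) = (\<integral>\<^sup>+z. ennreal (2 * bregman \<phi> (fst z) (S (snd z))) \<partial>\<pi>)"
    using int\<pi>[of "\<lambda>z. 2 * bregman \<phi> (fst z) (S (snd z))"] bregman_nonneg by simp
  finally show ?thesis
    unfolding transport_cost_split[OF \<pi>] add.assoc by (rule add_left_mono)
qed

lemma ROT_ge:
  assumes "0 < \<epsilon>" "a \<in> borel_measurable borel" "\<And>x. 0 \<le> a x"
  shows "ennreal base_cost + (\<integral>\<^sup>+x. ennreal (a x) - (\<integral>\<^sup>+y. ennreal (dual_integrand \<epsilon> (a x) x y) \<partial>\<mu>) \<partial>\<mu>) \<le> ROT \<epsilon> p \<mu> \<nu>"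
  unfolding ROT_def using assms by (intro INF_greatest coupling_value_ge)

text \<open>The regularisation for which the optimal transport distance is of order \<delta>.\<close>

definition "\<epsilon>_of \<delta> = \<delta> powr (real CARD('n) * (p - 1) + 2)"

text \<open>The multiplier of the local problem at x before scaling.\<close>

definition "level x = opt_level TYPE('n) p (geo x)"

lemma level_measurable [measurable]: "level \<in> borel_measurable borel"
  unfolding level_def[abs_def] opt_level_def by measurable

lemma level_nonneg: "0 \<le> level x" by (simp add: level_def opt_level_def)

lemma level_pos: "0 < f x ==> 0 < level x"
  unfolding level_def by (intro opt_level_pos p geo_pos)

definition scaled_dual :: "real => real ^ 'n => real ^ 'n => real" where
  "scaled_dual \<delta> x w = dual_factor 1 * max 0 (level x - 2 * bregman \<phi> x (x + \<delta> *\<^sub>R w) / \<delta>^2) powr (p / (p - 1))"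

lemma scaled_dual_nonneg: "0 \<le> scaled_dual \<delta> x w"
  using dual_factor_nonneg by (simp add: scaled_dual_def)

lemma scaled_dual_measurable [measurable]:
  assumes [measurable]: "u \<in> borel_measurable M" "v \<in> borel_measurable M"
  shows "(\<lambda>z. scaled_dual \<delta> (u z) (v z)) \<in> borel_measurable M"
  unfolding scaled_dual_def by measurable

text \<open>The substitution y=x+\<delta> w; the powers of \<delta> combine to \<delta>^2 by the choice of
\<epsilon>.\<close>

lemma dual_integral_scaled:
  assumes \<delta>: "0 < \<delta>"
  shows "(\<integral>\<^sup>+y. ennreal (dual_integrand (\<epsilon>_of \<delta>) (\<delta>^2 * level x) x y) \<partial>\<mu>) =
    ennreal (\<delta>^2) * (\<integral>\<^sup>+w. ennreal (scaled_dual \<delta> x w * f (x + \<delta> *\<^sub>R w)) \<partial>lborel)"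
proof -
  let ?p' = "p / (p - 1)" and ?d = "real CARD('n)"
  have eps: "dual_factor (\<epsilon>_of \<delta>) = dual_factor 1 * \<delta> powr (- ?d - 2 / (p - 1))"
  proof -
    have "(p * \<epsilon>_of \<delta>) powr (- 1 / (p - 1)) = p powr (- 1 / (p - 1)) * \<delta> powr ((?d * (p - 1) + 2) * (- 1 / (p - 1)))"
      using p by (simp add: \<epsilon>_of_def powr_mult powr_powr)
    also have "(?d * (p - 1) + 2) * (- 1 / (p - 1)) = - ?d - 2 / (p - 1)"
      using p by (simp add: distrib_right add_divide_distrib diff_divide_distrib)
    finally show ?thesis by (simp add: dual_factor_def)
  qed
  have sc: "dual_integrand (\<epsilon>_of \<delta>) (\<delta>^2 * level x) x (x + \<delta> *\<^sub>R w) =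
      \<delta> powr (2 - ?d) * scaled_dual \<delta> x w" for w
  proof -
    have "\<delta>^2 * level x - 2 * bregman \<phi> x (x + \<delta> *\<^sub>R w) = \<delta>^2 * (level x - 2 * bregman \<phi> x (x + \<delta> *\<^sub>R w) / \<delta>^2)"
      using \<delta> by (simp add: right_diff_distrib)
    also have "max 0 ... = \<delta>^2 * max 0 (level x - 2 * bregman \<phi> x (x + \<delta> *\<^sub>R w) / \<delta>^2)"
      using \<delta> by (simp add: max_def zero_le_mult_iff)
    finally have "max 0 (\<delta>^2 * level x - 2 * bregman \<phi> x (x + \<delta> *\<^sub>R w)) powr ?p' =
       \<delta> powr (2 * ?p') * max 0 (level x - 2 * bregman \<phi> x (x + \<delta> *\<^sub>R w) / \<delta>^2) powr ?p'"
      using \<delta> by (simp add: powr_mult powr_powr flip: powr_numeral)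
    moreover have "\<delta> powr (- ?d - 2 / (p - 1)) * \<delta> powr (2 * ?p') = \<delta> powr (2 - ?d)"
    proof -
      have "2 * ?p' = 2 + 2 / (p - 1)" using p by (simp add: field_simps)
      then show ?thesis by (simp flip: powr_add)
    qed
    moreover have "c * X * (Y * m) = Z * (c * m)" if "X * Y = Z" for c X Y Z m :: real
      using that by (simp add: mult_ac flip: that)
    ultimately show ?thesis
      unfolding dual_integrand_def scaled_dual_def eps by (simp only:)
  qed
  have "(\<integral>\<^sup>+y. ennreal (dual_integrand (\<epsilon>_of \<delta>) (\<delta>^2 * level x) x y) \<partial>\<mu>) =
      (\<integral>\<^sup>+y. ennreal (f y) * ennreal (dual_integrand (\<epsilon>_of \<delta>) (\<delta>^2 * level x) x y) \<partial>lborel)"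
    by (rule nn_integral_\<mu>) measurable
  also have "... = ennreal (\<delta> ^ CARD('n)) * (\<integral>\<^sup>+w. ennreal (f (x + \<delta> *\<^sub>R w)) * ennreal (dual_integrand (\<epsilon>_of \<delta>) (\<delta>^2 * level x) x (x + \<delta> *\<^sub>R w)) \<partial>lborel)"
  proof -
    have m: "(\<lambda>y. ennreal (f y) * ennreal (dual_integrand (\<epsilon>_of \<delta>) (\<delta>^2 * level x) x y)) \<in> borel_measurable borel"
      by measurable
    from nn_integral_lborel_affine[OF \<delta> m, of x] show ?thesis by simp
  qed
  also have "(\<integral>\<^sup>+w. ennreal (f (x + \<delta> *\<^sub>R w)) * ennreal (dual_integrand (\<epsilon>_of \<delta>) (\<delta>^2 * level x) x (x + \<delta> *\<^sub>R w)) \<partial>lborel) =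
      (\<integral>\<^sup>+w. ennreal (\<delta> powr (2 - ?d) * (scaled_dual \<delta> x w * f (x + \<delta> *\<^sub>R w))) \<partial>lborel)"
    unfolding sc ennreal_mult'[OF leb_density_nonneg, symmetric]
    by (intro nn_integral_cong) (simp only: mult_ac)
  also have "... = ennreal (\<delta> powr (2 - ?d)) * (\<integral>\<^sup>+w. ennreal (scaled_dual \<delta> x w * f (x + \<delta> *\<^sub>R w)) \<partial>lborel)"
    by (rule nn_integral_cmult_real) (simp, measurable)
  also have "ennreal (\<delta> ^ CARD('n)) * (ennreal (\<delta> powr (2 - ?d)) * (\<integral>\<^sup>+w. ennreal (scaled_dual \<delta> x w * f (x + \<delta> *\<^sub>R w)) \<partial>lborel)) =
      ennreal (\<delta> ^ CARD('n) * \<delta> powr (2 - ?d)) * (\<integral>\<^sup>+w. ennreal (scaled_dual \<delta> x w * f (x + \<delta> *\<^sub>R w)) \<partial>lborel)"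
    using \<delta> by (simp add: ennreal_mult' mult.assoc)
  also have "\<delta> ^ CARD('n) * \<delta> powr (2 - ?d) = \<delta>^2"
    using \<delta> by (simp add: powr_diff powr_realpow powr_numeral)
  finally show ?thesis .
qed

text \<open>The rescaled dual value. The truncated subtraction makes the integrand nonnegative, so that Fatou's lemma
applies without a majorant.\<close>

definition lower_functional :: "real => ennreal" where
  "lower_functional \<delta> = (\<integral>\<^sup>+x. ennreal (level x) - (\<integral>\<^sup>+w. ennreal (scaled_dual \<delta> x w * f (x + \<delta> *\<^sub>R w)) \<partial>lborel) \<partial>\<mu>)"

lemma lower_integrand_measurable [measurable]:
  "(\<lambda>x. ennreal (level x) - (\<integral>\<^sup>+w. ennreal (scaled_dual \<delta> x w * f (x + \<delta> *\<^sub>R w)) \<partial>lborel)) \<in> borel_measurable borel"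
  by measurable

lemma ROT_ge_scaled:
  assumes \<delta>: "0 < \<delta>"
  shows "ennreal base_cost + ennreal (\<delta>^2) * lower_functional \<delta> \<le> ROT (\<epsilon>_of \<delta>) p \<mu> \<nu>"
proof -
  have "ennreal (\<delta>^2) * lower_functional \<delta> =
      (\<integral>\<^sup>+x. ennreal (\<delta>^2) * (ennreal (level x) - (\<integral>\<^sup>+w. ennreal (scaled_dual \<delta> x w * f (x + \<delta> *\<^sub>R w)) \<partial>lborel)) \<partial>\<mu>)"
    unfolding lower_functional_def by (rule nn_integral_cmult[symmetric]) (simp cong: measurable_cong_sets)
  also have "... = (\<integral>\<^sup>+x. ennreal (\<delta>^2 * level x) - (\<integral>\<^sup>+y. ennreal (dual_integrand (\<epsilon>_of \<delta>) (\<delta>^2 * level x) x y) \<partial>\<mu>) \<partial>\<mu>)"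
    unfolding dual_integral_scaled[OF \<delta>]
    by (intro nn_integral_cong) (simp add: ennreal_right_diff_distrib ennreal_mult')
  finally show ?thesis
    using ROT_ge[of "\<epsilon>_of \<delta>" "\<lambda>x. \<delta>^2 * level x"] \<delta> level_nonneg by (simp add: \<epsilon>_of_def)
qed

end

section \<open>The limit of the lower bound\<close>

context transport_setting
begin

lemma excess_AE:
  "AE x in lborel. \<forall>s>f x. ((\<lambda>r. (\<integral>\<^sup>+y. ennreal (f y - s) * indicator (cball x r) y \<partial>lborel) / ennreal (r ^ CARD('n))) \<longlongrightarrow> 0) (at_right 0)"
proof -
  let ?E = "\<lambda>s x r. (\<integral>\<^sup>+y. ennreal (f y - s) * indicator (cball x r) y \<partial>lborel) / ennreal (r ^ CARD('n))"
  have "AE x in lborel. 0 \<le> real_of_rat q --> f x \<le> real_of_rat q --> ((?E (real_of_rat q) x) \<longlongrightarrow> 0) (at_right 0)" for q :: rat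
    using excess_average_vanishes[OF leb_density_measurable density_integrable, of "real_of_rat q"]
    by (cases "0 \<le> real_of_rat q") auto
  then have "AE x in lborel. \<forall>q. 0 \<le> real_of_rat q --> f x \<le> real_of_rat q --> ((?E (real_of_rat q) x) \<longlongrightarrow> 0) (at_right 0)"
    by (intro AE_all_countable[THEN iffD2] allI)
  then show ?thesis
  proof eventually_elim
    case (elim x)
    show ?case
    proof (intro allI impI)
      fix s assume "f x < s"
      then obtain q where q: "f x < real_of_rat q" "real_of_rat q < s" using of_rat_dense by blast
      have "0 \<le> real_of_rat q" using leb_density_nonneg[of \<mu> x] q by linarith
      then have lim: "((?E (real_of_rat q) x) \<longlongrightarrow> 0) (at_right 0)" using elim q by auto
      have le: "?E s x r \<le> ?E (real_of_rat q) x r" for r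
        using q by (intro divide_right_mono_ennreal nn_integral_mono mult_right_mono ennreal_leI) auto
      show "((?E s x) \<longlongrightarrow> 0) (at_right 0)"
        by (rule tendsto_sandwich[OF always_eventually always_eventually tendsto_const lim]) (use le in auto)
    qed
  qed
qed

lemma scaled_dual_bound:
  assumes "0 < \<delta>"
  shows "scaled_dual \<delta> x w \<le> dual_factor 1 * level x powr (p / (p - 1)) * indicator (cball 0 (sqrt (level x / \<sigma>m))) w"
proof -
  have b: "\<sigma>m * (norm w)^2 \<le> 2 * bregman \<phi> x (x + \<delta> *\<^sub>R w) / \<delta>^2"
    using bregman_ge[of x "x + \<delta> *\<^sub>R w"] assms by (simp add: power_mult_distrib field_simps)
  show ?thesis
  proof (cases "w \<in> cball 0 (sqrt (level x / \<sigma>m))")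
    case True
    have "0 \<le> \<sigma>m * (norm w)^2" using \<sigma>m_pos by simp
    then have "max 0 (level x - 2 * bregman \<phi> x (x + \<delta> *\<^sub>R w) / \<delta>^2) \<le> level x"
      using b level_nonneg[of x] by simp
    then have "max 0 (level x - 2 * bregman \<phi> x (x + \<delta> *\<^sub>R w) / \<delta>^2) powr (p / (p - 1)) \<le> level x powr (p / (p - 1))"
      using p by (intro powr_mono2) auto
    then show ?thesis using True dual_factor_nonneg unfolding scaled_dual_def by (simp add: mult_left_mono)
  next
    case False
    then have "sqrt (level x / \<sigma>m) < norm w" by simp
    then have "(sqrt (level x / \<sigma>m))^2 < (norm w)^2" by (intro power_strict_mono) (use level_nonneg \<sigma>m_pos in auto)
    then have "level x / \<sigma>m < (norm w)^2" using level_nonneg[of x] \<sigma>m_pos by simp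
    then have "level x < \<sigma>m * (norm w)^2" using \<sigma>m_pos by (simp add: field_simps)
    then have "max 0 (level x - 2 * bregman \<phi> x (x + \<delta> *\<^sub>R w) / \<delta>^2) = 0" using b by simp
    then show ?thesis using False by (simp add: scaled_dual_def)
  qed
qed

lemma limit_dual_integral:
  assumes fx: "0 < f x"
  shows "(\<integral>\<^sup>+w. ennreal (dual_factor 1 * max 0 (level x - w \<bullet> (A x *v w)) powr (p / (p - 1))) \<partial>lborel) =
    ennreal (level x / (p / (p - 1) + real CARD('n) / 2) / f x)"
proof -
  let ?J = "\<integral>\<^sup>+w. ennreal (dual_factor 1 * max 0 (level x - w \<bullet> (A x *v w)) powr (p / (p - 1))) \<partial>lborel"
  have m: "(\<lambda>w. dual_factor 1 * max 0 (level x - w \<bullet> (A x *v w)) powr (p / (p - 1))) \<in> borel_measurable lborel"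
  proof -
    show ?thesis by measurable
  qed
  have "ennreal (f x) * ?J = (\<integral>\<^sup>+w. ennreal (f x * (dual_factor 1 * max 0 (level x - w \<bullet> (A x *v w)) powr (p / (p - 1)))) \<partial>lborel)"
    using fx m by (intro nn_integral_cmult_real[symmetric]) auto
  also have "... = (\<integral>\<^sup>+w. ennreal ((p - 1) / p * (p * f x powr (1 - p)) powr (- 1 / (p - 1)) * max 0 (level x - w \<bullet> (A x *v w)) powr (p / (p - 1))) \<partial>lborel)"
  proof -
    have "(p * f x powr (1 - p)) powr (- 1 / (p - 1)) = p powr (- 1 / (p - 1)) * f x"
      by (rule lagrange_factor[OF p hessian_symmetric _ fx geo_def level_def]) (rule hessian_pos)
    then show ?thesis unfolding dual_factor_def by (simp add: mult_ac)
  qed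
  also have "... = ennreal (level x / (p / (p - 1) + real CARD('n) / 2))"
    by (rule dual_integral[OF p hessian_symmetric hessian_pos fx geo_def level_def])
  finally have "ennreal (f x) * ?J = ennreal (level x / (p / (p - 1) + real CARD('n) / 2))" .
  then have "ennreal (1 / f x) * (ennreal (f x) * ?J) = ennreal (1 / f x) * ennreal (level x / (p / (p - 1) + real CARD('n) / 2))"
    by simp
  moreover have "ennreal (1 / f x) * (ennreal (f x) * ?J) = ?J"
    using fx by (simp flip: mult.assoc ennreal_mult')
  moreover have "ennreal (1 / f x) * ennreal (level x / (p / (p - 1) + real CARD('n) / 2)) =
      ennreal (level x / (p / (p - 1) + real CARD('n) / 2) / f x)"
    using fx by (simp add: mult.commute flip: ennreal_mult')
  ultimately show ?thesis by simp
qed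

text \<open>For s>f(x) one has f\<le> s+(f-s)^+ near x: the first part converges by Taylor expansion, and the second
is negligible because the kernel is bounded and supported in a ball of radius of order \<delta>.\<close>

lemma lower_integrand_liminf_aux:
  assumes fx: "0 < f x" and s: "f x < s"
    and ex: "((\<lambda>r. (\<integral>\<^sup>+y. ennreal (f y - s) * indicator (cball x r) y \<partial>lborel) / ennreal (r ^ CARD('n))) \<longlongrightarrow> 0) (at_right 0)"
    and lim: "\<delta> \<longlonglongrightarrow> 0" and pos: "\<And>n. 0 < \<delta> n"
  shows "ennreal (level x) - ennreal (s * (level x / (p / (p - 1) + real CARD('n) / 2) / f x)) \<le>
    liminf (\<lambda>n. ennreal (level x) - (\<integral>\<^sup>+w. ennreal (scaled_dual (\<delta> n) x w * f (x + \<delta> n *\<^sub>R w)) \<partial>lborel))"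
proof -
  let ?d = "CARD('n)" and ?p' = "p / (p - 1)"
  let ?J = "level x / (?p' + real ?d / 2) / f x"
  have s0: "0 \<le> s" using s fx by simp
  define \<rho> where "\<rho> = sqrt (level x / \<sigma>m)"
  have \<rho>: "0 < \<rho>" using level_pos[OF fx] \<sigma>m_pos by (simp add: \<rho>_def)
  have [measurable]: "cball (0 :: real ^ 'n) \<rho> \<in> sets borel" by simp
  define k where "k = dual_factor 1 * level x powr ?p'"
  have k: "0 \<le> k" using dual_factor_nonneg by (simp add: k_def)
  let ?h = "\<lambda>n w. scaled_dual (\<delta> n) x w"
  have hb: "?h n w \<le> k * indicator (cball 0 \<rho>) w" for n w
    using scaled_dual_bound[OF pos[of n], of x w] by (simp add: k_def \<rho>_def)
  let ?X1 = "\<lambda>n. \<integral>\<^sup>+w. ennreal (?h n w) \<partial>lborel"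
  let ?X2 = "\<lambda>n. \<integral>\<^sup>+w. ennreal (f (x + \<delta> n *\<^sub>R w) - s) * indicator (cball 0 \<rho>) w \<partial>lborel"
  have le: "(\<integral>\<^sup>+w. ennreal (?h n w * f (x + \<delta> n *\<^sub>R w)) \<partial>lborel) \<le> ennreal s * ?X1 n + ennreal k * ?X2 n" for n
  proof -
    have "(\<integral>\<^sup>+w. ennreal (?h n w * f (x + \<delta> n *\<^sub>R w)) \<partial>lborel) \<le>
        (\<integral>\<^sup>+w. ennreal s * ennreal (?h n w) + ennreal k * (ennreal (f (x + \<delta> n *\<^sub>R w) - s) * indicator (cball 0 \<rho>) w) \<partial>lborel)"
    proof (rule nn_integral_mono)
      fix w
      have h0: "0 \<le> ?h n w" by (rule scaled_dual_nonneg)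
      define e where "e = max 0 (f (x + \<delta> n *\<^sub>R w) - s)"
      have ee: "ennreal (f (x + \<delta> n *\<^sub>R w) - s) = ennreal e" by (simp add: e_def ennreal_max_0)
      have "?h n w * f (x + \<delta> n *\<^sub>R w) \<le> ?h n w * (s + e)" using h0 by (intro mult_left_mono) (auto simp: e_def)
      also have "... \<le> s * ?h n w + (k * indicator (cball 0 \<rho>) w) * e"
        using mult_right_mono[OF hb[of n w], of e] by (simp add: e_def algebra_simps)
      finally have "ennreal (?h n w * f (x + \<delta> n *\<^sub>R w)) \<le> ennreal (s * ?h n w + (k * indicator (cball 0 \<rho>) w) * e)"
        by (rule ennreal_leI)
      also have "... = ennreal s * ennreal (?h n w) + ennreal k * (ennreal e * indicator (cball 0 \<rho>) w)"
        using s0 h0 k by (subst ennreal_plus) (auto simp: e_def ennreal_mult' indicator_def)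
      finally show "ennreal (?h n w * f (x + \<delta> n *\<^sub>R w)) \<le>
         ennreal s * ennreal (?h n w) + ennreal k * (ennreal (f (x + \<delta> n *\<^sub>R w) - s) * indicator (cball 0 \<rho>) w)"
        unfolding ee .
    qed
    also have "... = ennreal s * ?X1 n + ennreal k * ?X2 n"
    proof -
      have m1: "(\<lambda>w. ennreal (?h n w)) \<in> borel_measurable lborel" by measurable
      have m2: "(\<lambda>w. ennreal (f (x + \<delta> n *\<^sub>R w) - s) * indicator (cball 0 \<rho>) w) \<in> borel_measurable lborel"
        by measurable
      have m3: "(\<lambda>w. ennreal s * ennreal (?h n w)) \<in> borel_measurable lborel" by measurable
      have m4: "(\<lambda>w. ennreal k * (ennreal (f (x + \<delta> n *\<^sub>R w) - s) * indicator (cball 0 \<rho>) w)) \<in> borel_measurable lborel"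
        by measurable
      show ?thesis
        by (simp only: nn_integral_add[OF m3 m4] nn_integral_cmult[OF m1] nn_integral_cmult[OF m2])
    qed
    finally show ?thesis .
  qed
  have X1: "?X1 \<longlonglongrightarrow> ennreal ?J"
    unfolding limit_dual_integral[OF fx, symmetric]
  proof (rule nn_integral_dominated_convergence[where w = "\<lambda>w. ennreal (k * indicator (cball 0 \<rho>) w)"])
    show "AE w in lborel. ennreal (?h n w) \<le> ennreal (k * indicator (cball 0 \<rho>) w)" for n
      using hb by (intro AE_I2 ennreal_leI)
    have "(\<integral>\<^sup>+w. ennreal (k * indicator (cball 0 \<rho>) w) \<partial>(lborel :: (real ^ 'n) measure)) = ennreal k * emeasure lborel (cball 0 \<rho> :: (real ^ 'n) set)"
      using k by (subst nn_integral_cmult_real) (auto simp: ennreal_indicator)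
    also have "... < \<infinity>" using emeasure_lborel_cball_finite[of "0 :: real ^ 'n" \<rho>] by (simp add: ennreal_mult_less_top)
    finally show "(\<integral>\<^sup>+w. ennreal (k * indicator (cball 0 \<rho>) w) \<partial>(lborel :: (real ^ 'n) measure)) < \<infinity>" .
    have "(\<lambda>n. ?h n w) \<longlonglongrightarrow> dual_factor 1 * max 0 (level x - w \<bullet> (A x *v w)) powr ?p'" for w
      unfolding scaled_dual_def
    proof (intro tendsto_mult tendsto_const tendsto_powr2 tendsto_max tendsto_diff)
      show "(\<lambda>n. 2 * bregman \<phi> x (x + \<delta> n *\<^sub>R w) / (\<delta> n)^2) \<longlonglongrightarrow> w \<bullet> (A x *v w)"
        by (rule bregman_scaled_limit[OF lim pos])
    qed (use p in auto)
    then show "AE w in lborel. (\<lambda>n. ennreal (?h n w)) \<longlonglongrightarrow> ennreal (dual_factor 1 * max 0 (level x - w \<bullet> (A x *v w)) powr ?p')"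
      by (intro AE_I2 tendsto_ennrealI)
    show "(\<lambda>w. ennreal (dual_factor 1 * max 0 (level x - w \<bullet> (A x *v w)) powr ?p')) \<in> borel_measurable lborel"
      by measurable
  qed measurable
  have X2eq: "?X2 n = ennreal (\<rho> ^ ?d) * ((\<integral>\<^sup>+y. ennreal (f y - s) * indicator (cball x (\<rho> * \<delta> n)) y \<partial>lborel) / ennreal ((\<rho> * \<delta> n) ^ ?d))" for n
  proof -
    have [measurable]: "cball x (\<rho> * \<delta> n) \<in> sets borel" by simp
    have m: "(\<lambda>y. ennreal (f y - s) * indicator (cball x (\<rho> * \<delta> n)) y) \<in> borel_measurable borel" by measurable
    have "x + \<delta> n *\<^sub>R w \<in> cball x (\<rho> * \<delta> n) \<longleftrightarrow> w \<in> cball 0 \<rho>" for w :: "real ^ 'n"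
      using pos[of n] by (simp add: dist_norm mult.commute)
    then have "(\<integral>\<^sup>+y. ennreal (f y - s) * indicator (cball x (\<rho> * \<delta> n)) y \<partial>lborel) = ennreal (\<delta> n ^ ?d) * ?X2 n"
      using nn_integral_lborel_affine[OF pos[of n] m, of x] by (simp add: indicator_def)
    then have "ennreal (\<rho> ^ ?d) * ((\<integral>\<^sup>+y. ennreal (f y - s) * indicator (cball x (\<rho> * \<delta> n)) y \<partial>lborel) / ennreal ((\<rho> * \<delta> n) ^ ?d)) =
      ennreal (\<rho> ^ ?d) * (ennreal (\<delta> n ^ ?d) * ?X2 n / (ennreal (\<rho> ^ ?d) * ennreal (\<delta> n ^ ?d)))"
      using \<rho> pos[of n] by (simp add: power_mult_distrib ennreal_mult)
    also have "... = ?X2 n * ((ennreal (\<rho> ^ ?d) * ennreal (\<delta> n ^ ?d)) / (ennreal (\<rho> ^ ?d) * ennreal (\<delta> n ^ ?d)))"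
      by (simp add: ennreal_times_divide mult_ac)
    also have "... = ?X2 n"
    proof -
      have "ennreal (\<rho> ^ ?d) * ennreal (\<delta> n ^ ?d) = ennreal (\<rho> ^ ?d * \<delta> n ^ ?d)" using \<rho> by (simp add: ennreal_mult')
      moreover have "0 < \<rho> ^ ?d * \<delta> n ^ ?d" using \<rho> pos[of n] by simp
      then have "ennreal (\<rho> ^ ?d * \<delta> n ^ ?d) \<noteq> 0" unfolding ennreal_eq_0_iff by linarith
      then have "ennreal (\<rho> ^ ?d * \<delta> n ^ ?d) / ennreal (\<rho> ^ ?d * \<delta> n ^ ?d) = 1"
        by (rule ennreal_divide_self) (rule ennreal_less_top)
      ultimately show ?thesis by simp
    qed
    finally show ?thesis by simp
  qed
  have "filterlim (\<lambda>n. \<rho> * \<delta> n) (at_right 0) sequentially"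
    unfolding filterlim_at using \<rho> pos tendsto_mult_right_zero[OF lim, of \<rho>] by (auto simp: less_imp_neq[THEN not_sym])
  then have "(\<lambda>n. (\<integral>\<^sup>+y. ennreal (f y - s) * indicator (cball x (\<rho> * \<delta> n)) y \<partial>lborel) / ennreal ((\<rho> * \<delta> n) ^ ?d)) \<longlonglongrightarrow> 0"
    by (rule filterlim_compose[OF ex])
  then have "?X2 \<longlonglongrightarrow> ennreal (\<rho> ^ ?d) * 0"
    unfolding X2eq by (intro ennreal_tendsto_cmult) auto
  then have "(\<lambda>n. ennreal s * ?X1 n + ennreal k * ?X2 n) \<longlonglongrightarrow> ennreal s * ennreal ?J + ennreal k * 0"
    by (intro tendsto_add ennreal_tendsto_cmult X1) auto
  then have "(\<lambda>n. ennreal (level x) - (ennreal s * ?X1 n + ennreal k * ?X2 n)) \<longlonglongrightarrow> ennreal (level x) - ennreal (s * ?J)"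
  proof (intro tendsto_diff_ennreal tendsto_const)
    assume "(\<lambda>n. ennreal s * ?X1 n + ennreal k * ?X2 n) \<longlonglongrightarrow> ennreal s * ennreal ?J + ennreal k * 0"
    moreover have "ennreal s * ennreal ?J + ennreal k * 0 = ennreal (s * ?J)"
      by (simp only: ennreal_mult'[OF s0] mult_zero_right add_0_right)
    ultimately show "(\<lambda>n. ennreal s * ?X1 n + ennreal k * ?X2 n) \<longlonglongrightarrow> ennreal (s * ?J)" by (simp only:)
  qed simp_all
  then have "ennreal (level x) - ennreal (s * ?J) = liminf (\<lambda>n. ennreal (level x) - (ennreal s * ?X1 n + ennreal k * ?X2 n))"
    by (intro lim_imp_Liminf[symmetric]) auto
  also have "... \<le> liminf (\<lambda>n. ennreal (level x) - (\<integral>\<^sup>+w. ennreal (?h n w * f (x + \<delta> n *\<^sub>R w)) \<partial>lborel))"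
    using le by (intro Liminf_mono always_eventually allI ennreal_minus_mono) auto
  finally show ?thesis .
qed

text \<open>Let s decrease to f(x); the remaining fraction of the level is the local value.\<close>

lemma lower_integrand_liminf:
  assumes fx: "0 < f x"
    and ex: "\<forall>s>f x. ((\<lambda>r. (\<integral>\<^sup>+y. ennreal (f y - s) * indicator (cball x r) y \<partial>lborel) / ennreal (r ^ CARD('n))) \<longlongrightarrow> 0) (at_right 0)"
    and lim: "\<delta> \<longlonglongrightarrow> 0" and pos: "\<And>n. 0 < \<delta> n"
  shows "ennreal (C_const TYPE('n) p * geo x powr (- scaling_exponent TYPE('n) p)) \<le>
    liminf (\<lambda>n. ennreal (level x) - (\<integral>\<^sup>+w. ennreal (scaled_dual (\<delta> n) x w * f (x + \<delta> n *\<^sub>R w)) \<partial>lborel))"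
proof (rule tendsto_upperbound)
  let ?q = "p / (p - 1) + real CARD('n) / 2"
  let ?J = "level x / ?q / f x"
  have q: "0 < ?q" using p by (intro add_pos_nonneg) auto
  have J: "0 \<le> ?J" using q level_nonneg fx by simp
  have "((\<lambda>s. ennreal (level x) - ennreal (s * ?J)) \<longlongrightarrow> ennreal (level x) - ennreal (f x * ?J)) (at_right (f x))"
    by (intro tendsto_diff_ennreal tendsto_const tendsto_ennrealI tendsto_intros) auto
  also have "ennreal (level x) - ennreal (f x * ?J) = ennreal (level x - f x * ?J)"
    by (intro ennreal_minus mult_nonneg_nonneg J less_imp_le[OF fx])
  also have "level x - f x * ?J = level x * (1 - 1 / ?q)" using fx by (simp add: right_diff_distrib)
  also have "... = C_const TYPE('n) p * geo x powr (- scaling_exponent TYPE('n) p)"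
    unfolding level_def by (rule C_const_level[OF p geo_pos[OF fx]])
  finally show "((\<lambda>s. ennreal (level x) - ennreal (s * ?J)) \<longlongrightarrow>
    ennreal (C_const TYPE('n) p * geo x powr (- scaling_exponent TYPE('n) p))) (at_right (f x))" .
  show "\<forall>\<^sub>F s in at_right (f x). ennreal (level x) - ennreal (s * ?J) \<le>
    liminf (\<lambda>n. ennreal (level x) - (\<integral>\<^sup>+w. ennreal (scaled_dual (\<delta> n) x w * f (x + \<delta> n *\<^sub>R w)) \<partial>lborel))"
    by (intro eventually_at_rightI[of "f x" "f x + 1"] lower_integrand_liminf_aux fx lim pos ex[rule_format]) auto
qed simp

theorem lower_functional_liminf:
  assumes lim: "\<delta> \<longlonglongrightarrow> 0" and pos: "\<And>n. 0 < \<delta> n"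
  shows "ennreal (C_const TYPE('n) p) * K_fun \<mu> \<nu> \<phi> p \<le> liminf (\<lambda>n. lower_functional (\<delta> n))"
proof -
  let ?L = "\<lambda>n x. ennreal (level x) - (\<integral>\<^sup>+w. ennreal (scaled_dual (\<delta> n) x w * f (x + \<delta> n *\<^sub>R w)) \<partial>lborel)"
  have "ennreal (C_const TYPE('n) p) * K_fun \<mu> \<nu> \<phi> p =
      (\<integral>\<^sup>+x. ennreal (C_const TYPE('n) p * geo x powr (- scaling_exponent TYPE('n) p)) \<partial>\<mu>)"
    unfolding K_fun_geo using C_const_pos[OF p, where ?'n = 'n]
    by (intro nn_integral_cmult_real[symmetric]) auto
  also have "... \<le> (\<integral>\<^sup>+x. liminf (\<lambda>n. ?L n x) \<partial>\<mu>)"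
  proof (rule nn_integral_mono_AE, rule AE_\<mu>I)
    show "AE x in lborel. 0 < f x --> ennreal (C_const TYPE('n) p * geo x powr (- scaling_exponent TYPE('n) p)) \<le> liminf (\<lambda>n. ?L n x)"
      using excess_AE by eventually_elim (use lower_integrand_liminf lim pos in blast)
  qed
  also have "... \<le> liminf (\<lambda>n. \<integral>\<^sup>+x. ?L n x \<partial>\<mu>)"
    by (rule nn_integral_liminf) (simp cong: measurable_cong_sets)
  finally show ?thesis unfolding lower_functional_def .
qed

end

section \<open>Self-couplings with a density\<close>

context transport_setting
begin

abbreviation "double_integral h \<equiv> (\<integral>\<^sup>+x. \<integral>\<^sup>+y. h (x, y) \<partial>\<mu> \<partial>\<mu>)"
abbreviation "gap_cost u \<equiv> double_integral (\<lambda>z. ennreal (2 * bregman \<phi> (fst z) (snd z) * u z))"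
abbreviation "spread u \<equiv> double_integral (\<lambda>z. ennreal ((norm (fst z - snd z))^2 * u z))"
abbreviation "power_integral u \<equiv> double_integral (\<lambda>z. ennreal (u z powr p))"

text \<open>Symmetry replaces the condition on the second marginal. The function \<open>v\<close> is the prescribed
density of the marginal with respect to \<mu>.\<close>

definition self_plan :: "((real ^ 'n) \<times> (real ^ 'n) => real) => (real ^ 'n => real) => bool" where
  "self_plan u v \<longleftrightarrow> u \<in> borel_measurable borel \<and> (\<forall>z. 0 \<le> u z) \<and> (\<forall>x y. u (x, y) = u (y, x)) \<and>
     (AE x in \<mu>. (\<integral>\<^sup>+y. ennreal (u (x, y)) \<partial>\<mu>) = ennreal (v x))"

lemma pair_section_measurable:
  assumes "h \<in> borel_measurable (borel :: ((real ^ 'n) \<times> (real ^ 'n)) measure)"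
  shows "(\<lambda>y. h (x, y)) \<in> borel_measurable borel" "(\<lambda>x. h (x, y)) \<in> borel_measurable borel"
  by (rule measurable_compose[OF borel_measurable_Pair assms]; simp)+

lemma pair_borel_measurable:
  assumes "h \<in> borel_measurable (borel :: ((real ^ 'n) \<times> (real ^ 'n)) measure)"
    and "sets M = sets borel" "sets N = sets borel"
  shows "h \<in> borel_measurable (M \<Otimes>\<^sub>M N)"
proof -
  have "sets (M \<Otimes>\<^sub>M N) = sets borel"
    unfolding borel_prod[symmetric] by (rule sets_pair_measure_cong[OF assms(2,3)])
  then show ?thesis by (subst measurable_cong_sets[OF _ refl]) (use assms in auto)
qed

text \<open>The plan is pushed forward by (x,y)\<mapsto>(x,T(y)).\<close>

lemma ROT_le_self_plan:
  assumes u: "self_plan u (\<lambda>_. 1)" and \<epsilon>: "0 < \<epsilon>"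
  shows "ROT \<epsilon> p \<mu> \<nu> \<le> ennreal base_cost + gap_cost u
    + ennreal \<epsilon> * power_integral u"
proof -
  interpret P: pair_prob_space \<mu> \<nu> ..
  let ?R = "\<mu> \<Otimes>\<^sub>M \<nu>"
  have um: "u \<in> borel_measurable borel" and u0: "\<And>z. 0 \<le> u z" and sym: "\<And>x y. u (x, y) = u (y, x)"
    and mg: "AE x in \<mu>. (\<integral>\<^sup>+y. ennreal (u (x, y)) \<partial>\<mu>) = 1"
    using u by (auto simp: self_plan_def)
  have mg2: "AE y in \<mu>. (\<integral>\<^sup>+x. ennreal (u (x, y)) \<partial>\<mu>) = 1" using mg by (subst sym)
  define w where "w z = u (fst z, S (snd z))" for z
  have w0: "0 \<le> w z" for z by (simp add: w_def u0)
  have cS: "(\<lambda>z :: (real ^ 'n) \<times> (real ^ 'n). (fst z, S (snd z))) \<in> borel_measurable borel"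
    by (intro borel_measurable_continuous_onI continuous_intros continuous_on_compose2[OF continuous_on_inv_gradient]) auto
  have wm [measurable]: "w \<in> borel_measurable borel"
    unfolding w_def[abs_def] by (rule measurable_compose[OF cS um])
  have wm' [measurable]: "w \<in> borel_measurable (\<mu> \<Otimes>\<^sub>M \<nu>)" by (rule pair_borel_measurable[OF wm sets_\<mu> sets_\<nu>])
  define \<pi> where "\<pi> = density ?R (\<lambda>z. ennreal (w z))"
  have sets\<pi>: "sets \<pi> = sets borel" by (simp only: \<pi>_def sets_density sets_product)
  have int\<pi>: "(\<integral>\<^sup>+z. h z \<partial>\<pi>) = (\<integral>\<^sup>+x. \<integral>\<^sup>+y. ennreal (u (x, y)) * h (x, T y) \<partial>\<mu> \<partial>\<mu>)"
    if h: "h \<in> borel_measurable borel" for h :: "(real ^ 'n) \<times> (real ^ 'n) => ennreal"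
  proof -
    have [measurable]: "h \<in> borel_measurable (\<mu> \<Otimes>\<^sub>M \<nu>)" by (rule pair_borel_measurable[OF h sets_\<mu> sets_\<nu>])
    have "(\<integral>\<^sup>+z. h z \<partial>\<pi>) = (\<integral>\<^sup>+z. ennreal (w z) * h z \<partial>?R)"
      unfolding \<pi>_def by (rule nn_integral_density) measurable
    also have "... = (\<integral>\<^sup>+x. \<integral>\<^sup>+y. ennreal (w (x, y)) * h (x, y) \<partial>\<nu> \<partial>\<mu>)"
      by (rule \<nu>.nn_integral_fst[symmetric]) measurable
    also have "... = (\<integral>\<^sup>+x. \<integral>\<^sup>+y. ennreal (u (x, y)) * h (x, T y) \<partial>\<mu> \<partial>\<mu>)"
    proof (rule nn_integral_cong)
      fix x
      have "(\<lambda>y. ennreal (w (x, y)) * h (x, y)) \<in> borel_measurable borel"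
        using pair_section_measurable[OF wm] pair_section_measurable[OF h] by measurable
      then have "(\<integral>\<^sup>+y. ennreal (w (x, y)) * h (x, y) \<partial>\<nu>) = (\<integral>\<^sup>+y. ennreal (w (x, T y)) * h (x, T y) \<partial>\<mu>)"
        by (rule nn_integral_\<nu>)
      then show "(\<integral>\<^sup>+y. ennreal (w (x, y)) * h (x, y) \<partial>\<nu>) = (\<integral>\<^sup>+y. ennreal (u (x, y)) * h (x, T y) \<partial>\<mu>)"
        by (simp add: w_def)
    qed
    finally show ?thesis .
  qed
  have sp: "space \<pi> = UNIV" using sets_eq_imp_space_eq[OF sets\<pi>] by simp
  have fm: "fst \<in> \<pi> \<rightarrow>\<^sub>M borel" "snd \<in> \<pi> \<rightarrow>\<^sub>M borel"
    by (subst measurable_cong_sets[OF sets\<pi> refl], rule fst_borel_measurable snd_borel_measurable)+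
  have em: "emeasure \<pi> X = (\<integral>\<^sup>+x. \<integral>\<^sup>+y. ennreal (u (x, y)) * indicator X (x, T y) \<partial>\<mu> \<partial>\<mu>)"
    if X: "X \<in> sets borel" for X
    using int\<pi>[OF borel_measurable_indicator[OF X]] X sets\<pi> by simp
  have d1: "distr \<pi> borel fst = \<mu>"
  proof (rule measure_eqI)
    fix B assume "B \<in> sets (distr \<pi> borel fst)"
    then have B: "B \<in> sets borel" by simp
    have "emeasure (distr \<pi> borel fst) B = emeasure \<pi> (fst -` B)"
      using emeasure_distr[OF fm(1) B] by (simp add: sp)
    also have "... = (\<integral>\<^sup>+x. \<integral>\<^sup>+y. ennreal (u (x, y)) * indicator (fst -` B) (x, T y) \<partial>\<mu> \<partial>\<mu>)"
      by (rule em[OF measurable_sets_borel[OF fst_borel_measurable B]])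
    also have "... = (\<integral>\<^sup>+x. indicator B x \<partial>\<mu>)"
    proof (rule nn_integral_cong_AE, use mg in eventually_elim)
      case (elim x)
      have "(\<integral>\<^sup>+y. ennreal (u (x, y)) * indicator (fst -` B) (x, T y) \<partial>\<mu>) = (\<integral>\<^sup>+y. ennreal (u (x, y)) * indicator B x \<partial>\<mu>)"
        by (intro nn_integral_cong) (simp add: indicator_def)
      also have "... = (\<integral>\<^sup>+y. ennreal (u (x, y)) \<partial>\<mu>) * indicator B x"
        by (rule nn_integral_multc) (use pair_section_measurable[OF um] in \<open>simp cong: measurable_cong_sets\<close>)
      finally show ?case by (simp add: elim)
    qed
    also have "... = emeasure \<mu> B" using B by simp
    finally show "emeasure (distr \<pi> borel fst) B = emeasure \<mu> B" .
  qed simp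
  have d2: "distr \<pi> borel snd = \<nu>"
  proof (rule measure_eqI)
    fix B assume "B \<in> sets (distr \<pi> borel snd)"
    then have B [measurable]: "B \<in> sets borel" by simp
    have [measurable]: "u \<in> borel_measurable (\<mu> \<Otimes>\<^sub>M \<mu>)" by (rule pair_borel_measurable[OF um sets_\<mu> sets_\<mu>])
    interpret Q: pair_sigma_finite \<mu> \<mu> ..
    have "emeasure (distr \<pi> borel snd) B = emeasure \<pi> (snd -` B)"
      using emeasure_distr[OF fm(2) B] by (simp add: sp)
    also have "... = (\<integral>\<^sup>+x. \<integral>\<^sup>+y. ennreal (u (x, y)) * indicator (snd -` B) (x, T y) \<partial>\<mu> \<partial>\<mu>)"
      by (rule em[OF measurable_sets_borel[OF snd_borel_measurable B]])
    also have "... = (\<integral>\<^sup>+x. \<integral>\<^sup>+y. ennreal (u (x, y)) * indicator B (T y) \<partial>\<mu> \<partial>\<mu>)"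
      by (simp add: indicator_def)
    also have "... = (\<integral>\<^sup>+y. \<integral>\<^sup>+x. ennreal (u (x, y)) * indicator B (T y) \<partial>\<mu> \<partial>\<mu>)"
      by (rule Q.Fubini'[symmetric]) (simp add: case_prod_unfold)
    also have "... = (\<integral>\<^sup>+y. indicator B (T y) \<partial>\<mu>)"
    proof (rule nn_integral_cong_AE, use mg2 in eventually_elim)
      case (elim y)
      have "(\<integral>\<^sup>+x. ennreal (u (x, y)) * indicator B (T y) \<partial>\<mu>) = (\<integral>\<^sup>+x. ennreal (u (x, y)) \<partial>\<mu>) * indicator B (T y)"
        by (rule nn_integral_multc) (use pair_section_measurable[OF um] in \<open>simp cong: measurable_cong_sets\<close>)
      then show ?case by (simp add: elim)
    qed
    also have "... = emeasure \<nu> B"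
      using nn_integral_\<nu>[of "indicator B"] B by simp
    finally show "emeasure (distr \<pi> borel snd) B = emeasure \<nu> B" .
  qed simp
  have "emeasure \<pi> UNIV = emeasure (distr \<pi> borel fst) UNIV"
    using emeasure_distr[OF fm(1), of UNIV] by (simp add: sp)
  then have "prob_space \<pi>" using \<mu>.emeasure_space_1 by (intro prob_spaceI) (simp add: sp d1)
  then have \<pi>: "\<pi> \<in> couplings \<mu> \<nu>" by (simp add: couplings_def sets\<pi> d1 d2)
  have ac: "absolutely_continuous ?R \<pi>"
    unfolding \<pi>_def by (rule absolutely_continuousI_density) measurable
  have "AE z in ?R. ennreal (w z) = RN_deriv ?R \<pi> z"
    unfolding \<pi>_def by (rule P.RN_deriv_unique) measurable
  then have "Lp_penalty p ?R \<pi> = (\<integral>\<^sup>+z. ennreal (w z powr p) \<partial>?R)"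
    unfolding Lp_penalty_def if_P[OF ac]
    by (intro nn_integral_cong_AE, eventually_elim) (metis enn2real_ennreal w0)
  also have "... = (\<integral>\<^sup>+x. \<integral>\<^sup>+y. ennreal (w (x, y) powr p) \<partial>\<nu> \<partial>\<mu>)"
    by (rule \<nu>.nn_integral_fst[symmetric]) measurable
  also have "... = (\<integral>\<^sup>+x. \<integral>\<^sup>+y. ennreal (u (x, y) powr p) \<partial>\<mu> \<partial>\<mu>)"
  proof (rule nn_integral_cong)
    fix x
    have "(\<lambda>y. ennreal (w (x, y) powr p)) \<in> borel_measurable borel"
      using pair_section_measurable[OF wm] by measurable
    from nn_integral_\<nu>[OF this] show "(\<integral>\<^sup>+y. ennreal (w (x, y) powr p) \<partial>\<nu>) = (\<integral>\<^sup>+y. ennreal (u (x, y) powr p) \<partial>\<mu>)"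
      by (simp add: w_def)
  qed
  finally have LP: "Lp_penalty p ?R \<pi> = power_integral u" .
  have "(\<integral>\<^sup>+z. ennreal (2 * bregman \<phi> (fst z) (S (snd z))) \<partial>\<pi>) =
      (\<integral>\<^sup>+x. \<integral>\<^sup>+y. ennreal (u (x, y)) * ennreal (2 * bregman \<phi> x y) \<partial>\<mu> \<partial>\<mu>)"
    by (subst int\<pi>) auto
  also have "... = gap_cost u"
    using u0 bregman_nonneg by (intro nn_integral_cong) (simp add: mult_ac flip: ennreal_mult')
  finally have TC: "transport_cost \<pi> = ennreal base_cost + gap_cost u"
    using transport_cost_split[OF \<pi>] by simp
  have "ROT \<epsilon> p \<mu> \<nu> \<le> transport_cost \<pi> + ennreal \<epsilon> * Lp_penalty p ?R \<pi>"
    unfolding ROT_def by (rule INF_lower[OF \<pi>])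
  then show ?thesis by (simp only: TC LP)
qed

text \<open>Convexity of the power at (1-t)\<cdot> a/(1-t)+t\<cdot> b/t. For small t the first summand keeps its
leading constant, and the second pays a large constant.\<close>

lemma sum_powr_convex_split:
  fixes a b t :: real
  assumes "0 \<le> a" "0 \<le> b" "0 < t" "t < 1"
  shows "(a + b) powr p \<le> (1 - t) powr (1 - p) * a powr p + t powr (1 - p) * b powr p"
proof (cases "a = 0 \<or> b = 0")
  case True
  have "1 \<le> s powr (1 - p)" if "0 < s" "s < 1" for s :: real
  proof -
    have "1 powr (1 - p) \<le> s powr (1 - p)" using that p by (intro powr_mono2') auto
    then show ?thesis by simp
  qed
  from this[of t] this[of "1 - t"] have "1 \<le> t powr (1 - p)" "1 \<le> (1 - t) powr (1 - p)" using assms by auto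
  then have "1 * a powr p \<le> (1 - t) powr (1 - p) * a powr p" "1 * b powr p \<le> t powr (1 - p) * b powr p"
    by (intro mult_right_mono; simp)+
  then show ?thesis using True by auto
next
  case False
  have "convex_on {0<..} (\<lambda>x :: real. x powr p)" using p by (intro powr_convex) auto
  then have "((1 - t) *\<^sub>R (a / (1 - t)) + t *\<^sub>R (b / t)) powr p \<le> (1 - t) * (a / (1 - t)) powr p + t * (b / t) powr p"
    using assms False by (intro convex_onD) auto
  moreover have "(1 - t) *\<^sub>R (a / (1 - t)) + t *\<^sub>R (b / t) = a + b" using assms by simp
  moreover have "s * (c / s) powr p = s powr (1 - p) * c powr p" if "0 < s" "0 \<le> c" for s c :: real
    using that by (simp add: powr_divide powr_diff)
  ultimately show ?thesis using assms by simp
qed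

text \<open>The deficit \<open>v\<close> may be of order one on a small part of space, where the weight
\<open>W\<close> measures the cost. The threshold 2\<eta> is the deficit that the local plan leaves at density
points.\<close>

definition remainder_plan_bound :: "(real ^ 'n => real) => real => real => real => real => bool" where
  "remainder_plan_bound W \<kappa> \<eta> C \<delta> \<longleftrightarrow> (\<forall>v. v \<in> borel_measurable borel --> (\<forall>x. \<eta> \<le> v x \<and> v x \<le> 1) -->
     (\<exists>u. self_plan u v \<and>
       spread u + ennreal (\<epsilon>_of \<delta>) * power_integral u
       \<le> ennreal (\<delta>^2) * (ennreal \<kappa> + ennreal C * (\<integral>\<^sup>+x. ennreal (W x) * indicator {x. 2 * \<eta> < v x} x \<partial>\<mu>))))"

text \<open>The constant \<open>C\<close> may depend on \<kappa> and \<eta>. It multiplies an integral that can be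
made small after both have been fixed.\<close>

definition remainder_property :: bool where
  "remainder_property \<longleftrightarrow> (\<exists>W. W \<in> borel_measurable borel \<and> (\<forall>x. 1 \<le> W x) \<and> (\<integral>\<^sup>+x. ennreal (W x) \<partial>\<mu>) < \<infinity> \<and>
     (\<forall>\<kappa>>0. \<exists>\<eta> C \<delta>0. 0 < \<eta> \<and> \<eta> < 1 \<and> 0 \<le> C \<and> 0 < \<delta>0 \<and>
       (\<forall>\<delta>. 0 < \<delta> --> \<delta> < \<delta>0 --> remainder_plan_bound W \<kappa> \<eta> C \<delta>)))"

lemma section_cong_\<mu>:
  "h \<in> borel_measurable (borel :: ((real ^ 'n) \<times> (real ^ 'n)) measure) ==> (\<lambda>y. h (x, y)) \<in> borel_measurable \<mu>"
  using pair_section_measurable by (simp cong: measurable_cong_sets)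

lemma double_integral_add:
  assumes "h \<in> borel_measurable borel" "k \<in> borel_measurable borel"
  shows "double_integral (\<lambda>z. h z + k z) = double_integral h + double_integral (k :: _ => ennreal)"
proof -
  have m: "(\<lambda>x. \<integral>\<^sup>+y. h (x, y) \<partial>\<mu>) \<in> borel_measurable \<mu>" if "h \<in> borel_measurable borel" for h :: "_ => ennreal"
    using \<mu>.borel_measurable_nn_integral_fst[OF pair_borel_measurable[OF that sets_\<mu> sets_\<mu>]] .
  show ?thesis
    using assms by (simp add: nn_integral_add section_cong_\<mu> m)
qed

lemma double_integral_cmult:
  assumes "h \<in> borel_measurable borel"
  shows "double_integral (\<lambda>z. c * h z) = c * double_integral (h :: _ => ennreal)"
proof -
  have m: "(\<lambda>x. \<integral>\<^sup>+y. h (x, y) \<partial>\<mu>) \<in> borel_measurable \<mu>"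
    using \<mu>.borel_measurable_nn_integral_fst[OF pair_borel_measurable[OF assms sets_\<mu> sets_\<mu>]] .
  show ?thesis
    using assms by (simp add: nn_integral_cmult section_cong_\<mu> m)
qed

lemma double_integral_mono:
  assumes "\<And>z. h z \<le> k z" shows "double_integral h \<le> double_integral (k :: _ => ennreal)"
  using assms by (intro nn_integral_mono)

lemma norm_diff_measurable [measurable]:
  "(\<lambda>z. (norm (fst z - snd z))^2) \<in> borel_measurable (borel :: ((real ^ 'n) \<times> (real ^ 'n)) measure)"
  by (intro borel_measurable_continuous_onI continuous_intros)

text \<open>The first plan is the main part and keeps a factor close to one when t is small; the second is estimated
crudely through the upper Hessian bound.\<close>

lemma ROT_le_split:
  assumes u1: "self_plan u1 v1" and u2: "self_plan u2 (\<lambda>x. 1 - v1 x)"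
    and v1: "\<And>x. 0 \<le> v1 x \<and> v1 x \<le> 1" and \<epsilon>: "0 < \<epsilon>" and t: "0 < t" "t < 1"
  shows "ROT \<epsilon> p \<mu> \<nu> \<le> ennreal base_cost +
    ennreal ((1 - t) powr (1 - p)) * (gap_cost u1
      + ennreal \<epsilon> * power_integral u1) +
    ennreal (\<sigma>M + t powr (1 - p)) * (spread u2
      + ennreal \<epsilon> * power_integral u2)"
proof -
  let ?s = "(1 - t) powr (1 - p)" and ?r = "t powr (1 - p)"
  let ?I1 = "gap_cost u1"
  let ?P1 = "power_integral u1"
  let ?I2 = "spread u2"
  let ?P2 = "power_integral u2"
  have m1 [measurable]: "u1 \<in> borel_measurable borel" and n1: "\<And>z. 0 \<le> u1 z"
    and m2 [measurable]: "u2 \<in> borel_measurable borel" and n2: "\<And>z. 0 \<le> u2 z"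
    using u1 u2 by (auto simp: self_plan_def)
  have "self_plan (\<lambda>z. u1 z + u2 z) (\<lambda>_. 1)"
    unfolding self_plan_def
  proof (intro conjI allI)
    have "AE x in \<mu>. (\<integral>\<^sup>+y. ennreal (u1 (x, y)) \<partial>\<mu>) = ennreal (v1 x)"
      "AE x in \<mu>. (\<integral>\<^sup>+y. ennreal (u2 (x, y)) \<partial>\<mu>) = ennreal (1 - v1 x)"
      using u1 u2 by (auto simp: self_plan_def)
    then show "AE x in \<mu>. (\<integral>\<^sup>+y. ennreal (u1 (x, y) + u2 (x, y)) \<partial>\<mu>) = ennreal 1"
    proof eventually_elim
      case (elim x)
      have "(\<integral>\<^sup>+y. ennreal (u1 (x, y) + u2 (x, y)) \<partial>\<mu>) = (\<integral>\<^sup>+y. ennreal (u1 (x, y)) + ennreal (u2 (x, y)) \<partial>\<mu>)"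
        using n1 n2 by (simp add: ennreal_plus)
      also have "... = (\<integral>\<^sup>+y. ennreal (u1 (x, y)) \<partial>\<mu>) + (\<integral>\<^sup>+y. ennreal (u2 (x, y)) \<partial>\<mu>)"
        using section_cong_\<mu>[OF m1] section_cong_\<mu>[OF m2] by (intro nn_integral_add) measurable
      also have "... = ennreal 1" using v1[of x] by (simp add: elim flip: ennreal_plus)
      finally show ?case .
    qed
    show "(\<lambda>z. u1 z + u2 z) \<in> borel_measurable borel" by measurable
    show "u1 (x, y) + u2 (x, y) = u1 (y, x) + u2 (y, x)" for x y using u1 u2 by (auto simp: self_plan_def)
  qed (use n1 n2 in auto)
  from ROT_le_self_plan[OF this \<epsilon>]
  have "ROT \<epsilon> p \<mu> \<nu> \<le> ennreal base_cost + double_integral (\<lambda>z. ennreal (2 * bregman \<phi> (fst z) (snd z) * (u1 z + u2 z)))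
    + ennreal \<epsilon> * double_integral (\<lambda>z. ennreal ((u1 z + u2 z) powr p))" .
  also have "double_integral (\<lambda>z. ennreal (2 * bregman \<phi> (fst z) (snd z) * (u1 z + u2 z))) \<le> ?I1 + ennreal \<sigma>M * ?I2"
  proof -
    have "double_integral (\<lambda>z. ennreal (2 * bregman \<phi> (fst z) (snd z) * (u1 z + u2 z))) \<le>
        double_integral (\<lambda>z. ennreal (2 * bregman \<phi> (fst z) (snd z) * u1 z) + ennreal \<sigma>M * ennreal ((norm (fst z - snd z))^2 * u2 z))"
    proof (rule double_integral_mono)
      fix z
      have "2 * bregman \<phi> (fst z) (snd z) * (u1 z + u2 z) \<le> 2 * bregman \<phi> (fst z) (snd z) * u1 z + \<sigma>M * ((norm (fst z - snd z))^2 * u2 z)"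
        using mult_right_mono[OF bregman_le[of "fst z" "snd z"] n2[of z]] by (simp add: algebra_simps)
      then have "ennreal (2 * bregman \<phi> (fst z) (snd z) * (u1 z + u2 z)) \<le>
          ennreal (2 * bregman \<phi> (fst z) (snd z) * u1 z + \<sigma>M * ((norm (fst z - snd z))^2 * u2 z))" by (rule ennreal_leI)
      also have "... = ennreal (2 * bregman \<phi> (fst z) (snd z) * u1 z) + ennreal \<sigma>M * ennreal ((norm (fst z - snd z))^2 * u2 z)"
        using n1[of z] n2[of z] bregman_nonneg[of "fst z" "snd z"] \<sigma>m_pos \<sigma>m_le
        by (subst ennreal_plus) (auto simp: ennreal_mult')
      finally show "ennreal (2 * bregman \<phi> (fst z) (snd z) * (u1 z + u2 z)) \<le>
         ennreal (2 * bregman \<phi> (fst z) (snd z) * u1 z) + ennreal \<sigma>M * ennreal ((norm (fst z - snd z))^2 * u2 z)" .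
    qed
    also have "... = ?I1 + double_integral (\<lambda>z. ennreal \<sigma>M * ennreal ((norm (fst z - snd z))^2 * u2 z))"
      by (rule double_integral_add) measurable
    also have "double_integral (\<lambda>z. ennreal \<sigma>M * ennreal ((norm (fst z - snd z))^2 * u2 z)) = ennreal \<sigma>M * ?I2"
      by (rule double_integral_cmult) measurable
    finally show ?thesis .
  qed
  also have "double_integral (\<lambda>z. ennreal ((u1 z + u2 z) powr p)) \<le> ennreal ?s * ?P1 + ennreal ?r * ?P2"
  proof -
    have "double_integral (\<lambda>z. ennreal ((u1 z + u2 z) powr p)) \<le>
        double_integral (\<lambda>z. ennreal ?s * ennreal (u1 z powr p) + ennreal ?r * ennreal (u2 z powr p))"
    proof (rule double_integral_mono)
      fix z
      have "ennreal ((u1 z + u2 z) powr p) \<le> ennreal (?s * u1 z powr p + ?r * u2 z powr p)"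
        by (intro ennreal_leI sum_powr_convex_split n1 n2 t)
      then show "ennreal ((u1 z + u2 z) powr p) \<le> ennreal ?s * ennreal (u1 z powr p) + ennreal ?r * ennreal (u2 z powr p)"
        by (simp add: ennreal_plus ennreal_mult')
    qed
    also have "... = double_integral (\<lambda>z. ennreal ?s * ennreal (u1 z powr p)) + double_integral (\<lambda>z. ennreal ?r * ennreal (u2 z powr p))"
      by (rule double_integral_add) measurable
    also have "double_integral (\<lambda>z. ennreal ?s * ennreal (u1 z powr p)) = ennreal ?s * ?P1"
      by (rule double_integral_cmult) measurable
    also have "double_integral (\<lambda>z. ennreal ?r * ennreal (u2 z powr p)) = ennreal ?r * ?P2"
      by (rule double_integral_cmult) measurable
    finally show ?thesis .
  qed
  finally have "ROT \<epsilon> p \<mu> \<nu> \<le> ennreal base_cost + (?I1 + ennreal \<sigma>M * ?I2) + ennreal \<epsilon> * (ennreal ?s * ?P1 + ennreal ?r * ?P2)"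
    by (simp add: add_mono mult_left_mono add_left_mono)
  also have "... = ennreal base_cost + (?I1 + ennreal ?s * (ennreal \<epsilon> * ?P1)) + (ennreal \<sigma>M * ?I2 + ennreal ?r * (ennreal \<epsilon> * ?P2))"
    by (simp add: distrib_left add_ac mult_ac)
  also have "... \<le> ennreal base_cost + ennreal ?s * (?I1 + ennreal \<epsilon> * ?P1) + ennreal (\<sigma>M + ?r) * (?I2 + ennreal \<epsilon> * ?P2)"
  proof (intro add_mono order_refl)
    have "1 = 1 powr (1 - p)" by simp
    also have "1 powr (1 - p) \<le> ?s" using t p by (intro powr_mono2') auto
    finally have "1 \<le> ennreal ?s" by simp
    then have "1 * ?I1 \<le> ennreal ?s * ?I1" by (rule mult_right_mono) simp
    then show "?I1 + ennreal ?s * (ennreal \<epsilon> * ?P1) \<le> ennreal ?s * (?I1 + ennreal \<epsilon> * ?P1)"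
      by (simp add: distrib_left add_right_mono)
    have "ennreal \<sigma>M \<le> ennreal (\<sigma>M + ?r)" "ennreal ?r \<le> ennreal (\<sigma>M + ?r)"
      using \<sigma>m_pos \<sigma>m_le by (auto intro: ennreal_leI)
    then show "ennreal \<sigma>M * ?I2 + ennreal ?r * (ennreal \<epsilon> * ?P2) \<le> ennreal (\<sigma>M + ?r) * (?I2 + ennreal \<epsilon> * ?P2)"
      unfolding distrib_left by (intro add_mono mult_right_mono) auto
  qed
  finally show ?thesis .
qed

lemma \<epsilon>_of_pos: "0 < \<delta> ==> 0 < \<epsilon>_of \<delta>" by (simp add: \<epsilon>_of_def)

lemma self_plan_zero: "self_plan (\<lambda>_. 0) (\<lambda>_. 0)" by (simp add: self_plan_def)

text \<open>The remainder plan for v=1 is itself an admissible plan, with excess of order \<delta>^2; the lower bound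
then forces K to be finite.\<close>

theorem K_fun_finite:
  assumes "remainder_property"
  shows "K_fun \<mu> \<nu> \<phi> p < \<infinity>"
proof -
  obtain W where W [measurable]: "W \<in> borel_measurable borel" and W_fin: "(\<integral>\<^sup>+x. ennreal (W x) \<partial>\<mu>) < \<infinity>"
    and "\<forall>\<kappa>>0. \<exists>\<eta> C \<delta>0. 0 < \<eta> \<and> \<eta> < 1 \<and> 0 \<le> C \<and> 0 < \<delta>0 \<and>
       (\<forall>\<delta>. 0 < \<delta> --> \<delta> < \<delta>0 --> remainder_plan_bound W \<kappa> \<eta> C \<delta>)"
    using assms unfolding remainder_property_def by auto
  from this(3)[rule_format, of 1] obtain \<eta> C \<delta>0 where \<eta>: "0 < \<eta>" "\<eta> < 1" and "0 \<le> C" and \<delta>0: "0 < \<delta>0"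
    and b: "\<And>\<delta>. 0 < \<delta> ==> \<delta> < \<delta>0 ==> remainder_plan_bound W 1 \<eta> C \<delta>" by auto
  define B where "B = ennreal (\<sigma>M + (1 / 2) powr (1 - p)) * (ennreal 1 + ennreal C * (\<integral>\<^sup>+x. ennreal (W x) \<partial>\<mu>))"
  have B: "B < \<infinity>" using W_fin by (simp add: B_def ennreal_mult_less_top)
  have le: "lower_functional \<delta> \<le> B" if \<delta>: "0 < \<delta>" "\<delta> < \<delta>0" for \<delta>
  proof -
    obtain u where u: "self_plan u (\<lambda>_. 1)" and ub:
      "spread u + ennreal (\<epsilon>_of \<delta>) * power_integral u
       \<le> ennreal (\<delta>^2) * (ennreal 1 + ennreal C * (\<integral>\<^sup>+x. ennreal (W x) * indicator {x. 2 * \<eta> < 1} x \<partial>\<mu>))"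
      using b[OF \<delta>, unfolded remainder_plan_bound_def, rule_format, of "\<lambda>_. 1"] \<eta> by auto
    let ?X = "spread u + ennreal (\<epsilon>_of \<delta>) * power_integral u"
    \<comment> \<open>Splitting lemma with first part zero and \<open>t = 1 / 2\<close>.\<close>
    have "ennreal base_cost + ennreal (\<delta>^2) * lower_functional \<delta> \<le> ROT (\<epsilon>_of \<delta>) p \<mu> \<nu>"
      by (rule ROT_ge_scaled[OF \<delta>(1)])
    also have "... \<le> ennreal base_cost + ennreal (\<sigma>M + (1 / 2) powr (1 - p)) * ?X"
      using ROT_le_split[OF self_plan_zero _ _ \<epsilon>_of_pos[OF \<delta>(1)], of u "1 / 2"] u p by simp
    also have "... \<le> ennreal base_cost + ennreal (\<delta>^2) * B"
    proof (rule add_left_mono)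
      have "(\<integral>\<^sup>+x. ennreal (W x) * indicator {x. 2 * \<eta> < 1} x \<partial>\<mu>) \<le> (\<integral>\<^sup>+x. ennreal (W x) \<partial>\<mu>)"
        by (intro nn_integral_mono) (auto simp: indicator_def)
      then have "?X \<le> ennreal (\<delta>^2) * (ennreal 1 + ennreal C * (\<integral>\<^sup>+x. ennreal (W x) \<partial>\<mu>))"
        by (intro order_trans[OF ub] mult_left_mono add_left_mono) auto
      then show "ennreal (\<sigma>M + (1 / 2) powr (1 - p)) * ?X \<le> ennreal (\<delta>^2) * B"
        unfolding B_def mult.left_commute[of "ennreal (\<delta>^2)"] by (rule mult_left_mono) simp
    qed
    finally have "ennreal (\<delta>^2) * lower_functional \<delta> \<le> ennreal (\<delta>^2) * B"
      by (simp add: ennreal_add_left_cancel_le)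
    then show ?thesis using \<delta>(1) by (subst (asm) ennreal_mult_le_mult_iff) auto
  qed
  define \<delta> where "\<delta> n = \<delta>0 / 2 * inverse (real (Suc n))" for n
  have lim: "\<delta> \<longlonglongrightarrow> 0" unfolding \<delta>_def[abs_def] by (intro tendsto_mult_right_zero LIMSEQ_inverse_real_of_nat)
  have pos: "0 < \<delta> n" for n using \<delta>0 by (simp add: \<delta>_def)
  have small: "\<delta> n < \<delta>0" for n
  proof -
    have "\<delta>0 / 2 * inverse (real (Suc n)) \<le> \<delta>0 / 2 * 1" using \<delta>0 by (intro mult_left_mono) (auto simp: inverse_le_1_iff)
    then show ?thesis using \<delta>0 by (simp add: \<delta>_def)
  qed
  have "ennreal (C_const TYPE('n) p) * K_fun \<mu> \<nu> \<phi> p \<le> liminf (\<lambda>n. lower_functional (\<delta> n))"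
    by (rule lower_functional_liminf[OF lim pos])
  also have "... \<le> liminf (\<lambda>n. B)"
    using le[OF pos small] by (intro Liminf_mono always_eventually) auto
  also have "... = B" by (simp add: Liminf_const)
  finally have "ennreal (C_const TYPE('n) p) * K_fun \<mu> \<nu> \<phi> p < \<infinity>" using B by (rule le_less_trans)
  then show ?thesis using C_const_pos[OF p, where ?'n = 'n] by (auto simp: ennreal_mult_less_top)
qed

end

section \<open>Classes of nearly constant density and Hessian\<close>

context transport_setting
begin

text \<open>On the ball the form at a point is at most 1+e times the form at the centre, while the determinant may not
drop much; these are the directions needed for an upper bound.\<close>

definition comparable_on :: "real => real ^ 'n => real => bool" where
  "comparable_on e x0 r \<longleftrightarrow> (\<forall>\<xi>\<in>ball x0 r. (\<forall>v. v \<bullet> (A \<xi> *v v) \<le> (1 + e) * (v \<bullet> (A x0 *v v))) \<and> det (A x0) \<le> (1 + e) * det (A \<xi>))"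

lemma ex_comparable_ball:
  assumes "0 < e"
  shows "\<exists>r>0. comparable_on e x0 (2 * r)"
proof -
  let ?s = "\<lambda>\<xi>. \<Sum>i\<in>UNIV. \<Sum>j\<in>UNIV. \<bar>A \<xi> $ i $ j - A x0 $ i $ j\<bar>"
  have "continuous_on UNIV ?s" by (intro continuous_intros continuous_on_hessian)
  then have "isCont ?s x0" by (simp add: continuous_on_eq_continuous_at)
  then have "(?s \<longlongrightarrow> ?s x0) (at x0)" by (simp add: isCont_def)
  then have 1: "\<forall>\<^sub>F \<xi> in at x0. ?s \<xi> < e * \<sigma>m" using assms \<sigma>m_pos by (intro order_tendstoD) auto
  have "isCont (\<lambda>\<xi>. (1 + e) * det (A \<xi>)) x0"
    using det_hessian_continuous[of UNIV] by (intro continuous_intros) (simp add: continuous_on_eq_continuous_at)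
  then have "((\<lambda>\<xi>. (1 + e) * det (A \<xi>)) \<longlongrightarrow> (1 + e) * det (A x0)) (at x0)" by (simp add: isCont_def)
  moreover have "det (A x0) < (1 + e) * det (A x0)" using assms det_hessian_pos[of x0] by simp
  ultimately have 2: "\<forall>\<^sub>F \<xi> in at x0. det (A x0) < (1 + e) * det (A \<xi>)" by (rule order_tendstoD(1))
  obtain d where d: "0 < d" "\<And>\<xi>. \<xi> \<noteq> x0 ==> dist \<xi> x0 < d ==> ?s \<xi> < e * \<sigma>m \<and> det (A x0) < (1 + e) * det (A \<xi>)"
    using eventually_conj[OF 1 2] unfolding eventually_at by auto
  have "comparable_on e x0 (2 * (d / 2))"
    unfolding comparable_on_def
  proof (intro ballI conjI allI)
    fix \<xi> assume \<xi>: "\<xi> \<in> ball x0 (2 * (d / 2))"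
    have s: "?s \<xi> \<le> e * \<sigma>m" "det (A x0) \<le> (1 + e) * det (A \<xi>)"
      using d(2)[of \<xi>] \<xi> assms \<sigma>m_pos det_hessian_pos[of x0] by (cases "\<xi> = x0"; force simp: dist_commute)+
    then show "det (A x0) \<le> (1 + e) * det (A \<xi>)" by simp
    fix v :: "real ^ 'n"
    have "v \<bullet> (A \<xi> *v v) - v \<bullet> (A x0 *v v) = (\<Sum>i\<in>UNIV. \<Sum>j\<in>UNIV. (A \<xi> $ i $ j - A x0 $ i $ j) * (v $ i * v $ j))"
      by (simp add: inner_vec_def matrix_vector_mult_def sum_distrib_left sum_subtractf[symmetric] algebra_simps)
    also have "... \<le> (\<Sum>i\<in>UNIV. \<Sum>j\<in>UNIV. \<bar>A \<xi> $ i $ j - A x0 $ i $ j\<bar> * (norm v)^2)"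
    proof (intro sum_mono)
      fix i j
      have "\<bar>v $ i\<bar> * \<bar>v $ j\<bar> \<le> norm v * norm v" by (intro mult_mono component_le_norm_cart) auto
      then have "\<bar>A \<xi> $ i $ j - A x0 $ i $ j\<bar> * \<bar>v $ i * v $ j\<bar> \<le> \<bar>A \<xi> $ i $ j - A x0 $ i $ j\<bar> * (norm v)^2"
        by (intro mult_left_mono) (auto simp: abs_mult power2_eq_square)
      then show "(A \<xi> $ i $ j - A x0 $ i $ j) * (v $ i * v $ j) \<le> \<bar>A \<xi> $ i $ j - A x0 $ i $ j\<bar> * (norm v)^2"
        unfolding abs_mult[of _ "v $ i * v $ j", symmetric] by (rule order_trans[OF abs_ge_self])
    qed
    also have "... = ?s \<xi> * (norm v)^2" by (simp add: sum_distrib_right)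
    also have "... \<le> e * \<sigma>m * (norm v)^2" using s(1) by (rule mult_right_mono) simp
    also have "... \<le> e * (v \<bullet> (A x0 *v v))" using hessian_ge[of v x0] assms by (simp add: mult.assoc)
    finally show "v \<bullet> (A \<xi> *v v) \<le> (1 + e) * (v \<bullet> (A x0 *v v))" by (simp add: algebra_simps)
  qed
  then show ?thesis using d(1) by (intro exI[of _ "d / 2"]) auto
qed

text \<open>The sets where f is within a factor 1+e and the Hessian comparable to that at a centre cover {f>0}. A
countable subcover (Lindelof for the points (f(x),x)) is made disjoint, and finitely many classes carry most of the
W-weighted mass.\<close>

lemma classes_exist:
  assumes e: "0 < e" and W [measurable]: "W \<in> borel_measurable borel" and W_fin: "(\<integral>\<^sup>+x. ennreal (W x) \<partial>\<mu>) < \<infinity>"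
    and \<tau>: "0 < \<tau>"
  shows "\<exists>(N :: nat) E c xc r. (\<forall>j. E j \<in> sets borel \<and> 0 < c j \<and> 0 < r j \<and> E j \<subseteq> ball (xc j) (r j) \<and>
      (\<forall>x\<in>E j. c j \<le> f x \<and> f x \<le> (1 + e) * c j) \<and> comparable_on e (xc j) (2 * r j)) \<and> disjoint_family E \<and>
      (\<integral>\<^sup>+x. ennreal (W x) * indicator (- (\<Union>j<N. E j)) x \<partial>\<mu>) \<le> ennreal \<tau>"
proof -
  obtain R where R: "\<And>x0. 0 < R x0" "\<And>x0. comparable_on e x0 (2 * R x0)"
    using ex_comparable_ball[OF e] by metis
  define P where "P = {x. 0 < f x}"
  define cc where "cc x0 = f x0 / (1 + e / 2)" for x0
  have cc: "0 < cc x" "cc x < f x" "f x < (1 + e) * cc x" if "x \<in> P" for x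
    using that e by (auto simp: cc_def P_def field_simps)
  \<comment> \<open>Rectangles in (density, position) space; the density itself need not be continuous.\<close>
  define Op where "Op x0 = {cc x0<..<(1 + e) * cc x0} \<times> ball x0 (R x0)" for x0
  have "P \<noteq> {}"
  proof
    assume "P = {}"
    then have "AE x in \<mu>. False" using density_positive_AE by (auto simp: P_def)
    then show False by simp
  qed
  obtain F where F: "F \<subseteq> Op ` P" "countable F" "\<Union>F = \<Union>(Op ` P)"
    by (rule Lindelof[of "Op ` P"]) (auto simp: Op_def intro: open_Times)
  then obtain X where X: "countable X" "X \<subseteq> P" "F = Op ` X"
    using countable_subset_image[THEN iffD1, OF conjI[OF F(2,1)]] by blast
  have "X \<noteq> {}"
  proof
    assume "X = {}"
    then have "\<Union>(Op ` P) = {}" using F(3) X(3) by simp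
    moreover obtain x where "x \<in> P" using \<open>P \<noteq> {}\<close> by auto
    moreover have "(f x, x) \<in> Op x" using cc[OF \<open>x \<in> P\<close>] R(1) by (simp add: Op_def)
    ultimately show False by blast
  qed
  define xs where "xs = from_nat_into X"
  have xs: "range xs = X" "\<And>n. xs n \<in> P"
    using X(1,2) \<open>X \<noteq> {}\<close> by (auto simp: xs_def range_from_nat_into from_nat_into subset_iff)
  define D where "D n = {x. (f x, x) \<in> Op (xs n)}" for n
  have Dm: "D n \<in> sets borel" for n
  proof -
    have "D n = {x. cc (xs n) < f x \<and> f x < (1 + e) * cc (xs n) \<and> x \<in> ball (xs n) (R (xs n))}"
      by (auto simp: D_def Op_def)
    also have "... = {x. cc (xs n) < f x} \<inter> {x. f x < (1 + e) * cc (xs n)} \<inter> ball (xs n) (R (xs n))" by auto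
    also have "... \<in> sets borel" by (intro sets.Int borel_open[OF open_ball]) measurable
    finally show ?thesis .
  qed
  define E where "E = disjointed D"
  have Em: "E n \<in> sets borel" for n
  proof -
    have "range D \<subseteq> sets borel" using Dm by blast
    then have "range (disjointed D) \<subseteq> sets borel" by (rule sets.range_disjointed_sets)
    then show ?thesis unfolding E_def by blast
  qed
  have ED: "E n \<subseteq> D n" for n unfolding E_def by (rule disjointed_subset)
  have UE: "(\<Union>n. E n) = (\<Union>n. D n)" unfolding E_def by (rule UN_disjointed_eq)
  have cover: "x \<in> (\<Union>n. E n)" if "0 < f x" for x
  proof -
    have "x \<in> P" using that by (simp add: P_def)
    then have "(f x, x) \<in> Op x" using cc[of x] R(1) by (simp add: Op_def)
    then have "(f x, x) \<in> \<Union>F" using F(3) \<open>x \<in> P\<close> by blast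
    then obtain y where y: "y \<in> X" "(f x, x) \<in> Op y" unfolding X(3) by blast
    then obtain n where "y = xs n" using xs(1) by (metis rangeE)
    then have "x \<in> D n" using y(2) by (simp only: D_def mem_Collect_eq)
    then have "x \<in> (\<Union>n. D n)" by blast
    then show ?thesis by (simp only: UE)
  qed
  have "(\<lambda>N. \<integral>\<^sup>+x. ennreal (W x) * indicator (- (\<Union>j<N. E j)) x \<partial>\<mu>) \<longlonglongrightarrow> (\<integral>\<^sup>+x. 0 \<partial>\<mu>)"
  proof (rule nn_integral_dominated_convergence[where w = "\<lambda>x. ennreal (W x)"])
    fix N :: nat
    have "- (\<Union>j<N. E j) \<in> sets borel" using Em by (intro borel_comp sets.finite_UN) auto
    then have "(\<lambda>x. indicator (- (\<Union>j<N. E j)) x :: ennreal) \<in> borel_measurable borel"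
      by (rule borel_measurable_indicator)
    then have "(\<lambda>x. ennreal (W x) * indicator (- (\<Union>j<N. E j)) x) \<in> borel_measurable borel"
      by (rule borel_measurable_times_ennreal[rotated]) measurable
    then show "(\<lambda>x. ennreal (W x) * indicator (- (\<Union>j<N. E j)) x) \<in> borel_measurable \<mu>"
      by (simp only: measurable_cong_sets[OF sets_\<mu> refl])
    show "AE x in \<mu>. ennreal (W x) * indicator (- (\<Union>j<N. E j)) x \<le> ennreal (W x)"
      by (intro AE_I2) (simp split: split_indicator)
  next
    show "AE x in \<mu>. (\<lambda>N. ennreal (W x) * indicator (- (\<Union>j<N. E j)) x) \<longlonglongrightarrow> 0"
      using density_positive_AE
    proof eventually_elim
      case (elim x)
      then obtain n where n: "x \<in> E n" using cover by auto
      have "\<forall>\<^sub>F N in sequentially. ennreal (W x) * indicator (- (\<Union>j<N. E j)) x = 0"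
        unfolding eventually_sequentially
      proof (intro exI[of _ "Suc n"] allI impI)
        fix N assume "Suc n \<le> N"
        then have "x \<notin> - (\<Union>j<N. E j)" using n by auto
        then have "indicator (- (\<Union>j<N. E j)) x = (0 :: ennreal)" by (rule indicator_simps(2))
        then show "ennreal (W x) * indicator (- (\<Union>j<N. E j)) x = 0" by (simp only: mult_zero_right)
      qed
      then show ?case by (rule tendsto_eventually)
    qed
  qed (use W_fin in \<open>simp_all add: measurable_cong_sets[OF sets_\<mu> refl]\<close>)
  then have "\<forall>\<^sub>F N in sequentially. (\<integral>\<^sup>+x. ennreal (W x) * indicator (- (\<Union>j<N. E j)) x \<partial>\<mu>) < ennreal \<tau>"
    by (rule order_tendstoD) (use \<tau> in simp)
  then obtain N :: nat where N: "(\<integral>\<^sup>+x. ennreal (W x) * indicator (- (\<Union>j<N. E j)) x \<partial>\<mu>) < ennreal \<tau>"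
    by (rule eventually_sequentially[THEN iffD1, THEN exE]) blast
  show ?thesis
  proof (intro exI conjI allI ballI)
    fix j
    show "E j \<in> sets borel" by (rule Em)
    show "0 < cc (xs j)" by (rule cc[OF xs(2)])
    show "0 < R (xs j)" by (rule R)
    show "E j \<subseteq> ball (xs j) (R (xs j))" using ED[of j] by (auto simp: D_def Op_def)
    show "comparable_on e (xs j) (2 * R (xs j))" by (rule R)
    fix x assume "x \<in> E j"
    then have "x \<in> D j" using ED by blast
    then show "cc (xs j) \<le> f x" "f x \<le> (1 + e) * cc (xs j)" by (auto simp: D_def Op_def)
  next
    show "disjoint_family E" unfolding E_def by (rule disjoint_family_disjointed)
    show "(\<integral>\<^sup>+x. ennreal (W x) * indicator (- (\<Union>j<N. E j)) x \<partial>\<mu>) \<le> ennreal \<tau>" using N by simp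
  qed
qed

end

section \<open>The local plan\<close>

text \<open>Finitely many classes with centre \<open>xc j\<close>, radius \<open>r j\<close> and density between
\<open>c j\<close> and \<open>(1 + e) * c j\<close>; \<open>\<eta>\<close> is the deficit that the local plan leaves
everywhere, so that the remainder stays bounded away from zero.\<close>

locale local_classes = transport_setting \<phi> \<sigma>m \<sigma>M \<mu> \<nu> p
  for \<phi> :: "real ^ 'n => real" and \<sigma>m \<sigma>M :: real and \<mu> \<nu> :: "(real ^ 'n) measure" and p :: real +
  fixes e \<eta> :: real and N :: nat and E :: "nat => (real ^ 'n) set" and c :: "nat => real"
    and xc :: "nat => real ^ 'n" and r :: "nat => real"
  assumes e: "0 < e" "e < \<eta>" and \<eta>: "\<eta> < 1"
    and E_sets [measurable]: "\<And>j. E j \<in> sets borel"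
    and c: "\<And>j. 0 < c j" and r: "\<And>j. 0 < r j" and E_ball: "\<And>j. E j \<subseteq> ball (xc j) (r j)"
    and f_on_E: "\<And>j x. x \<in> E j ==> c j \<le> f x \<and> f x \<le> (1 + e) * c j"
    and comparable: "\<And>j. comparable_on e (xc j) (2 * r j)"
    and disj: "disjoint_family E"
begin

definition "tc j = c j / sqrt (det (A (xc j)))"
definition "ac j = opt_level TYPE('n) p (tc j)"
definition "U j = opt_profile p (c j) (ac j) (A (xc j))"
text \<open>The profile at scale \<open>\<delta>\<close>, with its mass preserved.\<close>

definition "V j \<delta> z = U j ((1 / \<delta>) *\<^sub>R z) / \<delta> ^ CARD('n)"
definition "k = (1 - \<eta>) / (1 + e)"
definition "u1 \<delta> z = k * (\<Sum>j<N. indicator (E j) (fst z) * indicator (E j) (snd z) * (V j \<delta> (snd z - fst z) / c j))"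
definition "m1 \<delta> x = enn2real (\<integral>\<^sup>+y. ennreal (u1 \<delta> (x, y)) \<partial>\<mu>)"

lemma tc_pos: "0 < tc j" using c det_hessian_pos by (simp add: tc_def)
lemma ac_pos: "0 < ac j" unfolding ac_def by (rule opt_level_pos[OF p tc_pos])
text \<open>The factor \<open>k\<close> makes the marginal at most 1-\<eta> although f may exceed \<open>c j\<close>;
where the class fills the scale, the marginal is at least 1-2\<eta>, as e<\<eta>.\<close>

lemma k_bounds: "0 < k" "k \<le> 1" "1 - 2 * \<eta> < k"
proof -
  show "0 < k" "k \<le> 1" using e \<eta> by (auto simp: k_def)
  have "(1 - 2 * \<eta>) * (1 + e) = 1 - \<eta> - (\<eta> - e) - 2 * \<eta> * e" by (simp add: algebra_simps)
  also have "... < 1 - \<eta>" using e by (smt (verit) mult_pos_pos)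
  finally show "1 - 2 * \<eta> < k" using e by (simp add: k_def field_simps)
qed

lemma U_nonneg: "0 \<le> U j z" by (simp add: U_def opt_profile_def)
lemma V_nonneg: "0 < \<delta> ==> 0 \<le> V j \<delta> z" by (simp add: V_def U_nonneg)

lemma U_measurable [measurable]: "U j \<in> borel_measurable borel"
proof -
  show ?thesis unfolding U_def opt_profile_def[abs_def] by measurable
qed

lemma V_measurable [measurable]:
  assumes [measurable]: "h \<in> borel_measurable M"
  shows "(\<lambda>z. V j \<delta> (h z)) \<in> borel_measurable M"
  unfolding V_def by measurable

lemma U_even: "U j (- z) = U j z"
proof -
  have "A (xc j) *v (- z) = - (A (xc j) *v z)"
    by (metis matrix_vector_mult_scaleR scaleR_minus1_left)
  then show ?thesis by (simp add: U_def opt_profile_def)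
qed

lemma V_even: "V j \<delta> (x - y) = V j \<delta> (y - x)"
  using U_even[of j "(1 / \<delta>) *\<^sub>R (x - y)"] by (simp add: V_def scaleR_diff_right)

lemma U_mass: "(\<integral>\<^sup>+z. ennreal (U j z) \<partial>lborel) = 1"
  unfolding U_def by (rule opt_profile_mass[OF p hessian_symmetric hessian_pos c tc_def ac_def])

lemma U_value: "(\<integral>\<^sup>+z. ennreal ((z \<bullet> (A (xc j) *v z)) * U j z + c j powr (1 - p) * U j z powr p) \<partial>lborel)
    = ennreal (C_const TYPE('n) p * tc j powr (- scaling_exponent TYPE('n) p))"
  unfolding U_def by (rule opt_profile_value[OF p hessian_symmetric hessian_pos c tc_def ac_def])

definition "\<rho> j = sqrt (ac j / \<sigma>m)"
definition "Umax j = (ac j / (p * c j powr (1 - p))) powr (1 / (p - 1))"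

lemma \<rho>_pos: "0 < \<rho> j" using ac_pos \<sigma>m_pos by (simp add: \<rho>_def)

lemma U_support: "U j z \<noteq> 0 ==> norm z \<le> \<rho> j"
proof (rule ccontr)
  assume "U j z \<noteq> 0" and n: "\<not> norm z \<le> \<rho> j"
  then have "max 0 (ac j - z \<bullet> (A (xc j) *v z)) \<noteq> 0" by (auto simp: U_def opt_profile_def)
  then have "z \<bullet> (A (xc j) *v z) < ac j" by (auto simp: max_def split: if_splits)
  then have "\<sigma>m * (norm z)^2 < ac j" using hessian_ge[of z "xc j"] by linarith
  then have "(norm z)^2 < ac j / \<sigma>m" using \<sigma>m_pos by (simp add: field_simps)
  moreover have "(\<rho> j)^2 < (norm z)^2" using n \<rho>_pos[of j] by (intro power_strict_mono) auto
  moreover have "(\<rho> j)^2 = ac j / \<sigma>m" using ac_pos[of j] \<sigma>m_pos by (simp add: \<rho>_def)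
  ultimately show False by linarith
qed

lemma U_le: "U j z \<le> Umax j"
proof -
  have "0 \<le> z \<bullet> (A (xc j) *v z)" by (rule hessian_nonneg)
  then have "max 0 (ac j - z \<bullet> (A (xc j) *v z)) / (p * c j powr (1 - p)) \<le> ac j / (p * c j powr (1 - p))"
    using ac_pos[of j] p by (intro divide_right_mono) auto
  then show ?thesis unfolding U_def opt_profile_def Umax_def using p by (intro powr_mono2) auto
qed

lemma nn_integral_V:
  assumes \<delta>: "0 < \<delta>" and [measurable]: "h \<in> borel_measurable borel"
  shows "(\<integral>\<^sup>+y. h y * ennreal (V j \<delta> (y - x)) \<partial>lborel) = (\<integral>\<^sup>+w. h (x + \<delta> *\<^sub>R w) * ennreal (U j w) \<partial>lborel)"
proof -
  have "(\<integral>\<^sup>+y. h y * ennreal (V j \<delta> (y - x)) \<partial>lborel) =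
      ennreal (\<delta> ^ CARD('n)) * (\<integral>\<^sup>+w. h (x + \<delta> *\<^sub>R w) * ennreal (V j \<delta> (\<delta> *\<^sub>R w)) \<partial>lborel)"
    using nn_integral_lborel_affine[OF \<delta>, of "\<lambda>y. h y * ennreal (V j \<delta> (y - x))" x] by simp
  also have "... = (\<integral>\<^sup>+w. ennreal (\<delta> ^ CARD('n)) * (h (x + \<delta> *\<^sub>R w) * ennreal (V j \<delta> (\<delta> *\<^sub>R w))) \<partial>lborel)"
    by (rule nn_integral_cmult[symmetric]) measurable
  also have "... = (\<integral>\<^sup>+w. h (x + \<delta> *\<^sub>R w) * ennreal (U j w) \<partial>lborel)"
  proof (rule nn_integral_cong)
    fix w :: "real ^ 'n"
    have "ennreal (\<delta> ^ CARD('n)) * ennreal (V j \<delta> (\<delta> *\<^sub>R w)) = ennreal (\<delta> ^ CARD('n) * V j \<delta> (\<delta> *\<^sub>R w))"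
      using \<delta> by (intro ennreal_mult'[symmetric]) simp
    also have "\<delta> ^ CARD('n) * V j \<delta> (\<delta> *\<^sub>R w) = U j w" using \<delta> by (simp add: V_def)
    finally show "ennreal (\<delta> ^ CARD('n)) * (h (x + \<delta> *\<^sub>R w) * ennreal (V j \<delta> (\<delta> *\<^sub>R w))) = h (x + \<delta> *\<^sub>R w) * ennreal (U j w)"
      by (simp only: mult.left_commute[of _ "h _"])
  qed
  finally show ?thesis .
qed

lemma V_mass: "0 < \<delta> ==> (\<integral>\<^sup>+y. ennreal (V j \<delta> (y - x)) \<partial>lborel) = 1"
  using nn_integral_V[of \<delta> "\<lambda>_. 1" j x] by (simp add: U_mass)

lemma u1_measurable [measurable]: "u1 \<delta> \<in> borel_measurable borel"
proof -
  have [measurable]: "(\<lambda>z :: (real ^ 'n) \<times> (real ^ 'n). indicator (E j) (fst z) :: real) \<in> borel_measurable borel"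
    "(\<lambda>z :: (real ^ 'n) \<times> (real ^ 'n). indicator (E j) (snd z) :: real) \<in> borel_measurable borel" for j
    subgoal by (rule measurable_compose[OF fst_borel_measurable borel_measurable_indicator[OF E_sets[of j]]])
    subgoal by (rule measurable_compose[OF snd_borel_measurable borel_measurable_indicator[OF E_sets[of j]]])
    done
  show ?thesis unfolding u1_def by measurable
qed

lemma u1_nonneg: "0 < \<delta> ==> 0 \<le> u1 \<delta> z"
  unfolding u1_def using k_bounds V_nonneg[of \<delta>] less_imp_le[OF c]
  by (intro mult_nonneg_nonneg sum_nonneg divide_nonneg_nonneg) auto

lemma u1_symmetric: "u1 \<delta> (x, y) = u1 \<delta> (y, x)"
  unfolding u1_def by (simp add: V_even[of _ \<delta> x y] mult_ac)

lemma u1_on_class: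
  assumes "j < N" "x \<in> E j"
  shows "u1 \<delta> (x, y) = k * (indicator (E j) y * (V j \<delta> (y - x) / c j))"
proof -
  have "(\<Sum>i<N. indicator (E i) x * indicator (E i) y * (V i \<delta> (y - x) / c i)) =
      (\<Sum>i<N. if i = j then indicator (E j) y * (V j \<delta> (y - x) / c j) else 0)"
  proof (intro sum.cong refl)
    fix i
    show "indicator (E i) x * indicator (E i) y * (V i \<delta> (y - x) / c i) =
        (if i = j then indicator (E j) y * (V j \<delta> (y - x) / c j) else 0)"
      using disj assms(2) by (auto simp: indicator_def disjoint_family_on_def)
  qed
  then show ?thesis using assms(1) by (simp add: u1_def)
qed

lemma u1_off_class: "x \<notin> (\<Union>j<N. E j) ==> u1 \<delta> (x, y) = 0"
  by (simp add: u1_def)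

text \<open>On its class the local plan is dominated by the scaled profile, since f\<le>(1+e)c_j.\<close>

lemma nn_integral_\<mu>_class:
  assumes "j < N" "x \<in> E j" and h [measurable]: "h \<in> borel_measurable borel" and "0 < \<delta>"
  shows "(\<integral>\<^sup>+y. h y * ennreal (u1 \<delta> (x, y)) \<partial>\<mu>) \<le> ennreal (1 - \<eta>) * (\<integral>\<^sup>+y. h y * ennreal (V j \<delta> (y - x)) \<partial>lborel)"
proof -
  have "(\<integral>\<^sup>+y. h y * ennreal (u1 \<delta> (x, y)) \<partial>\<mu>) = (\<integral>\<^sup>+y. ennreal (f y) * (h y * ennreal (u1 \<delta> (x, y))) \<partial>lborel)"
    using pair_section_measurable[OF u1_measurable] by (intro nn_integral_\<mu>) measurable
  also have "... \<le> (\<integral>\<^sup>+y. ennreal (1 - \<eta>) * (h y * ennreal (V j \<delta> (y - x))) \<partial>lborel)"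
  proof (rule nn_integral_mono)
    fix y
    have "f y * u1 \<delta> (x, y) \<le> (1 - \<eta>) * V j \<delta> (y - x)"
    proof (cases "y \<in> E j")
      case True
      have "f y * (k * (V j \<delta> (y - x) / c j)) = (f y / c j) * k * V j \<delta> (y - x)" by simp
      also have "... \<le> (1 + e) * k * V j \<delta> (y - x)"
        using f_on_E[OF True] c[of j] k_bounds V_nonneg[OF \<open>0 < \<delta>\<close>]
        by (intro mult_right_mono) (auto simp: pos_divide_le_eq)
      also have "(1 + e) * k = 1 - \<eta>" using e by (simp add: k_def)
      finally show ?thesis using True by (simp add: u1_on_class[OF assms(1,2)])
    next
      case False
      then show ?thesis using \<eta> V_nonneg[OF \<open>0 < \<delta>\<close>] by (simp add: u1_on_class[OF assms(1,2)])
    qed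
    then have "ennreal (f y) * ennreal (u1 \<delta> (x, y)) \<le> ennreal (1 - \<eta>) * ennreal (V j \<delta> (y - x))"
      using \<eta> by (simp add: ennreal_leI leb_density_nonneg flip: ennreal_mult')
    then have "h y * (ennreal (f y) * ennreal (u1 \<delta> (x, y))) \<le> h y * (ennreal (1 - \<eta>) * ennreal (V j \<delta> (y - x)))"
      by (rule mult_left_mono) simp
    then show "ennreal (f y) * (h y * ennreal (u1 \<delta> (x, y))) \<le> ennreal (1 - \<eta>) * (h y * ennreal (V j \<delta> (y - x)))"
      by (simp add: mult_ac)
  qed
  also have "... = ennreal (1 - \<eta>) * (\<integral>\<^sup>+y. h y * ennreal (V j \<delta> (y - x)) \<partial>lborel)"
    by (rule nn_integral_cmult) measurable
  finally show ?thesis .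
qed

lemma u1_marginal_le:
  assumes "0 < \<delta>"
  shows "(\<integral>\<^sup>+y. ennreal (u1 \<delta> (x, y)) \<partial>\<mu>) \<le> ennreal (1 - \<eta>)"
proof (cases "x \<in> (\<Union>j<N. E j)")
  case True
  then obtain j where j: "j < N" "x \<in> E j" by auto
  show ?thesis using nn_integral_\<mu>_class[OF j _ assms, of "\<lambda>_. 1"] by (simp add: V_mass[OF assms])
qed (simp add: u1_off_class)

lemma m1_bounds: "0 < \<delta> ==> 0 \<le> m1 \<delta> x \<and> m1 \<delta> x \<le> 1 - \<eta>"
  using u1_marginal_le[of \<delta> x] \<eta> by (auto simp: m1_def intro: enn2real_leI)

lemma m1_measurable [measurable]: "m1 \<delta> \<in> borel_measurable borel"
proof -
  have "(\<lambda>x. \<integral>\<^sup>+y. ennreal (u1 \<delta> (x, y)) \<partial>\<mu>) \<in> borel_measurable \<mu>"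
  proof (rule \<mu>.borel_measurable_nn_integral_fst)
    show "(\<lambda>z. ennreal (u1 \<delta> z)) \<in> borel_measurable (\<mu> \<Otimes>\<^sub>M \<mu>)"
      by (rule pair_borel_measurable) auto
  qed
  then have "(\<lambda>x. \<integral>\<^sup>+y. ennreal (u1 \<delta> (x, y)) \<partial>\<mu>) \<in> borel_measurable borel" by (simp cong: measurable_cong_sets)
  then show ?thesis unfolding m1_def[abs_def] by measurable
qed

lemma self_plan_u1:
  assumes "0 < \<delta>" shows "self_plan (u1 \<delta>) (m1 \<delta>)"
proof -
  have "(\<integral>\<^sup>+y. ennreal (u1 \<delta> (x, y)) \<partial>\<mu>) = ennreal (m1 \<delta> x)" for x
  proof -
    have "(\<integral>\<^sup>+y. ennreal (u1 \<delta> (x, y)) \<partial>\<mu>) < top" using u1_marginal_le[OF assms, of x] by (rule le_less_trans) simp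
    then show ?thesis by (simp add: m1_def)
  qed
  then show ?thesis using u1_nonneg[OF assms] u1_symmetric by (simp add: self_plan_def)
qed

text \<open>The segment from x+\<delta> w to x stays in the doubled ball, where the Hessian is comparable to that at
the centre.\<close>

lemma class_transport_le:
  assumes j: "j < N" "x \<in> E j" and \<delta>: "0 < \<delta>" "\<delta> * \<rho> j < r j"
  shows "(\<integral>\<^sup>+y. ennreal (2 * bregman \<phi> x y) * ennreal (u1 \<delta> (x, y)) \<partial>\<mu>) \<le>
    ennreal (\<delta>^2 * (1 + e)) * (\<integral>\<^sup>+w. ennreal ((w \<bullet> (A (xc j) *v w)) * U j w) \<partial>lborel)"
proof -
  have "(\<integral>\<^sup>+y. ennreal (2 * bregman \<phi> x y) * ennreal (u1 \<delta> (x, y)) \<partial>\<mu>) \<le>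
      ennreal (1 - \<eta>) * (\<integral>\<^sup>+y. ennreal (2 * bregman \<phi> x y) * ennreal (V j \<delta> (y - x)) \<partial>lborel)"
    by (rule nn_integral_\<mu>_class[OF j _ \<delta>(1)]) measurable
  also have "... \<le> 1 * (\<integral>\<^sup>+y. ennreal (2 * bregman \<phi> x y) * ennreal (V j \<delta> (y - x)) \<partial>lborel)"
    using e by (intro mult_right_mono) auto
  also have "... = (\<integral>\<^sup>+w. ennreal (2 * bregman \<phi> x (x + \<delta> *\<^sub>R w)) * ennreal (U j w) \<partial>lborel)"
    by (subst nn_integral_V[OF \<delta>(1)]) auto
  also have "... \<le> (\<integral>\<^sup>+w. ennreal (\<delta>^2 * (1 + e) * ((w \<bullet> (A (xc j) *v w)) * U j w)) \<partial>lborel)"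
  proof (rule nn_integral_mono)
    fix w :: "real ^ 'n"
    have "2 * bregman \<phi> x (x + \<delta> *\<^sub>R w) * U j w \<le> \<delta>^2 * (1 + e) * ((w \<bullet> (A (xc j) *v w)) * U j w)"
    proof (cases "U j w = 0")
      case False
      let ?y = "x + \<delta> *\<^sub>R w"
      obtain t where t: "t \<in> {0<..<1}" "2 * bregman \<phi> x ?y = (x - ?y) \<bullet> (A (?y + t *\<^sub>R (x - ?y)) *v (x - ?y))"
        using bregman_mean_value[of x ?y] by auto
      let ?\<xi> = "?y + t *\<^sub>R (x - ?y)"
      have "?\<xi> - x = ((1 - t) * \<delta>) *\<^sub>R w" by (simp add: algebra_simps)
      then have "norm (?\<xi> - x) = (1 - t) * (\<delta> * norm w)" using t \<delta> by (simp add: abs_mult)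
      also have "... \<le> 1 * (\<delta> * norm w)" using t \<delta> by (intro mult_right_mono) auto
      also have "... \<le> \<delta> * \<rho> j" using U_support[OF False] \<delta> by simp
      finally have "dist ?\<xi> x < r j" using \<delta> by (simp add: dist_norm)
      moreover have "dist (xc j) x < r j" using E_ball[of j] j by auto
      ultimately have "?\<xi> \<in> ball (xc j) (2 * r j)"
        using dist_triangle[of "xc j" ?\<xi> x] by (simp add: dist_commute)
      then have "(x - ?y) \<bullet> (A ?\<xi> *v (x - ?y)) \<le> (1 + e) * ((x - ?y) \<bullet> (A (xc j) *v (x - ?y)))"
        using comparable[of j] unfolding comparable_on_def by blast
      also have "(x - ?y) \<bullet> (A (xc j) *v (x - ?y)) = \<delta>^2 * (w \<bullet> (A (xc j) *v w))"
      proof -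
        have "x - ?y = (- \<delta>) *\<^sub>R w" by simp
        then show ?thesis by (simp only: matrix_vector_mult_scaleR inner_scaleR_left inner_scaleR_right) (simp add: power2_eq_square)
      qed
      finally have "2 * bregman \<phi> x ?y \<le> (1 + e) * (\<delta>^2 * (w \<bullet> (A (xc j) *v w)))"
        unfolding t(2) .
      from mult_right_mono[OF this U_nonneg[of j w]] show ?thesis by (simp add: mult_ac)
    qed simp
    then show "ennreal (2 * bregman \<phi> x (x + \<delta> *\<^sub>R w)) * ennreal (U j w) \<le> ennreal (\<delta>^2 * (1 + e) * ((w \<bullet> (A (xc j) *v w)) * U j w))"
      using bregman_nonneg by (simp add: ennreal_leI flip: ennreal_mult')
  qed
  also have "... = ennreal (\<delta>^2 * (1 + e)) * (\<integral>\<^sup>+w. ennreal ((w \<bullet> (A (xc j) *v w)) * U j w) \<partial>lborel)"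
  proof (rule nn_integral_cmult_real)
    show "(\<lambda>w. (w \<bullet> (A (xc j) *v w)) * U j w) \<in> borel_measurable lborel" by measurable
  qed (use e in simp)
  finally show ?thesis .
qed

text \<open>One factor of u^p serves as mass and the remaining power is estimated by the profile; the powers of
\<delta> again combine to \<delta>^2.\<close>

lemma class_penalty_le:
  assumes j: "j < N" "x \<in> E j" and \<delta>: "0 < \<delta>"
  shows "ennreal (\<epsilon>_of \<delta>) * (\<integral>\<^sup>+y. ennreal (u1 \<delta> (x, y) powr p) \<partial>\<mu>) \<le>
    ennreal (\<delta>^2) * (\<integral>\<^sup>+w. ennreal (c j powr (1 - p) * U j w powr p) \<partial>lborel)"
proof -
  let ?d = "real CARD('n)"
  have pw: "u1 \<delta> (x, y) powr p \<le> (c j powr (1 - p) * \<delta> powr (- ?d * (p - 1)) * U j ((1 / \<delta>) *\<^sub>R (y - x)) powr (p - 1)) * u1 \<delta> (x, y) / c j powr 0" if "y \<in> E j" for y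
  proof -
    have "u1 \<delta> (x, y) = k * (V j \<delta> (y - x) / c j)" using that by (simp add: u1_on_class[OF j])
    also have "... \<le> 1 * (V j \<delta> (y - x) / c j)" using k_bounds V_nonneg[OF \<delta>] c[of j] by (intro mult_right_mono) auto
    finally have "u1 \<delta> (x, y) \<le> V j \<delta> (y - x) / c j" by simp
    then have "u1 \<delta> (x, y) powr (p - 1) \<le> (V j \<delta> (y - x) / c j) powr (p - 1)"
      using u1_nonneg[OF \<delta>] p by (intro powr_mono2) auto
    also have "... = c j powr (1 - p) * \<delta> powr (- ?d * (p - 1)) * U j ((1 / \<delta>) *\<^sub>R (y - x)) powr (p - 1)"
    proof -
      have "(V j \<delta> (y - x) / c j) powr (p - 1) = U j ((1 / \<delta>) *\<^sub>R (y - x)) powr (p - 1) / (\<delta> ^ CARD('n)) powr (p - 1) / c j powr (p - 1)"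
        unfolding V_def using \<delta> c[of j] U_nonneg[of j] by (simp only: powr_divide)
      also have "(\<delta> ^ CARD('n)) powr (p - 1) = \<delta> powr (?d * (p - 1))" using \<delta> by (simp add: powr_realpow[symmetric] powr_powr)
      finally have q: "(V j \<delta> (y - x) / c j) powr (p - 1) = U j ((1 / \<delta>) *\<^sub>R (y - x)) powr (p - 1) / \<delta> powr (?d * (p - 1)) / c j powr (p - 1)" .
      have "- ?d * (p - 1) = - (?d * (p - 1))" "1 - p = - (p - 1)" by simp_all
      then have "\<delta> powr (- ?d * (p - 1)) = inverse (\<delta> powr (?d * (p - 1)))" "c j powr (1 - p) = inverse (c j powr (p - 1))"
        by (simp_all only: powr_minus)
      then show ?thesis unfolding q by (simp only: divide_inverse mult_ac)
    qed
    finally have "u1 \<delta> (x, y) powr (p - 1) * u1 \<delta> (x, y) \<le> (c j powr (1 - p) * \<delta> powr (- ?d * (p - 1)) * U j ((1 / \<delta>) *\<^sub>R (y - x)) powr (p - 1)) * u1 \<delta> (x, y)"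
      using u1_nonneg[OF \<delta>] by (rule mult_right_mono)
    moreover have "u1 \<delta> (x, y) powr (p - 1) * u1 \<delta> (x, y) = u1 \<delta> (x, y) powr p"
      using u1_nonneg[OF \<delta>, of "(x, y)"] powr_mult_base[of "u1 \<delta> (x, y)" "p - 1"] by (simp add: mult.commute)
    ultimately show ?thesis using c[of j] by simp
  qed
  let ?K = "c j powr (1 - p) * \<delta> powr (- ?d * (p - 1))"
  have "(\<integral>\<^sup>+y. ennreal (u1 \<delta> (x, y) powr p) \<partial>\<mu>) \<le>
      (\<integral>\<^sup>+y. ennreal (?K * U j ((1 / \<delta>) *\<^sub>R (y - x)) powr (p - 1)) * ennreal (u1 \<delta> (x, y)) \<partial>\<mu>)"
  proof (rule nn_integral_mono)
    fix y
    show "ennreal (u1 \<delta> (x, y) powr p) \<le> ennreal (?K * U j ((1 / \<delta>) *\<^sub>R (y - x)) powr (p - 1)) * ennreal (u1 \<delta> (x, y))"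
    proof (cases "y \<in> E j")
      case True
      then show ?thesis using pw[OF True] c[of j] by (simp add: ennreal_leI flip: ennreal_mult')
    qed (simp add: u1_on_class[OF j])
  qed
  also have "... \<le> ennreal (1 - \<eta>) * (\<integral>\<^sup>+y. ennreal (?K * U j ((1 / \<delta>) *\<^sub>R (y - x)) powr (p - 1)) * ennreal (V j \<delta> (y - x)) \<partial>lborel)"
    by (rule nn_integral_\<mu>_class[OF j _ \<delta>(1)]) measurable
  also have "... \<le> 1 * (\<integral>\<^sup>+y. ennreal (?K * U j ((1 / \<delta>) *\<^sub>R (y - x)) powr (p - 1)) * ennreal (V j \<delta> (y - x)) \<partial>lborel)"
    using e by (intro mult_right_mono) auto
  also have "... = (\<integral>\<^sup>+w. ennreal (?K * U j w powr (p - 1)) * ennreal (U j w) \<partial>lborel)"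
    using \<delta> by (subst nn_integral_V[OF \<delta>(1)]) auto
  also have "... = (\<integral>\<^sup>+w. ennreal (\<delta> powr (- ?d * (p - 1)) * (c j powr (1 - p) * U j w powr p)) \<partial>lborel)"
  proof (rule nn_integral_cong)
    fix w
    have "U j w powr (p - 1) * U j w = U j w powr p"
      using U_nonneg[of j w] powr_mult_base[of "U j w" "p - 1"] by (simp add: mult.commute)
    moreover have "?K * U j w powr (p - 1) * U j w = \<delta> powr (- ?d * (p - 1)) * (c j powr (1 - p) * (U j w powr (p - 1) * U j w))"
      by (simp only: mult_ac)
    ultimately have "?K * U j w powr (p - 1) * U j w = \<delta> powr (- ?d * (p - 1)) * (c j powr (1 - p) * U j w powr p)"
      by (simp only:)
    then show "ennreal (?K * U j w powr (p - 1)) * ennreal (U j w) = ennreal (\<delta> powr (- ?d * (p - 1)) * (c j powr (1 - p) * U j w powr p))"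
      by (simp only: ennreal_mult'[symmetric, OF mult_nonneg_nonneg[OF mult_nonneg_nonneg[OF powr_ge_zero powr_ge_zero] powr_ge_zero]])
  qed
  also have "... = ennreal (\<delta> powr (- ?d * (p - 1))) * (\<integral>\<^sup>+w. ennreal (c j powr (1 - p) * U j w powr p) \<partial>lborel)"
    by (rule nn_integral_cmult_real) (simp, measurable)
  finally have "ennreal (\<epsilon>_of \<delta>) * (\<integral>\<^sup>+y. ennreal (u1 \<delta> (x, y) powr p) \<partial>\<mu>) \<le>
     ennreal (\<epsilon>_of \<delta>) * (ennreal (\<delta> powr (- ?d * (p - 1))) * (\<integral>\<^sup>+w. ennreal (c j powr (1 - p) * U j w powr p) \<partial>lborel))"
    by (rule mult_left_mono) simp
  also have "... = ennreal (\<epsilon>_of \<delta> * \<delta> powr (- ?d * (p - 1))) * (\<integral>\<^sup>+w. ennreal (c j powr (1 - p) * U j w powr p) \<partial>lborel)"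
    using \<epsilon>_of_pos[OF \<delta>] by (simp add: ennreal_mult' mult.assoc)
  also have "\<epsilon>_of \<delta> * \<delta> powr (- ?d * (p - 1)) = \<delta>^2"
    using \<delta> by (simp add: \<epsilon>_of_def powr_numeral flip: powr_add)
  finally show ?thesis .
qed

lemma class_value_le:
  assumes x: "x \<in> E j"
  shows "tc j powr (- scaling_exponent TYPE('n) p) \<le> (1 + e) powr (2 * scaling_exponent TYPE('n) p) * geo x powr (- scaling_exponent TYPE('n) p)"
proof -
  let ?s = "scaling_exponent TYPE('n) p"
  have s: "0 < ?s" by (rule scaling_exponent_pos[OF p])
  have "x \<in> ball (xc j) (2 * r j)" using E_ball[of j] x r[of j] by auto
  then have "det (A (xc j)) \<le> (1 + e) * det (A x)" using comparable[of j] unfolding comparable_on_def by blast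
  also have "... \<le> (1 + e)^2 * det (A x)"
    using e det_hessian_pos[of x] by (intro mult_right_mono) (auto simp: power2_eq_square)
  finally have "sqrt (det (A (xc j))) \<le> sqrt ((1 + e)^2 * det (A x))" by simp
  also have "... = (1 + e) * sqrt (det (A x))" using e by (simp add: real_sqrt_mult)
  finally have sq: "sqrt (det (A (xc j))) \<le> (1 + e) * sqrt (det (A x))" .
  have f: "f x \<le> (1 + e) * c j" "0 < f x" using f_on_E[OF x] c[of j] by auto
  have "geo x = f x / sqrt (det (A x))" by (rule geo_def)
  also have "... \<le> ((1 + e) * c j) / (sqrt (det (A (xc j))) / (1 + e))"
    using f sq e det_hessian_pos[of "xc j"] by (intro frac_le) (auto simp: field_simps)
  also have "... = (1 + e)^2 * tc j" using e by (simp add: tc_def power2_eq_square field_simps)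
  finally have g: "geo x / (1 + e)^2 \<le> tc j" using e by (simp add: field_simps)
  have "tc j powr (- ?s) \<le> (geo x / (1 + e)^2) powr (- ?s)"
    using g geo_pos[OF f(2)] e s by (intro powr_mono2') auto
  also have "... = (1 + e) powr (2 * ?s) * geo x powr (- ?s)"
  proof -
    have "(geo x / (1 + e)^2) powr (- ?s) = geo x powr (- ?s) / ((1 + e) powr 2) powr (- ?s)"
      using e by (simp add: powr_divide powr_numeral)
    also have "((1 + e) powr 2) powr (- ?s) = (1 + e) powr (- (2 * ?s))" by (simp add: powr_powr)
    finally show ?thesis by (simp add: powr_minus_divide)
  qed
  finally show ?thesis .
qed

text \<open>On each class this is the value of the frozen problem; passing from its constant t to the pointwise one
costs a power of 1+e.\<close>

lemma local_plan_value_le: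
  assumes \<delta>: "0 < \<delta>" "\<And>j. j < N ==> \<delta> * \<rho> j < r j"
  shows "gap_cost (u1 \<delta>) +
      ennreal (\<epsilon>_of \<delta>) * power_integral (u1 \<delta>)
    \<le> ennreal (\<delta>^2 * (1 + e) powr (1 + 2 * scaling_exponent TYPE('n) p)) * (ennreal (C_const TYPE('n) p) * K_fun \<mu> \<nu> \<phi> p)"
proof -
  let ?s = "scaling_exponent TYPE('n) p" and ?C = "C_const TYPE('n) p"
  have Cp: "0 < ?C" by (rule C_const_pos[OF p])
  have m: "(\<lambda>z. ennreal (2 * bregman \<phi> (fst z) (snd z) * u1 \<delta> z)) \<in> borel_measurable borel"
    "(\<lambda>z. ennreal (u1 \<delta> z powr p)) \<in> borel_measurable borel"
    "(\<lambda>z. ennreal (\<epsilon>_of \<delta>) * ennreal (u1 \<delta> z powr p)) \<in> borel_measurable borel" by measurable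
  have "gap_cost (u1 \<delta>) +
      ennreal (\<epsilon>_of \<delta>) * power_integral (u1 \<delta>) =
      double_integral (\<lambda>z. ennreal (2 * bregman \<phi> (fst z) (snd z) * u1 \<delta> z) + ennreal (\<epsilon>_of \<delta>) * ennreal (u1 \<delta> z powr p))"
    by (simp only: double_integral_add[OF m(1,3)] double_integral_cmult[OF m(2)])
  also have "... \<le> (\<integral>\<^sup>+x. ennreal (\<delta>^2 * (1 + e) powr (1 + 2 * ?s)) * ennreal (?C * geo x powr (- ?s)) \<partial>\<mu>)"
  proof (rule nn_integral_mono)
    fix x
    let ?L = "\<integral>\<^sup>+y. ennreal (2 * bregman \<phi> (fst (x, y)) (snd (x, y)) * u1 \<delta> (x, y)) + ennreal (\<epsilon>_of \<delta>) * ennreal (u1 \<delta> (x, y) powr p) \<partial>\<mu>"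
    show "?L \<le> ennreal (\<delta>^2 * (1 + e) powr (1 + 2 * ?s)) * ennreal (?C * geo x powr (- ?s))"
    proof (cases "x \<in> (\<Union>j<N. E j)")
      case False
      then show ?thesis by (simp add: u1_off_class)
    next
      case True
      then obtain j where j: "j < N" "x \<in> E j" by auto
      let ?I1 = "\<integral>\<^sup>+w. ennreal ((w \<bullet> (A (xc j) *v w)) * U j w) \<partial>lborel"
      let ?I2 = "\<integral>\<^sup>+w. ennreal (c j powr (1 - p) * U j w powr p) \<partial>lborel"
      have "?L = (\<integral>\<^sup>+y. ennreal (2 * bregman \<phi> x y * u1 \<delta> (x, y)) \<partial>\<mu>) + (\<integral>\<^sup>+y. ennreal (\<epsilon>_of \<delta>) * ennreal (u1 \<delta> (x, y) powr p) \<partial>\<mu>)"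
        unfolding fst_conv snd_conv using section_cong_\<mu>[OF m(1), of x] section_cong_\<mu>[OF m(3), of x]
        by (intro nn_integral_add) simp_all
      also have "(\<integral>\<^sup>+y. ennreal (\<epsilon>_of \<delta>) * ennreal (u1 \<delta> (x, y) powr p) \<partial>\<mu>) = ennreal (\<epsilon>_of \<delta>) * (\<integral>\<^sup>+y. ennreal (u1 \<delta> (x, y) powr p) \<partial>\<mu>)"
        using section_cong_\<mu>[OF m(2), of x] by (intro nn_integral_cmult)
      also have "(\<integral>\<^sup>+y. ennreal (2 * bregman \<phi> x y * u1 \<delta> (x, y)) \<partial>\<mu>) = (\<integral>\<^sup>+y. ennreal (2 * bregman \<phi> x y) * ennreal (u1 \<delta> (x, y)) \<partial>\<mu>)"
        using bregman_nonneg by (intro nn_integral_cong ennreal_mult') simp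
      also have "... + ennreal (\<epsilon>_of \<delta>) * (\<integral>\<^sup>+y. ennreal (u1 \<delta> (x, y) powr p) \<partial>\<mu>) \<le>
          ennreal (\<delta>^2 * (1 + e)) * ?I1 + ennreal (\<delta>^2) * ?I2"
        by (intro add_mono class_transport_le class_penalty_le j \<delta>)
      also have "... \<le> ennreal (\<delta>^2 * (1 + e)) * ?I1 + ennreal (\<delta>^2 * (1 + e)) * ?I2"
        using e by (intro add_left_mono mult_right_mono ennreal_leI) (auto simp: mult_le_cancel_left1)
      also have "... = ennreal (\<delta>^2 * (1 + e)) * (?I1 + ?I2)" by (simp add: distrib_left)
      also have "?I1 + ?I2 = (\<integral>\<^sup>+w. ennreal ((w \<bullet> (A (xc j) *v w)) * U j w) + ennreal (c j powr (1 - p) * U j w powr p) \<partial>lborel)"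
        by (rule nn_integral_add[symmetric]) measurable
      also have "... = (\<integral>\<^sup>+w. ennreal ((w \<bullet> (A (xc j) *v w)) * U j w + c j powr (1 - p) * U j w powr p) \<partial>lborel)"
      proof (rule nn_integral_cong)
        fix w :: "real ^ 'n"
        have "0 \<le> w \<bullet> (A (xc j) *v w)" by (rule hessian_nonneg)
        then show "ennreal ((w \<bullet> (A (xc j) *v w)) * U j w) + ennreal (c j powr (1 - p) * U j w powr p) =
           ennreal ((w \<bullet> (A (xc j) *v w)) * U j w + c j powr (1 - p) * U j w powr p)"
          using U_nonneg[of j w] by (intro ennreal_plus[symmetric]) auto
      qed
      also have "... = ennreal (?C * tc j powr (- ?s))" by (rule U_value)
      also have "ennreal (\<delta>^2 * (1 + e)) * ennreal (?C * tc j powr (- ?s)) \<le> ennreal (\<delta>^2 * (1 + e)) * ennreal (?C * ((1 + e) powr (2 * ?s) * geo x powr (- ?s)))"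
        using Cp by (intro mult_left_mono ennreal_leI class_value_le[OF j(2)]) auto
      also have "... = ennreal (\<delta>^2 * (1 + e) powr (1 + 2 * ?s)) * ennreal (?C * geo x powr (- ?s))"
      proof -
        have "(1 + e) powr (1 + 2 * ?s) = (1 + e) * (1 + e) powr (2 * ?s)" using e by (simp add: powr_add)
        then show ?thesis using e Cp by (simp add: mult_ac flip: ennreal_mult')
      qed
      finally show ?thesis .
    qed
  qed
  also have "... = ennreal (\<delta>^2 * (1 + e) powr (1 + 2 * ?s)) * (\<integral>\<^sup>+x. ennreal (?C * geo x powr (- ?s)) \<partial>\<mu>)"
    by (rule nn_integral_cmult) measurable
  also have "(\<integral>\<^sup>+x. ennreal (?C * geo x powr (- ?s)) \<partial>\<mu>) = ennreal ?C * K_fun \<mu> \<nu> \<phi> p"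
    unfolding K_fun_geo using Cp by (intro nn_integral_cmult_real) auto
  finally show ?thesis .
qed

text \<open>At a density point of the class the profile loses only what falls outside the class within its support,
and this is o(\<delta>^d) in volume against a maximum of order \<delta>^{-d}.\<close>

lemma local_plan_mass:
  assumes lim: "\<delta> \<longlonglongrightarrow> 0" and pos: "\<And>n. 0 < \<delta> n"
  shows "AE x in \<mu>. x \<in> (\<Union>j<N. E j) --> (\<forall>\<^sub>F n in sequentially. 1 - m1 (\<delta> n) x \<le> 2 * \<eta>)"
proof (rule AE_\<mu>I)
  have "AE x in lborel. \<forall>j. x \<in> E j --> ((\<lambda>r. measure lborel (cball x r - E j) / r ^ CARD('n)) \<longlongrightarrow> 0) (at_right 0)"
    using density_point_complement[OF E_sets] by (intro AE_all_countable[THEN iffD2] allI) simp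
  then show "AE x in lborel. 0 < f x --> x \<in> (\<Union>j<N. E j) --> (\<forall>\<^sub>F n in sequentially. 1 - m1 (\<delta> n) x \<le> 2 * \<eta>)"
  proof (eventually_elim, intro impI)
    fix x assume dens: "\<forall>j. x \<in> E j --> ((\<lambda>r. measure lborel (cball x r - E j) / r ^ CARD('n)) \<longlongrightarrow> 0) (at_right 0)"
      and "x \<in> (\<Union>j<N. E j)"
    then obtain j where j: "j < N" "x \<in> E j" by auto
    let ?q = "\<lambda>n. measure lborel (cball x (\<rho> j * \<delta> n) - E j) / (\<rho> j * \<delta> n) ^ CARD('n)"
    have "filterlim (\<lambda>n. \<rho> j * \<delta> n) (at_right 0) sequentially"
      unfolding filterlim_at using \<rho>_pos[of j] pos tendsto_mult_right_zero[OF lim, of "\<rho> j"]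
      by (auto simp: less_imp_neq[THEN not_sym])
    with dens[rule_format, OF j(2)] have "?q \<longlonglongrightarrow> 0" by (rule filterlim_compose)
    then have "(\<lambda>n. k * (1 - Umax j * \<rho> j ^ CARD('n) * ?q n)) \<longlonglongrightarrow> k * (1 - Umax j * \<rho> j ^ CARD('n) * 0)"
      by (intro tendsto_intros)
    then have ev: "\<forall>\<^sub>F n in sequentially. 1 - 2 * \<eta> < k * (1 - Umax j * \<rho> j ^ CARD('n) * ?q n)"
      by (rule order_tendstoD) (use k_bounds in simp)
    have low: "k * (1 - Umax j * \<rho> j ^ CARD('n) * ?q n) \<le> m1 (\<delta> n) x" for n
    proof -
      let ?G = "cball x (\<rho> j * \<delta> n) - E j"
      have Gm [measurable]: "?G \<in> sets borel" by simp
      have Gfin: "emeasure lborel ?G < \<infinity>"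
        by (rule le_less_trans[OF emeasure_mono[of _ "cball x (\<rho> j * \<delta> n)"] emeasure_lborel_cball_finite]) auto
      have dn: "0 < \<delta> n ^ CARD('n)" using pos by simp
      have V_le: "V j (\<delta> n) (y - x) \<le> indicator (E j) y * V j (\<delta> n) (y - x) + Umax j / \<delta> n ^ CARD('n) * indicator ?G y" for y
      proof (cases "y \<in> E j \<or> V j (\<delta> n) (y - x) = 0")
        case True
        moreover have "0 \<le> Umax j" by (simp add: Umax_def)
        ultimately show ?thesis using dn V_nonneg[OF pos] by (auto simp: indicator_def)
      next
        case False
        then have "U j ((1 / \<delta> n) *\<^sub>R (y - x)) \<noteq> 0" by (simp add: V_def)
        then have "norm ((1 / \<delta> n) *\<^sub>R (y - x)) \<le> \<rho> j" by (rule U_support)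
        then have "norm (y - x) / \<delta> n \<le> \<rho> j" using pos[of n] by simp
        then have "dist x y \<le> \<rho> j * \<delta> n"
          using pos[of n] by (simp add: dist_norm norm_minus_commute pos_divide_le_eq)
        then show ?thesis using False U_le[of j "(1 / \<delta> n) *\<^sub>R (y - x)"] dn by (simp add: V_def divide_right_mono)
      qed
      let ?M = "\<integral>\<^sup>+y. ennreal (indicator (E j) y * V j (\<delta> n) (y - x)) \<partial>lborel"
      let ?g = "Umax j / \<delta> n ^ CARD('n) * measure lborel ?G"
      have g00: "0 \<le> ?g" using dn by (simp add: Umax_def)
      have kg: "0 \<le> k * ?g" by (rule mult_nonneg_nonneg[OF less_imp_le[OF k_bounds(1)] g00])
      have g0: "0 \<le> Umax j / \<delta> n ^ CARD('n)" using dn by (simp add: Umax_def)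
      have "1 = (\<integral>\<^sup>+y. ennreal (V j (\<delta> n) (y - x)) \<partial>lborel)" using V_mass[OF pos] by simp
      also have "... \<le> (\<integral>\<^sup>+y. ennreal (indicator (E j) y * V j (\<delta> n) (y - x)) + ennreal (Umax j / \<delta> n ^ CARD('n) * indicator ?G y) \<partial>lborel)"
      proof (rule nn_integral_mono)
        fix y
        have "ennreal (V j (\<delta> n) (y - x)) \<le> ennreal (indicator (E j) y * V j (\<delta> n) (y - x) + Umax j / \<delta> n ^ CARD('n) * indicator ?G y)"
          by (rule ennreal_leI[OF V_le])
        also have "... = ennreal (indicator (E j) y * V j (\<delta> n) (y - x)) + ennreal (Umax j / \<delta> n ^ CARD('n) * indicator ?G y)"
          using V_nonneg[OF pos, of j n "y - x"] g0 by (intro ennreal_plus mult_nonneg_nonneg) auto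
        finally show "ennreal (V j (\<delta> n) (y - x)) \<le> ennreal (indicator (E j) y * V j (\<delta> n) (y - x)) + ennreal (Umax j / \<delta> n ^ CARD('n) * indicator ?G y)" .
      qed
      also have "... = ?M + (\<integral>\<^sup>+y. ennreal (Umax j / \<delta> n ^ CARD('n) * indicator ?G y) \<partial>lborel)"
        by (rule nn_integral_add) measurable
      also have "(\<integral>\<^sup>+y. ennreal (Umax j / \<delta> n ^ CARD('n) * indicator ?G y) \<partial>lborel) = ennreal ?g"
      proof -
        have "(\<integral>\<^sup>+y. ennreal (Umax j / \<delta> n ^ CARD('n) * indicator ?G y) \<partial>lborel) = ennreal (Umax j / \<delta> n ^ CARD('n)) * (\<integral>\<^sup>+y. ennreal (indicator ?G y) \<partial>lborel)"
          by (rule nn_integral_cmult_real[OF g0]) measurable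
        also have "(\<integral>\<^sup>+y. ennreal (indicator ?G y) \<partial>lborel) = ennreal (measure lborel ?G)"
          using Gfin by (simp add: ennreal_indicator emeasure_eq_ennreal_measure)
        finally show ?thesis by (simp only: ennreal_mult'[OF g0])
      qed
      finally have M1: "1 \<le> ?M + ennreal ?g" .
      have "ennreal k * ?M = (\<integral>\<^sup>+y. ennreal (k * (indicator (E j) y * V j (\<delta> n) (y - x))) \<partial>lborel)"
        using k_bounds by (intro nn_integral_cmult_real[symmetric]) auto
      also have "... \<le> (\<integral>\<^sup>+y. ennreal (f y) * ennreal (u1 (\<delta> n) (x, y)) \<partial>lborel)"
      proof (rule nn_integral_mono)
        fix y
        have "k * (indicator (E j) y * V j (\<delta> n) (y - x)) \<le> f y * u1 (\<delta> n) (x, y)"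
        proof (cases "y \<in> E j")
          case True
          have "1 * (k * V j (\<delta> n) (y - x)) \<le> f y / c j * (k * V j (\<delta> n) (y - x))"
            using f_on_E[OF True] c[of j] k_bounds V_nonneg[OF pos] by (intro mult_right_mono) auto
          then show ?thesis using True by (simp add: u1_on_class[OF j] mult_ac)
        next
          case False
          then show ?thesis using u1_nonneg[OF pos, of n "(x, y)"] leb_density_nonneg[of \<mu> y] by simp
        qed
        then show "ennreal (k * (indicator (E j) y * V j (\<delta> n) (y - x))) \<le> ennreal (f y) * ennreal (u1 (\<delta> n) (x, y))"
          by (simp add: ennreal_leI leb_density_nonneg flip: ennreal_mult')
      qed
      also have "... = (\<integral>\<^sup>+y. ennreal (u1 (\<delta> n) (x, y)) \<partial>\<mu>)"
        using pair_section_measurable[OF u1_measurable] by (intro nn_integral_\<mu>[symmetric]) measurable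
      also have "... = ennreal (m1 (\<delta> n) x)"
      proof -
        have "(\<integral>\<^sup>+y. ennreal (u1 (\<delta> n) (x, y)) \<partial>\<mu>) < top" using u1_marginal_le[OF pos, of n x] by (rule le_less_trans) simp
        then show ?thesis by (simp add: m1_def)
      qed
      finally have kM: "ennreal k * ?M \<le> ennreal (m1 (\<delta> n) x)" .
      have "ennreal k * 1 \<le> ennreal k * (?M + ennreal ?g)" using M1 by (rule mult_left_mono) simp
      also have "... = ennreal k * ?M + ennreal (k * ?g)"
        using k_bounds(1) by (simp only: distrib_left ennreal_mult'[of k ?g] less_imp_le)
      also have "... \<le> ennreal (m1 (\<delta> n) x) + ennreal (k * ?g)" using kM by (rule add_right_mono)
      also have "... = ennreal (m1 (\<delta> n) x + k * ?g)"
        using m1_bounds[OF pos, of n x] by (intro ennreal_plus[symmetric] kg) auto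
      finally have "ennreal k \<le> ennreal (m1 (\<delta> n) x + k * ?g)" by (simp only: mult_1_right)
      moreover have "0 \<le> m1 (\<delta> n) x + k * ?g" using m1_bounds[OF pos, of n x] kg by (intro add_nonneg_nonneg) auto
      ultimately have "k \<le> m1 (\<delta> n) x + k * ?g" by (simp only: ennreal_le_iff)
      moreover have "?g = Umax j * \<rho> j ^ CARD('n) * ?q n"
        using \<rho>_pos[of j] pos[of n] by (simp add: power_mult_distrib)
      ultimately have "k \<le> m1 (\<delta> n) x + k * (Umax j * \<rho> j ^ CARD('n) * ?q n)" by (simp only:)
      then show ?thesis by (simp only: right_diff_distrib mult_1_right diff_le_eq)
    qed
    show "\<forall>\<^sub>F n in sequentially. 1 - m1 (\<delta> n) x \<le> 2 * \<eta>"
      using ev by eventually_elim (use low in \<open>smt (verit)\<close>)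
  qed
qed

end

section \<open>The upper bound in the limit\<close>

text \<open>The deficit exceeds 2\<eta> only outside the classes and, inside them,
on sets whose indicators tend to zero almost everywhere;
dominated convergence with majorant W.\<close>

lemma (in local_classes) uncovered_mass_vanishes:
  assumes lim: "\<delta> \<longlonglongrightarrow> 0" and pos: "\<And>n. 0 < \<delta> n" and W [measurable]: "W \<in> borel_measurable borel"
    and W_fin: "(\<integral>\<^sup>+x. ennreal (W x) \<partial>\<mu>) < \<infinity>"
    and rest: "(\<integral>\<^sup>+x. ennreal (W x) * indicator (- (\<Union>j<N. E j)) x \<partial>\<mu>) \<le> ennreal \<tau>" and \<tau>: "0 < \<tau>"
  shows "\<forall>\<^sub>F n in sequentially. (\<integral>\<^sup>+x. ennreal (W x) * indicator {x. 2 * \<eta> < 1 - m1 (\<delta> n) x} x \<partial>\<mu>) \<le> ennreal (2 * \<tau>)"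
proof -
  let ?H = "\<Union>j<N. E j"
  let ?B = "\<lambda>n. {x. 2 * \<eta> < 1 - m1 (\<delta> n) x}"
  let ?J = "\<lambda>n x. ennreal (W x) * indicator (?H \<inter> ?B n) x"
  have H: "?H \<in> sets borel" using E_sets by (intro sets.finite_UN) auto
  have B: "?B n \<in> sets borel" for n by measurable
  have HB: "?H \<inter> ?B n \<in> sets borel" for n using H B by (rule sets.Int)
  have J: "?J n \<in> borel_measurable \<mu>" for n
  proof -
    have "(\<lambda>x. indicator (?H \<inter> ?B n) x :: ennreal) \<in> borel_measurable borel" using HB by (rule borel_measurable_indicator)
    then have "?J n \<in> borel_measurable borel" by (rule borel_measurable_times_ennreal[rotated]) measurable
    then show ?thesis by (simp only: measurable_cong_sets[OF sets_\<mu> refl])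
  qed
  have R: "(\<lambda>x. ennreal (W x) * indicator (- ?H) x) \<in> borel_measurable \<mu>"
  proof -
    have "(\<lambda>x. indicator (- ?H) x :: ennreal) \<in> borel_measurable borel" using borel_comp[OF H] by (rule borel_measurable_indicator)
    then have "(\<lambda>x. ennreal (W x) * indicator (- ?H) x) \<in> borel_measurable borel" by (rule borel_measurable_times_ennreal[rotated]) measurable
    then show ?thesis by (simp only: measurable_cong_sets[OF sets_\<mu> refl])
  qed
  have "(\<lambda>n. \<integral>\<^sup>+x. ?J n x \<partial>\<mu>) \<longlonglongrightarrow> (\<integral>\<^sup>+x. 0 \<partial>\<mu>)"
  proof (rule nn_integral_dominated_convergence[where w = "\<lambda>x. ennreal (W x)"])
    show "AE x in \<mu>. ?J n x \<le> ennreal (W x)" for n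
      by (intro AE_I2) (simp split: split_indicator)
    show "AE x in \<mu>. (\<lambda>n. ?J n x) \<longlonglongrightarrow> 0"
      using local_plan_mass[OF lim pos]
    proof eventually_elim
      case (elim x)
      show ?case
      proof (cases "x \<in> ?H")
        case True
        with elim have "\<forall>\<^sub>F n in sequentially. 1 - m1 (\<delta> n) x \<le> 2 * \<eta>" by simp
        then have "\<forall>\<^sub>F n in sequentially. ?J n x = 0"
          by eventually_elim simp
        then show ?thesis by (rule tendsto_eventually)
      next
        case False
        then have "?J n x = 0" for n by simp
        then show ?thesis by (simp only: tendsto_const)
      qed
    qed
  qed (use J W_fin in \<open>simp_all add: measurable_cong_sets[OF sets_\<mu> refl]\<close>)
  then have "\<forall>\<^sub>F n in sequentially. (\<integral>\<^sup>+x. ?J n x \<partial>\<mu>) < ennreal \<tau>"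
    by (rule order_tendstoD) (use \<tau> in simp)
  then show ?thesis
  proof eventually_elim
    case (elim n)
    have "(\<integral>\<^sup>+x. ennreal (W x) * indicator (?B n) x \<partial>\<mu>) \<le> (\<integral>\<^sup>+x. ennreal (W x) * indicator (- ?H) x + ?J n x \<partial>\<mu>)"
      by (intro nn_integral_mono) (auto split: split_indicator)
    also have "... = (\<integral>\<^sup>+x. ennreal (W x) * indicator (- ?H) x \<partial>\<mu>) + (\<integral>\<^sup>+x. ?J n x \<partial>\<mu>)"
      using R J by (rule nn_integral_add)
    also have "... \<le> ennreal \<tau> + ennreal \<tau>" using rest less_imp_le[OF elim] by (rule add_mono)
    also have "... = ennreal (2 * \<tau>)" using \<tau> by (simp flip: ennreal_plus)
    finally show ?case .
  qed
qed

context transport_setting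
begin

text \<open>The parameters are chosen in the order t, \<kappa>, (\<eta>,C), e, and finally the classes, whose
uncovered mass has to be small relative to C.\<close>

theorem ROT_upper_limit:
  assumes RP: "remainder_property" and lim: "\<delta> \<longlonglongrightarrow> 0" and pos: "\<And>n. 0 < \<delta> n" and \<tau>: "0 < \<tau>"
  shows "\<forall>\<^sub>F n in sequentially. ROT (\<epsilon>_of (\<delta> n)) p \<mu> \<nu> \<le>
    ennreal base_cost + ennreal ((\<delta> n)^2) * (ennreal (C_const TYPE('n) p) * K_fun \<mu> \<nu> \<phi> p + ennreal \<tau>)"
proof -
  let ?C = "C_const TYPE('n) p" and ?s = "scaling_exponent TYPE('n) p"
  define L where "L = ?C * enn2real (K_fun \<mu> \<nu> \<phi> p)"
  have C0: "0 < ?C" by (rule C_const_pos[OF p])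
  have L0: "0 \<le> L" using C0 by (simp add: L_def)
  have LK: "ennreal ?C * K_fun \<mu> \<nu> \<phi> p = ennreal L"
    using K_fun_finite[OF RP] C0 by (simp add: L_def ennreal_mult')
  have "((\<lambda>t. (1 - t) powr (1 - p) * L) \<longlongrightarrow> (1 - 0) powr (1 - p) * L) (at_right (0 :: real))"
    by (intro tendsto_intros) auto
  then have "\<forall>\<^sub>F t in at_right (0 :: real). (1 - t) powr (1 - p) * L < L + \<tau> / 2"
    by (rule order_tendstoD) (use \<tau> in simp)
  moreover have "\<forall>\<^sub>F t in at_right (0 :: real). t \<in> {0<..<1}" by (rule eventually_at_right_real) simp
  ultimately have "\<forall>\<^sub>F t in at_right (0 :: real). (1 - t) powr (1 - p) * L < L + \<tau> / 2 \<and> t \<in> {0<..<1}"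
    by (rule eventually_conj)
  \<comment> \<open>The factor \<open>(1 - t) powr (1 - p)\<close> of the local plan is close to one.\<close>
  then obtain t :: real where t: "(1 - t) powr (1 - p) * L < L + \<tau> / 2" "0 < t" "t < 1"
    using eventually_happens[of _ "at_right (0 :: real)"] by fastforce
  let ?r = "(1 - t) powr (1 - p)"
  define M where "M = \<sigma>M + t powr (1 - p)"
  have M: "0 < M" using \<sigma>m_pos \<sigma>m_le t by (simp add: M_def add_pos_pos)
  obtain W where W [measurable]: "W \<in> borel_measurable borel" and W_fin: "(\<integral>\<^sup>+x. ennreal (W x) \<partial>\<mu>) < \<infinity>"
    and WR: "\<forall>\<kappa>>0. \<exists>\<eta> C \<delta>0. 0 < \<eta> \<and> \<eta> < 1 \<and> 0 \<le> C \<and> 0 < \<delta>0 \<and>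
       (\<forall>\<delta>. 0 < \<delta> --> \<delta> < \<delta>0 --> remainder_plan_bound W \<kappa> \<eta> C \<delta>)"
    using RP unfolding remainder_property_def by auto
  define \<kappa> where "\<kappa> = \<tau> / (4 * M)"
  have \<kappa>: "0 < \<kappa>" using \<tau> M by (simp add: \<kappa>_def)
  obtain \<eta> C \<delta>0 where \<eta>: "0 < \<eta>" "\<eta> < 1" and C: "0 \<le> C" and \<delta>0: "0 < \<delta>0"
    and b: "\<And>\<delta>. 0 < \<delta> ==> \<delta> < \<delta>0 ==> remainder_plan_bound W \<kappa> \<eta> C \<delta>"
    using WR[rule_format, OF \<kappa>] by auto
  have "((\<lambda>e. (1 + e) powr (1 + 2 * ?s) * (?r * L)) \<longlongrightarrow> (1 + 0) powr (1 + 2 * ?s) * (?r * L)) (at_right (0 :: real))"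
    by (intro tendsto_intros) auto
  then have "\<forall>\<^sub>F e in at_right (0 :: real). (1 + e) powr (1 + 2 * ?s) * (?r * L) < L + \<tau> / 2"
    by (rule order_tendstoD) (use t in simp)
  moreover have "\<forall>\<^sub>F e in at_right (0 :: real). e \<in> {0<..<\<eta>}" by (rule eventually_at_right_real) (rule \<eta>)
  ultimately have "\<forall>\<^sub>F e in at_right (0 :: real). (1 + e) powr (1 + 2 * ?s) * (?r * L) < L + \<tau> / 2 \<and> e \<in> {0<..<\<eta>}"
    by (rule eventually_conj)
  \<comment> \<open>Freezing density and Hessian on a class costs a factor close to one.\<close>
  then obtain e :: real where e_close: "(1 + e) powr (1 + 2 * ?s) * (?r * L) < L + \<tau> / 2" "0 < e" "e < \<eta>"
    using eventually_happens[of _ "at_right (0 :: real)"] by fastforce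
  define \<tau>' where "\<tau>' = \<tau> / (8 * M * (C + 1))"
  have \<tau>': "0 < \<tau>'" using \<tau> M C by (simp add: \<tau>'_def)
  obtain N :: nat and E c xc r where cl: "\<forall>j. E j \<in> sets borel \<and> 0 < c j \<and> 0 < r j \<and> E j \<subseteq> ball (xc j) (r j) \<and>
      (\<forall>x\<in>E j. c j \<le> f x \<and> f x \<le> (1 + e) * c j) \<and> comparable_on e (xc j) (2 * r j)" and dj: "disjoint_family E"
    and rest: "(\<integral>\<^sup>+x. ennreal (W x) * indicator (- (\<Union>j<N. E j)) x \<partial>\<mu>) \<le> ennreal \<tau>'"
    using classes_exist[OF e_close(2) W W_fin \<tau>'] by (elim exE conjE) blast
  interpret local_classes \<phi> \<sigma>m \<sigma>M \<mu> \<nu> p e \<eta> N E c xc r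
    by unfold_locales (use cl dj e_close \<eta> in \<open>blast+\<close>)
  have ev1: "\<forall>\<^sub>F n in sequentially. (\<integral>\<^sup>+x. ennreal (W x) * indicator {x. 2 * \<eta> < 1 - m1 (\<delta> n) x} x \<partial>\<mu>) \<le> ennreal (2 * \<tau>')"
    by (rule uncovered_mass_vanishes[OF lim pos W W_fin rest \<tau>'])
  have ev2: "\<forall>\<^sub>F n in sequentially. \<delta> n < \<delta>0" using lim \<delta>0 by (rule order_tendstoD)
  have ev3: "\<forall>\<^sub>F n in sequentially. \<forall>j\<in>{..<N}. \<delta> n * \<rho> j < r j"
  proof (intro eventually_ball_finite ballI)
    fix j
    have "(\<lambda>n. \<delta> n * \<rho> j) \<longlonglongrightarrow> 0" using lim by (rule tendsto_mult_left_zero)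
    then show "\<forall>\<^sub>F n in sequentially. \<delta> n * \<rho> j < r j" by (rule order_tendstoD) (use cl in blast)
  qed simp
  show ?thesis
    using ev1 ev2 ev3
  proof eventually_elim
    case (elim n)
    let ?u1 = "u1 (\<delta> n)" and ?\<epsilon> = "\<epsilon>_of (\<delta> n)" and ?dd = "(\<delta> n)^2"
    let ?I = "\<integral>\<^sup>+x. ennreal (W x) * indicator {x. 2 * \<eta> < 1 - m1 (\<delta> n) x} x \<partial>\<mu>"
    have "\<forall>x. \<eta> \<le> 1 - m1 (\<delta> n) x \<and> 1 - m1 (\<delta> n) x \<le> 1"
    proof
      fix x show "\<eta> \<le> 1 - m1 (\<delta> n) x \<and> 1 - m1 (\<delta> n) x \<le> 1" using m1_bounds[OF pos[of n], of x] by linarith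
    qed
    moreover have "(\<lambda>x. 1 - m1 (\<delta> n) x) \<in> borel_measurable borel" by measurable
    ultimately obtain u2 where u2: "self_plan u2 (\<lambda>x. 1 - m1 (\<delta> n) x)" and u2b:
      "spread u2 + ennreal ?\<epsilon> * power_integral u2
       \<le> ennreal ?dd * (ennreal \<kappa> + ennreal C * ?I)"
      using b[OF pos elim(2), unfolded remainder_plan_bound_def, rule_format, of "\<lambda>x. 1 - m1 (\<delta> n) x"] by blast
    have v1: "0 \<le> m1 (\<delta> n) x \<and> m1 (\<delta> n) x \<le> 1" for x
      using m1_bounds[OF pos[of n], of x] e by linarith
    have "ROT ?\<epsilon> p \<mu> \<nu> \<le> ennreal base_cost +
      ennreal ?r * (gap_cost ?u1
        + ennreal ?\<epsilon> * power_integral ?u1) +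
      ennreal M * (spread u2
        + ennreal ?\<epsilon> * power_integral u2)"
      unfolding M_def
      by (rule ROT_le_split[OF self_plan_u1[OF pos] u2 v1 \<epsilon>_of_pos[OF pos] t(2,3)])
    also have "... \<le> ennreal base_cost + ennreal ?r * (ennreal (?dd * (1 + e) powr (1 + 2 * ?s)) * ennreal L) +
      ennreal M * (ennreal ?dd * (ennreal \<kappa> + ennreal C * ennreal (2 * \<tau>')))"
    proof (intro add_mono mult_left_mono order_refl)
      show "gap_cost ?u1
        + ennreal ?\<epsilon> * power_integral ?u1 \<le> ennreal (?dd * (1 + e) powr (1 + 2 * ?s)) * ennreal L"
        unfolding LK[symmetric] by (rule local_plan_value_le[OF pos]) (use elim(3) in blast)
      have "ennreal ?dd * (ennreal \<kappa> + ennreal C * ?I) \<le> ennreal ?dd * (ennreal \<kappa> + ennreal C * ennreal (2 * \<tau>'))"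
        by (intro mult_left_mono add_left_mono elim(1)) auto
      with u2b show "spread u2 + ennreal ?\<epsilon> * power_integral u2
        \<le> ennreal ?dd * (ennreal \<kappa> + ennreal C * ennreal (2 * \<tau>'))" by (rule order_trans)
    qed auto
    also have "... = ennreal base_cost + ennreal ?dd * (ennreal ((1 + e) powr (1 + 2 * ?s) * (?r * L)) + ennreal (M * (\<kappa> + C * (2 * \<tau>'))))"
    proof -
      have 1: "ennreal ?r * (ennreal (?dd * (1 + e) powr (1 + 2 * ?s)) * ennreal L) = ennreal ?dd * ennreal ((1 + e) powr (1 + 2 * ?s) * (?r * L))"
        using L0 by (simp add: mult_ac flip: ennreal_mult')
      have "ennreal \<kappa> + ennreal C * ennreal (2 * \<tau>') = ennreal (\<kappa> + C * (2 * \<tau>'))"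
        using \<kappa> C \<tau>' by (subst ennreal_mult'[symmetric]) (auto simp flip: ennreal_plus)
      then have 2: "ennreal M * (ennreal ?dd * (ennreal \<kappa> + ennreal C * ennreal (2 * \<tau>'))) = ennreal ?dd * ennreal (M * (\<kappa> + C * (2 * \<tau>')))"
        using M by (simp add: ennreal_mult' mult.left_commute)
      show ?thesis unfolding 1 2 by (simp add: distrib_left add.assoc)
    qed
    also have "... \<le> ennreal base_cost + ennreal ?dd * (ennreal (L + \<tau> / 2) + ennreal (\<tau> / 2))"
    proof (intro add_left_mono mult_left_mono add_mono ennreal_leI)
      show "(1 + e) powr (1 + 2 * ?s) * (?r * L) \<le> L + \<tau> / 2" using e_close by simp
      have "C * (2 * \<tau>') \<le> (C + 1) * (2 * \<tau>')" using \<tau>' by (intro mult_right_mono) auto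
      also have "... = \<tau> / (4 * M)"
      proof -
        have "C + 1 \<noteq> 0" "M \<noteq> 0" using C M by auto
        then show ?thesis by (simp add: \<tau>'_def divide_simps)
      qed
      finally have "M * (\<kappa> + C * (2 * \<tau>')) \<le> M * (\<tau> / (4 * M) + \<tau> / (4 * M))"
        using M by (intro mult_left_mono) (auto simp: \<kappa>_def)
      also have "... = \<tau> / 2" using M by (simp add: field_simps)
      finally show "M * (\<kappa> + C * (2 * \<tau>')) \<le> \<tau> / 2" .
    qed simp
    also have "ennreal (L + \<tau> / 2) + ennreal (\<tau> / 2) = ennreal L + ennreal \<tau>"
      using L0 \<tau> by (simp flip: ennreal_plus)
    finally show ?case unfolding LK .
  qed
qed

end

section \<open>Block diagonal plans\<close>

context transport_setting
begin

abbreviation "block_mass v B \<equiv> \<integral>\<^sup>+x. ennreal (indicator B x * v x) \<partial>\<mu>"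
abbreviation "block_power v B \<equiv> \<integral>\<^sup>+x. ennreal (indicator B x * v x powr p) \<partial>\<mu>"
abbreviation "block_penalty v Q I \<equiv> \<Sum>i\<in>I. ennreal (enn2real (block_mass v (Q i)) powr (1 - p)) * block_power v (Q i)"

lemma block_mass_eq:
  assumes "\<And>x. 0 \<le> v x" "\<And>x. v x \<le> 1"
  shows "block_mass v B = ennreal (enn2real (block_mass v B))"
proof -
  have "block_mass v B \<le> (\<integral>\<^sup>+x. 1 \<partial>\<mu>)"
    using assms by (intro nn_integral_mono) (auto split: split_indicator)
  also have "... < top" using \<mu>.emeasure_space_1 by simp
  finally show ?thesis by simp
qed

text \<open>On every cell the plan is the normalised product of v\<mu> with itself. Any function \<open>D\<close> with
|x-y|^2\<le> D(x)+D(y) on cells controls the cost through the marginals alone.\<close>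

lemma block_plan:
  fixes I :: "'i set" and S :: "'i => (real ^ 'n) set"
  assumes I: "finite I" and S: "\<And>i. i \<in> I ==> S i \<in> sets borel" and disj: "disjoint_family_on S I"
    and cover: "AE x in \<mu>. x \<in> (\<Union>i\<in>I. S i)"
    and v [measurable]: "v \<in> borel_measurable borel" and v_pos: "0 < \<eta>" "\<And>x. \<eta> \<le> v x" "\<And>x. v x \<le> 1"
    and D [measurable]: "D \<in> borel_measurable borel" and D0: "\<And>x. 0 \<le> D x"
    and diam: "\<And>i x y. i \<in> I ==> x \<in> S i ==> y \<in> S i ==> (norm (x - y))^2 \<le> D x + D y"
  shows "\<exists>u. self_plan u v \<and>
    spread u \<le> 2 * (\<integral>\<^sup>+x. ennreal (D x * v x) \<partial>\<mu>) \<and>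
    power_integral u \<le>
      block_penalty v S I"
proof -
  interpret P: pair_prob_space \<mu> \<mu> ..
  have v0: "0 < v x" "0 \<le> v x" for x using v_pos(1) v_pos(2)[of x] by auto
  define V where "V i = enn2real (block_mass v (S i))" for i
  define u where "u z = (\<Sum>i\<in>I. indicator (S i) (fst z) * indicator (S i) (snd z) * (v (fst z) * v (snd z) / V i))" for z
  have ind [measurable]: "(\<lambda>x. indicator (S i) x :: real) \<in> borel_measurable borel" if "i \<in> I" for i
    using S[OF that] by (rule borel_measurable_indicator)
  have vS [measurable]: "(\<lambda>x. ennreal (indicator (S i) x * v x)) \<in> borel_measurable borel" if "i \<in> I" for i
    using ind[OF that] by measurable
  have V_eq: "block_mass v (S i) = ennreal (V i)" for i unfolding V_def by (rule block_mass_eq[OF v0(2) v_pos(3)])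
  have V0: "0 \<le> V i" for i by (simp add: V_def)
  \<comment> \<open>Cells with \<open>V i = 0\<close> are null sets; there \<open>u\<close> is zero because of the division by zero.\<close>
  have V_pos: "AE x in \<mu>. \<forall>i\<in>I. x \<in> S i --> 0 < V i"
  proof (rule AE_finite_allI[OF I])
    fix i assume i: "i \<in> I"
    show "AE x in \<mu>. x \<in> S i --> 0 < V i"
    proof (cases "V i = 0")
      case True
      then have "block_mass v (S i) = 0" by (simp add: V_eq)
      moreover have "(\<lambda>x. ennreal (indicator (S i) x * v x)) \<in> borel_measurable \<mu>"
        using vS[OF i] by (simp cong: measurable_cong_sets)
      ultimately have "AE x in \<mu>. ennreal (indicator (S i) x * v x) = 0" by (simp add: nn_integral_0_iff_AE)
      then show ?thesis
      proof eventually_elim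
        case (elim x) then show ?case using v0(1)[of x] by (auto split: split_indicator_asm)
      qed
    qed (use V0[of i] in auto)
  qed
  have fst_ind: "(\<lambda>z :: (real ^ 'n) \<times> (real ^ 'n). indicator (S i) (fst z) :: real) \<in> borel_measurable borel"
    and snd_ind: "(\<lambda>z :: (real ^ 'n) \<times> (real ^ 'n). indicator (S i) (snd z) :: real) \<in> borel_measurable borel" if "i \<in> I" for i
    by (rule measurable_compose[OF fst_borel_measurable ind[OF that]], rule measurable_compose[OF snd_borel_measurable ind[OF that]])
  have [measurable]: "(\<lambda>z :: (real ^ 'n) \<times> (real ^ 'n). v (fst z)) \<in> borel_measurable borel"
    "(\<lambda>z :: (real ^ 'n) \<times> (real ^ 'n). v (snd z)) \<in> borel_measurable borel"
    by - (rule measurable_compose[OF fst_borel_measurable v], rule measurable_compose[OF snd_borel_measurable v])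
  have [measurable]: "(\<lambda>z :: (real ^ 'n) \<times> (real ^ 'n). D (fst z)) \<in> borel_measurable borel"
    "(\<lambda>z :: (real ^ 'n) \<times> (real ^ 'n). D (snd z)) \<in> borel_measurable borel"
    by - (rule measurable_compose[OF fst_borel_measurable D], rule measurable_compose[OF snd_borel_measurable D])
  have um [measurable]: "u \<in> borel_measurable borel"
    unfolding u_def by (intro borel_measurable_sum borel_measurable_times fst_ind snd_ind) measurable
  have u0: "0 \<le> u z" for z
    unfolding u_def using V0 v0 by (intro sum_nonneg mult_nonneg_nonneg divide_nonneg_nonneg) auto
  have u_in: "u (x, y) = indicator (S i) y * v y * (v x / V i)" if i: "i \<in> I" "x \<in> S i" for i x y
  proof -
    have "(\<Sum>l\<in>I. indicator (S l) x * indicator (S l) y * (v x * v y / V l)) =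
        (\<Sum>l\<in>I. if l = i then indicator (S i) y * v y * (v x / V i) else 0)"
    proof (intro sum.cong refl)
      fix l assume l: "l \<in> I"
      show "indicator (S l) x * indicator (S l) y * (v x * v y / V l) = (if l = i then indicator (S i) y * v y * (v x / V i) else 0)"
      proof (cases "l = i")
        case False
        then have "x \<notin> S l" using disj i l by (auto simp: disjoint_family_on_def)
        then show ?thesis using False by simp
      qed (use i in simp)
    qed
    then show ?thesis using i(1) I by (simp add: u_def)
  qed
  have u_out: "u (x, y) = 0" if "x \<notin> (\<Union>i\<in>I. S i)" for x y using that by (simp add: u_def)
  have sym: "u (x, y) = u (y, x)" for x y by (simp add: u_def mult_ac)
  have sec: "(\<integral>\<^sup>+y. ennreal (indicator (S i) y * v y * k) \<partial>\<mu>) = ennreal (V i * k)" if "i \<in> I" "0 \<le> k" for i k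
  proof -
    have "(\<integral>\<^sup>+y. ennreal (indicator (S i) y * v y * k) \<partial>\<mu>) = (\<integral>\<^sup>+y. ennreal k * ennreal (indicator (S i) y * v y) \<partial>\<mu>)"
      using that(2) by (intro nn_integral_cong) (simp add: mult.commute ennreal_mult')
    also have "... = ennreal k * ennreal (V i)"
      unfolding V_eq[symmetric] using vS[OF that(1)] by (intro nn_integral_cmult) (simp cong: measurable_cong_sets)
    also have "... = ennreal (V i * k)" using that(2) by (simp add: ennreal_mult' mult.commute)
    finally show ?thesis .
  qed
  have marg: "AE x in \<mu>. (\<integral>\<^sup>+y. ennreal (u (x, y)) \<partial>\<mu>) = ennreal (v x)"
    using cover V_pos
  proof eventually_elim
    case (elim x)
    then obtain i where i: "i \<in> I" "x \<in> S i" "0 < V i" by auto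
    have "(\<integral>\<^sup>+y. ennreal (u (x, y)) \<partial>\<mu>) = ennreal (V i * (v x / V i))"
      unfolding u_in[OF i(1,2)] using i v0 by (intro sec) auto
    then show ?case using i by simp
  qed
  have plan: "self_plan u v" using um u0 sym marg by (auto simp: self_plan_def)
  have dm1: "(\<lambda>z. ennreal (D (fst z) * u z)) \<in> borel_measurable borel" and dm2: "(\<lambda>z. ennreal (D (snd z) * u z)) \<in> borel_measurable borel"
    by measurable
  have cost1: "double_integral (\<lambda>z. ennreal (D (fst z) * u z)) = (\<integral>\<^sup>+x. ennreal (D x * v x) \<partial>\<mu>)"
  proof (rule nn_integral_cong_AE)
    show "AE x in \<mu>. (\<integral>\<^sup>+y. ennreal (D (fst (x, y)) * u (x, y)) \<partial>\<mu>) = ennreal (D x * v x)"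
      using marg
    proof eventually_elim
      case (elim x)
      have "(\<integral>\<^sup>+y. ennreal (D (fst (x, y)) * u (x, y)) \<partial>\<mu>) = (\<integral>\<^sup>+y. ennreal (D x) * ennreal (u (x, y)) \<partial>\<mu>)"
        using D0 by (simp add: ennreal_mult')
      also have "... = ennreal (D x) * (\<integral>\<^sup>+y. ennreal (u (x, y)) \<partial>\<mu>)"
        using section_cong_\<mu>[OF um] by (intro nn_integral_cmult) measurable
      finally show ?case using D0 by (simp add: elim ennreal_mult')
    qed
  qed
  have cost2: "double_integral (\<lambda>z. ennreal (D (snd z) * u z)) = double_integral (\<lambda>z. ennreal (D (fst z) * u z))"
  proof -
    have "(\<lambda>z. ennreal (D (snd z) * u z)) \<in> borel_measurable (\<mu> \<Otimes>\<^sub>M \<mu>)"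
      by (rule pair_borel_measurable[OF dm2 sets_\<mu> sets_\<mu>])
    then have "double_integral (\<lambda>z. ennreal (D (snd z) * u z)) = (\<integral>\<^sup>+y. \<integral>\<^sup>+x. ennreal (D (snd (x, y)) * u (x, y)) \<partial>\<mu> \<partial>\<mu>)"
      by (intro P.Fubini'[symmetric]) (simp add: case_prod_beta')
    then show ?thesis by (simp add: sym)
  qed
  have "spread u \<le> double_integral (\<lambda>z. ennreal (D (fst z) * u z) + ennreal (D (snd z) * u z))"
  proof (rule double_integral_mono)
    fix z :: "(real ^ 'n) \<times> (real ^ 'n)"
    obtain x y where z: "z = (x, y)" by (cases z)
    have "(norm (x - y))^2 * u z \<le> (D x + D y) * u z"
    proof (cases "u z = 0")
      case False
      then obtain i where i: "i \<in> I" "x \<in> S i" using u_out[of x y] z by blast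
      then have "y \<in> S i" using False u_in[OF i, of y] z by (auto split: split_indicator_asm)
      then show ?thesis using diam[OF i] u0 by (intro mult_right_mono) auto
    qed simp
    then have "ennreal ((norm (x - y))^2 * u z) \<le> ennreal (D x * u z + D y * u z)" by (simp add: ennreal_leI distrib_right)
    also have "... = ennreal (D x * u z) + ennreal (D y * u z)" using D0 u0 by (intro ennreal_plus mult_nonneg_nonneg) auto
    finally show "ennreal ((norm (fst z - snd z))^2 * u z) \<le> ennreal (D (fst z) * u z) + ennreal (D (snd z) * u z)" by (simp add: z)
  qed
  also have "... = 2 * (\<integral>\<^sup>+x. ennreal (D x * v x) \<partial>\<mu>)"
    unfolding double_integral_add[OF dm1 dm2] cost2 cost1 by (simp add: mult_2)
  finally have cost: "spread u \<le> 2 * (\<integral>\<^sup>+x. ennreal (D x * v x) \<partial>\<mu>)" .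
  have vp [measurable]: "(\<lambda>x. ennreal (indicator (S i) x * v x powr p)) \<in> borel_measurable borel" if "i \<in> I" for i
    using ind[OF that] by measurable
  have "power_integral u \<le> (\<integral>\<^sup>+x. (\<Sum>i\<in>I. ennreal (V i powr (1 - p)) * ennreal (indicator (S i) x * v x powr p)) \<partial>\<mu>)"
  proof (rule nn_integral_mono)
    fix x
    show "(\<integral>\<^sup>+y. ennreal (u (x, y) powr p) \<partial>\<mu>) \<le> (\<Sum>i\<in>I. ennreal (V i powr (1 - p)) * ennreal (indicator (S i) x * v x powr p))"
    proof (cases "x \<in> (\<Union>i\<in>I. S i)")
      case False
      then show ?thesis using p by (simp add: u_out)
    next
      case True
      then obtain i where i: "i \<in> I" "x \<in> S i" by auto
      have "(\<integral>\<^sup>+y. ennreal (u (x, y) powr p) \<partial>\<mu>) \<le> (\<integral>\<^sup>+y. ennreal (indicator (S i) y * v y * (v x / V i) powr p) \<partial>\<mu>)"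
      proof (intro nn_integral_mono ennreal_leI)
        fix y
        have "v y powr p \<le> v y powr 1" using v0[of y] v_pos(3)[of y] p by (intro powr_mono') auto
        then have "v y powr p * (v x / V i) powr p \<le> v y * (v x / V i) powr p"
          using v0[of y] by (intro mult_right_mono) auto
        moreover have "(v y * (v x / V i)) powr p = v y powr p * (v x / V i) powr p"
          by (rule powr_mult)
        ultimately show "u (x, y) powr p \<le> indicator (S i) y * v y * (v x / V i) powr p"
          using p by (simp add: u_in[OF i] split: split_indicator)
      qed
      also have "... = ennreal (V i * (v x / V i) powr p)" using i(1) by (intro sec) auto
      also have "V i * (v x / V i) powr p = V i powr (1 - p) * v x powr p"
      proof (cases "V i = 0")
        case False
        then have "0 < V i" using V0[of i] by simp
        then have "V i powr (1 - p) = V i / V i powr p" by (simp add: powr_diff)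
        then show ?thesis using v0[of x] V0[of i] by (simp add: powr_divide)
      qed simp
      also have "ennreal (V i powr (1 - p) * v x powr p) = ennreal (V i powr (1 - p)) * ennreal (indicator (S i) x * v x powr p)"
        using i by (simp add: ennreal_mult')
      also have "... \<le> (\<Sum>i\<in>I. ennreal (V i powr (1 - p)) * ennreal (indicator (S i) x * v x powr p))"
        using I i(1) by (intro member_le_sum) auto
      finally show ?thesis .
    qed
  qed
  also have "... = (\<Sum>i\<in>I. ennreal (V i powr (1 - p)) * block_power v (S i))"
    using vp by (subst nn_integral_sum) (auto simp: nn_integral_cmult cong: measurable_cong_sets intro!: sum.cong)
  finally show ?thesis using plan cost unfolding V_def by blast
qed

lemma remainder_mass_split:
  assumes W [measurable]: "W \<in> borel_measurable borel" and W0: "\<And>x. 0 \<le> W x"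
    and v [measurable]: "v \<in> borel_measurable borel" and \<eta>: "0 < \<eta>" and v1: "\<And>x. v x \<le> 1"
  shows "(\<integral>\<^sup>+x. ennreal (W x * v x) \<partial>\<mu>) \<le> ennreal (2 * \<eta>) * (\<integral>\<^sup>+x. ennreal (W x) \<partial>\<mu>) + (\<integral>\<^sup>+x. ennreal (W x) * indicator {x. 2 * \<eta> < v x} x \<partial>\<mu>)"
proof -
  have "(\<integral>\<^sup>+x. ennreal (W x * v x) \<partial>\<mu>) \<le> (\<integral>\<^sup>+x. ennreal (2 * \<eta>) * ennreal (W x) + ennreal (W x) * indicator {x. 2 * \<eta> < v x} x \<partial>\<mu>)"
  proof (rule nn_integral_mono)
    fix x
    show "ennreal (W x * v x) \<le> ennreal (2 * \<eta>) * ennreal (W x) + ennreal (W x) * indicator {x. 2 * \<eta> < v x} x"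
    proof (cases "2 * \<eta> < v x")
      case True
      have "W x * v x \<le> W x * 1" using W0 v1 by (intro mult_left_mono) auto
      then have "ennreal (W x * v x) \<le> ennreal (W x)" by (simp add: ennreal_leI)
      then show ?thesis using True by (simp add: add_increasing)
    next
      case False
      have "W x * v x \<le> W x * (2 * \<eta>)" using W0 False by (intro mult_left_mono) auto
      then have "ennreal (W x * v x) \<le> ennreal (2 * \<eta> * W x)" by (intro ennreal_leI) (simp add: mult.commute)
      then show ?thesis using False \<eta> by (simp add: ennreal_mult')
    qed
  qed
  also have "... = (\<integral>\<^sup>+x. ennreal (2 * \<eta>) * ennreal (W x) \<partial>\<mu>) + (\<integral>\<^sup>+x. ennreal (W x) * indicator {x. 2 * \<eta> < v x} x \<partial>\<mu>)"
    by (rule nn_integral_add) measurable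
  also have "(\<integral>\<^sup>+x. ennreal (2 * \<eta>) * ennreal (W x) \<partial>\<mu>) = ennreal (2 * \<eta>) * (\<integral>\<^sup>+x. ennreal (W x) \<partial>\<mu>)"
    by (rule nn_integral_cmult) measurable
  finally show ?thesis .
qed

end

text \<open>Weighted arithmetic-geometric mean of V_i and 1/N, with weights 2-p and p-1.\<close>

lemma sum_powr_le_card:
  fixes V :: "'i => real"
  assumes I: "finite I" "I \<noteq> {}" and V: "\<And>i. i \<in> I ==> 0 \<le> V i" "(\<Sum>i\<in>I. V i) \<le> 1" and p: "1 < p" "p \<le> 2"
  shows "(\<Sum>i\<in>I. V i powr (2 - p)) \<le> real (card I) powr (p - 1)"
proof -
  let ?N = "real (card I)"
  have N: "0 < ?N" using I by (simp add: card_gt_0_iff)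
  have "V i powr (2 - p) * (1 / ?N) powr (p - 1) \<le> (2 - p) * V i + (p - 1) * (1 / ?N)" if "i \<in> I" for i
  proof (cases "V i = 0")
    case False
    then show ?thesis using V(1)[OF that] N p by (intro Youngs_inequality_0) auto
  qed (use p N in simp)
  then have "(\<Sum>i\<in>I. V i powr (2 - p) * (1 / ?N) powr (p - 1)) \<le> (\<Sum>i\<in>I. (2 - p) * V i + (p - 1) * (1 / ?N))"
    by (intro sum_mono) auto
  also have "... = (2 - p) * (\<Sum>i\<in>I. V i) + (p - 1)"
    using N by (simp add: sum.distrib sum_distrib_left)
  also have "... \<le> (2 - p) * 1 + (p - 1)" using p V(2) by (intro add_right_mono mult_left_mono) auto
  finally have "(\<Sum>i\<in>I. V i powr (2 - p)) * (1 / ?N) powr (p - 1) \<le> 1" by (simp add: sum_distrib_right)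
  moreover have "(1 / ?N) powr (p - 1) = 1 / ?N powr (p - 1)" using N by (simp add: powr_divide)
  ultimately show ?thesis using N by (simp add: field_simps)
qed

section \<open>The remainder under a moment bound\<close>

text \<open>A monotone map of the line onto a bounded interval with derivative of order |t|^{-1-a}. Equal cells of the
image pull back to cells whose diameter grows like |t|^{1+a}.\<close>

definition squash :: "real => real => real" where
  "squash a t = sgn t * (1 - (1 + \<bar>t\<bar>) powr (- a))"

lemma squash_bounds: assumes "0 < a" shows "\<bar>squash a t\<bar> \<le> 1"
proof -
  have "(1 + \<bar>t\<bar>) powr (- a) \<le> (1 + \<bar>t\<bar>) powr 0" using assms by (intro powr_mono) auto
  then show ?thesis by (auto simp: squash_def abs_mult sgn_if)
qed

lemma squash_measurable [measurable]: "squash a \<in> borel_measurable borel"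
  unfolding squash_def[abs_def] by measurable

lemma powr_decrement_ge:
  fixes a s t m :: real
  assumes a: "0 < a" and st: "0 \<le> s" "s \<le> t" "t \<le> m"
  shows "t - s \<le> ((1 + s) powr (- a) - (1 + t) powr (- a)) * ((1 + m) powr (1 + a) / a)"
proof (cases "s = t")
  case False
  then have "s < t" using st by linarith
  have "\<exists>z. s < z \<and> z < t \<and> - ((1 + t) powr (- a)) - - ((1 + s) powr (- a)) = (t - s) * (a * (1 + z) powr (- a - 1))"
    using \<open>s < t\<close> st(1) by (intro MVT2) (auto intro!: derivative_eq_intros simp: algebra_simps)
  then obtain z where z: "s < z" "z < t" "(1 + s) powr (- a) - (1 + t) powr (- a) = (t - s) * (a * (1 + z) powr (- a - 1))" by auto
  have "1 = (1 + z) powr (- a - 1) * (1 + z) powr (1 + a)" using z st by (simp flip: powr_add)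
  also have "... \<le> (1 + z) powr (- a - 1) * (1 + m) powr (1 + a)"
    using z st a by (intro mult_left_mono powr_mono2) auto
  finally have "(t - s) * 1 \<le> (t - s) * ((1 + z) powr (- a - 1) * (1 + m) powr (1 + a))"
    using st by (intro mult_left_mono) auto
  also have "... = ((1 + s) powr (- a) - (1 + t) powr (- a)) * ((1 + m) powr (1 + a) / a)"
    unfolding z(3) using a by simp
  finally show ?thesis by simp
qed simp

text \<open>The derivative bound on [-m,m], with the two half-lines treated separately because of the kink of |t| at
0.\<close>

lemma squash_expands:
  assumes a: "0 < a" and m: "\<bar>s\<bar> \<le> m" "\<bar>t\<bar> \<le> m"
  shows "\<bar>s - t\<bar> \<le> \<bar>squash a s - squash a t\<bar> * ((1 + m) powr (1 + a) / a)"
proof -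
  let ?K = "(1 + m) powr (1 + a) / a"
  define g where "g r = 1 - (1 + r) powr (- a)" for r :: real
  have K: "0 \<le> ?K" using a by simp
  have pos: "squash a r = g r" if "0 \<le> r" for r using that by (cases "r = 0") (auto simp: squash_def g_def)
  have neg: "squash a r = - g (- r)" if "r \<le> 0" for r using that by (cases "r = 0") (auto simp: squash_def g_def)
  have step: "r' - r \<le> (g r' - g r) * ?K" if "0 \<le> r" "r \<le> r'" "r' \<le> m" for r r'
    using powr_decrement_ge[OF a that] by (simp add: g_def)
  have g0: "g 0 = 0" by (simp add: g_def)
  have main: "t - s \<le> (squash a t - squash a s) * ?K" if st: "s \<le> t" "\<bar>s\<bar> \<le> m" "\<bar>t\<bar> \<le> m" for s t
  proof -
    consider "0 \<le> s" | "t \<le> 0" | "s < 0" "0 < t" by linarith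
    then show ?thesis
    proof cases
      case 1 then show ?thesis using step[of s t] st by (simp add: pos)
    next
      case 2 then show ?thesis using step[of "- t" "- s"] st by (simp add: neg)
    next
      case 3
      then show ?thesis using add_mono[OF step[of 0 t] step[of 0 "- s"]] st by (simp add: pos neg g0 distrib_right add_divide_distrib)
    qed
  qed
  have *: "(squash a t - squash a s) * ?K \<le> \<bar>squash a s - squash a t\<bar> * ?K" for s t
    using K by (intro mult_right_mono) auto
  show ?thesis
  proof (cases "s \<le> t")
    case True then show ?thesis using main[of s t] *[of t s] m by linarith
  next
    case False then show ?thesis using main[of t s] *[of s t] m by (simp add: abs_minus_commute)
  qed
qed

context transport_setting
begin

text \<open>As v^p\<le> v, a cell of mass V contributes at most V^{2-p}, whatever its shape.\<close>

lemma block_penalty_le_card: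
  fixes I :: "'i set" and S :: "'i => (real ^ 'n) set"
  assumes I: "finite I" "I \<noteq> {}" and S: "\<And>i. i \<in> I ==> S i \<in> sets borel" and disj: "disjoint_family_on S I"
    and v [measurable]: "v \<in> borel_measurable borel" and v01: "\<And>x. 0 \<le> v x" "\<And>x. v x \<le> 1" and p2: "p \<le> 2"
  shows "block_penalty v S I \<le> ennreal (real (card I) powr (p - 1))"
proof -
  define V where "V i = enn2real (block_mass v (S i))" for i
  have V_le: "block_mass v (S i) \<le> emeasure \<mu> (S i)" if "i \<in> I" for i
  proof -
    have "block_mass v (S i) \<le> (\<integral>\<^sup>+x. indicator (S i) x \<partial>\<mu>)"
      using v01 by (intro nn_integral_mono) (auto split: split_indicator)
    then show ?thesis using S[OF that] by simp
  qed
  have V_eq: "block_mass v (S i) = ennreal (V i)" for i unfolding V_def by (rule block_mass_eq[OF v01])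
  have V0: "0 \<le> V i" for i by (simp add: V_def)
  have "ennreal (\<Sum>i\<in>I. V i) = (\<Sum>i\<in>I. ennreal (V i))" using V0 by simp
  also have "... \<le> (\<Sum>i\<in>I. emeasure \<mu> (S i))" using V_le V_eq by (intro sum_mono) simp
  also have "... = emeasure \<mu> (\<Union>i\<in>I. S i)" using S disj I by (intro sum_emeasure) auto
  also have "... \<le> ennreal 1" using \<mu>.emeasure_le_1 by simp
  finally have sum1: "(\<Sum>i\<in>I. V i) \<le> 1" by simp
  have "(\<Sum>i\<in>I. ennreal (V i powr (1 - p)) * block_power v (S i)) \<le>
      (\<Sum>i\<in>I. ennreal (V i powr (2 - p)))"
  proof (intro sum_mono)
    fix i assume i: "i \<in> I"
    have "v x powr p \<le> v x powr 1" for x using v01 p by (intro powr_mono') auto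
    then have "block_power v (S i) \<le> ennreal (V i)"
      unfolding V_eq[symmetric] using v01 by (intro nn_integral_mono ennreal_leI mult_left_mono) auto
    then have "ennreal (V i powr (1 - p)) * block_power v (S i) \<le> ennreal (V i powr (1 - p)) * ennreal (V i)"
      by (rule mult_left_mono) simp
    also have "... = ennreal (V i powr (2 - p))"
      using V0[of i] powr_mult_base[of "V i" "1 - p"] by (simp add: mult.commute flip: ennreal_mult')
    finally show "ennreal (V i powr (1 - p)) * block_power v (S i) \<le> ennreal (V i powr (2 - p))" .
  qed
  also have "... = ennreal (\<Sum>i\<in>I. V i powr (2 - p))" by simp
  also have "... \<le> ennreal (real (card I) powr (p - 1))"
    by (intro ennreal_leI sum_powr_le_card I V0 sum1 p p2)
  finally show ?thesis unfolding V_def .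
qed

text \<open>Products of intervals of length s in the squashed coordinates: there are O(s^{-d}) of them, and they cover
the whole space.\<close>

lemma squash_cells:
  assumes a: "0 < a" and s: "0 < s" "s < 1"
  shows "\<exists>(I :: ('n => int) set) S. finite I \<and> I \<noteq> {} \<and> real (card I) \<le> (4 / s) ^ CARD('n) \<and> (\<forall>i. S i \<in> sets borel) \<and>
    disjoint_family_on S I \<and> (\<Union>i\<in>I. S i) = (UNIV :: (real ^ 'n) set) \<and>
    (\<forall>i x y. x \<in> S i --> y \<in> S i --> (norm (x - y))^2 \<le>
       real CARD('n) / a^2 * s^2 * (1 + norm x) powr (2 + 2 * a) + real CARD('n) / a^2 * s^2 * (1 + norm y) powr (2 + 2 * a))"
proof -
  define J where "J = {\<lfloor>- 1 / s\<rfloor>..\<lfloor>1 / s\<rfloor>}"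
  define I where "I = (PiE UNIV (\<lambda>_. J) :: ('n => int) set)"
  define S where "S c = {x :: real ^ 'n. \<forall>k. \<lfloor>squash a (x $ k) / s\<rfloor> = c k}" for c
  have J: "\<lfloor>squash a t / s\<rfloor> \<in> J" for t
  proof -
    have "- 1 \<le> squash a t" "squash a t \<le> 1" using squash_bounds[OF a, of t] by linarith+
    then have "- 1 / s \<le> squash a t / s" "squash a t / s \<le> 1 / s"
      using s by (auto intro: divide_right_mono[of _ _ s] simp del: divide_minus_left)
    then show ?thesis unfolding J_def by (auto intro: floor_mono)
  qed
  have "(\<lambda>_. \<lfloor>squash a 0 / s\<rfloor>) \<in> I" using J by (auto simp: I_def)
  then have "I \<noteq> {}" by blast
  moreover have "finite I" by (auto simp: I_def J_def intro: finite_PiE)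
  moreover have "real (card I) \<le> (4 / s) ^ CARD('n)"
  proof -
    have "real (card J) \<le> 4 / s"
    proof -
      have "- 1 / s - 1 < real_of_int \<lfloor>- 1 / s\<rfloor>" "real_of_int \<lfloor>1 / s\<rfloor> \<le> 1 / s" by linarith+
      moreover have "1 < 1 / s" "- 1 / s = - (1 / s)" "4 / s = 4 * (1 / s)" using s by simp_all
      moreover have "real (card J) = max 0 (real_of_int \<lfloor>1 / s\<rfloor> - real_of_int \<lfloor>- 1 / s\<rfloor> + 1)"
        unfolding J_def by (simp add: max_def)
      ultimately show ?thesis by linarith
    qed
    then have "real (card J) ^ CARD('n) \<le> (4 / s) ^ CARD('n)" by (intro power_mono) auto
    then show ?thesis by (simp add: I_def card_PiE)
  qed
  moreover have "S c \<in> sets borel" for c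
  proof -
    have "S c = (\<Inter>k\<in>UNIV. {x. of_int (c k) \<le> squash a (x $ k) / s} \<inter> {x. squash a (x $ k) / s < of_int (c k) + 1})"
      by (auto simp: S_def floor_eq_iff)
    also have "... \<in> sets borel"
    proof (intro sets.finite_INT sets.Int)
      fix k :: 'n
      have [measurable]: "(\<lambda>x :: real ^ 'n. x $ k) \<in> borel_measurable borel"
        by (intro borel_measurable_continuous_onI continuous_intros)
      show "{x. of_int (c k) \<le> squash a (x $ k) / s} \<in> sets borel" "{x. squash a (x $ k) / s < of_int (c k) + 1} \<in> sets borel"
        by measurable
    qed auto
    finally show ?thesis .
  qed
  moreover have "disjoint_family_on S I"
  proof (unfold disjoint_family_on_def, intro ballI impI)
    fix c c' :: "'n => int" assume "c \<noteq> c'"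
    then obtain k where "c k \<noteq> c' k" by blast
    then show "S c \<inter> S c' = {}" by (auto simp: S_def)
  qed
  moreover have "(\<Union>i\<in>I. S i) = UNIV"
  proof (intro set_eqI iffI UNIV_I)
    fix x :: "real ^ 'n"
    have "(\<lambda>k. \<lfloor>squash a (x $ k) / s\<rfloor>) \<in> I" using J by (auto simp: I_def)
    moreover have "x \<in> S (\<lambda>k. \<lfloor>squash a (x $ k) / s\<rfloor>)" by (simp add: S_def)
    ultimately show "x \<in> (\<Union>i\<in>I. S i)" by blast
  qed
  moreover have "(norm (x - y))^2 \<le>
       real CARD('n) / a^2 * s^2 * (1 + norm x) powr (2 + 2 * a) + real CARD('n) / a^2 * s^2 * (1 + norm y) powr (2 + 2 * a)"
    if x: "x \<in> S c" and y: "y \<in> S c" for c x y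
  proof -
    let ?m = "max (norm x) (norm y)" and ?q = "2 + 2 * a"
    let ?b = "s^2 / a^2 * ((1 + norm x) powr ?q + (1 + norm y) powr ?q)"
    have comp: "(x $ k - y $ k)^2 \<le> ?b" for k
    proof -
      have "\<lfloor>squash a (x $ k) / s\<rfloor> = \<lfloor>squash a (y $ k) / s\<rfloor>" using x y by (simp add: S_def)
      then have "\<bar>squash a (x $ k) / s - squash a (y $ k) / s\<bar> \<le> 1" by linarith
      then have "\<bar>squash a (x $ k) - squash a (y $ k)\<bar> / s \<le> 1" using s by (simp flip: diff_divide_distrib)
      then have sq: "\<bar>squash a (x $ k) - squash a (y $ k)\<bar> \<le> s" using s by (simp add: pos_divide_le_eq)
      have "\<bar>x $ k - y $ k\<bar> \<le> \<bar>squash a (x $ k) - squash a (y $ k)\<bar> * ((1 + ?m) powr (1 + a) / a)"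
        using component_le_norm_cart[of x k] component_le_norm_cart[of y k] by (intro squash_expands[OF a]) auto
      also have "... \<le> s * ((1 + ?m) powr (1 + a) / a)" using sq a by (intro mult_right_mono) auto
      finally have "\<bar>x $ k - y $ k\<bar>^2 \<le> (s * ((1 + ?m) powr (1 + a) / a))^2" by (intro power_mono) auto
      also have "... = s^2 / a^2 * ((1 + ?m) powr (1 + a))^2" by (simp add: power_mult_distrib power_divide)
      also have "((1 + ?m) powr (1 + a))^2 = (1 + ?m) powr ?q"
        by (simp add: power2_eq_square distrib_left flip: powr_add)
      also have "s^2 / a^2 * (1 + ?m) powr ?q \<le> ?b" by (intro mult_left_mono) (auto simp: max_def)
      finally show ?thesis by (simp only: power2_abs)
    qed
    have "(norm (x - y))^2 = (\<Sum>k\<in>UNIV. (x $ k - y $ k)^2)"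
      unfolding power2_norm_eq_inner inner_vec_def by (simp add: power2_eq_square)
    also have "... \<le> (\<Sum>k\<in>(UNIV :: 'n set). ?b)" by (intro sum_mono comp)
    also have "... = real CARD('n) / a^2 * s^2 * (1 + norm x) powr ?q + real CARD('n) / a^2 * s^2 * (1 + norm y) powr ?q"
      by (simp add: distrib_left)
    finally show ?thesis .
  qed
  ultimately show ?thesis by (intro exI[of _ I] exI[of _ S]) blast
qed

text \<open>The cells are taken at scale s=\<rho>\<delta>. A large \<rho> makes the penalty small compared with
\<delta>^2, and then a small \<eta> makes the transport cost of the bulk small.\<close>

theorem remainder_property_moment:
  assumes p2: "p \<le> 2" and \<beta>: "0 < \<beta>" and mom: "\<mu> \<in> prob_moment (2 + \<beta>)"
  shows "remainder_property"
proof -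
  let ?d = "CARD('n)"
  define a where "a = \<beta> / 2"
  have a: "0 < a" using \<beta> by (simp add: a_def)
  define W :: "real ^ 'n => real" where "W x = (1 + norm x) powr (2 + 2 * a)" for x
  have W_meas [measurable]: "W \<in> borel_measurable borel" unfolding W_def[abs_def] by measurable
  have W1: "1 \<le> W x" for x
  proof -
    have "(1 + norm x) powr 0 \<le> W x" unfolding W_def using a by (intro powr_mono) auto
    moreover have "1 + norm x \<noteq> 0" using norm_ge_zero[of x] by linarith
    ultimately show ?thesis by simp
  qed
  have W_fin: "(\<integral>\<^sup>+x. ennreal (W x) \<partial>\<mu>) < \<infinity>"
  proof -
    have le: "W x \<le> 2 powr (2 + \<beta>) * (1 + norm x powr (2 + \<beta>))" for x
    proof -
      have "W x \<le> (2 * max 1 (norm x)) powr (2 + \<beta>)"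
        unfolding W_def a_def using \<beta> by (auto intro!: powr_mono2)
      also have "... = 2 powr (2 + \<beta>) * max 1 (norm x) powr (2 + \<beta>)" by (simp add: powr_mult)
      also have "... \<le> 2 powr (2 + \<beta>) * (1 + norm x powr (2 + \<beta>))"
        by (intro mult_left_mono) (auto simp: max_def)
      finally show ?thesis .
    qed
    have "(\<integral>\<^sup>+x. ennreal (W x) \<partial>\<mu>) \<le> (\<integral>\<^sup>+x. ennreal (2 powr (2 + \<beta>)) * (1 + ennreal (norm x powr (2 + \<beta>))) \<partial>\<mu>)"
    proof (rule nn_integral_mono)
      fix x
      have "ennreal (W x) \<le> ennreal (2 powr (2 + \<beta>) * (1 + norm x powr (2 + \<beta>)))" using le by (rule ennreal_leI)
      then show "ennreal (W x) \<le> ennreal (2 powr (2 + \<beta>)) * (1 + ennreal (norm x powr (2 + \<beta>)))"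
        by (simp add: ennreal_mult' ennreal_plus)
    qed
    also have "... = ennreal (2 powr (2 + \<beta>)) * (1 + (\<integral>\<^sup>+x. ennreal (norm x powr (2 + \<beta>)) \<partial>\<mu>))"
      using \<mu>.emeasure_space_1 by (simp add: nn_integral_cmult nn_integral_add)
    also have "... < \<infinity>" using mom by (simp add: prob_moment_def ennreal_mult_less_top)
    finally show ?thesis .
  qed
  define IW where "IW = enn2real (\<integral>\<^sup>+x. ennreal (W x) \<partial>\<mu>)"
  have IW_eq: "(\<integral>\<^sup>+x. ennreal (W x) \<partial>\<mu>) = ennreal IW" using W_fin by (simp add: IW_def)
  have IW0: "0 \<le> IW" by (simp add: IW_def)
  have "\<exists>\<eta> C \<delta>0. 0 < \<eta> \<and> \<eta> < 1 \<and> 0 \<le> C \<and> 0 < \<delta>0 \<and>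
       (\<forall>\<delta>. 0 < \<delta> --> \<delta> < \<delta>0 --> remainder_plan_bound W \<kappa> \<eta> C \<delta>)" if \<kappa>: "0 < \<kappa>" for \<kappa>
  proof -
    let ?e = "real ?d * (p - 1)"
    define b where "b = (\<kappa> / 2) powr (1 / ?e)"
    \<comment> \<open>With \<open>(4 / \<rho>) powr ?e = \<kappa> / 2\<close> the cells contribute \<open>\<kappa> / 2\<close> to the penalty.\<close>
    define \<rho> where "\<rho> = 4 / b"
    have e0: "0 < ?e" using p by simp
    have b0: "0 < b" using \<kappa> by (simp add: b_def)
    have be: "b powr ?e = \<kappa> / 2" using e0 \<kappa> p by (simp add: b_def powr_powr)
    have \<rho>0: "0 < \<rho>" using b0 by (simp add: \<rho>_def)
    define K where "K = real ?d / a^2 * \<rho>^2"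
    have K0: "0 < K" using a \<rho>0 by (simp add: K_def)
    define C where "C = 2 * K"
    have C0: "0 < C" using K0 by (simp add: C_def)
    define \<eta> where "\<eta> = min (1 / 2) (\<kappa> / (4 * C * (IW + 1)))"
    have \<eta>: "0 < \<eta>" "\<eta> < 1" using \<kappa> C0 IW0 by (auto simp: \<eta>_def)
    have small: "C * (2 * \<eta> * IW) \<le> \<kappa> / 2"
    proof -
      have nz: "0 < 4 * C * (IW + 1)" using C0 IW0 by simp
      have "\<eta> \<le> \<kappa> / (4 * C * (IW + 1))" unfolding \<eta>_def by linarith
      then have "\<eta> * (4 * C * (IW + 1)) \<le> \<kappa>" using nz by (simp only: pos_le_divide_eq)
      moreover have "\<eta> * (4 * C * IW) \<le> \<eta> * (4 * C * (IW + 1))" using \<eta> C0 by (intro mult_left_mono) auto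
      moreover have "C * (2 * \<eta> * IW) = \<eta> * (4 * C * IW) / 2" by simp
      ultimately show ?thesis by linarith
    qed
    have "remainder_plan_bound W \<kappa> \<eta> C \<delta>" if \<delta>: "0 < \<delta>" "\<delta> < 1 / \<rho>" for \<delta>
      unfolding remainder_plan_bound_def
    proof (intro allI impI)
      fix v :: "real ^ 'n => real"
      assume v [measurable]: "v \<in> borel_measurable borel" and vb: "\<forall>x. \<eta> \<le> v x \<and> v x \<le> 1"
      define s where "s = \<rho> * \<delta>"
      have s: "0 < s" "s < 1" using \<delta> \<rho>0 by (auto simp: s_def pos_less_divide_eq mult.commute)
      let ?R = "\<integral>\<^sup>+x. ennreal (W x) * indicator {x. 2 * \<eta> < v x} x \<partial>\<mu>"
      define D where "D x = K * \<delta>^2 * W x" for x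
      have D0: "0 \<le> D x" for x using K0 W1[of x] by (simp add: D_def)
      have Dm: "D \<in> borel_measurable borel" unfolding D_def[abs_def] by measurable
      obtain I :: "('n => int) set" and S :: "('n => int) => (real ^ 'n) set" where I: "finite I" "I \<noteq> {}" "real (card I) \<le> (4 / s) ^ ?d"
        and S: "\<forall>i. S i \<in> sets borel" "disjoint_family_on S I" "(\<Union>i\<in>I. S i) = UNIV"
        and SD: "\<forall>i x y. x \<in> S i --> y \<in> S i --> (norm (x - y))^2 \<le>
          real ?d / a^2 * s^2 * (1 + norm x) powr (2 + 2 * a) + real ?d / a^2 * s^2 * (1 + norm y) powr (2 + 2 * a)"
        using squash_cells[OF a s] by (elim exE conjE) (rule that; assumption)
      have Ks: "real ?d / a^2 * s^2 = K * \<delta>^2" by (simp add: K_def s_def power_mult_distrib)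
      have diam: "(norm (x - y))^2 \<le> D x + D y" if "i \<in> I" "x \<in> S i" "y \<in> S i" for i x y
        using SD[rule_format, OF that(2,3)] unfolding Ks D_def W_def .
      have v0: "0 \<le> v x" for x using vb[rule_format, of x] \<eta>(1) by linarith
      obtain u where u: "self_plan u v"
        and cost: "spread u \<le> 2 * (\<integral>\<^sup>+x. ennreal (D x * v x) \<partial>\<mu>)"
        and pen: "power_integral u \<le>
          block_penalty v S I"
      proof -
        have "AE x in \<mu>. x \<in> (\<Union>i\<in>I. S i)" unfolding S(3) by simp
        note plan = block_plan[OF I(1) S(1)[rule_format] S(2) this v \<eta>(1) vb[rule_format, THEN conjunct1] vb[rule_format, THEN conjunct2] Dm D0]
        show thesis by (rule exE, rule plan, erule (2) diam, elim conjE, rule that)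
      qed
      have "2 * (\<integral>\<^sup>+x. ennreal (D x * v x) \<partial>\<mu>) = ennreal (\<delta>^2 * C) * (\<integral>\<^sup>+x. ennreal (W x * v x) \<partial>\<mu>)"
      proof -
        have "(\<integral>\<^sup>+x. ennreal (D x * v x) \<partial>\<mu>) = (\<integral>\<^sup>+x. ennreal (K * \<delta>^2 * (W x * v x)) \<partial>\<mu>)" by (simp add: D_def mult_ac)
        also have "... = ennreal (K * \<delta>^2) * (\<integral>\<^sup>+x. ennreal (W x * v x) \<partial>\<mu>)"
          using K0 by (intro nn_integral_cmult_real) auto
        finally have "2 * (\<integral>\<^sup>+x. ennreal (D x * v x) \<partial>\<mu>) = (ennreal 2 * ennreal (K * \<delta>^2)) * (\<integral>\<^sup>+x. ennreal (W x * v x) \<partial>\<mu>)"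
          by (simp add: mult.assoc)
        also have "ennreal 2 * ennreal (K * \<delta>^2) = ennreal (\<delta>^2 * C)"
          using K0 by (simp add: C_def mult_ac flip: ennreal_mult' del: ennreal_numeral)
        finally show ?thesis .
      qed
      also have "... \<le> ennreal (\<delta>^2 * C) * (ennreal (2 * \<eta>) * ennreal IW + ?R)"
        unfolding IW_eq[symmetric] using W1 vb order_trans[OF zero_le_one W1]
        by (intro mult_left_mono remainder_mass_split \<eta>(1)) auto
      also have "... = ennreal (\<delta>^2) * (ennreal (C * (2 * \<eta> * IW)) + ennreal C * ?R)"
        using C0 \<eta>(1) IW0 by (simp add: distrib_left ennreal_mult' mult.assoc)
      also have "... \<le> ennreal (\<delta>^2) * (ennreal (\<kappa> / 2) + ennreal C * ?R)"
        by (intro mult_left_mono add_right_mono ennreal_leI small) simp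
      finally have cost': "spread u \<le> ennreal (\<delta>^2) * (ennreal (\<kappa> / 2) + ennreal C * ?R)"
        using cost by (rule order_trans[rotated])
      have "power_integral u \<le> ennreal (real (card I) powr (p - 1))"
        using vb v0 by (intro order_trans[OF pen] block_penalty_le_card I S(1)[rule_format] S(2) v p2) auto
      also have "... \<le> ennreal (((4 / s) ^ ?d) powr (p - 1))"
        using I p by (intro ennreal_leI powr_mono2) auto
      also have "((4 / s) ^ ?d) powr (p - 1) = (b / \<delta>) powr ?e"
      proof -
        have "4 / s = b / \<delta>" using b0 \<delta> by (simp add: s_def \<rho>_def field_simps)
        moreover have "0 < b / \<delta>" using b0 \<delta> by simp
        ultimately show ?thesis by (simp add: powr_powr flip: powr_realpow)
      qed
      also have "(b / \<delta>) powr ?e = \<kappa> / 2 * \<delta> powr (- ?e)"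
        unfolding powr_divide be powr_minus divide_inverse[of "\<kappa> / 2"] ..
      finally have "ennreal (\<epsilon>_of \<delta>) * power_integral u \<le> ennreal (\<epsilon>_of \<delta>) * ennreal (\<kappa> / 2 * \<delta> powr (- ?e))"
        by (rule mult_left_mono) simp
      also have "... = ennreal (\<epsilon>_of \<delta> * \<delta> powr (- ?e) * (\<kappa> / 2))"
        using less_imp_le[OF \<epsilon>_of_pos[OF \<delta>(1)]] by (simp add: mult_ac flip: ennreal_mult')
      also have "\<epsilon>_of \<delta> * \<delta> powr (- ?e) = \<delta>^2"
        using \<delta> by (simp add: \<epsilon>_of_def powr_numeral flip: powr_add)
      finally have pen': "ennreal (\<epsilon>_of \<delta>) * power_integral u \<le> ennreal (\<delta>^2) * ennreal (\<kappa> / 2)"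
        unfolding ennreal_mult'[OF zero_le_power2] .
      have "ennreal (\<delta>^2) * (ennreal (\<kappa> / 2) + ennreal C * ?R) + ennreal (\<delta>^2) * ennreal (\<kappa> / 2) =
          ennreal (\<delta>^2) * ((ennreal (\<kappa> / 2) + ennreal (\<kappa> / 2)) + ennreal C * ?R)"
        by (simp add: distrib_left add_ac)
      also have "ennreal (\<kappa> / 2) + ennreal (\<kappa> / 2) = ennreal \<kappa>" using \<kappa> by (simp flip: ennreal_plus)
      finally show "\<exists>u. self_plan u v \<and> spread u +
          ennreal (\<epsilon>_of \<delta>) * power_integral u \<le> ennreal (\<delta>^2) * (ennreal \<kappa> + ennreal C * ?R)"
        using u add_mono[OF cost' pen'] by auto
    qed
    then show ?thesis using \<eta> C0 \<rho>0 by (intro exI[of _ \<eta>] exI[of _ C] exI[of _ "1 / \<rho>"]) auto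
  qed
  then show ?thesis unfolding remainder_property_def using W_meas W1 W_fin by blast
qed

end

section \<open>The remainder for regular marginals\<close>

lemma norm_axis: "norm (axis k a :: real ^ 'n) = \<bar>a\<bar>"
proof -
  have "axis k a = a *\<^sub>R (axis k 1 :: real ^ 'n)" by (simp add: vec_eq_iff axis_def)
  then show ?thesis by simp
qed

text \<open>At a boundary point, the ball around s e_k of radius \<kappa> s lies above the graph if \<kappa>(1+2L)=1.
A point of the closure either is the centre of a ball inside or is close to the boundary.\<close>

lemma lipschitz_boundary_inner_ball:
  fixes Q :: "(real ^ 'n) set"
  assumes "lipschitz_boundary Q"
  shows "\<exists>\<kappa>>0. \<kappa> \<le> 1 \<and> (\<exists>s0>0. \<forall>x\<in>closure Q. \<forall>s. 0 < s --> s < s0 --> (\<exists>z. dist x z < 2 * s \<and> ball z (\<kappa> * s) \<subseteq> Q))"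
proof -
  obtain L r0 where L: "0 < L" and r0: "0 < r0" and chart: "\<forall>x0 \<in> frontier Q. \<exists>(R :: real ^ 'n => real ^ 'n) k (g :: real ^ 'n => real).
        orthogonal_transformation R \<and> L-lipschitz_on {x. x $ k = 0} g \<and> g 0 = 0 \<and>
        R ` ((\<lambda>x. x - x0) ` Q \<inter> ball 0 r0) = {x \<in> ball 0 r0. x $ k > g (x - axis k (x $ k))}"
    using assms unfolding lipschitz_boundary_def by auto
  define \<kappa> where "\<kappa> = 1 / (1 + 2 * L)"
  have \<kappa>: "0 < \<kappa>" "\<kappa> \<le> 1" "\<kappa> + 2 * L * \<kappa> = 1" using L by (auto simp: \<kappa>_def field_simps)
  have boundary: "\<exists>z. dist x0 z = s \<and> ball z (\<kappa> * s) \<subseteq> Q" if x0: "x0 \<in> frontier Q" and s: "0 < s" "s < r0 / 2" for x0 s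
  proof -
    obtain R :: "real ^ 'n => real ^ 'n" and k and g :: "real ^ 'n => real" where R: "orthogonal_transformation R"
      and g: "L-lipschitz_on {x. x $ k = 0} g" "g 0 = 0"
      and im: "R ` ((\<lambda>x. x - x0) ` Q \<inter> ball 0 r0) = {x \<in> ball 0 r0. x $ k > g (x - axis k (x $ k))}"
      using chart x0 by blast
    obtain w where w: "R w = axis k s" using orthogonal_transformation_surj[OF R] by (metis surjD)
    have Rn: "norm (R x) = norm x" for x using R by (rule orthogonal_transformation_norm)
    have Rl: "linear R" using R by (rule orthogonal_transformation_linear)
    have nw: "norm w = s" using Rn[of w] s by (simp add: w norm_axis)
    have "y \<in> Q" if y: "y \<in> ball (x0 + w) (\<kappa> * s)" for y
    proof -
      define h where "h = R (y - (x0 + w))"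
      have h: "norm h < \<kappa> * s" using y by (simp add: h_def Rn dist_norm norm_minus_commute)
      have hk: "\<bar>h $ k\<bar> \<le> norm h" by (rule component_le_norm_cart)
      have "y - x0 = w + (y - (x0 + w))" by simp
      then have Ry: "R (y - x0) = axis k s + h" by (simp only: linear_add[OF Rl] w h_def)
      have "norm (axis k s + h) \<le> s + norm h" using norm_triangle_ineq[of "axis k s" h] s by (simp add: norm_axis)
      also have "\<kappa> * s \<le> 1 * s" using \<kappa> s by (intro mult_right_mono) auto
      ultimately have in_ball: "norm (axis k s + h) < r0" using h s by linarith
      define h' where "h' = (axis k s + h) - axis k ((axis k s + h) $ k)"
      have h'_eq: "h' = h - axis k (h $ k)" by (simp add: h'_def vec_eq_iff axis_def)
      have h'k: "h' $ k = 0" by (simp add: h'_eq axis_def)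
      have "norm h' \<le> norm h + norm (axis k (h $ k))" unfolding h'_eq by (rule norm_triangle_ineq4)
      then have "norm h' \<le> 2 * norm h" using hk by (simp add: norm_axis)
      then have nh': "L * norm h' \<le> L * (2 * norm h)" using L by (intro mult_left_mono) auto
      have "dist (g h') (g 0) \<le> L * dist h' 0" using h'k by (intro lipschitz_onD[OF g(1)]) auto
      then have "g h' \<le> L * norm h'" using g(2) by (simp add: dist_norm)
      also have "... \<le> L * (2 * norm h)" by (rule nh')
      also have "... \<le> L * (2 * (\<kappa> * s))" using L h by (intro mult_left_mono) auto
      also have "... = s - \<kappa> * s"
      proof -
        have "(\<kappa> + 2 * L * \<kappa>) * s = s" by (simp add: \<kappa>(3))
        then show ?thesis by (simp add: algebra_simps)
      qed
      also have "... < s + h $ k" using h hk by linarith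
      finally have "g h' < (axis k s + h) $ k" by (simp add: axis_def)
      then have "R (y - x0) \<in> R ` ((\<lambda>x. x - x0) ` Q \<inter> ball 0 r0)"
        unfolding im Ry using in_ball by (simp add: h'_def)
      then have "y - x0 \<in> (\<lambda>x. x - x0) ` Q"
        using orthogonal_transformation_inj[OF R] by (auto dest: injD)
      then show ?thesis by auto
    qed
    moreover have "dist x0 (x0 + w) = s" by (simp add: dist_norm nw)
    ultimately show ?thesis by blast
  qed
  have "\<exists>z. dist x z < 2 * s \<and> ball z (\<kappa> * s) \<subseteq> Q" if x: "x \<in> closure Q" and s: "0 < s" "s < r0 / 2" for x s
  proof (cases "ball x s \<subseteq> Q")
    case True
    have "\<kappa> * s \<le> 1 * s" using \<kappa> s by (intro mult_right_mono) auto
    then have "ball x (\<kappa> * s) \<subseteq> ball x s" by (simp add: subset_ball)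
    then show ?thesis using True s by (intro exI[of _ x]) auto
  next
    case False
    obtain q where "q \<in> Q" "dist q x < s" using x s unfolding closure_approachable by blast
    then have "q \<in> ball x s \<inter> Q" by (simp add: dist_commute)
    then have "ball x s \<inter> Q \<noteq> {}" by blast
    then have "ball x s \<inter> frontier Q \<noteq> {}" using False by (intro connected_Int_frontier) auto
    then obtain x0 where x0: "x0 \<in> frontier Q" "dist x x0 < s" by auto
    obtain z where "dist x0 z = s" "ball z (\<kappa> * s) \<subseteq> Q" using boundary[OF x0(1) s] by blast
    then show ?thesis using x0(2) dist_triangle[of x z x0] by (intro exI[of _ z]) auto
  qed
  then show ?thesis using \<kappa>(1,2) r0 by (intro exI[of _ \<kappa>] conjI exI[of _ "r0 / 2"]) auto
qed

text \<open>The points of X are added one by one, except those close to a point already chosen.\<close>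

lemma finite_separated_net:
  fixes X :: "'a::metric_space set"
  assumes "finite X" "0 < r"
  shows "\<exists>Y\<subseteq>X. (\<forall>x\<in>Y. \<forall>y\<in>Y. x \<noteq> y --> r \<le> dist x y) \<and> (\<forall>x\<in>X. \<exists>y\<in>Y. dist x y < r)"
  using assms(1)
proof induction
  case (insert a X)
  then obtain Y where Y: "Y \<subseteq> X" "\<forall>x\<in>Y. \<forall>y\<in>Y. x \<noteq> y --> r \<le> dist x y" "\<forall>x\<in>X. \<exists>y\<in>Y. dist x y < r" by blast
  show ?case
  proof (cases "\<exists>y\<in>Y. dist a y < r")
    case True
    then have "\<forall>x\<in>insert a X. \<exists>y\<in>Y. dist x y < r" using Y(3) by auto
    moreover have "Y \<subseteq> insert a X" using Y(1) by auto
    ultimately show ?thesis using Y(2) by (intro exI[of _ Y] conjI)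
  next
    case False
    have "\<forall>x\<in>insert a Y. \<forall>y\<in>insert a Y. x \<noteq> y --> r \<le> dist x y"
      using Y(2) False by (auto simp: dist_commute not_less)
    moreover have "\<forall>x\<in>insert a X. \<exists>y\<in>insert a Y. dist x y < r" using Y(3) assms(2) by auto
    moreover have "insert a Y \<subseteq> insert a X" using Y(1) by auto
    ultimately show ?thesis by (intro exI[of _ "insert a Y"] conjI)
  qed
qed simp

text \<open>The complement of the support is a countable union of null sets, by second countability.\<close>

lemma AE_msupport:
  fixes M :: "'a::second_countable_topology measure"
  assumes sets: "sets M = sets borel"
  shows "AE x in M. x \<in> msupport M"
proof -
  define F where "F = {U. open U \<and> emeasure M U = 0}"
  obtain F' where F': "F' \<subseteq> F" "countable F'" "\<Union>F' = \<Union>F"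
    by (rule Lindelof[of F]) (auto simp: F_def)
  have "(\<Union>U\<in>F'. U) \<in> null_sets M"
    using F' by (intro null_sets_UN' ) (auto simp: F_def null_sets_def sets)
  then have "\<Union>F \<in> null_sets M" using F'(3) by simp
  moreover have "{x \<in> space M. x \<notin> msupport M} \<subseteq> \<Union>F"
    by (auto simp: msupport_def F_def zero_less_iff_neq_zero)
  ultimately show ?thesis by (rule AE_I')
qed

context transport_setting
begin

lemma ball_mass_ge:
  assumes "regular_density \<mu>"
  shows "\<exists>m>0. \<forall>z r. 0 \<le> r --> ball z r \<subseteq> msupport \<mu> --> ennreal (m * r ^ CARD('n)) \<le> emeasure \<mu> (ball z r)"
proof -
  obtain h m where h: "AE x in lborel. f x = h x" and m: "0 < m" "\<And>x. x \<in> msupport \<mu> ==> m \<le> h x"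
    using assms unfolding regular_density_def by auto
  let ?b = "unit_ball_vol (real CARD('n))"
  have "ennreal (m * ?b * r ^ CARD('n)) \<le> emeasure \<mu> (ball z r)" if r: "0 \<le> r" and z: "ball z r \<subseteq> msupport \<mu>" for z r
  proof -
    have "ennreal (m * ?b * r ^ CARD('n)) = ennreal m * emeasure lborel (ball z r)"
      using m r emeasure_ball[OF r, of z] by (simp add: ennreal_mult' mult.assoc)
    also have "... = (\<integral>\<^sup>+x. ennreal m * indicator (ball z r) x \<partial>lborel)"
      by (rule nn_integral_cmult_indicator[symmetric]) simp
    also have "... \<le> (\<integral>\<^sup>+x. ennreal (f x) * indicator (ball z r) x \<partial>lborel)"
    proof (rule nn_integral_mono_AE)
      show "AE x in lborel. ennreal m * indicator (ball z r) x \<le> ennreal (f x) * indicator (ball z r) x"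
        using h
      proof eventually_elim
        case (elim x)
        then show ?case using m(2)[of x] z by (auto split: split_indicator intro!: ennreal_leI)
      qed
    qed
    also have "... = (\<integral>\<^sup>+x. indicator (ball z r) x \<partial>\<mu>)" by (rule nn_integral_\<mu>[symmetric], rule borel_measurable_indicator) simp
    also have "... = emeasure \<mu> (ball z r)" by simp
    finally show ?thesis .
  qed
  then show ?thesis using m(1) by (intro exI[of _ "m * ?b"]) auto
qed

definition massive_partition :: "real => real => (real ^ 'n) set => (real ^ 'n => (real ^ 'n) set) => bool" where
  "massive_partition c s Y Q \<longleftrightarrow> finite Y \<and> (\<forall>y\<in>Y. Q y \<in> sets borel) \<and>
    disjoint_family_on Q Y \<and> (AE x in \<mu>. x \<in> (\<Union>y\<in>Y. Q y)) \<and>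
    (\<forall>y. \<forall>x\<in>Q y. \<forall>x'\<in>Q y. norm (x - x') \<le> 14 * s) \<and> (\<forall>y\<in>Y. ennreal (c * s ^ CARD('n)) \<le> emeasure \<mu> (Q y))"

text \<open>Around a maximal 6s-separated set the balls of radius 3s are disjoint and each contains a ball of radius
\<kappa> s inside the support, hence mass of order s^d. Each cell consists of its core ball and a share of the points
in reach of radius 7s; ties are broken by an enumeration.\<close>

lemma massive_cells:
  assumes supp: "regular_support \<mu>" and dens: "regular_density \<mu>"
  shows "\<exists>c>0. \<exists>s0>0. \<forall>s. 0 < s --> s < s0 --> (\<exists>Y Q. massive_partition c s Y Q)"
proof -
  let ?K = "msupport \<mu>" and ?\<Omega> = "interior (msupport \<mu>)"
  have Kc: "?K = closure ?\<Omega>" and bd: "bounded ?\<Omega>" and lip: "lipschitz_boundary ?\<Omega>" using supp by (auto simp: regular_support_def)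
  have cpt: "compact ?K" by (subst Kc) (use bd in simp)
  obtain \<kappa> s0 where \<kappa>: "0 < \<kappa>" "\<kappa> \<le> 1" and s0: "0 < s0"
    and inner: "\<And>x s. x \<in> ?K ==> 0 < s ==> s < s0 ==> \<exists>z. dist x z < 2 * s \<and> ball z (\<kappa> * s) \<subseteq> ?\<Omega>"
    using lipschitz_boundary_inner_ball[OF lip] unfolding Kc[symmetric] by blast
  obtain m where m: "0 < m" "\<And>z r. 0 \<le> r ==> ball z r \<subseteq> ?K ==> ennreal (m * r ^ CARD('n)) \<le> emeasure \<mu> (ball z r)"
    using ball_mass_ge[OF dens] by auto
  have "\<exists>Y Q. massive_partition (m * \<kappa> ^ CARD('n)) s Y Q"
    if s: "0 < s" "s < s0" for s
  proof -
    obtain X where X: "finite X" "X \<subseteq> ?K" "?K \<subseteq> (\<Union>x\<in>X. ball x s)"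
      by (rule compactE_image[OF cpt, of ?K "\<lambda>x. ball x s"]) (use s in auto)
    obtain Y where Y: "Y \<subseteq> X" and sep: "\<And>x y. x \<in> Y ==> y \<in> Y ==> x \<noteq> y ==> 6 * s \<le> dist x y"
      and net: "\<And>x. x \<in> X ==> \<exists>y\<in>Y. dist x y < 6 * s"
      using finite_separated_net[OF X(1), of "6 * s"] s by auto
    have Yf: "finite Y" using Y X(1) by (rule finite_subset)
    \<comment> \<open>The order given by \<open>idx\<close> decides which cell takes a point in reach of several centres.\<close>
    obtain idx :: "real ^ 'n => nat" where idx: "inj_on idx Y" using finite_imp_inj_to_nat_seg[OF Yf] by blast
    \<comment> \<open>The core balls of the other centres are never touched.\<close>
    define D where "D y = ball y (7 * s) - (\<Union>y'\<in>Y - {y}. ball y' (3 * s))" for y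
    define S where "S y = D y - (\<Union>y'\<in>{y' \<in> Y. idx y' < idx y}. D y')" for y
    have Dm: "D y \<in> sets borel" for y unfolding D_def using Yf by (intro sets.Diff sets.finite_UN) auto
    have Sm: "S y \<in> sets borel" for y unfolding S_def using Yf Dm by (intro sets.Diff sets.finite_UN) auto
    have far: "x \<notin> ball y' (3 * s)" if "x \<in> ball y (3 * s)" "y \<in> Y" "y' \<in> Y" "y \<noteq> y'" for x y y'
      using that sep[of y y'] dist_triangle2[of y y' x] by (auto simp: dist_commute)
    have core: "ball y (3 * s) \<subseteq> S y" if y: "y \<in> Y" for y
    proof
      fix x assume x: "x \<in> ball y (3 * s)"
      then have "x \<in> D y" using far[OF x y] s by (auto simp: D_def)
      moreover have "x \<notin> D y'" if "y' \<in> Y" "idx y' < idx y" for y' using x y that by (auto simp: D_def)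
      ultimately show "x \<in> S y" by (auto simp: S_def)
    qed
    have "disjoint_family_on S Y"
      unfolding disjoint_family_on_def
    proof (intro ballI impI)
      fix y y' assume "y \<in> Y" "y' \<in> Y" "y \<noteq> y'"
      then have "idx y < idx y' \<or> idx y' < idx y" using idx by (meson inj_onD linorder_neqE_nat)
      then show "S y \<inter> S y' = {}" using \<open>y \<in> Y\<close> \<open>y' \<in> Y\<close> by (auto simp: S_def)
    qed
    moreover have "AE x in \<mu>. x \<in> (\<Union>y\<in>Y. S y)"
      using AE_msupport[OF sets_\<mu>]
    proof eventually_elim
      case (elim x)
      have "\<exists>y. y \<in> Y \<and> x \<in> D y"
      proof (cases "\<exists>y\<in>Y. x \<in> ball y (3 * s)")
        case True
        then obtain y where "y \<in> Y" "x \<in> ball y (3 * s)" by blast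
        then have "y \<in> Y" "x \<in> S y" using core by blast+
        then show ?thesis by (auto simp: S_def)
      next
        case False
        obtain x0 where x0: "x0 \<in> X" "dist x0 x < s" using X(3) elim by auto
        obtain y where "y \<in> Y" "dist x0 y < 6 * s" using net[OF x0(1)] by blast
        moreover have "dist y x < 7 * s" using x0(2) calculation(2) dist_triangle[of y x x0] by (simp add: dist_commute)
        ultimately show ?thesis using False by (auto simp: D_def)
      qed
      then obtain y where "y \<in> Y \<and> x \<in> D y" "\<forall>y'. y' \<in> Y \<and> x \<in> D y' --> idx y \<le> idx y'"
        using ex_has_least_nat[of "\<lambda>y. y \<in> Y \<and> x \<in> D y" _ idx] by blast
      then have "y \<in> Y" "x \<in> S y" by (auto simp: S_def not_less[symmetric])
      then show ?case by blast
    qed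
    moreover have "norm (x - x') \<le> 14 * s" if "x \<in> S y" "x' \<in> S y" for x x' y
    proof -
      have "dist y x < 7 * s" "dist y x' < 7 * s" using that by (auto simp: S_def D_def)
      then show ?thesis using dist_triangle2[of x x' y] by (simp add: dist_norm norm_minus_commute)
    qed
    moreover have "ennreal (m * \<kappa> ^ CARD('n) * s ^ CARD('n)) \<le> emeasure \<mu> (S y)" if y: "y \<in> Y" for y
    proof -
      obtain z where z: "dist y z < 2 * s" "ball z (\<kappa> * s) \<subseteq> ?\<Omega>" using inner[of y s] y Y X(2) s by auto
      have "m * \<kappa> ^ CARD('n) * s ^ CARD('n) = m * (\<kappa> * s) ^ CARD('n)" by (simp add: power_mult_distrib)
      also have "ennreal ... \<le> emeasure \<mu> (ball z (\<kappa> * s))"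
        using z(2) interior_subset \<kappa> s by (intro m(2)) auto
      also have "... \<le> emeasure \<mu> (S y)"
      proof (rule emeasure_mono)
        have "\<kappa> * s \<le> 1 * s" using \<kappa> s by (intro mult_right_mono) auto
        then have "ball z (\<kappa> * s) \<subseteq> ball y (3 * s)" using z(1) by (intro ball_subset_ball_iff[THEN iffD2]) (auto simp: dist_commute)
        then show "ball z (\<kappa> * s) \<subseteq> S y" using core[OF y] by blast
        show "S y \<in> sets \<mu>" using Sm by simp
      qed
      finally show ?thesis .
    qed
    ultimately show ?thesis unfolding massive_partition_def using Yf Sm by (intro exI[of _ Y] exI[of _ S]) blast
  qed
  then show ?thesis using m(1) \<kappa>(1) s0 by (intro exI[of _ "m * \<kappa> ^ CARD('n)"] conjI exI[of _ s0]) auto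
qed

text \<open>As v\<ge>\<eta>, a cell of mass at least a has V\<ge>\<eta> a, which bounds V^{1-p} uniformly; what
remains is the integral of v^p.\<close>

lemma block_penalty_massive:
  fixes I :: "'i set" and S :: "'i => (real ^ 'n) set"
  assumes I: "finite I" and S: "\<And>i. i \<in> I ==> S i \<in> sets borel" and disj: "disjoint_family_on S I"
    and v [measurable]: "v \<in> borel_measurable borel" and \<eta>: "0 < \<eta>" and vb: "\<And>x. \<eta> \<le> v x" "\<And>x. v x \<le> 1"
    and a: "0 < a" and mass: "\<And>i. i \<in> I ==> ennreal a \<le> emeasure \<mu> (S i)"
  shows "block_penalty v S I \<le>
      ennreal ((\<eta> * a) powr (1 - p)) * (ennreal ((2 * \<eta>) powr p) + emeasure \<mu> {x. 2 * \<eta> < v x})"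
proof -
  have v0: "0 \<le> v x" for x using vb(1)[of x] \<eta> by linarith
  have V_ge: "\<eta> * a \<le> enn2real (block_mass v (S i))" if i: "i \<in> I" for i
  proof -
    have "ennreal (\<eta> * a) \<le> ennreal \<eta> * emeasure \<mu> (S i)"
      using \<eta> mass[OF i] by (simp add: ennreal_mult' mult_left_mono)
    also have "... = (\<integral>\<^sup>+x. ennreal \<eta> * indicator (S i) x \<partial>\<mu>)" using S[OF i] by (simp add: nn_integral_cmult_indicator)
    also have "... \<le> block_mass v (S i)"
      using vb(1) by (intro nn_integral_mono) (auto split: split_indicator intro: ennreal_leI)
    finally have "ennreal (\<eta> * a) \<le> block_mass v (S i)" .
    then have "ennreal (\<eta> * a) \<le> ennreal (enn2real (block_mass v (S i)))"
      by (subst (asm) block_mass_eq[OF v0 vb(2)])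
    then show ?thesis using \<eta> a by simp
  qed
  have m: "(\<lambda>x. ennreal (indicator (S i) x * v x powr p)) \<in> borel_measurable \<mu>" if "i \<in> I" for i
  proof -
    have [measurable]: "S i \<in> sets borel" by (rule S[OF that])
    have "(\<lambda>x. ennreal (indicator (S i) x * v x powr p)) \<in> borel_measurable borel" by measurable
    then show ?thesis by (simp cong: measurable_cong_sets)
  qed
  have "block_penalty v S I \<le>
      (\<Sum>i\<in>I. ennreal ((\<eta> * a) powr (1 - p)) * block_power v (S i))"
    using V_ge \<eta> a p by (intro sum_mono mult_right_mono ennreal_leI powr_mono2') auto
  also have "... = ennreal ((\<eta> * a) powr (1 - p)) * (\<integral>\<^sup>+x. (\<Sum>i\<in>I. ennreal (indicator (S i) x * v x powr p)) \<partial>\<mu>)"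
    by (simp only: nn_integral_sum[OF m] sum_distrib_left)
  also have "... \<le> ennreal ((\<eta> * a) powr (1 - p)) * (\<integral>\<^sup>+x. ennreal ((2 * \<eta>) powr p) + indicator {x. 2 * \<eta> < v x} x \<partial>\<mu>)"
  proof (intro mult_left_mono nn_integral_mono)
    fix x
    have "(\<Sum>i\<in>I. ennreal (indicator (S i) x * v x powr p)) = ennreal (indicator (\<Union>i\<in>I. S i) x * v x powr p)"
      by (simp add: indicator_UN_disjoint[OF I disj] sum_distrib_right)
    also have "... \<le> ennreal (v x powr p)" by (intro ennreal_leI) (auto split: split_indicator)
    also have "... \<le> ennreal ((2 * \<eta>) powr p) + indicator {x. 2 * \<eta> < v x} x"
    proof (cases "2 * \<eta> < v x")
      case True
      have "v x powr p \<le> 1 powr p" using vb(2) v0 p by (intro powr_mono2) auto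
      then have "ennreal (v x powr p) \<le> 1" by simp
      then show ?thesis using True by (simp add: add_increasing)
    next
      case False
      then show ?thesis using v0 p by (auto intro!: ennreal_leI powr_mono2)
    qed
    finally show "(\<Sum>i\<in>I. ennreal (indicator (S i) x * v x powr p)) \<le> ennreal ((2 * \<eta>) powr p) + indicator {x. 2 * \<eta> < v x} x" .
  qed simp
  also have "(\<integral>\<^sup>+x. ennreal ((2 * \<eta>) powr p) + indicator {x. 2 * \<eta> < v x} x \<partial>\<mu>) = ennreal ((2 * \<eta>) powr p) + emeasure \<mu> {x. 2 * \<eta> < v x}"
    using \<mu>.emeasure_space_1 by (subst nn_integral_add) auto
  finally show ?thesis .
qed

text \<open>At scale \<delta> the factor (\<eta> c\<delta>^d)^{1-p} compensates \<epsilon>\<delta>^{-2}, and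
\<eta>^{1-p}(2\<eta>)^p is still of order \<eta>.\<close>

theorem remainder_property_regular:
  assumes supp: "regular_support \<mu>" and dens: "regular_density \<mu>"
  shows "remainder_property"
proof -
  let ?d = "CARD('n)"
  obtain c s0 where c: "0 < c" and s0: "0 < s0" and cells: "\<And>s. 0 < s ==> s < s0 ==> \<exists>Y Q. massive_partition c s Y Q"
    using massive_cells[OF supp dens] by auto
  have "\<exists>\<eta> C \<delta>0. 0 < \<eta> \<and> \<eta> < 1 \<and> 0 \<le> C \<and> 0 < \<delta>0 \<and>
       (\<forall>\<delta>. 0 < \<delta> --> \<delta> < \<delta>0 --> remainder_plan_bound (\<lambda>_. 1) \<kappa> \<eta> C \<delta>)" if \<kappa>: "0 < \<kappa>" for \<kappa>
  proof -
    \<comment> \<open>392 is twice 196, the square of the relative cell diameter 14.\<close>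
    define B where "B = 392 + c powr (1 - p) * 2 powr p"
    have B: "0 < B" by (simp add: B_def add_pos_nonneg)
    define \<eta> where "\<eta> = min (1 / 2) (\<kappa> / B)"
    have \<eta>: "0 < \<eta>" "\<eta> < 1" using \<kappa> B by (auto simp: \<eta>_def)
    have "\<eta> \<le> \<kappa> / B" unfolding \<eta>_def by linarith
    then have small: "\<eta> * B \<le> \<kappa>" using B by (simp only: pos_le_divide_eq)
    define q where "q = (\<eta> * c) powr (1 - p)"
    have "remainder_plan_bound (\<lambda>_. 1) \<kappa> \<eta> (196 + q) \<delta>" if \<delta>: "0 < \<delta>" "\<delta> < s0" for \<delta>
      unfolding remainder_plan_bound_def
    proof (intro allI impI)
      fix v :: "real ^ 'n => real"
      assume v [measurable]: "v \<in> borel_measurable borel" and vb: "\<forall>x. \<eta> \<le> v x \<and> v x \<le> 1"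
      let ?R = "emeasure \<mu> {x. 2 * \<eta> < v x}"
      have R: "(\<integral>\<^sup>+x. ennreal 1 * indicator {x. 2 * \<eta> < v x} x \<partial>\<mu>) = ?R" by simp
      obtain Y :: "(real ^ 'n) set" and S :: "real ^ 'n => (real ^ 'n) set" where Y: "finite Y" and S: "\<forall>y\<in>Y. S y \<in> sets borel"
        "disjoint_family_on S Y" "AE x in \<mu>. x \<in> (\<Union>y\<in>Y. S y)" "\<forall>y. \<forall>x\<in>S y. \<forall>x'\<in>S y. norm (x - x') \<le> 14 * \<delta>"
        and mass: "\<forall>y\<in>Y. ennreal (c * \<delta> ^ ?d) \<le> emeasure \<mu> (S y)"
        using cells[OF \<delta>] unfolding massive_partition_def by (elim exE conjE) (rule that; assumption)
      have diam: "(norm (x - x'))^2 \<le> 98 * \<delta>^2 + 98 * \<delta>^2" if "y \<in> Y" "x \<in> S y" "x' \<in> S y" for x x' y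
        using power_mono[OF S(4)[rule_format, OF that(2,3)] norm_ge_zero, of 2] by (simp add: power_mult_distrib)
      obtain u where u: "self_plan u v"
        and cost: "spread u \<le> 2 * (\<integral>\<^sup>+x. ennreal (98 * \<delta>^2 * v x) \<partial>\<mu>)"
        and pen: "power_integral u \<le>
          block_penalty v S Y"
      proof -
        have D: "(\<lambda>_. 98 * \<delta>^2) \<in> borel_measurable borel" "\<And>x :: real ^ 'n. 0 \<le> 98 * \<delta>^2" by auto
        note plan = block_plan[OF Y S(1)[rule_format] S(2,3) v \<eta>(1) vb[rule_format, THEN conjunct1] vb[rule_format, THEN conjunct2] D]
        show thesis by (rule exE, rule plan, assumption, erule (2) diam, elim conjE, rule that)
      qed
      have "2 * (\<integral>\<^sup>+x. ennreal (98 * \<delta>^2 * v x) \<partial>\<mu>) = ennreal (\<delta>^2 * 196) * (\<integral>\<^sup>+x. ennreal (1 * v x) \<partial>\<mu>)"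
      proof -
        have "(\<integral>\<^sup>+x. ennreal (98 * \<delta>^2 * v x) \<partial>\<mu>) = ennreal (98 * \<delta>^2) * (\<integral>\<^sup>+x. ennreal (v x) \<partial>\<mu>)"
          by (intro nn_integral_cmult_real) auto
        then have "2 * (\<integral>\<^sup>+x. ennreal (98 * \<delta>^2 * v x) \<partial>\<mu>) = (ennreal 2 * ennreal (98 * \<delta>^2)) * (\<integral>\<^sup>+x. ennreal (v x) \<partial>\<mu>)"
          by (simp add: mult.assoc)
        also have "ennreal 2 * ennreal (98 * \<delta>^2) = ennreal (\<delta>^2 * 196)"
          by (simp add: mult_ac flip: ennreal_mult' del: ennreal_numeral)
        finally show ?thesis by simp
      qed
      also have "... \<le> ennreal (\<delta>^2 * 196) * (ennreal (2 * \<eta>) * (\<integral>\<^sup>+x. ennreal 1 \<partial>\<mu>) + (\<integral>\<^sup>+x. ennreal 1 * indicator {x. 2 * \<eta> < v x} x \<partial>\<mu>))"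
        using vb by (intro mult_left_mono remainder_mass_split \<eta>(1) v) auto
      also have "... = ennreal (\<delta>^2) * (ennreal (196 * (2 * \<eta>)) + ennreal 196 * ?R)"
      proof -
        have one: "(\<integral>\<^sup>+x. ennreal 1 \<partial>\<mu>) = 1" using \<mu>.emeasure_space_1 by simp
        have "ennreal (196 * (2 * \<eta>)) = ennreal 196 * ennreal (2 * \<eta>)" by (rule ennreal_mult') simp
        then show ?thesis unfolding R one mult_1_right by (simp only: ennreal_mult'[OF zero_le_power2] distrib_left mult.assoc)
      qed
      finally have cost': "spread u \<le> ennreal (\<delta>^2) * (ennreal (196 * (2 * \<eta>)) + ennreal 196 * ?R)"
        using cost by (rule order_trans[rotated])
      have c\<delta>: "0 < c * \<delta> ^ ?d" using c \<delta> by simp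
      have "power_integral u \<le> ennreal ((\<eta> * (c * \<delta> ^ ?d)) powr (1 - p)) * (ennreal ((2 * \<eta>) powr p) + ?R)"
        using vb by (intro order_trans[OF pen] block_penalty_massive Y S(1)[rule_format] S(2) v \<eta>(1) c\<delta> mass[rule_format]) auto
      then have "ennreal (\<epsilon>_of \<delta>) * power_integral u \<le>
          ennreal (\<epsilon>_of \<delta>) * (ennreal ((\<eta> * (c * \<delta> ^ ?d)) powr (1 - p)) * (ennreal ((2 * \<eta>) powr p) + ?R))"
        by (rule mult_left_mono) simp
      also have "... = ennreal (\<epsilon>_of \<delta> * (\<eta> * (c * \<delta> ^ ?d)) powr (1 - p)) * (ennreal ((2 * \<eta>) powr p) + ?R)"
        using less_imp_le[OF \<epsilon>_of_pos[OF \<delta>(1)]] by (simp only: ennreal_mult' mult.assoc)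
      also have "\<epsilon>_of \<delta> * (\<eta> * (c * \<delta> ^ ?d)) powr (1 - p) = \<delta>^2 * q"
      proof -
        have "(\<eta> * (c * \<delta> ^ ?d)) powr (1 - p) = q * \<delta> powr (real ?d * (1 - p))"
          using \<delta> by (simp add: q_def powr_mult powr_powr mult.assoc flip: powr_realpow)
        moreover have "\<epsilon>_of \<delta> * \<delta> powr (real ?d * (1 - p)) = \<delta>^2"
          using \<delta> by (simp add: \<epsilon>_of_def powr_numeral algebra_simps flip: powr_add)
        ultimately show ?thesis by (simp add: mult_ac)
      qed
      also have "ennreal (\<delta>^2 * q) * (ennreal ((2 * \<eta>) powr p) + ?R) = ennreal (\<delta>^2) * (ennreal (q * (2 * \<eta>) powr p) + ennreal q * ?R)"
        by (simp add: distrib_left ennreal_mult' mult.assoc q_def)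
      also have "q * (2 * \<eta>) powr p = c powr (1 - p) * 2 powr p * \<eta>"
      proof -
        have "\<eta> powr (1 - p) * \<eta> powr p = \<eta>" using \<eta>(1) by (simp flip: powr_add)
        then show ?thesis by (simp add: q_def powr_mult mult_ac)
      qed
      finally have pen': "ennreal (\<epsilon>_of \<delta>) * power_integral u \<le>
          ennreal (\<delta>^2) * (ennreal (c powr (1 - p) * 2 powr p * \<eta>) + ennreal q * ?R)" .
      have "ennreal (\<delta>^2) * (ennreal (196 * (2 * \<eta>)) + ennreal 196 * ?R) + ennreal (\<delta>^2) * (ennreal (c powr (1 - p) * 2 powr p * \<eta>) + ennreal q * ?R) =
          ennreal (\<delta>^2) * ((ennreal (196 * (2 * \<eta>)) + ennreal (c powr (1 - p) * 2 powr p * \<eta>)) + (ennreal 196 + ennreal q) * ?R)"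
        by (simp only: distrib_left distrib_right add_ac)
      also have "ennreal (196 * (2 * \<eta>)) + ennreal (c powr (1 - p) * 2 powr p * \<eta>) = ennreal (\<eta> * B)"
        using \<eta>(1) by (subst ennreal_plus[symmetric]) (auto simp: B_def algebra_simps)
      also have "ennreal 196 + ennreal q = ennreal (196 + q)" by (rule ennreal_plus[symmetric]) (auto simp: q_def)
      also have "ennreal (\<delta>^2) * (ennreal (\<eta> * B) + ennreal (196 + q) * ?R) \<le> ennreal (\<delta>^2) * (ennreal \<kappa> + ennreal (196 + q) * ?R)"
        by (intro mult_left_mono add_right_mono ennreal_leI small) simp
      finally show "\<exists>u. self_plan u v \<and> spread u +
          ennreal (\<epsilon>_of \<delta>) * power_integral u \<le>
          ennreal (\<delta>^2) * (ennreal \<kappa> + ennreal (196 + q) * (\<integral>\<^sup>+x. ennreal 1 * indicator {x. 2 * \<eta> < v x} x \<partial>\<mu>))"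
        unfolding R using u add_mono[OF cost' pen'] by (intro exI[of _ u] conjI) (auto intro: order_trans)
    qed
    then show ?thesis using \<eta> s0 by (intro exI[of _ \<eta>] exI[of _ "196 + q"] exI[of _ s0]) (auto simp: q_def add_nonneg_nonneg)
  qed
  then show ?thesis unfolding remainder_property_def using \<mu>.emeasure_space_1 by (intro exI[of _ "\<lambda>_. 1"]) auto
qed

end

section \<open>The rescaled excess\<close>

lemma le_excess_quotient:
  assumes "0 < w" "0 \<le> b" and le: "ennreal b + ennreal w * X \<le> R"
  shows "enn2ereal X \<le> (enn2ereal R - enn2ereal (ennreal b)) / ereal w"
proof -
  have "ereal b + ereal w * enn2ereal X \<le> enn2ereal R"
    using le assms by (simp add: less_eq_ennreal.rep_eq plus_ennreal.rep_eq times_ennreal.rep_eq enn2ereal_ennreal)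
  then have "ereal w * enn2ereal X \<le> enn2ereal R - ereal b" by (subst ereal_le_minus) (auto simp: add.commute)
  then show ?thesis using assms by (subst ereal_le_divide_pos) (auto simp: enn2ereal_ennreal)
qed

lemma excess_quotient_le:
  assumes "0 < w" "0 \<le> b" and le: "R \<le> ennreal b + ennreal w * X"
  shows "(enn2ereal R - enn2ereal (ennreal b)) / ereal w \<le> enn2ereal X"
proof -
  have "enn2ereal R \<le> ereal b + ereal w * enn2ereal X"
    using le assms by (simp add: less_eq_ennreal.rep_eq plus_ennreal.rep_eq times_ennreal.rep_eq enn2ereal_ennreal)
  then have "enn2ereal R - ereal b \<le> ereal w * enn2ereal X" by (subst ereal_minus_le) (auto simp: add.commute)
  then show ?thesis using assms by (subst ereal_divide_le_pos) (auto simp: enn2ereal_ennreal)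
qed

context transport_setting
begin

text \<open>Along \<epsilon>=\<delta>^{d(p-1)+2} the quotient is bounded below by \<open>lower_functional\<close>;
when K=\<infinity> this already forces divergence.\<close>

theorem rescaled_excess_limit:
  assumes upper: "K_fun \<mu> \<nu> \<phi> p = \<infinity> \<or> remainder_property"
  shows "((\<lambda>\<epsilon>. (enn2ereal (ROT \<epsilon> p \<mu> \<nu>) - enn2ereal (OT \<mu> \<nu>)) / ereal (\<epsilon> powr (2 / (real CARD('n) * (p - 1) + 2))))
        \<longlongrightarrow> ereal (C_const TYPE('n) p) * enn2ereal (K_fun \<mu> \<nu> \<phi> p)) (at_right 0)"
  unfolding tendsto_at_iff_sequentially
proof (intro allI impI)
  let ?E = "real CARD('n) * (p - 1) + 2"
  let ?q = "\<lambda>\<epsilon>. (enn2ereal (ROT \<epsilon> p \<mu> \<nu>) - enn2ereal (OT \<mu> \<nu>)) / ereal (\<epsilon> powr (2 / ?E))"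
  fix X :: "nat => real" assume X: "\<forall>i. X i \<in> {0<..} - {0}" "X \<longlonglongrightarrow> 0"
  define L where "L = ennreal (C_const TYPE('n) p) * K_fun \<mu> \<nu> \<phi> p"
  have C0: "0 < C_const TYPE('n) p" by (rule C_const_pos[OF p])
  have L: "ereal (C_const TYPE('n) p) * enn2ereal (K_fun \<mu> \<nu> \<phi> p) = enn2ereal L"
    using C0 by (simp add: L_def times_ennreal.rep_eq enn2ereal_ennreal)
  have E: "0 < ?E" using p by (intro add_nonneg_pos mult_nonneg_nonneg) auto
  define \<delta> where "\<delta> n = X n powr (1 / ?E)" for n
  have Xpos: "0 < X n" for n using X(1)[rule_format, of n] by simp
  have pos: "0 < \<delta> n" for n using Xpos[of n] by (simp add: \<delta>_def)
  have "\<delta> \<longlonglongrightarrow> 0 powr (1 / ?E)"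
    unfolding \<delta>_def[abs_def] using X(2) E Xpos by (intro tendsto_powr' tendsto_const) (auto intro!: always_eventually less_imp_le)
  then have lim: "\<delta> \<longlonglongrightarrow> 0" by simp
  have \<epsilon>: "\<epsilon>_of (\<delta> n) = X n" for n using Xpos[of n] E by (simp add: \<epsilon>_of_def \<delta>_def powr_powr)
  have w: "X n powr (2 / ?E) = (\<delta> n)^2" for n
    using Xpos[of n] by (simp add: \<delta>_def power2_eq_square flip: powr_add)
  have q: "?q (X n) = (enn2ereal (ROT (\<epsilon>_of (\<delta> n)) p \<mu> \<nu>) - enn2ereal (ennreal base_cost)) / ereal ((\<delta> n)^2)" for n
    unfolding OT_eq \<epsilon> w ..
  have low: "enn2ereal (lower_functional (\<delta> n)) \<le> ?q (X n)" for n
    unfolding q using pos[of n] by (intro le_excess_quotient base_cost_nonneg ROT_ge_scaled) auto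
  have "(\<lambda>n. ?q (X n)) \<longlonglongrightarrow> enn2ereal L"
  proof (rule order_tendstoI)
    fix a assume a: "a < enn2ereal L"
    show "\<forall>\<^sub>F n in sequentially. a < ?q (X n)"
    proof (cases "a < 0")
      case True
      then show ?thesis using low order_trans[OF enn2ereal_nonneg low] by (intro always_eventually allI) (rule less_le_trans)
    next
      case False
      then have ea: "enn2ereal (e2ennreal a) = a" by (intro enn2ereal_e2ennreal) simp
      have "e2ennreal a < L" unfolding less_ennreal.rep_eq ea by (rule a)
      also have "L \<le> liminf (\<lambda>n. lower_functional (\<delta> n))" unfolding L_def by (rule lower_functional_liminf[OF lim pos])
      finally have "e2ennreal a < liminf (\<lambda>n. lower_functional (\<delta> n))" .
      from less_LiminfD[OF this] have "\<forall>\<^sub>F n in sequentially. e2ennreal a < lower_functional (\<delta> n)" .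
      then show ?thesis
      proof eventually_elim
        case (elim n)
        then have "a < enn2ereal (lower_functional (\<delta> n))" by (simp add: less_ennreal.rep_eq ea)
        then show ?case using low by (rule less_le_trans)
      qed
    qed
  next
    fix a assume a: "enn2ereal L < a"
    have Kfin: "K_fun \<mu> \<nu> \<phi> p \<noteq> \<infinity>"
    proof
      assume "K_fun \<mu> \<nu> \<phi> p = \<infinity>"
      then have "L = \<infinity>" using C0 by (simp add: L_def ennreal_mult_top)
      then show False using a by simp
    qed
    then have RP: "remainder_property" using upper by blast
    have "L \<noteq> \<infinity>" using Kfin by (simp add: L_def ennreal_mult_eq_top_iff)
    then obtain l where l: "0 \<le> l" "L = ennreal l" by (cases L) auto
    obtain z where z: "enn2ereal L < ereal z" "ereal z < a" using ereal_dense2[OF a] by blast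
    have lz: "l < z" using z(1) l by (simp add: enn2ereal_ennreal)
    have "\<forall>\<^sub>F n in sequentially. ROT (\<epsilon>_of (\<delta> n)) p \<mu> \<nu> \<le> ennreal base_cost + ennreal ((\<delta> n)^2) * (L + ennreal (z - l))"
      unfolding L_def using lz by (intro ROT_upper_limit[OF RP lim pos]) simp
    then show "\<forall>\<^sub>F n in sequentially. ?q (X n) < a"
    proof eventually_elim
      case (elim n)
      have "?q (X n) \<le> enn2ereal (L + ennreal (z - l))"
        unfolding q using pos[of n] by (intro excess_quotient_le base_cost_nonneg elim) simp
      also have "L + ennreal (z - l) = ennreal z" using l lz by (simp flip: ennreal_plus)
      also have "enn2ereal (ennreal z) = ereal z" using l lz by (simp add: enn2ereal_ennreal)
      finally show ?case using z(2) by simp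
    qed
  qed
  then show "(?q \<circ> X) \<longlonglongrightarrow> ereal (C_const TYPE('n) p) * enn2ereal (K_fun \<mu> \<nu> \<phi> p)" unfolding L comp_def .
qed

end

theorem theorem2p1:
  fixes \<mu> \<nu> :: "(real ^ 'n) measure" and \<phi> :: "real ^ 'n \<Rightarrow> real" and p \<sigma>m \<sigma>M :: real
  assumes "1 < p"
    and "\<mu> \<in> prob_moment_ac 2" and "\<nu> \<in> prob_moment_ac 2"
    and "convex_on UNIV \<phi>" and "C2 \<phi>"
    and "0 < \<sigma>m" and "\<sigma>m \<le> \<sigma>M"
    and "distr \<mu> borel (gradient \<phi>) = \<nu>"
    and "\<And>y. loewner_le (mat \<sigma>m) (hessian \<phi> y) \<and> loewner_le (hessian \<phi> y) (mat \<sigma>M)"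
  shows
    "((p \<le> 2 \<and> (\<exists>\<beta>>0. \<mu> \<in> prob_moment (2 + \<beta>) \<and> \<nu> \<in> prob_moment (2 + \<beta>))) \<or>
      (2 < p \<and> regular_support \<mu> \<and> regular_support \<nu> \<and> regular_density \<mu> \<and> regular_density \<nu>) \<or>
      K_fun \<mu> \<nu> \<phi> p = \<infinity> \<longrightarrow>
      ((\<lambda>\<epsilon>. (enn2ereal (ROT \<epsilon> p \<mu> \<nu>) - enn2ereal (OT \<mu> \<nu>)) /
            ereal (\<epsilon> powr (2 / (real CARD('n) * (p - 1) + 2))))
        \<longlongrightarrow> ereal (C_const TYPE('n) p) * enn2ereal (K_fun \<mu> \<nu> \<phi> p)) (at_right 0)) \<and>
     ((p \<le> 2 \<and> (\<exists>\<beta>>0. \<mu> \<in> prob_moment (2 + \<beta>) \<and> \<nu> \<in> prob_moment (2 + \<beta>))) \<or>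
      (2 < p \<and> regular_support \<mu> \<and> regular_support \<nu> \<and> regular_density \<mu> \<and> regular_density \<nu>) \<longrightarrow>
      K_fun \<mu> \<nu> \<phi> p < \<infinity>)"
proof -
  interpret transport_setting \<phi> \<sigma>m \<sigma>M \<mu> \<nu> p
    by unfold_locales (use assms in auto)
  have "remainder_property" if "(p \<le> 2 \<and> (\<exists>\<beta>>0. \<mu> \<in> prob_moment (2 + \<beta>) \<and> \<nu> \<in> prob_moment (2 + \<beta>))) \<or>
      (2 < p \<and> regular_support \<mu> \<and> regular_support \<nu> \<and> regular_density \<mu> \<and> regular_density \<nu>)"
    using that remainder_property_moment remainder_property_regular by blast
  then show ?thesis using rescaled_excess_limit K_fun_finite by blast
qed

end
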